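(* Among the finite $3$-groups $V$ with $V/V'\simeq C_3\times C_3$ there exist precisely two metabelian Schur $\sigma$-groups. Both have order $3^5=243$, nilpotency class $3$ and coclass $2$. The first is $\langle 243,5\rangle$, with transfer kernel type D.10, and the second is $\langle 243,7\rangle$, with transfer kernel type D.5. They are the unique terminal immediate descendants with step size $s=2$ of the extra special group $\langle 27,3\rangle$, and thus are isolated vertices without parents in the coclass forest $\mathcal{F}(2)$.
   Context: $\langle n,i\rangle$ denotes the $i$-th group of order $n$ in the SmallGroups Library; $\langle 27,3\rangle$ is the extra special group of order $27$ and exponent $3$. A Schur $\sigma$-group (for $p=3$) is a pro-$3$-group $G$ with $d_2(G)=d_1(G)$, where $d_i(G)=\dim_{\mathbb{F}_3}\mathrm{H}^i(G,\mathbb{F}_3)$, that possesses an automorphism $\sigma$ acting as inversion $x\mapsto x^{-1}$ on $G/G'$. The coclass of a group of order $3^n$ and nilpotency class $c$ is $n-c$. For a finite non-abelian $3$-group $V$ of class $c$ with lower central series $\gamma_j(V)$, the parent of $V$ is $\pi(V)=V/\gamma_c(V)$, and $V$ is an immediate descendant of $W$ if $W\simeq\pi(V)$; the step size of the edge $V\to W$ is $s=\log_3(|V|/|W|)$. A group is terminal if it has no immediate descendants. The coclass forest $\mathcal{F}(2)$ is the graph of (isomorphism classes of) finite $3$-groups of coclass $2$ with abelianization $C_3\times C_3$, whose edges join groups to their parents whenever the parent also has coclass $2$. Transfer kernel type (TKT): let $H_1,\dots,H_4$ be the four maximal subgroups of $V$, $T_i:V/V'\to H_i/H_i'$ the Artin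 transfer homomorphisms. If every $\ker(T_i)$ has order $3$, the TKT is $\varkappa=(\varkappa(1)\varkappa(2)\varkappa(3)\varkappa(4))$ with $\ker(T_i)=H_{\varkappa(i)}/V'$, regarded up to renumbering of the $H_i$, i.e. up to replacing $\varkappa$ by $\pi^{-1}\circ\varkappa\circ\pi$ with $\pi\in S_4$. Representatives: D.5 is $(1212)$, D.10 is $(1123)$. *)

theory Defs
  imports "HOL-Algebra.Algebra" "HOL-Library.Numeral_Type"
begin

definition finite_3_group :: "('a, 'b) monoid_scheme \<Rightarrow> bool" where
  "finite_3_group G \<longleftrightarrow> group G \<and> (\<exists>n::nat. order G = 3 ^ n)"

definition commutator_subgroup :: "('a, 'b) monoid_scheme \<Rightarrow> 'a set" where
  "commutator_subgroup G = derived G (carrier G)"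

definition abelianization :: "('a, 'b) monoid_scheme \<Rightarrow> 'a set monoid" where
  "abelianization G = G Mod commutator_subgroup G"

definition abelianization_C3_C3 :: "('a, 'b) monoid_scheme \<Rightarrow> bool" where
  "abelianization_C3_C3 G \<longleftrightarrow>
     abelianization G \<cong> integer_mod_group 3 \<times>\<times> integer_mod_group 3"

definition metabelian :: "('a, 'b) monoid_scheme \<Rightarrow> bool" where
  "metabelian G \<longleftrightarrow> derived G (commutator_subgroup G) = {\<one>\<^bsub>G\<^esub>}"

text \<open>
  Inhomogeneous cochains. An \<open>n\<close>-tuple of group elements is a list of length \<open>n\<close>, and a cochain is
  extended by zero to all other lists. The numeral type \<^typ>\<open>3\<close> is the ring of integers modulo 3.
\<close>

definition cochains :: "('a, 'b) monoid_scheme \<Rightarrow> nat \<Rightarrow> ('a list \<Rightarrow> 3) set" where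
  "cochains G n = {f. \<forall>xs. \<not> (length xs = n \<and> set xs \<subseteq> carrier G) \<longrightarrow> f xs = 0}"

definition coboundary ::
  "('a, 'b) monoid_scheme \<Rightarrow> nat \<Rightarrow> ('a list \<Rightarrow> 3) \<Rightarrow> 'a list \<Rightarrow> 3" where
  "coboundary G n f xs =
     (if length xs = n + 1 \<and> set xs \<subseteq> carrier G
      then f (tl xs)
         + (\<Sum>i=1..n. (-1) ^ i *
              f (take (i - 1) xs @ [xs ! (i - 1) \<otimes>\<^bsub>G\<^esub> xs ! i] @ drop (i + 1) xs))
         + (-1) ^ (n + 1) * f (butlast xs)
      else 0)"

definition cocycle_group :: "('a, 'b) monoid_scheme \<Rightarrow> nat \<Rightarrow> ('a list \<Rightarrow> 3) monoid" where
  "cocycle_group G n =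
     \<lparr>carrier = {f \<in> cochains G n. coboundary G n f = (\<lambda>xs. 0)},
      monoid.mult = (\<lambda>f g xs. f xs + g xs), one = (\<lambda>xs. 0)\<rparr>"

fun coboundaries :: "('a, 'b) monoid_scheme \<Rightarrow> nat \<Rightarrow> ('a list \<Rightarrow> 3) set" where
  "coboundaries G 0 = {\<lambda>xs. 0}"
| "coboundaries G (Suc n) = coboundary G n ` cochains G n"

definition cohomology_group ::
  "('a, 'b) monoid_scheme \<Rightarrow> nat \<Rightarrow> ('a list \<Rightarrow> 3) set monoid" where
  "cohomology_group G n = cocycle_group G n Mod coboundaries G n"

text \<open>
  In a vector space over the prime field the subspace spanned by a set is the additive subgroup
  generated by it, so the dimension is the least cardinality of a generating set.
\<close>

definition dim_F3 :: "('a, 'b) monoid_scheme \<Rightarrow> nat" where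
  "dim_F3 A = (LEAST d. \<exists>S. S \<subseteq> carrier A \<and> finite S \<and> card S = d \<and> generate A S = carrier A)"

definition cohomology_dim :: "('a, 'b) monoid_scheme \<Rightarrow> nat \<Rightarrow> nat" where
  "cohomology_dim G n = dim_F3 (cohomology_group G n)"

text \<open>
  Only finite groups are considered here; a finite pro-3-group is a finite 3-group with the
  discrete topology, so that continuous cohomology is the cohomology defined above.
\<close>

definition schur_sigma_group :: "('a, 'b) monoid_scheme \<Rightarrow> bool" where
  "schur_sigma_group G \<longleftrightarrow>
     finite_3_group G \<and>
     cohomology_dim G 2 = cohomology_dim G 1 \<and>
     (\<exists>\<sigma>\<in>auto G. \<forall>x\<in>carrier G.
        commutator_subgroup G #>\<^bsub>G\<^esub> \<sigma> x
          = inv\<^bsub>abelianization G\<^esub> (commutator_subgroup G #>\<^bsub>G\<^esub> x))"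

text \<open>The index 0 is a dummy: the series starts with \<open>lower_central G 1 = carrier G\<close>.\<close>

fun lower_central :: "('a, 'b) monoid_scheme \<Rightarrow> nat \<Rightarrow> 'a set" where
  "lower_central G 0 = carrier G"
| "lower_central G (Suc 0) = carrier G"
| "lower_central G (Suc (Suc j)) =
     generate G {x \<otimes>\<^bsub>G\<^esub> y \<otimes>\<^bsub>G\<^esub> inv\<^bsub>G\<^esub> x \<otimes>\<^bsub>G\<^esub> inv\<^bsub>G\<^esub> y | x y.
       x \<in> lower_central G (Suc j) \<and> y \<in> carrier G}"

definition nilpotency_class :: "('a, 'b) monoid_scheme \<Rightarrow> nat" where
  "nilpotency_class G = (LEAST c. lower_central G (c + 1) = {\<one>\<^bsub>G\<^esub>})"

definition has_coclass :: "('a, 'b) monoid_scheme \<Rightarrow> nat \<Rightarrow> bool" where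
  "has_coclass G r \<longleftrightarrow> (\<exists>n. order G = 3 ^ n \<and> n = nilpotency_class G + r)"

definition parent :: "('a, 'b) monoid_scheme \<Rightarrow> 'a set monoid" where
  "parent V = V Mod lower_central V (nilpotency_class V)"

definition immediate_descendant ::
  "('a, 'b) monoid_scheme \<Rightarrow> ('c, 'd) monoid_scheme \<Rightarrow> bool" where
  "immediate_descendant V W \<longleftrightarrow> finite_3_group V \<and> \<not> comm_group V \<and> W \<cong> parent V"

definition step_size :: "('a, 'b) monoid_scheme \<Rightarrow> ('c, 'd) monoid_scheme \<Rightarrow> real" where
  "step_size V W = log 3 (real (order V) / real (order W))"

text \<open>Every finite group is isomorphic to one whose elements are natural numbers.\<close>

definition terminal :: "('a, 'b) monoid_scheme \<Rightarrow> bool" where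
  "terminal W \<longleftrightarrow> \<not> (\<exists>V :: nat monoid. immediate_descendant V W)"

text \<open>
  The isomorphism class of a finite group is represented by all groups on natural numbers that are
  isomorphic to it.
\<close>

definition iso_class :: "('a, 'b) monoid_scheme \<Rightarrow> nat monoid set" where
  "iso_class G = {H :: nat monoid. group H \<and> H \<cong> G}"

definition forest_member :: "nat \<Rightarrow> nat monoid \<Rightarrow> bool" where
  "forest_member r V \<longleftrightarrow> finite_3_group V \<and> abelianization_C3_C3 V \<and> has_coclass V r"

definition forest_vertices :: "nat \<Rightarrow> nat monoid set set" where
  "forest_vertices r = {iso_class V | V. forest_member r V}"

text \<open>An edge points from a group to its parent.\<close>

definition forest_edges :: "nat \<Rightarrow> (nat monoid set \<times> nat monoid set) set" where
  "forest_edges r =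
     {(iso_class V, iso_class (parent V)) | V.
        forest_member r V \<and> \<not> comm_group V \<and> iso_class (parent V) \<in> forest_vertices r}"

definition isolated_vertex :: "nat \<Rightarrow> nat monoid set \<Rightarrow> bool" where
  "isolated_vertex r v \<longleftrightarrow>
     v \<in> forest_vertices r \<and> (\<forall>w. (v, w) \<notin> forest_edges r \<and> (w, v) \<notin> forest_edges r)"

definition without_parent :: "nat \<Rightarrow> nat monoid set \<Rightarrow> bool" where
  "without_parent r v \<longleftrightarrow> v \<in> forest_vertices r \<and> \<not> (\<exists>w. (v, w) \<in> forest_edges r)"

definition maximal_subgroups :: "('a, 'b) monoid_scheme \<Rightarrow> 'a set set" where
  "maximal_subgroups G =
     {H. subgroup H G \<and> H \<noteq> carrier G \<and>
         (\<forall>K. subgroup K G \<and> H \<subseteq> K \<longrightarrow> K = H \<or> K = carrier G)}"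

text \<open>
  The transfer from \<open>G\<close> to \<open>H/H'\<close>: with a left transversal \<open>r\<close> of \<open>H\<close>, the element \<open>g\<close> is sent
  to the product of the classes of \<open>r(gC)\<inverse> g r(C)\<close> over the left cosets \<open>C\<close> of \<open>H\<close>. The value does
  not depend on the transversal; here it is the one picked by choice.
\<close>

definition artin_transfer :: "('a, 'b) monoid_scheme \<Rightarrow> 'a set \<Rightarrow> 'a \<Rightarrow> 'a set" where
  "artin_transfer G H g =
     (let r = (\<lambda>C. SOME x. x \<in> C) in
      finprod (G\<lparr>carrier := H\<rparr> Mod derived G H)
        (\<lambda>C. derived G H #>\<^bsub>G\<^esub> (inv\<^bsub>G\<^esub> (r (g <#\<^bsub>G\<^esub> C)) \<otimes>\<^bsub>G\<^esub> g \<otimes>\<^bsub>G\<^esub> r C))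
        (lcosets\<^bsub>G\<^esub> H))"

text \<open>The kernel of the homomorphism from \<open>G/G'\<close> to \<open>H/H'\<close> induced by the transfer.\<close>

definition transfer_kernel :: "('a, 'b) monoid_scheme \<Rightarrow> 'a set \<Rightarrow> 'a set set" where
  "transfer_kernel G H =
     (\<lambda>g. commutator_subgroup G #>\<^bsub>G\<^esub> g) `
       {g \<in> carrier G. artin_transfer G H g = \<one>\<^bsub>G\<lparr>carrier := H\<rparr> Mod derived G H\<^esub>}"

text \<open>
  \<open>Hs\<close> is a numbering of the maximal subgroups. As it is existentially quantified, the property
  depends only on the orbit of \<open>\<kappa>\<close> under renumbering. Lists are indexed from 0, the entries of
  \<open>\<kappa>\<close> are numbers from 1 to 4.
\<close>

definition has_TKT :: "('a, 'b) monoid_scheme \<Rightarrow> nat list \<Rightarrow> bool" where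
  "has_TKT G \<kappa> \<longleftrightarrow>
     length \<kappa> = 4 \<and> set \<kappa> \<subseteq> {1..4} \<and>
     (\<exists>Hs. length Hs = 4 \<and> distinct Hs \<and> set Hs = maximal_subgroups G \<and>
        (\<forall>i<4. transfer_kernel G (Hs ! i)
               = carrier (G\<lparr>carrier := Hs ! (\<kappa> ! i - 1)\<rparr> Mod commutator_subgroup G)))"

definition TKT_D5 :: "nat list" where "TKT_D5 = [1, 2, 1, 2]"
definition TKT_D10 :: "nat list" where "TKT_D10 = [1, 1, 2, 3]"

text \<open>
  The group (27,3): normal forms \<open>x^a y^b s^c\<close> in the group of order 27 and exponent 3 generated by \<open>x\<close> and \<open>y\<close>
  with central \<open>s = [y,x]\<close>.
\<close>

definition SG27_3 :: "(3 \<times> 3 \<times> 3) monoid" where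
  "SG27_3 =
     \<lparr>carrier = UNIV,
      monoid.mult = (\<lambda>(a, b, c) (a', b', c'). (a + a', b + b', c + c' + b * a')),
      one = (0, 0, 0)\<rparr>"

text \<open>
  With \<open>[g,h] = g\<inverse> h\<inverse> g h\<close>, \<open>pc_group p q k l\<close> is the group with power-commutator
  presentation on \<open>x, y, s, t, u\<close> given by \<open>[y,x] = s\<close>, \<open>[s,x] = t\<close>, \<open>[s,y] = u\<close>,
  \<open>x^3 = t^p u^q\<close>, \<open>y^3 = t^k u^l\<close>, \<open>s^3 = t^3 = u^3 = 1\<close> and \<open>t, u\<close> central. The tuple
  \<open>(a, b, c, d, e)\<close> stands for \<open>x^a y^b s^c t^d u^e\<close> with exponents represented by \<open>-1, 0, 1\<close>.
  In \<^typ>\<open>3\<close>, the binomial coefficient \<open>a\<close> over 2 is \<open>a - a * a\<close>, and \<open>- a * b * (a + b)\<close> is the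
  carry in the balanced ternary addition of \<open>a\<close> and \<open>b\<close>.
\<close>

definition pc_group :: "3 \<Rightarrow> 3 \<Rightarrow> 3 \<Rightarrow> 3 \<Rightarrow> (3 \<times> 3 \<times> 3 \<times> 3 \<times> 3) monoid" where
  "pc_group p q k l =
     \<lparr>carrier = UNIV,
      monoid.mult = (\<lambda>(a, b, c, d, e) (a', b', c', d', e').
        (a + a',
         b + b',
         c + c' + b * a',
         d + d' + c * a' + b * (a' - a' * a')
           - p * (a * a' * (a + a')) - k * (b * b' * (b + b')),
         e + e' + c * b' + a' * (b - b * b) + a' * b * b'
           - q * (a * a' * (a + a')) - l * (b * b' * (b + b')))),
      one = (0, 0, 0, 0, 0)\<rparr>"

text \<open>
  The groups with identifiers 5 and 7 among those of order 243 in the SmallGroups Library. The first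
  has \<open>x^3 = y^3 = [s,x]\<close>, the second \<open>x^3 = [s,x]\<close> and \<open>y^3 = [s,y]\<close>.
\<close>

definition SG243_5 :: "(3 \<times> 3 \<times> 3 \<times> 3 \<times> 3) monoid" where
  "SG243_5 = pc_group 1 0 1 0"

definition SG243_7 :: "(3 \<times> 3 \<times> 3 \<times> 3 \<times> 3) monoid" where
  "SG243_7 = pc_group 1 0 0 1"


text \<open>
  The next lemmas confirm that these groups are as described: \<open>SG27_3\<close> is extraspecial of order 27
  and exponent 3, and \<open>pc_group\<close> is the group of order 243 with the presentation above.
\<close>

lemma three_eq_0: "(3::3) = 0"
  by simp

lemma triple_mult_eq_0: "x * 3 = (0::3)" "3 * x = (0::3)" "y * (x * 3) = (0::3)" "z * (y * (x * 3)) = (0::3)"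
  "x * 9 = (0::3)"
proof -
  have "(9::3) = 3 * 3" by simp
  then show "x * 9 = (0::3)" by (metis three_eq_0 mult_zero_left mult_zero_right)
qed (metis three_eq_0 mult_zero_left mult_zero_right)+

lemma cases_3: "(x::3) = 0 \<or> x = 1 \<or> x = - 1"
proof (cases x rule: bit1_cases)
  case (of_int z)
  then have "z = 0 \<or> z = 1 \<or> z = 2" by auto
  with of_int show ?thesis by auto
qed

lemma group_SG27_3: "group SG27_3"
proof (rule groupI)
  fix v assume "v \<in> carrier SG27_3"
  obtain a b c where v: "v = (a, b, c)" by (cases v)
  have "(- a, - b, b * a - c) \<otimes>\<^bsub>SG27_3\<^esub> v = \<one>\<^bsub>SG27_3\<^esub>"
    by (simp add: v SG27_3_def algebra_simps)
  then show "\<exists>w\<in>carrier SG27_3. w \<otimes>\<^bsub>SG27_3\<^esub> v = \<one>\<^bsub>SG27_3\<^esub>"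
    by (rule bexI) (simp add: SG27_3_def)
qed (auto simp: SG27_3_def algebra_simps)

lemma order_SG27_3: "order SG27_3 = 27"
  by (simp add: order_def SG27_3_def card_UNIV_def)

lemma exponent_SG27_3: "v \<otimes>\<^bsub>SG27_3\<^esub> v \<otimes>\<^bsub>SG27_3\<^esub> v = \<one>\<^bsub>SG27_3\<^esub>"
proof -
  obtain a b c where v: "v = (a, b, c)" by (cases v)
  have "a + a + a = 3 * a" "b + b + b = 3 * b"
    "c + c + b * a + c + (b + b) * a = 3 * (c + b * a)"
    by (simp_all add: algebra_simps)
  then show ?thesis
    by (simp add: v SG27_3_def triple_mult_eq_0)
qed

lemma center_SG27_3:
  "{z \<in> carrier SG27_3. \<forall>g\<in>carrier SG27_3. z \<otimes>\<^bsub>SG27_3\<^esub> g = g \<otimes>\<^bsub>SG27_3\<^esub> z}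
     = {(0, 0, c) | c. True}"
proof -
  have "a = 0 \<and> b = 0" if "\<forall>g. (a, b, c) \<otimes>\<^bsub>SG27_3\<^esub> g = g \<otimes>\<^bsub>SG27_3\<^esub> (a, b, c)" for a b c
    using that[rule_format, of "(1, 0, 0)"] that[rule_format, of "(0, 1, 0)"]
    by (simp add: SG27_3_def)
  then show ?thesis
    by (fastforce simp: SG27_3_def)
qed

lemma commutator_subgroup_SG27_3: "commutator_subgroup SG27_3 = {(0, 0, c) | c. True}"
proof -
  interpret group SG27_3 by (rule group_SG27_3)
  have carrier: "carrier SG27_3 = UNIV" by (simp add: SG27_3_def)
  have inv: "inv\<^bsub>SG27_3\<^esub> (a, b, c) = (- a, - b, b * a - c)" for a b c
    by (rule inv_equality) (simp_all add: SG27_3_def algebra_simps)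
  have comm: "(a, b, c) \<otimes>\<^bsub>SG27_3\<^esub> (a', b', c') \<otimes>\<^bsub>SG27_3\<^esub> inv\<^bsub>SG27_3\<^esub> (a, b, c)
      \<otimes>\<^bsub>SG27_3\<^esub> inv\<^bsub>SG27_3\<^esub> (a', b', c') = (0, 0, b * a' - b' * a)" for a b c a' b' c'
    unfolding inv by (simp add: SG27_3_def algebra_simps)
  have set: "derived_set SG27_3 (carrier SG27_3) = {(0, 0, c) | c. True}"
  proof -
    have "(0, 0, c) \<in> derived_set SG27_3 (carrier SG27_3)" for c
    proof -
      have "(0, 0, c) \<in> {(0, c, 0) \<otimes>\<^bsub>SG27_3\<^esub> (1, 0, 0) \<otimes>\<^bsub>SG27_3\<^esub> inv\<^bsub>SG27_3\<^esub> (0, c, 0)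
          \<otimes>\<^bsub>SG27_3\<^esub> inv\<^bsub>SG27_3\<^esub> (1, 0, 0)}"
        using comm[of 0 c 0 1 0 0] by simp
      then show ?thesis unfolding carrier by blast
    qed
    moreover have "v \<in> {(0, 0, c) | c. True}"
      if "v \<in> derived_set SG27_3 (carrier SG27_3)" for v
      using that comm by (auto simp: carrier)
    ultimately show ?thesis by blast
  qed
  have "subgroup {(0, 0, c) | c. True} SG27_3"
    by (rule subgroupI) (auto simp: carrier inv, auto simp: SG27_3_def)
  then show ?thesis
    unfolding commutator_subgroup_def derived_def set
    by (intro generateI[symmetric]) auto
qed

lemma group_pc_group: "group (pc_group p q k l)"
proof (rule groupI)
  fix u v w :: "3 \<times> 3 \<times> 3 \<times> 3 \<times> 3"
  obtain a b c d e where u: "u = (a, b, c, d, e)" by (cases u)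
  obtain a' b' c' d' e' where v: "v = (a', b', c', d', e')" by (cases v)
  obtain a'' b'' c'' d'' e'' where w: "w = (a'', b'', c'', d'', e'')" by (cases w)
  show "u \<otimes>\<^bsub>pc_group p q k l\<^esub> v \<otimes>\<^bsub>pc_group p q k l\<^esub> w
      = u \<otimes>\<^bsub>pc_group p q k l\<^esub> (v \<otimes>\<^bsub>pc_group p q k l\<^esub> w)"
    unfolding u v w by (simp add: pc_group_def) (simp add: algebra_simps triple_mult_eq_0)
next
  fix v assume "v \<in> carrier (pc_group p q k l)"
  obtain a b c d e where v: "v = (a, b, c, d, e)" by (cases v)
  have "(- a, - b, b * a - c, (c - b * a) * a + b * (a - a * a) - d,
      (c - b * a) * b + a * (b + b * b) + a * b * b - e) \<otimes>\<^bsub>pc_group p q k l\<^esub> v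
      = \<one>\<^bsub>pc_group p q k l\<^esub>"
    by (simp add: v pc_group_def algebra_simps)
  then show "\<exists>w\<in>carrier (pc_group p q k l). w \<otimes>\<^bsub>pc_group p q k l\<^esub> v = \<one>\<^bsub>pc_group p q k l\<^esub>"
    by (rule bexI) (simp add: pc_group_def)
qed (auto simp: pc_group_def)

lemma order_pc_group: "order (pc_group p q k l) = 3 ^ 5"
  by (simp add: order_def pc_group_def)

lemma pc_group_relations:
  fixes p q k l
  defines "G \<equiv> pc_group p q k l"
  defines "x \<equiv> (1, 0, 0, 0, 0)" and "y \<equiv> (0, 1, 0, 0, 0)" and "s \<equiv> (0, 0, 1, 0, 0)"
    and "t \<equiv> (0, 0, 0, 1, 0)" and "u \<equiv> (0, 0, 0, 0, 1)"
  shows "y \<otimes>\<^bsub>G\<^esub> x = x \<otimes>\<^bsub>G\<^esub> y \<otimes>\<^bsub>G\<^esub> s"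
    and "s \<otimes>\<^bsub>G\<^esub> x = x \<otimes>\<^bsub>G\<^esub> s \<otimes>\<^bsub>G\<^esub> t"
    and "s \<otimes>\<^bsub>G\<^esub> y = y \<otimes>\<^bsub>G\<^esub> s \<otimes>\<^bsub>G\<^esub> u"
    and "t \<otimes>\<^bsub>G\<^esub> v = v \<otimes>\<^bsub>G\<^esub> t"
    and "u \<otimes>\<^bsub>G\<^esub> v = v \<otimes>\<^bsub>G\<^esub> u"
    and "x \<otimes>\<^bsub>G\<^esub> x \<otimes>\<^bsub>G\<^esub> x = (0, 0, 0, p, q)"
    and "y \<otimes>\<^bsub>G\<^esub> y \<otimes>\<^bsub>G\<^esub> y = (0, 0, 0, k, l)"
    and "s \<otimes>\<^bsub>G\<^esub> s \<otimes>\<^bsub>G\<^esub> s = \<one>\<^bsub>G\<^esub>"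
    and "t \<otimes>\<^bsub>G\<^esub> t \<otimes>\<^bsub>G\<^esub> t = \<one>\<^bsub>G\<^esub>"
    and "u \<otimes>\<^bsub>G\<^esub> u \<otimes>\<^bsub>G\<^esub> u = \<one>\<^bsub>G\<^esub>"
  unfolding assms by (cases v, simp_all add: pc_group_def algebra_simps triple_mult_eq_0)+

lemma pc_group_generators:
  "generate (pc_group p q k l) {(1, 0, 0, 0, 0), (0, 1, 0, 0, 0)} = carrier (pc_group p q k l)"
proof -
  let ?G = "pc_group p q k l"
  let ?S = "generate ?G {(1, 0, 0, 0, 0), (0, 1, 0, 0, 0)}"
  interpret group ?G by (rule group_pc_group)
  have carrier: "carrier ?G = UNIV" by (simp add: pc_group_def)
  have one: "\<one>\<^bsub>?G\<^esub> = (0, 0, 0, 0, 0)" by (simp add: pc_group_def)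
  have sub: "subgroup ?S ?G"
    by (rule generate_is_subgroup) (simp add: carrier)
  note closed = subgroup.m_closed[OF sub] subgroup.m_inv_closed[OF sub]
  have quot: "w \<in> ?S" if "v \<in> ?S" "v \<otimes>\<^bsub>?G\<^esub> w \<in> ?S" for v w
  proof -
    have "w = inv\<^bsub>?G\<^esub> v \<otimes>\<^bsub>?G\<^esub> (v \<otimes>\<^bsub>?G\<^esub> w)"
      by (simp add: carrier m_assoc[symmetric])
    then show ?thesis using closed that by metis
  qed
  have x: "(1, 0, 0, 0, 0) \<in> ?S" and y: "(0, 1, 0, 0, 0) \<in> ?S"
    by (auto intro: generate.incl)
  have s: "(0, 0, 1, 0, 0) \<in> ?S"
    using closed(1)[OF y x] closed(1)[OF x y] quot
    by (metis pc_group_relations(1))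
  have t: "(0, 0, 0, 1, 0) \<in> ?S"
    using closed(1)[OF s x] closed(1)[OF x s] quot
    by (metis pc_group_relations(2))
  have u: "(0, 0, 0, 0, 1) \<in> ?S"
    using closed(1)[OF s y] closed(1)[OF y s] quot
    by (metis pc_group_relations(3))
  have z: "(0, 0, 0, 0, 0) \<in> ?S"
    using subgroup.one_closed[OF sub] by (simp add: one)
  have neg: "w \<in> ?S" if "v \<in> ?S" "v \<otimes>\<^bsub>?G\<^esub> w = (0, 0, 0, 0, 0)" for v w
    using quot that z by metis
  have "(a, 0, 0, 0, 0) \<in> ?S" for a
    using cases_3[of a] x z neg[OF x, of "(a, 0, 0, 0, 0)"] by (auto simp: pc_group_def)
  moreover have "(0, b, 0, 0, 0) \<in> ?S" for b
    using cases_3[of b] y z neg[OF y, of "(0, b, 0, 0, 0)"] by (auto simp: pc_group_def)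
  moreover have "(0, 0, c, 0, 0) \<in> ?S" for c
    using cases_3[of c] s z neg[OF s, of "(0, 0, c, 0, 0)"] by (auto simp: pc_group_def)
  moreover have "(0, 0, 0, d, 0) \<in> ?S" for d
    using cases_3[of d] t z neg[OF t, of "(0, 0, 0, d, 0)"] by (auto simp: pc_group_def)
  moreover have "(0, 0, 0, 0, e) \<in> ?S" for e
    using cases_3[of e] u z neg[OF u, of "(0, 0, 0, 0, e)"] by (auto simp: pc_group_def)
  ultimately have "(a, 0, 0, 0, 0) \<otimes>\<^bsub>?G\<^esub> ((0, b, 0, 0, 0) \<otimes>\<^bsub>?G\<^esub> ((0, 0, c, 0, 0) \<otimes>\<^bsub>?G\<^esub>
      ((0, 0, 0, d, 0) \<otimes>\<^bsub>?G\<^esub> (0, 0, 0, 0, e)))) \<in> ?S" for a b c d e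
    by (intro closed(1))
  then have "(a, b, c, d, e) \<in> ?S" for a b c d e
    by (simp add: pc_group_def)
  then show ?thesis by (auto simp: carrier)
qed

end

theory Submission
  imports Defs
begin

text \<open>
  Let \<open>V\<close> be a finite 3-group and let \<open>a\<close>, \<open>b\<close> be the coordinates of an isomorphism of its
  abelianization with \<open>C\<^sub>3 \<times> C\<^sub>3\<close>. The condition on the cohomology dimensions holds iff the second
  cohomology group is spanned by the two Bockstein classes of \<open>a\<close> and \<open>b\<close>, which are represented by
  the carries of the addition. The automorphism \<open>\<sigma>\<close> changes their sign, so every cocycle that is
  \<open>\<sigma>\<close>-invariant up to a coboundary is itself a coboundary. Solving cocycle equations one after
  the other yields a homomorphism of \<open>V\<close> onto a group \<open>pc_group p q k l\<close>, and up to isomorphism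
  only seven parameter quadruples have to be considered.

  If \<open>P\<close> is one of the two groups of the theorem, then in every central extension of \<open>P\<close> the
  commutator subgroup meets the kernel trivially. Therefore the homomorphism is injective, and
  conversely \<open>P\<close> satisfies the condition on the cohomology dimensions and is terminal. For the
  other five groups, a further
  invariant cocycle yields a homomorphism to a central extension of order 729, and a cocycle on
  that extension takes different values at \<open>(s, t)\<close> and \<open>(t, s)\<close> for certain images \<open>s\<close>, \<open>t\<close> of
  elements of the commutator subgroup. Its pullback to \<open>V\<close> is a coboundary up to carries, so these
  elements do not commute and \<open>V\<close> is not metabelian. The extensions of order 729 also show that these
  five groups are not terminal.
\<close>

section \<open>Cocycles with values in the field with three elements\<close>

text \<open>Parity under \<sigma> decides which equations are solvable. The coordinates
  \<open>a\<close>, \<open>b\<close> are odd, \<open>c\<close> (weight two) is even,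
  \<open>d\<close> and \<open>e\<close> (weight three) are odd up to lower terms, \<open>v\<close>
  (weight four) is even again, and the carry classes are odd. So the obstructions to
  \<open>c\<close> and \<open>v\<close> contain no carries and vanish exactly, whereas those to
  \<open>d\<close> and \<open>e\<close> may contain them, and the coefficients are the exponents
  \<open>p\<close>, \<open>q\<close>, \<open>k\<close>, \<open>l\<close> in the cubes of the
  generators. The last cocycle may contain carries too, but it is evaluated on the commutator
  subgroup, where they vanish. The obstacle is that the order of \<open>V\<close> is not bounded in
  advance: \<open>V\<close> is only ever mapped to small explicit groups, coordinate by coordinate.
  Statements on central extensions yield the cohomological condition through the universal
  coefficient sequence 0 -> Ext(V/V', F3) -> H^2(V, F3) -> Hom(M(V), F3) -> 0 with the Schur
  multiplier M(V): the carry classes form the Ext term, so they span exactly when the multiplier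
  vanishes.\<close>

definition carry :: "3 \<Rightarrow> 3 \<Rightarrow> 3" where
  "carry a b = - (a * b * (a + b))"

lemma F3_cube: "x * x * x = (x::3)" "x * (x * x) = x" "x * (x * (x * y)) = x * (y::3)"
  using cases_3[of x] by auto

lemma F3_uminus: "- x = x + (x::3)"
  using cases_3[of x] by auto

lemma F3_add3: "x + (x + x) = (0::3)" "x + (x + (x + y)) = (y::3)" "x + x + x = (0::3)"
  using cases_3[of x] by auto

lemma F3_two: "2 = (- 1::3)" "numeral (num.Bit0 num.One) = (- 1 :: 3)"
  by simp_all

lemmas F3_distrib = diff_conv_add_uminus mult_minus_left mult_minus_right minus_add_distrib
  minus_minus mult_1_left mult_1_right F3_two distrib_left distrib_right mult.assoc
  mult_zero_left mult_zero_right add_0_left add_0_right minus_zero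

text \<open>Polynomials over the field with three elements are normalised by expanding, sorting the
  factors and reducing with \<open>x^3 = x\<close>, removing all signs with \<open>- x = x + x\<close>, and finally sorting
  the summands and reducing with \<open>x + x + x = 0\<close>.\<close>

lemmas F3_poly_mult = F3_distrib mult_ac F3_cube
lemmas F3_poly_add = add_ac F3_add3 add_0_left add_0_right

definition cocycle :: "('a, 'b) monoid_scheme \<Rightarrow> ('a \<Rightarrow> 'a \<Rightarrow> 3) \<Rightarrow> bool" where
  "cocycle G f \<longleftrightarrow> (\<forall>x\<in>carrier G. \<forall>y\<in>carrier G. \<forall>z\<in>carrier G.
     f x y + f (x \<otimes>\<^bsub>G\<^esub> y) z = f y z + f x (y \<otimes>\<^bsub>G\<^esub> z))"

text \<open>The unit contains the correction \<open>- f 1 1\<close> because cocycles are not assumed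
  to be normalised.\<close>

definition ext_group ::
  "('a, 'b) monoid_scheme \<Rightarrow> ('a \<Rightarrow> 'a \<Rightarrow> 3) \<Rightarrow> ('a \<times> 3) monoid" where
  "ext_group G f =
     \<lparr>carrier = carrier G \<times> UNIV,
      monoid.mult = (\<lambda>(x, i) (y, j). (x \<otimes>\<^bsub>G\<^esub> y, i + j + f x y)),
      one = (\<one>\<^bsub>G\<^esub>, - f \<one>\<^bsub>G\<^esub> \<one>\<^bsub>G\<^esub>)\<rparr>"

lemma cocycle_pullback:
  assumes "cocycle G f" "\<phi> \<in> hom V G"
  shows "cocycle V (\<lambda>x y. f (\<phi> x) (\<phi> y))"
  using assms by (auto simp: cocycle_def hom_def Pi_iff)

text \<open>Total carry into the next ternary digit when the digits of the list are added to
  \<open>s\<close> one after the other.\<close>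

fun carry_list :: "3 \<Rightarrow> 3 list \<Rightarrow> 3" where
  "carry_list s [] = 0"
| "carry_list s (x # xs) = carry s x + carry_list (s + x) xs"

type_synonym F3_5 = "3 \<times> 3 \<times> 3 \<times> 3 \<times> 3"

text \<open>
  The cochains \<open>v\<close> and \<open>z\<close> below were found by computer, solving for polynomials that satisfy the
  cocycle identity. The extension by \<open>v\<close> has order 729, and in the extension by \<open>z\<close> of the latter two
  elements of the commutator subgroup do not commute. The letters F, G and O distinguish the
  parameters \<open>(0, q, -1, 0)\<close>, \<open>(1, 0, 0, -1)\<close> and \<open>(0, -1, 1, 0)\<close>.
\<close>

definition vF :: "F3_5 \<Rightarrow> F3_5 \<Rightarrow> 3" where
  "vF = (\<lambda>(a, b, c, d, e) (a', b', c', d', e').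
     d * a' - b * a' * a' - c * a' * a' - carry_list c [b * a', c'] - carry b b')"

definition zF_rest :: "3 \<Rightarrow> 3 \<Rightarrow> 3 \<Rightarrow> 3 \<Rightarrow> 3 \<Rightarrow> 3 \<Rightarrow> 3 \<Rightarrow> 3" where
  "zF_rest b c d v a' b' c' =
     - b * c' + c * b' + b * b * c * b' + b * b * b' * c' + d * b' - v * b' + b * c * b' * b'
     + b * b' * b' * c' - c * c * a' + c * a' * b' - d * a' * b' + b * b * a' * b' * b'
     - b * c * a' * a' - b * a' * a' * c' + c * a' * a' * b' + d * c' + c * a' * c' - c * c'
     - carry_list c [b * a', c']"

definition zF :: "3 \<Rightarrow> F3_5 \<times> 3 \<Rightarrow> F3_5 \<times> 3 \<Rightarrow> 3" where
  "zF q = (\<lambda>((a, b, c, d, e), v) ((a', b', c', d', e'), v').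
     zF_rest b c d v a' b' c'
     + carry_list e [c * b', a' * (b - b * b), a' * b * b', q * carry a a', e'])"

definition vG :: "F3_5 \<Rightarrow> F3_5 \<Rightarrow> 3" where
  "vG = (\<lambda>(a, b, c, d, e) (a', b', c', d', e').
     d * b' + e * a' + c * a' * b' + b * a' * (b' - a' - a' * b' - b + b * a')
     + carry a a' * (b + b') - carry_list c [b * a', c'] + carry a a' - carry b b')"

definition zG :: "F3_5 \<times> 3 \<Rightarrow> F3_5 \<times> 3 \<Rightarrow> 3" where
  "zG = (\<lambda>((a, b, c, d, e), v) ((a', b', c', d', e'), v').
     - b * c' + a * c' - b * d' - c * c * a' + b * a' * c' - a * a * c * a' - a * a * a' * c' - d * a' + v * a'
     + c * a' * a' - b * c * a' * a' - b * a' * a' * c' + b * b * a' * a' - a * c * a' * a'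
     - a * a' * a' * c' - a * a * b * a' * a' - e * a' * a' + d * c' + c * a' * c'
     - carry_list d [c * a', b * (a' - a' * a'), carry a a', d'])"

definition vO :: "F3_5 \<Rightarrow> F3_5 \<Rightarrow> 3" where
  "vO = (\<lambda>(a, b, c, d, e) (a', b', c', d', e').
     d * a' + e * b' - c * a' * a' - c * b' * b' + b * a' * b' - b * a' * b' * b' - b * a' * a'
     - b * b * a' - b * b * a' * b' - carry a a' * (b + b') - carry a a' + carry b b')"

definition zO :: "F3_5 \<times> 3 \<Rightarrow> F3_5 \<times> 3 \<Rightarrow> 3" where
  "zO = (\<lambda>((a, b, c, d, e), v) ((a', b', c', d', e'), v').
     b * c' * c' - a * c' + b * b * c * a' + b * b * a' * c' + a * a * c * a' + a * a * a' * c'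
     - d * a' - e * a' + v * a' + c * a' * a' + a * c * a' * a' + a * a' * a' * c'
     + a * a * b * a' * a' - d * a' * a' + e * c' - b * c * c' - c * c')"

lemma mult_pc_group:
  "(a, b, c, d, e) \<otimes>\<^bsub>pc_group p q k l\<^esub> (a', b', c', d', e') =
     (a + a', b + b', c + c' + b * a',
      d + d' + c * a' + b * (a' - a' * a') + p * carry a a' + k * carry b b',
      e + e' + c * b' + a' * (b - b * b) + a' * b * b' + q * carry a a' + l * carry b b')"
  by (simp add: pc_group_def carry_def)

lemma cocycle_vF: "cocycle (pc_group 0 q (- 1) 0) vF"
  unfolding cocycle_def
proof (intro ballI, clarify)
  fix a b c d e a' b' c' d' e' a'' b'' c'' d'' e''
  let ?x = "(a,b,c,d,e)::F3_5" let ?y = "(a',b',c',d',e')::F3_5" let ?z = "(a'',b'',c'',d'',e'')::F3_5"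
  show "vF ?x ?y + vF (?x \<otimes>\<^bsub>pc_group 0 q (- 1) 0\<^esub> ?y) ?z = vF ?y ?z + vF ?x (?y \<otimes>\<^bsub>pc_group 0 q (- 1) 0\<^esub> ?z)"
    unfolding mult_pc_group vF_def prod.case carry_list.simps carry_def
    apply (simp only: F3_poly_mult)
    apply (simp only: F3_uminus)
    apply (simp only: F3_poly_add)
    done
qed

lemma cocycle_vG: "cocycle (pc_group 1 0 0 (- 1)) vG"
  unfolding cocycle_def
proof (intro ballI, clarify)
  fix a b c d e a' b' c' d' e' a'' b'' c'' d'' e''
  let ?x = "(a,b,c,d,e)::F3_5" let ?y = "(a',b',c',d',e')::F3_5" let ?z = "(a'',b'',c'',d'',e'')::F3_5"
  show "vG ?x ?y + vG (?x \<otimes>\<^bsub>pc_group 1 0 0 (- 1)\<^esub> ?y) ?z = vG ?y ?z + vG ?x (?y \<otimes>\<^bsub>pc_group 1 0 0 (- 1)\<^esub> ?z)"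
    unfolding mult_pc_group vG_def prod.case carry_list.simps carry_def
    apply (simp only: F3_poly_mult)
    apply (simp only: F3_uminus)
    apply (simp only: F3_poly_add)
    done
qed

lemma cocycle_vO: "cocycle (pc_group 0 (- 1) 1 0) vO"
  unfolding cocycle_def
proof (intro ballI, clarify)
  fix a b c d e a' b' c' d' e' a'' b'' c'' d'' e''
  let ?x = "(a,b,c,d,e)::F3_5" let ?y = "(a',b',c',d',e')::F3_5" let ?z = "(a'',b'',c'',d'',e'')::F3_5"
  show "vO ?x ?y + vO (?x \<otimes>\<^bsub>pc_group 0 (- 1) 1 0\<^esub> ?y) ?z = vO ?y ?z + vO ?x (?y \<otimes>\<^bsub>pc_group 0 (- 1) 1 0\<^esub> ?z)"
    unfolding mult_pc_group vO_def prod.case carry_list.simps carry_def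
    apply (simp only: F3_poly_mult)
    apply (simp only: F3_uminus)
    apply (simp only: F3_poly_add)
    done
qed

lemma mult_ext_group:
  "(x, i) \<otimes>\<^bsub>ext_group G f\<^esub> (y, j) = (x \<otimes>\<^bsub>G\<^esub> y, i + j + f x y)"
  by (simp add: ext_group_def)

lemma F3_one_cases: "(1::3) + 1 = - 1" "(-1::3) + - 1 = 1" "- (1::3) * x = - x" by simp_all
lemma cocycle_zG: "cocycle (ext_group (pc_group 1 0 0 (- 1)) vG) zG"
  unfolding cocycle_def
proof (intro ballI, clarify)
  fix a b c d e v a' b' c' d' e' v' a'' b'' c'' d'' e'' v''
  let ?x = "((a,b,c,d,e),v)::F3_5\<times>3" let ?y = "((a',b',c',d',e'),v')::F3_5\<times>3" let ?z = "((a'',b'',c'',d'',e''),v'')::F3_5\<times>3"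
  let ?G = "ext_group (pc_group 1 0 0 (- 1)) vG"
  show "zG ?x ?y + zG (?x \<otimes>\<^bsub>?G\<^esub> ?y) ?z = zG ?y ?z + zG ?x (?y \<otimes>\<^bsub>?G\<^esub> ?z)"
    unfolding mult_ext_group mult_pc_group zG_def vG_def prod.case carry_list.simps carry_def
    \<comment> \<open>Fixing \<open>a''\<close> and \<open>a'\<close> first splits the identity into
      nine shorter polynomial identities.\<close>
    using cases_3[of a''] cases_3[of a']
    apply (elim disjE; hypsubst)
    apply (simp_all only: F3_poly_mult F3_one_cases mult_1_right mult_1_left minus_minus)
    apply (simp_all only: F3_uminus)
    apply (simp_all only: F3_poly_add)
    done
qed

section \<open>Arithmetic of balanced ternary carries\<close>

lemma carry_0 [simp]: "carry 0 x = 0" "carry x 0 = 0"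
  by (simp_all add: carry_def)

text \<open>The cocycle identity of the extension Z/9 of Z/3: both sides are the total carry of
  \<open>x + y + z\<close>.\<close>

lemma carry_assoc: "carry x y + carry (x + y) z = carry y z + carry x (y + z)"
  by (simp add: carry_def algebra_simps)

text \<open>The digits -1, 0, 1 are symmetric under sign change, so scaling by a digit scales the
  integer carry.\<close>

lemma carry_scale: "carry (r * x) (r * y) = r * carry x y"
  using cases_3[of r] by (auto simp: carry_def algebra_simps)

text \<open>Both sides vanish: three balanced digits sum to at most 3 in absolute value, so the two
  successive carries are never equal and nonzero, the only case in which they would carry
  again.\<close>

lemma carry_carry: "carry (carry x y) (carry (x + y) z) = carry (carry y z) (carry x (y + z))"
  using cases_3[of x] cases_3[of y] cases_3[of z] by (auto simp: carry_def)

text \<open>Iteration of \<open>carry_assoc\<close>: the total carry does not depend on the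
  bracketing, so the list may be summed before \<open>s\<close> is added.\<close>

lemma carry_list_0: "carry_list s xs = carry_list 0 xs + carry s (sum_list xs)"
proof (induction xs arbitrary: s)
  case (Cons x xs)
  show ?case
    using Cons[of "s + x"] Cons[of x] carry_assoc[of s x "sum_list xs"] by (simp add: algebra_simps)
qed simp

lemma carry_list_append: "carry_list s (xs @ ys) = carry_list s xs + carry_list (s + sum_list xs) ys"
  by (induction xs arbitrary: s) (simp_all add: add.assoc)

text \<open>Four digits have the same total carry in either grouping, and the hypotheses make the
  last carry \<open>carry (x + y) (k + l)\<close> of the second grouping cancel.\<close>

lemma carry_interchange:
  assumes "x + y = x' + y'" "k + l = k' + l'"
  shows "carry x k + carry y l + carry (x + k) (y + l) - (carry x' k' + carry y' l' + carry (x' + k') (y' + l'))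
    = carry x y - carry x' y' + (carry k l - carry k' l')"
proof -
  have "carry x k + carry y l + carry (x + k) (y + l) = carry x y + carry k l + carry (x + y) (k + l)" for x k y l
    by (simp add: carry_def algebra_simps)
  from this[of x k y l] this[of x' k' y' l'] assms show ?thesis by simp
qed

text \<open>The cochain \<open>carry_list e (xs @ [k, e'])\<close> is the carry in adding \<open>e\<close>, \<open>e'\<close>, the entries of \<open>xs\<close> and \<open>k\<close>
  as integers, so the contributions of \<open>e\<close> and \<open>k\<close> to its coboundary cancel.\<close>

lemma coboundary_carry_list:
  fixes e e' e'' :: 3
  assumes m: "sum_list xs1 + sum_list xs2 = sum_list xs3 + sum_list xs4"
    and k: "k1 + k2 = k3 + k4" "carry k1 k2 = carry k3 k4"
  shows "carry_list e (xs1 @ [k1, e']) + carry_list (e + e' + sum_list xs1 + k1) (xs2 @ [k2, e''])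
      - (carry_list e' (xs3 @ [k3, e'']) + carry_list e (xs4 @ [k4, e' + e'' + sum_list xs3 + k3]))
    = carry_list 0 xs1 + carry_list 0 xs2 - (carry_list 0 xs3 + carry_list 0 xs4)
      + (carry (sum_list xs1) (sum_list xs2) - carry (sum_list xs3) (sum_list xs4))"
proof -
  define m1 m2 m3 m4 where "m1 = sum_list xs1" and "m2 = sum_list xs2" and "m3 = sum_list xs3" and "m4 = sum_list xs4"
  note defs = m1_def m2_def m3_def m4_def
  have split: "carry_list e (xs @ [k, e']) = carry_list 0 xs + carry (sum_list xs) k
      + (carry e (sum_list xs + k) + carry (e + (sum_list xs + k)) e')" for e e' k xs
    using carry_assoc[of e "sum_list xs" k]
    by (simp add: carry_list_append carry_list_0[of e xs] add.assoc)
  \<comment> \<open>With every list replaced by its sum, all carries that involve \<open>e\<close>,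
    \<open>e'\<close> or \<open>e''\<close> cancel.\<close>
  have R: "carry e n1 + carry (e + n1) e' + (carry (e + e' + n1) n2 + carry (e + e' + n1 + n2) e'')
      - (carry e' n3 + carry (e' + n3) e'' + (carry e n4 + carry (e + n4) (e' + e'' + n3)))
      = carry n1 n2 - carry n3 n4" if "n1 + n2 = n3 + n4" for n1 n2 n3 n4
  proof -
    have n4: "n4 = n1 + n2 - n3" using that by (simp add: algebra_simps)
    show ?thesis
      unfolding n4 carry_def
      apply (simp only: F3_poly_mult)
      apply (simp only: F3_uminus)
      apply (simp only: F3_poly_add)
      done
  qed
  have mm: "m1 + m2 = m3 + m4" using m by (simp only: defs)
  then have "(m1 + m2) + (k1 + k2) = (m3 + m4) + (k3 + k4)" by (simp only: k(1))
  then have "m1 + k1 + (m2 + k2) = m3 + k3 + (m4 + k4)" by (simp only: add_ac)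
  note R = R[OF this] and I = carry_interchange[OF mm k(1)]
  have "carry_list e (xs1 @ [k1, e']) + carry_list (e + e' + m1 + k1) (xs2 @ [k2, e''])
      - (carry_list e' (xs3 @ [k3, e'']) + carry_list e (xs4 @ [k4, e' + e'' + m3 + k3]))
    = (carry_list 0 xs1 + carry_list 0 xs2 - (carry_list 0 xs3 + carry_list 0 xs4))
      + (carry m1 k1 + carry m2 k2 - (carry m3 k3 + carry m4 k4))
      + (carry (m1 + k1) (m2 + k2) - carry (m3 + k3) (m4 + k4))"
    unfolding split defs[symmetric] R[symmetric] by (simp only: add_ac diff_conv_add_uminus minus_add_distrib)
  also have "\<dots> = (carry_list 0 xs1 + carry_list 0 xs2 - (carry_list 0 xs3 + carry_list 0 xs4))
      + (carry m1 m2 - carry m3 m4)"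
    using I k(2) by (simp add: algebra_simps)
  finally show ?thesis by (simp only: defs)
qed

lemma zF_split:
  "zF q ((a, b, c, d, e), v) ((a', b', c', d', e'), v')
    = zF_rest b c d v a' b' c' + carry_list e ([c * b', a' * (b - b * b), a' * b * b'] @ [q * carry a a', e'])"
  by (simp only: zF_def prod.case append.simps)

text \<open>The variables \<open>e\<close>, \<open>e'\<close>, \<open>e''\<close> and the parameter
  \<open>q\<close> enter \<open>zF\<close> only through the list of carries.
  \<open>coboundary_carry_list\<close> eliminates them, and \<open>rest\<close> is a polynomial
  identity in what remains.\<close>

lemma cocycle_zF: "cocycle (ext_group (pc_group 0 q (- 1) 0) vF) (zF q)"
  unfolding cocycle_def
proof (intro ballI, clarify)
  fix a b c d e v a' b' c' d' e' v' a'' b'' c'' d'' e'' v''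
  let ?x = "((a,b,c,d,e),v)::F3_5\<times>3" let ?y = "((a',b',c',d',e'),v')::F3_5\<times>3" let ?z = "((a'',b'',c'',d'',e''),v'')::F3_5\<times>3"
  let ?G = "ext_group (pc_group 0 q (- 1) 0) vF"
  let ?L = "\<lambda>b c a' b'. [c * b', a' * (b - b * b), a' * b * b']"
  let ?k = "\<lambda>a a'. q * carry a a'"
  have sum: "sum_list (?L b c a' b') = c * b' + a' * (b - b * b) + a' * b * b'" for b c a' b'
    by (simp add: add.assoc)
  have comp: "((a, b, c, d, e), v) \<otimes>\<^bsub>?G\<^esub> ((a', b', c', d', e'), v') = ((a + a', b + b', c + c' + b * a',
      d + d' + c * a' + b * (a' - a' * a') - carry b b',
      e + e' + sum_list (?L b c a' b') + ?k a a'), v + v' + vF (a,b,c,d,e) (a',b',c',d',e'))"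
    for a b c d e v a' b' c' d' e' v'
    by (simp add: mult_ext_group mult_pc_group sum)
  have k: "?k a a' + ?k (a + a') a'' = ?k a' a'' + ?k a (a' + a'')"
    using carry_assoc[of a a' a''] by (simp only: distrib_left[symmetric])
  \<comment> \<open>The entry \<open>q * carry a a'\<close> is itself a carry, so carries of carries
    have to cancel as well.\<close>
  have kk: "carry (?k a a') (?k (a + a') a'') = carry (?k a' a'') (?k a (a' + a''))"
    by (simp only: carry_scale carry_carry)
  have m: "sum_list (?L b c a' b') + sum_list (?L (b + b') (c + c' + b * a') a'' b'')
      = sum_list (?L b' c' a'' b'') + sum_list (?L b c (a' + a'') (b' + b''))"
    by (simp add: sum algebra_simps) (simp add: triple_mult_eq_0)
  note C = coboundary_carry_list[OF m k kk, of e e' e'']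
  have rest: "zF_rest b c d v a' b' c'
      + zF_rest (b + b') (c + c' + b * a') (d + d' + c * a' + b * (a' - a' * a') - carry b b')
          (v + v' + vF (a,b,c,d,e) (a',b',c',d',e')) a'' b'' c''
      + (carry_list 0 (?L b c a' b') + carry_list 0 (?L (b + b') (c + c' + b * a') a'' b'')
          - (carry_list 0 (?L b' c' a'' b'') + carry_list 0 (?L b c (a' + a'') (b' + b'')))
        + (carry (sum_list (?L b c a' b')) (sum_list (?L (b + b') (c + c' + b * a') a'' b''))
          - carry (sum_list (?L b' c' a'' b'')) (sum_list (?L b c (a' + a'') (b' + b'')))))
    = zF_rest b' c' d' v' a'' b'' c'' + zF_rest b c d v (a' + a'') (b' + b'') (c' + c'' + b' * a'')"
    unfolding sum zF_rest_def vF_def prod.case carry_list.simps carry_def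
    using cases_3[of a''] cases_3[of b''] cases_3[of a'] cases_3[of b']
    apply (elim disjE)
    apply ((hypsubst, (simp only: F3_poly_mult F3_one_cases mult_1_right mult_1_left minus_minus)?, (simp only: F3_uminus)?, (simp only: F3_poly_add)?)[1])+
    done
  have combine: "(A1 + C1) + (A2 + C2) = (A3 + C3) + (A4 + C4)"
    if "A1 + A2 + D = A3 + A4" "C1 + C2 - (C3 + C4) = D" for A1 A2 A3 A4 C1 C2 C3 C4 D :: 3
    using that by (simp add: algebra_simps)
  show "zF q ?x ?y + zF q (?x \<otimes>\<^bsub>?G\<^esub> ?y) ?z = zF q ?y ?z + zF q ?x (?y \<otimes>\<^bsub>?G\<^esub> ?z)"
    unfolding comp zF_split by (rule combine[OF rest C])
qed

lemma cocycle_zO: "cocycle (ext_group (pc_group 0 (- 1) 1 0) vO) zO"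
  unfolding cocycle_def
proof (intro ballI, clarify)
  fix a b c d e v a' b' c' d' e' v' a'' b'' c'' d'' e'' v''
  let ?x = "((a,b,c,d,e),v)::F3_5\<times>3" let ?y = "((a',b',c',d',e'),v')::F3_5\<times>3" let ?z = "((a'',b'',c'',d'',e''),v'')::F3_5\<times>3"
  let ?G = "ext_group (pc_group 0 (- 1) 1 0) vO"
  show "zO ?x ?y + zO (?x \<otimes>\<^bsub>?G\<^esub> ?y) ?z = zO ?y ?z + zO ?x (?y \<otimes>\<^bsub>?G\<^esub> ?z)"
    unfolding mult_ext_group mult_pc_group zO_def vO_def prod.case carry_list.simps carry_def
    using cases_3[of a''] cases_3[of a']
    apply (elim disjE)
    apply ((hypsubst, (simp only: F3_poly_mult F3_one_cases mult_1_right mult_1_left minus_minus)?, (simp only: F3_uminus)?, (simp only: F3_poly_add)?)[1])+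
    done
qed

section \<open>Coordinates of the abelianization\<close>

lemma carry_simps [simp]: "carry 1 1 = 1" "carry 2 1 = 0" "carry (- 1) 1 = 0" "carry 1 (- 1) = 0"
    "carry (- 1) (- 1) = - 1"
  by (simp_all add: carry_def)

lemma carry_uminus: "carry (- x) (- y) = - carry x y"
  by (simp add: carry_def algebra_simps)

lemma carry_commute: "carry x y = carry y x"
  by (simp add: carry_def algebra_simps)

text \<open>Equivalently, \<open>x\<close> goes to \<open>(x, h x)\<close> is a homomorphic section
  of \<open>ext_group G f\<close>. Up to sign this says that \<open>f\<close> is the coboundary of
  \<open>h\<close>.\<close>

definition cobounds :: "('a, 'b) monoid_scheme \<Rightarrow> ('a \<Rightarrow> 3) \<Rightarrow> ('a \<Rightarrow> 'a \<Rightarrow> 3) \<Rightarrow> bool" where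
  "cobounds G h f \<longleftrightarrow> (\<forall>x\<in>carrier G. \<forall>y\<in>carrier G. h (x \<otimes>\<^bsub>G\<^esub> y) = h x + h y + f x y)"

lemma cobounds_D: "cobounds G h f \<Longrightarrow> x \<in> carrier G \<Longrightarrow> y \<in> carrier G \<Longrightarrow> h (x \<otimes>\<^bsub>G\<^esub> y) = h x + h y + f x y"
  by (simp add: cobounds_def)

locale C3_C3_group = group V for V :: "('a, 'b) monoid_scheme" (structure) +
  fixes a b :: "'a \<Rightarrow> 3"
  assumes finite_carrier: "finite (carrier V)"
    and a_mult [simp]: "x \<in> carrier V \<Longrightarrow> y \<in> carrier V \<Longrightarrow> a (x \<otimes> y) = a x + a y"
    and b_mult [simp]: "x \<in> carrier V \<Longrightarrow> y \<in> carrier V \<Longrightarrow> b (x \<otimes> y) = b x + b y"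
    and kernel_ab: "{g \<in> carrier V. a g = 0 \<and> b g = 0} = commutator_subgroup V"
    and ex_10: "\<exists>x\<in>carrier V. a x = 1 \<and> b x = 0"
    and ex_01: "\<exists>x\<in>carrier V. a x = 0 \<and> b x = 1"
begin

lemma a_one [simp]: "a \<one> = 0" and b_one [simp]: "b \<one> = 0"
  using a_mult[of \<one> \<one>] b_mult[of \<one> \<one>] by simp_all

lemma a_inv [simp]: "x \<in> carrier V \<Longrightarrow> a (inv x) = - a x"
  using a_mult[of x "inv x"] by (simp add: eq_neg_iff_add_eq_0 add.commute)

lemma b_inv [simp]: "x \<in> carrier V \<Longrightarrow> b (inv x) = - b x"
  using b_mult[of x "inv x"] by (simp add: eq_neg_iff_add_eq_0 add.commute)

lemma ab_derived: "g \<in> commutator_subgroup V \<Longrightarrow> a g = 0" "g \<in> commutator_subgroup V \<Longrightarrow> b g = 0"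
    "g \<in> commutator_subgroup V \<Longrightarrow> g \<in> carrier V"
  using kernel_ab by auto

lemma derived_iff: "g \<in> commutator_subgroup V \<longleftrightarrow> g \<in> carrier V \<and> a g = 0 \<and> b g = 0"
  using kernel_ab by auto

text \<open>Symmetry of \<open>f\<close> gives \<open>w\<close> the same value at \<open>x y\<close>
  and \<open>y x\<close>. Since \<open>x y\<close> is a commutator times \<open>y x\<close> and
  \<open>f\<close> vanishes when its first entry lies in the commutator subgroup, \<open>w\<close>
  must kill commutators. It is applied to combinations of carries and to
  \<open>f = 0\<close>.\<close>

lemma vanishes_derived:
  assumes w: "cobounds V w f"
    and f: "\<And>x y. x \<in> carrier V \<Longrightarrow> y \<in> carrier V \<Longrightarrow> f x y = f y x"
    and f0: "\<And>x y. x \<in> commutator_subgroup V \<Longrightarrow> y \<in> carrier V \<Longrightarrow> f x y = 0"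
    and g: "g \<in> commutator_subgroup V"
  shows "w g = 0"
proof -
  have comm: "w (x \<otimes> y \<otimes> inv x \<otimes> inv y) = 0" if x: "x \<in> carrier V" and y: "y \<in> carrier V" for x y
  proof -
    let ?k = "x \<otimes> y \<otimes> inv x \<otimes> inv y"
    have k: "?k \<in> commutator_subgroup V"
      using x y by (simp add: derived_iff)
    have "?k \<otimes> (y \<otimes> x) = x \<otimes> y"
      using x y by (simp add: m_assoc inv_solve_left)
        (metis inv_closed l_inv m_assoc m_closed r_one l_one)
    then have "w (x \<otimes> y) = w ?k + w (y \<otimes> x) + f ?k (y \<otimes> x)"
      using cobounds_D[OF w, of ?k "y \<otimes> x"] x y by simp
    moreover have "w (x \<otimes> y) = w (y \<otimes> x)"
      using cobounds_D[OF w] f x y by (simp add: add.commute)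
    ultimately show ?thesis
      using f0[OF k] x y by simp
  qed
  have "w \<one> = 0"
    using cobounds_D[OF w, of \<one> \<one>] f0[of \<one> \<one>] by (simp add: derived_iff)
  note one = this
  have sub: "derived_set V (carrier V) \<subseteq> carrier V" by auto
  have "g \<in> generate V (derived_set V (carrier V))"
    using g by (simp add: commutator_subgroup_def derived_def)
  then show ?thesis
  proof (induction rule: generate.induct)
    case one then show ?case by fact
  next
    case (incl h) then show ?case using comm by auto
  next
    case (inv h)
    then have h: "w h = 0" "h \<in> commutator_subgroup V"
      using comm by (auto simp: derived_iff)
    have "w (h \<otimes> inv h) = w h + w (inv h) + f h (inv h)"
      by (rule cobounds_D[OF w]) (use h in \<open>simp_all add: ab_derived\<close>)
    then show ?case
      using h f0[OF h(2)] one by (simp add: ab_derived)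
  next
    case (eng h1 h2)
    then have "h1 \<in> commutator_subgroup V" "h2 \<in> commutator_subgroup V"
      by (simp_all add: commutator_subgroup_def derived_def)
    then show ?case
      using eng cobounds_D[OF w] f0 by (simp add: ab_derived)
  qed
qed

text \<open>Evaluation at cubes: the cube of a lift of a basis vector lies in the commutator
  subgroup, where \<open>w\<close> vanishes, while the law for \<open>w\<close> gives
  \<open>3 * w x + m = m\<close> (respectively \<open>n\<close>).\<close>

lemma carry_independent:
  assumes w: "cobounds V w (\<lambda>x y. m * carry (a x) (a y) + n * carry (b x) (b y))"
  shows "m = 0 \<and> n = 0"
proof -
  have 0: "w g = 0" if "g \<in> commutator_subgroup V" for g
    using vanishes_derived[OF w _ _ that] by (simp add: carry_commute ab_derived)
  obtain x where x: "x \<in> carrier V" "a x = 1" "b x = 0" using ex_10 by blast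
  obtain y where y: "y \<in> carrier V" "a y = 0" "b y = 1" using ex_01 by blast
  have three: "r + r + r = (0::3)" for r using F3_add3(3) .
  have "w (x \<otimes> x \<otimes> x) = w x + w x + w x + m"
    using cobounds_D[OF w] x by simp
  moreover have "x \<otimes> x \<otimes> x \<in> commutator_subgroup V"
    using x by (simp add: derived_iff)
  moreover have "w (y \<otimes> y \<otimes> y) = w y + w y + w y + n"
    using cobounds_D[OF w] y by simp
  moreover have "y \<otimes> y \<otimes> y \<in> commutator_subgroup V"
    using y by (simp add: derived_iff)
  ultimately show ?thesis using 0 three by simp
qed

lemma ex_ab: "\<exists>g\<in>carrier V. a g = i \<and> b g = j"
proof -
  obtain x where x: "x \<in> carrier V" "a x = 1" "b x = 0" using ex_10 by blast
  obtain y where y: "y \<in> carrier V" "a y = 0" "b y = 1" using ex_01 by blast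
  have "\<exists>g\<in>carrier V. a g = i \<and> b g = 0"
    using cases_3[of i] x a_inv[of x] b_inv[of x] a_one b_one inv_closed[of x] one_closed
    by (elim disjE) (metis neg_0_equal_iff_equal)+
  then obtain g where g: "g \<in> carrier V" "a g = i" "b g = 0" by blast
  have "\<exists>g\<in>carrier V. a g = 0 \<and> b g = j"
    using cases_3[of j] y a_inv[of y] b_inv[of y] a_one b_one inv_closed[of y] one_closed
    by (elim disjE) (metis neg_0_equal_iff_equal)+
  then obtain h where h: "h \<in> carrier V" "a h = 0" "b h = j" by blast
  show ?thesis
    by (rule bexI[of _ "g \<otimes> h"]) (use g h in simp_all)
qed

text \<open>After subtraction of the combination with coefficients \<open>h x\<close> and
  \<open>h y\<close>, the homomorphism kills lifts of both basis vectors and, by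
  \<open>vanishes_derived\<close>, the commutator subgroup, hence everything.\<close>

lemma hom_combination:
  assumes h: "cobounds V h (\<lambda>_ _. 0)"
  obtains i j where "\<And>x. x \<in> carrier V \<Longrightarrow> h x = i * a x + j * b x"
proof -
  obtain x where x: "x \<in> carrier V" "a x = 1" "b x = 0" using ex_10 by blast
  obtain y where y: "y \<in> carrier V" "a y = 0" "b y = 1" using ex_01 by blast
  define w where "w g = h g - h x * a g - h y * b g" for g
  have w: "cobounds V w (\<lambda>_ _. 0)"
    using h by (simp add: cobounds_def w_def algebra_simps)
  have w_mult: "w (g \<otimes> g') = w g + w g'" if "g \<in> carrier V" "g' \<in> carrier V" for g g'
    using cobounds_D[OF w that] by simp
  have w0: "w g = 0" if "g \<in> commutator_subgroup V" for g
    using vanishes_derived[OF w _ _ that] by simp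
  have wx: "w x = 0" "w y = 0" using x y by (simp_all add: w_def)
  have wone: "w \<one> = 0" using w_mult[of \<one> \<one>] by simp
  have winv: "w (inv g) = - w g" if "g \<in> carrier V" for g
    using w_mult[of g "inv g"] that wone by (simp add: eq_neg_iff_add_eq_0 add.commute)
  have "w g = 0" if g: "g \<in> carrier V" for g
  proof -
    have "\<exists>u\<in>carrier V. a u = a g \<and> b u = 0 \<and> w u = 0"
      using cases_3[of "a g"] x a_inv[of x] b_inv[of x] inv_closed[of x] winv[of x] wx wone
      by (elim disjE) (metis neg_0_equal_iff_equal a_one b_one one_closed)+
    then obtain u where u: "u \<in> carrier V" "a u = a g" "b u = 0" "w u = 0" by blast
    have "\<exists>v\<in>carrier V. a v = 0 \<and> b v = b g \<and> w v = 0"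
      using cases_3[of "b g"] y a_inv[of y] b_inv[of y] inv_closed[of y] winv[of y] wx wone
      by (elim disjE) (metis neg_0_equal_iff_equal a_one b_one one_closed)+
    then obtain v where v: "v \<in> carrier V" "a v = 0" "b v = b g" "w v = 0" by blast
    have "g \<otimes> inv (u \<otimes> v) \<in> commutator_subgroup V"
      using g u v by (simp add: derived_iff del: inv_mult_group)
    then have "w g = w (u \<otimes> v)"
      using w0 w_mult[of g "inv (u \<otimes> v)"] winv[of "u \<otimes> v"] g u v by simp
    then show ?thesis using w_mult[of u v] u v by simp
  qed
  then have "\<And>g. g \<in> carrier V \<Longrightarrow> h g = h x * a g + h y * b g"
    by (simp add: w_def algebra_simps)
  then show ?thesis by (rule that)
qed

end

section \<open>Dimension of the second cohomology group\<close>

text \<open>Two generators of exponent 3 in a commutative group admit only the nine products with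
  exponents below 3.\<close>

lemma (in comm_group) dim_F3_2_order_le:
  assumes fin: "finite (carrier G)" and exp: "\<And>x. x \<in> carrier G \<Longrightarrow> x \<otimes> x \<otimes> x = \<one>"
    and dim: "dim_F3 G = 2"
  shows "order G \<le> 9"
proof -
  let ?P = "\<lambda>d. \<exists>S. S \<subseteq> carrier G \<and> finite S \<and> card S = d \<and> generate G S = carrier G"
  have "generate G (carrier G) = carrier G"
    by (rule generateI[symmetric]) (auto simp: subgroup_self)
  with fin have "?P (card (carrier G))" by blast
  then have "?P (LEAST d. ?P d)" by (rule LeastI)
  then obtain S where S: "S \<subseteq> carrier G" "card S = 2" "generate G S = carrier G"
    using dim by (auto simp: dim_F3_def)
  then obtain s t where st: "S = {s, t}" by (auto simp: card_2_iff)
  have s: "s \<in> carrier G" and t: "t \<in> carrier G" using S st by auto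
  let ?T = "(\<lambda>(i, j). s [^] (i::nat) \<otimes> t [^] (j::nat)) ` ({..<3} \<times> {..<3})"
  have pow3: "x [^] (3::nat) = \<one>" if "x \<in> carrier G" for x
    using exp[OF that] that by (simp add: numeral_3_eq_3)
  have pow_mod: "x [^] n = x [^] (n mod 3)" if "x \<in> carrier G" for x and n :: nat
  proof -
    have "x [^] n = x [^] (3 * (n div 3) + n mod 3)" by simp
    also have "\<dots> = (x [^] (3::nat)) [^] (n div 3) \<otimes> x [^] (n mod 3)"
      using that by (simp add: nat_pow_pow nat_pow_mult)
    finally show ?thesis using that pow3 by (simp add: nat_pow_one)
  qed
  have T: "s [^] i \<otimes> t [^] j \<in> ?T" for i j :: nat
    using pow_mod[OF s, of i] pow_mod[OF t, of j]
    by (intro image_eqI[of _ _ "(i mod 3, j mod 3)"]) auto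
  have inv_pow: "inv x = x [^] (2::nat)" if "x \<in> carrier G" for x
    using exp[OF that] that by (intro inv_equality) (simp_all add: numeral_2_eq_2 m_assoc)
  have "s [^] (1::nat) \<otimes> t [^] (0::nat) = s" "s [^] (0::nat) \<otimes> t [^] (1::nat) = t"
    "s [^] (2::nat) \<otimes> t [^] (0::nat) = inv s" "s [^] (0::nat) \<otimes> t [^] (2::nat) = inv t"
    using s t inv_pow by simp_all
  then have gens: "s \<in> ?T" "t \<in> ?T" "inv s \<in> ?T" "inv t \<in> ?T"
    using T by metis+
  have "x \<in> ?T" if "x \<in> generate G S" for x
    using that
  proof (induction rule: generate.induct)
    case one
    show ?case using T[of 0 0] by simp
  next
    case (incl h)
    then have "h = s \<or> h = t" using st by simp
    then show ?case using gens by (elim disjE) (simp_all only:)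
  next
    case (inv h)
    then have "h = s \<or> h = t" using st by simp
    then show ?case using gens by (elim disjE) (simp_all only:)
  next
    case (eng h1 h2)
    then obtain i j i' j' :: nat where "h1 = s [^] i \<otimes> t [^] j" "h2 = s [^] i' \<otimes> t [^] j'" by auto
    then have "h1 \<otimes> h2 = s [^] (i + i') \<otimes> t [^] (j + j')"
      using s t by (simp add: nat_pow_mult[symmetric] m_ac)
    then show ?case using T by metis
  qed
  then have "order G \<le> card ?T"
    unfolding order_def using S(3) by (intro card_mono) auto
  also have "\<dots> \<le> card ({..<3::nat} \<times> {..<3::nat})" by (rule card_image_le) simp
  finally show ?thesis by simp
qed

lemma (in comm_group) card_generate_1:
  assumes exp: "\<And>x. x \<in> carrier G \<Longrightarrow> x \<otimes> x \<otimes> x = \<one>"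
    and S: "S \<subseteq> {s}" "s \<in> carrier G"
  shows "card (generate G S) \<le> 3"
proof -
  let ?T = "{\<one>, s, s \<otimes> s}"
  have e: "s \<otimes> s \<otimes> s = \<one>" by (rule exp[OF S(2)])
  have i: "inv s = s \<otimes> s" using e S(2) by (intro inv_equality) simp_all
  have a: "s \<otimes> (s \<otimes> s) = \<one>" "s \<otimes> s \<otimes> (s \<otimes> s) = s"
    using e S(2) by (simp_all add: m_assoc[symmetric])
  have "generate G S \<subseteq> ?T"
  proof
    fix x assume "x \<in> generate G S"
    then show "x \<in> ?T"
    proof (induction rule: generate.induct)
      case (incl h) then show ?case using S by auto
    next
      case (inv h) then show ?case using S i by auto
    next
      case (eng h1 h2) then show ?case using S e a by auto
    qed simp
  qed
  then have "card (generate G S) \<le> card ?T" by (intro card_mono) auto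
  also have "\<dots> \<le> 3" by (simp add: card_insert_if)
  finally show ?thesis .
qed

text \<open>One element generates at most three elements. Two elements, the second outside the
  subgroup generated by a nontrivial first one, generate by Lagrange a subgroup of order 9.\<close>

lemma (in comm_group) dim_F3_order_9:
  assumes exp: "\<And>x. x \<in> carrier G \<Longrightarrow> x \<otimes> x \<otimes> x = \<one>"
    and ord: "order G = 9"
  shows "dim_F3 G = 2"
  unfolding dim_F3_def
proof (rule Least_equality)
  have fin: "finite (carrier G)" using ord order_gt_0_iff_finite by simp
  have "card (generate G {}) \<le> 3" by (rule card_generate_1[OF exp _ one_closed]) auto
  have "\<not> carrier G \<subseteq> {\<one>}"
    using ord card_mono[of "{\<one>}" "carrier G"] by (auto simp: order_def)
  then obtain s where s: "s \<in> carrier G" "s \<noteq> \<one>" by blast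
  have "card (generate G {s}) \<le> 3" by (rule card_generate_1[OF exp _ s(1)]) auto
  then have "\<not> carrier G \<subseteq> generate G {s}"
    using ord card_mono[of "generate G {s}" "carrier G"] finite_subset[OF generate_incl[of "{s}"] fin] s
    by (auto simp: order_def)
  then obtain t where t: "t \<in> carrier G" "t \<notin> generate G {s}" by blast
  have st: "{s, t} \<subseteq> carrier G" using s t by simp
  have sub: "subgroup (generate G {s, t}) G" by (rule generate_is_subgroup[OF st])
  have "card (generate G {s, t}) dvd order G"
    using dvd_triv_right[of "card (generate G {s, t})" "card (rcosets generate G {s, t})"] lagrange[OF sub] by simp
  then have dvd: "card (generate G {s, t}) dvd 3 ^ 2" using ord by simp
  have sub1: "subgroup (generate G {s}) G" by (rule generate_is_subgroup) (use s in simp)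
  have "generate G {s} \<subset> generate G {s, t}"
    using t mono_generate[of "{s}" "{s,t}"] generate.incl[of t "{s,t}" G] by auto
  then have "card (generate G {s}) < card (generate G {s, t})"
    using finite_subset[OF generate_incl[OF st] fin] by (rule psubset_card_mono[rotated])
  moreover have "card (generate G {s}) \<noteq> 1"
  proof
    assume "card (generate G {s}) = 1"
    then obtain z where "generate G {s} = {z}" by (auto simp: card_1_singleton_iff)
    moreover have "s \<in> generate G {s}" "\<one> \<in> generate G {s}" by (auto intro: generate.intros)
    ultimately show False using s by auto
  qed
  moreover have "card (generate G {s}) dvd 3 ^ 2"
    using dvd_triv_right[of "card (generate G {s})" "card (rcosets generate G {s})"] lagrange[OF sub1] ord by simp
  ultimately have "card (generate G {s, t}) = 9"
  proof -
    assume lt: "card (generate G {s}) < card (generate G {s, t})" and 1: "card (generate G {s}) \<noteq> 1"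
      and d: "card (generate G {s}) dvd 3 ^ 2"
    have three: "Factorial_Ring.prime (3::nat)" by simp
    obtain i where i: "i \<le> 2" "card (generate G {s}) = 3 ^ i"
      using d divides_primepow_nat[OF three] by blast
    obtain j where j: "j \<le> 2" "card (generate G {s, t}) = 3 ^ j"
      using dvd divides_primepow_nat[OF three] by blast
    have "i < j" using lt i j by simp
    moreover have "i \<noteq> 0" using 1 i by (intro notI) simp
    ultimately have "j = 2" using j by simp
    then show ?thesis using j by simp
  qed
  then have "generate G {s, t} = carrier G"
    using generate_incl[OF st] fin ord by (intro card_subset_eq) (auto simp: order_def)
  moreover have "card {s, t} = 2"
    using t generate.incl[of s "{s}"] by (cases "s = t") auto
  ultimately show "\<exists>S. S \<subseteq> carrier G \<and> finite S \<and> card S = 2 \<and> generate G S = carrier G"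
    using st by blast
next
  fix d assume "\<exists>S. S \<subseteq> carrier G \<and> finite S \<and> card S = d \<and> generate G S = carrier G"
  then obtain S where S: "S \<subseteq> carrier G" "finite S" "card S = d" "generate G S = carrier G" by blast
  show "2 \<le> d"
  proof (rule ccontr)
    assume "\<not> 2 \<le> d"
    then have "card S \<le> Suc 0" using S by simp
    then have one: "\<forall>x\<in>S. \<forall>y\<in>S. x = y"
      using S(2) by (simp add: card_le_Suc0_iff_eq)
    obtain s where "S \<subseteq> {s}" "s \<in> carrier G"
    proof (cases "S = {}")
      case True
      show ?thesis by (rule that[of \<one>]) (use True in auto)
    next
      case False
      then obtain x where "x \<in> S" by blast
      then show ?thesis using that[of x] one S(1) by blast
    qed
    then have "card (generate G S) \<le> 3" using card_generate_1[OF exp] by blast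
    then show False using S ord by (simp add: order_def)
  qed
qed

section \<open>Cochains on lists in degrees one and two\<close>

lemma coboundary_add:
  "coboundary G n (\<lambda>xs. f xs + g xs) = (\<lambda>xs. coboundary G n f xs + coboundary G n g xs)"
  by (rule ext) (simp add: coboundary_def sum.distrib algebra_simps)

lemma coboundary_uminus:
  "coboundary G n (\<lambda>xs. - f xs) = (\<lambda>xs. - coboundary G n f xs)"
  by (rule ext) (simp add: coboundary_def sum_negf algebra_simps)

lemma coboundary_0: "coboundary G n (\<lambda>xs. 0) = (\<lambda>xs. 0)"
  by (rule ext) (simp add: coboundary_def)

lemma cocycle_group_simps [simp]:
  "carrier (cocycle_group G n) = {f \<in> cochains G n. coboundary G n f = (\<lambda>xs. 0)}"
  "f \<otimes>\<^bsub>cocycle_group G n\<^esub> g = (\<lambda>xs. f xs + g xs)"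
  "\<one>\<^bsub>cocycle_group G n\<^esub> = (\<lambda>xs. 0)"
  by (simp_all add: cocycle_group_def)

lemma comm_group_cocycle_group: "comm_group (cocycle_group G n)"
proof (rule comm_groupI)
  fix f assume "f \<in> carrier (cocycle_group G n)"
  then show "\<exists>g\<in>carrier (cocycle_group G n). g \<otimes>\<^bsub>cocycle_group G n\<^esub> f = \<one>\<^bsub>cocycle_group G n\<^esub>"
    by (intro bexI[of _ "\<lambda>xs. - f xs"]) (auto simp: cochains_def coboundary_uminus)
qed (auto simp: cochains_def coboundary_add coboundary_0 algebra_simps)

lemma finite_cocycle_group:
  assumes "finite (carrier G)"
  shows "finite (carrier (cocycle_group G n))"
proof -
  have "finite {xs. set xs \<subseteq> carrier G \<and> length xs = n}"
    by (rule finite_lists_length_eq[OF assms])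
  then have "finite {f::'a list \<Rightarrow> 3. \<forall>xs. (xs \<in> {xs. set xs \<subseteq> carrier G \<and> length xs = n} \<longrightarrow> f xs \<in> UNIV)
      \<and> (xs \<notin> {xs. set xs \<subseteq> carrier G \<and> length xs = n} \<longrightarrow> f xs = 0)}"
    by (rule finite_set_of_finite_funs) simp
  then show ?thesis
    by (rule finite_subset[rotated]) (auto simp: cochains_def)
qed

text \<open>Together with \<open>cochain2\<close> a bridge from functions of group elements to
  cochains on lists, which have to vanish on all lists of the wrong shape.\<close>

definition cochain1 :: "('a, 'b) monoid_scheme \<Rightarrow> ('a \<Rightarrow> 3) \<Rightarrow> 'a list \<Rightarrow> 3" where
  "cochain1 G h xs = (if length xs = 1 \<and> set xs \<subseteq> carrier G then h (xs ! 0) else 0)"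

definition cochain2 :: "('a, 'b) monoid_scheme \<Rightarrow> ('a \<Rightarrow> 'a \<Rightarrow> 3) \<Rightarrow> 'a list \<Rightarrow> 3" where
  "cochain2 G f xs = (if length xs = 2 \<and> set xs \<subseteq> carrier G then f (xs ! 0) (xs ! 1) else 0)"

lemma cochain1_Cons [simp]: "x \<in> carrier G \<Longrightarrow> cochain1 G h [x] = h x"
  by (simp add: cochain1_def)

lemma cochain2_Cons [simp]: "x \<in> carrier G \<Longrightarrow> y \<in> carrier G \<Longrightarrow> cochain2 G f [x, y] = f x y"
  by (simp add: cochain2_def)

lemma cochain1_in: "cochain1 G h \<in> cochains G (Suc 0)"
  by (auto simp: cochains_def cochain1_def)

lemma cochain2_in: "cochain2 G f \<in> cochains G 2"
  by (auto simp: cochains_def cochain2_def)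

lemma cochains_1E: "f \<in> cochains G (Suc 0) \<Longrightarrow> f = cochain1 G (\<lambda>x. f [x])"
  by (rule ext) (auto simp: cochains_def cochain1_def length_Suc_conv)

lemma cochains_2E: "f \<in> cochains G 2 \<Longrightarrow> f = cochain2 G (\<lambda>x y. f [x, y])"
  by (rule ext) (auto simp: cochains_def cochain2_def length_Suc_conv numeral_2_eq_2)

lemma coboundaries_2: "coboundaries G 2 = coboundary G (Suc 0) ` cochains G (Suc 0)"
  by (simp add: numeral_2_eq_2)

context group
begin

lemma coboundary_cochain1:
  "coboundary G (Suc 0) (cochain1 G h) = cochain2 G (\<lambda>x y. h y - h (x \<otimes> y) + h x)"
proof (rule ext)
  fix xs
  show "coboundary G (Suc 0) (cochain1 G h) xs = cochain2 G (\<lambda>x y. h y - h (x \<otimes> y) + h x) xs"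
  proof (cases "length xs = 2 \<and> set xs \<subseteq> carrier G")
    case True
    then obtain x y where xs: "xs = [x, y]" by (auto simp: length_Suc_conv numeral_2_eq_2)
    with True show ?thesis by (simp add: coboundary_def)
  next
    case False
    then show ?thesis by (auto simp: coboundary_def cochain2_def)
  qed
qed

lemma coboundary_1:
  assumes "h \<in> cochains G (Suc 0)"
  shows "coboundary G (Suc 0) h = cochain2 G (\<lambda>x y. h [y] - h [x \<otimes> y] + h [x])"
  by (subst cochains_1E[OF assms]) (rule coboundary_cochain1)

lemma coboundary_cochain2:
  "coboundary G 2 (cochain2 G f) = (\<lambda>xs. 0) \<longleftrightarrow> cocycle G f"
proof -
  have val: "coboundary G 2 (cochain2 G f) [x, y, z] = f y z - f (x \<otimes> y) z + f x (y \<otimes> z) - f x y"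
    if "x \<in> carrier G" "y \<in> carrier G" "z \<in> carrier G" for x y z
  proof -
    have "{1..2::nat} = {1, 2}" by auto
    then show ?thesis using that by (simp add: coboundary_def numeral_2_eq_2)
  qed
  show ?thesis
  proof
    assume z: "coboundary G 2 (cochain2 G f) = (\<lambda>xs. 0)"
    show "cocycle G f"
      unfolding cocycle_def
    proof (intro ballI)
      fix x y z assume "x \<in> carrier G" "y \<in> carrier G" "z \<in> carrier G"
      then show "f x y + f (x \<otimes> y) z = f y z + f x (y \<otimes> z)"
        using val[of x y z] fun_cong[OF z, of "[x, y, z]"] by (simp add: algebra_simps)
    qed
  next
    assume c: "cocycle G f"
    show "coboundary G 2 (cochain2 G f) = (\<lambda>xs. 0)"
    proof (rule ext)
      fix xs
      show "coboundary G 2 (cochain2 G f) xs = 0"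
      proof (cases "length xs = 3 \<and> set xs \<subseteq> carrier G")
        case True
        then obtain x y z where xs: "xs = [x, y, z]" by (auto simp: length_Suc_conv numeral_3_eq_3)
        with True c show ?thesis using val[of x y z] by (auto simp: cocycle_def algebra_simps)
      next
        case False
        then show ?thesis by (auto simp: coboundary_def)
      qed
    qed
  qed
qed

lemma cochain2_cocycle: "cochain2 G f \<in> carrier (cocycle_group G 2) \<longleftrightarrow> cocycle G f"
  by (simp add: cochain2_in coboundary_cochain2)

lemma cochain2_coboundary: "cochain2 G f \<in> coboundaries G 2 \<longleftrightarrow> (\<exists>h. cobounds G h f)"
proof
  assume "cochain2 G f \<in> coboundaries G 2"
  then obtain h where "h \<in> cochains G (Suc 0)" "cochain2 G f = coboundary G (Suc 0) h"
    unfolding coboundaries_2 by blast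
  then have eq: "cochain2 G f = cochain2 G (\<lambda>x y. h [y] - h [x \<otimes> y] + h [x])"
    by (simp add: coboundary_1)
  \<comment> \<open>The sign convention of \<open>cobounds\<close> is opposite to that of
    \<open>coboundary\<close>, whence the minus.\<close>
  have "cobounds G (\<lambda>x. - h [x]) f"
    unfolding cobounds_def
  proof (intro ballI)
    fix x y assume "x \<in> carrier G" "y \<in> carrier G"
    then show "- h [x \<otimes> y] = - h [x] + - h [y] + f x y"
      using fun_cong[OF eq, of "[x, y]"] by simp
  qed
  then show "\<exists>h. cobounds G h f" by blast
next
  assume "\<exists>h. cobounds G h f"
  then obtain h where h: "cobounds G h f" by blast
  have "cochain2 G f = coboundary G (Suc 0) (cochain1 G (\<lambda>x. - h x))"
    unfolding coboundary_cochain1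
    using h by (intro ext) (auto simp: cochain2_def cobounds_def length_Suc_conv numeral_2_eq_2)
  then show "cochain2 G f \<in> coboundaries G 2"
    unfolding coboundaries_2 using cochain1_in by blast
qed

lemma cobounds_cocycle: "cobounds G h f \<Longrightarrow> cocycle G f"
  unfolding cobounds_def cocycle_def
proof (intro ballI)
  fix x y z
  assume h: "\<forall>x\<in>carrier G. \<forall>y\<in>carrier G. h (x \<otimes> y) = h x + h y + f x y"
    and xyz: "x \<in> carrier G" "y \<in> carrier G" "z \<in> carrier G"
  then have "h (x \<otimes> y \<otimes> z) = h x + h y + f x y + h z + f (x \<otimes> y) z"
    "h (x \<otimes> (y \<otimes> z)) = h x + (h y + h z + f y z) + f x (y \<otimes> z)" by simp_all
  then show "f x y + f (x \<otimes> y) z = f y z + f x (y \<otimes> z)"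
    using xyz by (simp add: m_assoc algebra_simps)
qed

lemma coboundaries_2_subset: "coboundaries G 2 \<subseteq> carrier (cocycle_group G 2)"
proof
  fix F assume "F \<in> coboundaries G 2"
  then obtain h where "h \<in> cochains G (Suc 0)" "F = coboundary G (Suc 0) h"
    unfolding coboundaries_2 by blast
  then have F: "F = cochain2 G (\<lambda>x y. h [y] - h [x \<otimes> y] + h [x])"
    by (simp add: coboundary_1)
  with \<open>F \<in> coboundaries G 2\<close> obtain k where "cobounds G k (\<lambda>x y. h [y] - h [x \<otimes> y] + h [x])"
    using cochain2_coboundary by blast
  then show "F \<in> carrier (cocycle_group G 2)"
    unfolding F cochain2_cocycle by (rule cobounds_cocycle)
qed

lemma subgroup_coboundaries_2: "subgroup (coboundaries G 2) (cocycle_group G 2)"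
proof -
  interpret Z: comm_group "cocycle_group G 2" by (rule comm_group_cocycle_group)
  have two: "coboundaries G 2 = coboundary G 1 ` cochains G 1" by (simp add: coboundaries_2)
  show ?thesis
  proof (rule Z.subgroupI[OF coboundaries_2_subset])
    show "coboundaries G 2 \<noteq> {}" using cochain1_in by (auto simp: two)
  next
    fix F assume F: "F \<in> coboundaries G 2"
    then obtain h where h: "h \<in> cochains G 1" "F = coboundary G 1 h" by (auto simp: two)
    have n: "(\<lambda>xs. - F xs) \<in> coboundaries G 2"
      unfolding two by (rule image_eqI[of _ _ "\<lambda>xs. - h xs"])
        (use h in \<open>auto simp: coboundary_uminus cochains_def\<close>)
    have "inv\<^bsub>cocycle_group G 2\<^esub> F = (\<lambda>xs. - F xs)"
    proof (rule Z.inv_equality)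
      show "(\<lambda>xs. - F xs) \<otimes>\<^bsub>cocycle_group G 2\<^esub> F = \<one>\<^bsub>cocycle_group G 2\<^esub>" by simp
    qed (use F n coboundaries_2_subset in blast)+
    then show "inv\<^bsub>cocycle_group G 2\<^esub> F \<in> coboundaries G 2" using n by simp
  next
    fix F F' assume "F \<in> coboundaries G 2" "F' \<in> coboundaries G 2"
    then obtain h h' where h: "h \<in> cochains G 1" "F = coboundary G 1 h"
        "h' \<in> cochains G 1" "F' = coboundary G 1 h'" by (auto simp: two)
    show "F \<otimes>\<^bsub>cocycle_group G 2\<^esub> F' \<in> coboundaries G 2"
      unfolding two by (rule image_eqI[of _ _ "\<lambda>xs. h xs + h' xs"])
        (use h in \<open>auto simp: coboundary_add cochains_def\<close>)
  qed
qed

text \<open>The coefficients are trivial, so the two terms \<open>f []\<close> and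
  \<open>- f []\<close> in the coboundary of a 0-cochain cancel.\<close>

lemma coboundaries_1: "coboundaries G 1 = {\<lambda>xs. 0}"
proof -
  have "coboundary G 0 f = (\<lambda>xs. 0)" if "f \<in> cochains G 0" for f
    by (rule ext) (auto simp: coboundary_def length_Suc_conv)
  moreover have "(\<lambda>xs. 0) \<in> cochains G 0" by (simp add: cochains_def)
  ultimately show ?thesis by auto
qed

end

lemma order_Mod:
  assumes "comm_group A" "subgroup B A"
  shows "order (A Mod B) * card B = order A"
proof -
  interpret comm_group A by fact
  show ?thesis using lagrange[OF assms(2)] by (simp add: order_def FactGroup_def)
qed

context C3_C3_group
begin

text \<open>By \<open>carry_independent\<close> the two carry classes always span a plane in the
  second cohomology group; the condition says that this plane is everything.\<close>

definition balanced :: bool where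
  "balanced \<longleftrightarrow> (\<forall>f. cocycle V f \<longrightarrow>
     (\<exists>h m n. cobounds V h (\<lambda>x y. f x y + (m * carry (a x) (a y) + n * carry (b x) (b y)))))"

lemma exponent_3_Mod:
  assumes "subgroup B (cocycle_group V n)" "C \<in> carrier (cocycle_group V n Mod B)"
  shows "C \<otimes>\<^bsub>cocycle_group V n Mod B\<^esub> C \<otimes>\<^bsub>cocycle_group V n Mod B\<^esub> C = \<one>\<^bsub>cocycle_group V n Mod B\<^esub>"
proof -
  interpret Z: comm_group "cocycle_group V n" by (rule comm_group_cocycle_group)
  interpret N: normal B "cocycle_group V n" using assms(1) by (rule Z.subgroup_imp_normal)
  obtain F where F: "F \<in> carrier (cocycle_group V n)" "C = B #>\<^bsub>cocycle_group V n\<^esub> F"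
    using assms(2) by (auto simp: FactGroup_def RCOSETS_def)
  have FFF: "F \<otimes>\<^bsub>cocycle_group V n\<^esub> F \<otimes>\<^bsub>cocycle_group V n\<^esub> F = \<one>\<^bsub>cocycle_group V n\<^esub>"
    by (simp add: triple_mult_eq_0)
  have "C \<otimes>\<^bsub>cocycle_group V n Mod B\<^esub> C \<otimes>\<^bsub>cocycle_group V n Mod B\<^esub> C
      = B #>\<^bsub>cocycle_group V n\<^esub> (F \<otimes>\<^bsub>cocycle_group V n\<^esub> F \<otimes>\<^bsub>cocycle_group V n\<^esub> F)"
    using F(1) N.rcos_sum Z.m_closed unfolding F(2) FactGroup_def by (simp del: cocycle_group_simps)
  then show ?thesis unfolding FFF
    using Z.coset_mult_one[OF subgroup.subset[OF assms(1)]] by (simp add: FactGroup_def del: cocycle_group_simps)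
qed

lemma comm_group_Mod:
  assumes "subgroup B (cocycle_group V n)"
  shows "comm_group (cocycle_group V n Mod B)"
  using comm_group.abelian_FactGroup[OF comm_group_cocycle_group assms] .

text \<open>There are no nonzero 1-coboundaries, and the 1-cocycles are the nine homomorphisms
  \<open>i * a + j * b\<close>.\<close>

lemma cohomology_dim_1: "cohomology_dim V 1 = 2"
proof -
  let ?Z = "cocycle_group V 1"
  interpret Z: comm_group ?Z by (rule comm_group_cocycle_group)
  have sub: "subgroup (coboundaries V 1) ?Z"
    using Z.triv_subgroup unfolding coboundaries_1 by simp
  interpret H: comm_group "?Z Mod coboundaries V 1" by (rule comm_group_Mod[OF sub])
  let ?h = "\<lambda>(i, j). cochain1 V (\<lambda>x. i * a x + j * b x)"
  have "bij_betw ?h UNIV (carrier ?Z)"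
  proof (rule bij_betwI')
    fix p q :: "3 \<times> 3"
    obtain i j i' j' where pq: "p = (i, j)" "q = (i', j')" by (metis surj_pair)
    obtain x where x: "x \<in> carrier V" "a x = 1" "b x = 0" using ex_10 by blast
    obtain y where y: "y \<in> carrier V" "a y = 0" "b y = 1" using ex_01 by blast
    show "(?h p = ?h q) \<longleftrightarrow> (p = q)"
    proof
      assume eq: "?h p = ?h q"
      show "p = q"
        using fun_cong[OF eq, of "[x]"] fun_cong[OF eq, of "[y]"] x y pq by simp
    qed simp
  next
    fix p :: "3 \<times> 3"
    obtain i j where p: "p = (i, j)" by (metis surj_pair)
    have "coboundary V (Suc 0) (cochain1 V (\<lambda>x. i * a x + j * b x)) = (\<lambda>xs. 0)"
      unfolding coboundary_cochain1
      by (rule ext) (auto simp: cochain2_def length_Suc_conv numeral_2_eq_2 algebra_simps)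
    then show "?h p \<in> carrier ?Z"
      using cochain1_in p by simp
  next
    fix F assume "F \<in> carrier ?Z"
    then have F: "F = cochain1 V (\<lambda>x. F [x])" "coboundary V (Suc 0) F = (\<lambda>xs. 0)"
      using cochains_1E by auto
    have eq: "cochain2 V (\<lambda>x y. F [y] - F [x \<otimes> y] + F [x]) = (\<lambda>xs. 0)"
      using F(2) coboundary_1[of F] \<open>F \<in> carrier ?Z\<close> by simp
    have "cobounds V (\<lambda>x. F [x]) (\<lambda>_ _. 0)"
      unfolding cobounds_def
    proof (intro ballI)
      fix x y assume "x \<in> carrier V" "y \<in> carrier V"
      then show "F [x \<otimes> y] = F [x] + F [y] + 0"
        using fun_cong[OF eq, of "[x, y]"] by (simp add: algebra_simps)
    qed
    then obtain i j where ij: "\<And>x. x \<in> carrier V \<Longrightarrow> F [x] = i * a x + j * b x"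
      using hom_combination by blast
    have "F = cochain1 V (\<lambda>x. i * a x + j * b x)"
      by (subst F(1)) (auto simp: cochain1_def ij fun_eq_iff length_Suc_conv)
    then show "\<exists>p\<in>UNIV. F = ?h p" by (intro bexI[of _ "(i, j)"]) auto
  qed
  from bij_betw_same_card[OF this] have "order ?Z = 9"
    by (simp add: order_def card_UNIV_def)
  then have "order (?Z Mod coboundaries V 1) = 9"
    using order_Mod[OF comm_group_cocycle_group sub] by (simp add: coboundaries_1[simplified])
  then have "dim_F3 (?Z Mod coboundaries V 1) = 2"
    by (intro H.dim_F3_order_9 exponent_3_Mod[OF sub]) assumption+
  then show ?thesis
    by (simp add: cohomology_dim_def cohomology_group_def)
qed

text \<open>The nine combinations of carries represent distinct classes. As the second cohomology
  group has exponent 3, dimension two amounts to order nine, that is, to these classes being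
  all.\<close>

lemma cohomology_dim_2_iff: "cohomology_dim V 2 = cohomology_dim V 1 \<longleftrightarrow> balanced"
proof -
  let ?Z = "cocycle_group V 2" and ?B = "coboundaries V 2"
  interpret Z: comm_group ?Z by (rule comm_group_cocycle_group)
  note sub = subgroup_coboundaries_2
  interpret H: comm_group "?Z Mod ?B" by (rule comm_group_Mod[OF sub])
  define f where "f = (\<lambda>(m, n) x y. m * carry (a x) (a y) + n * carry (b x) (b y))"
  have f_cocycle: "cocycle V (f p)" for p
    unfolding cocycle_def
  proof (intro ballI)
    fix x y z assume "x \<in> carrier V" "y \<in> carrier V" "z \<in> carrier V"
    then show "f p x y + f p (x \<otimes> y) z = f p y z + f p x (y \<otimes> z)"
      by (cases p) (simp add: f_def carry_def algebra_simps)
  qed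
  have f_add: "f (m, n) x y + f (m', n') x y = f (m + m', n + n') x y" for m n m' n' x y
    by (simp add: f_def algebra_simps)
  let ?F = "\<lambda>p. ?B #>\<^bsub>?Z\<^esub> cochain2 V (f p)"
  have mem: "cochain2 V g \<in> ?B #>\<^bsub>?Z\<^esub> cochain2 V g' \<longleftrightarrow> (\<exists>h. cobounds V h (\<lambda>x y. g x y - g' x y))"
    if "cocycle V g" "cocycle V g'" for g g'
  proof -
    have "cochain2 V g \<in> ?B #>\<^bsub>?Z\<^esub> cochain2 V g' \<longleftrightarrow> (\<exists>\<beta>\<in>?B. cochain2 V g = (\<lambda>xs. \<beta> xs + cochain2 V g' xs))"
      by (auto simp: r_coset_def)
    also have "\<dots> \<longleftrightarrow> (\<lambda>xs. cochain2 V g xs - cochain2 V g' xs) \<in> ?B"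
      by (auto simp: fun_eq_iff)
        (metis (mono_tags, lifting) diff_add_cancel)
    also have "(\<lambda>xs. cochain2 V g xs - cochain2 V g' xs) = cochain2 V (\<lambda>x y. g x y - g' x y)"
      by (auto simp: cochain2_def fun_eq_iff)
    finally show ?thesis by (simp add: cochain2_coboundary)
  qed
  have inj: "inj ?F"
  proof (rule injI)
    fix p q assume eq: "?F p = ?F q"
    obtain m n m' n' where pq: "p = (m, n)" "q = (m', n')" by (metis surj_pair)
    have "cochain2 V (f p) \<in> ?B #>\<^bsub>?Z\<^esub> cochain2 V (f p)"
      using Z.rcos_self[OF _ sub] f_cocycle cochain2_cocycle by blast
    then obtain h where "cobounds V h (\<lambda>x y. f p x y - f q x y)"
      using mem[OF f_cocycle f_cocycle] eq by metis
    then have "cobounds V h (\<lambda>x y. (m - m') * carry (a x) (a y) + (n - n') * carry (b x) (b y))"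
      by (simp add: pq f_def algebra_simps)
    then show "p = q" using carry_independent pq by fastforce
  qed
  have ran: "range ?F \<subseteq> carrier (?Z Mod ?B)"
    using f_cocycle cochain2_cocycle by (auto simp: FactGroup_def RCOSETS_def simp del: cocycle_group_simps)
  have fin: "finite (carrier (?Z Mod ?B))"
    using finite_cocycle_group[OF finite_carrier, of 2] by (simp add: FactGroup_def RCOSETS_def del: cocycle_group_simps)
  have card: "card (range ?F) = 9"
    using card_image[OF inj] by (simp add: card_UNIV_def)
  have bal: "balanced \<longleftrightarrow> range ?F = carrier (?Z Mod ?B)"
  proof
    assume bal: "balanced"
    show "range ?F = carrier (?Z Mod ?B)"
    proof (rule antisym[OF ran], rule subsetI)
      fix C assume "C \<in> carrier (?Z Mod ?B)"
      then obtain F where F: "F \<in> carrier ?Z" "C = ?B #>\<^bsub>?Z\<^esub> F"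
        by (auto simp: FactGroup_def RCOSETS_def)
      define g where "g x y = F [x, y]" for x y
      have Fg: "F = cochain2 V g" using F cochains_2E[of F V] by (simp add: g_def[abs_def])
      then have g: "cocycle V g" using F(1) cochain2_cocycle by simp
      then obtain h m n where "cobounds V h (\<lambda>x y. g x y + (m * carry (a x) (a y) + n * carry (b x) (b y)))"
        using bal unfolding balanced_def by blast
      then have "cobounds V h (\<lambda>x y. g x y - f (- m, - n) x y)"
        by (simp add: f_def algebra_simps)
      then have "cochain2 V g \<in> ?F (- m, - n)" using mem[OF g f_cocycle] by blast
      then have "C = ?F (- m, - n)"
        using Z.repr_independence[OF _ _ sub] f_cocycle cochain2_cocycle Fg F(2) by metis
      then show "C \<in> range ?F" by blast
    qed
  next
    assume eq: "range ?F = carrier (?Z Mod ?B)"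
    show balanced
      unfolding balanced_def
    proof (intro allI impI)
      fix g assume g: "cocycle V g"
      then have "?B #>\<^bsub>?Z\<^esub> cochain2 V g \<in> carrier (?Z Mod ?B)"
        using cochain2_cocycle by (auto simp: FactGroup_def RCOSETS_def simp del: cocycle_group_simps)
      then obtain p where "?B #>\<^bsub>?Z\<^esub> cochain2 V g = ?F p" using eq by (metis (no_types, lifting) imageE)
      moreover have "cochain2 V g \<in> ?B #>\<^bsub>?Z\<^esub> cochain2 V g"
        using Z.rcos_self[OF _ sub] g cochain2_cocycle by blast
      ultimately obtain h where h: "cobounds V h (\<lambda>x y. g x y - f p x y)"
        using mem[OF g f_cocycle] by metis
      obtain m n where "p = (m, n)" by (metis surj_pair)
      then have "cobounds V h (\<lambda>x y. g x y + (- m * carry (a x) (a y) + - n * carry (b x) (b y)))"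
        using h by (simp add: f_def algebra_simps)
      then show "\<exists>h m n. cobounds V h (\<lambda>x y. g x y + (m * carry (a x) (a y) + n * carry (b x) (b y)))"
        by blast
    qed
  qed
  have exp: "C \<otimes>\<^bsub>?Z Mod ?B\<^esub> C \<otimes>\<^bsub>?Z Mod ?B\<^esub> C = \<one>\<^bsub>?Z Mod ?B\<^esub>" if "C \<in> carrier (?Z Mod ?B)" for C
    using exponent_3_Mod[OF sub that] .
  have "cohomology_dim V 2 = 2 \<longleftrightarrow> balanced"
  proof
    assume "cohomology_dim V 2 = 2"
    then have "order (?Z Mod ?B) \<le> 9"
      using H.dim_F3_2_order_le[OF fin exp] by (simp add: cohomology_dim_def cohomology_group_def)
    then have "range ?F = carrier (?Z Mod ?B)"
      using card ran fin by (intro card_seteq) (simp_all add: order_def)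
    then show balanced using bal by simp
  next
    assume balanced
    then have "order (?Z Mod ?B) = 9" using bal card by (simp add: order_def)
    then show "cohomology_dim V 2 = 2"
      using H.dim_F3_order_9[OF exp] by (simp add: cohomology_dim_def cohomology_group_def)
  qed
  then show ?thesis unfolding cohomology_dim_1 .
qed

end

section \<open>Groups given by power-commutator presentations\<close>

text \<open>Power with exponent in \<open>3\<close>, represented by -1, 0 or 1 to match the balanced
  carries. It is additive in the exponent only if the cube of \<open>g\<close> is trivial; see
  \<open>pw_add_carry\<close>.\<close>

definition pw :: "('a, 'b) monoid_scheme \<Rightarrow> 'a \<Rightarrow> 3 \<Rightarrow> 'a" where
  "pw G g r = (if r = 0 then \<one>\<^bsub>G\<^esub> else if r = 1 then g else inv\<^bsub>G\<^esub> g)"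

context group
begin

lemma pw_simps [simp]: "pw G g 0 = \<one>" "pw G g 1 = g" "pw G g (- 1) = inv g"
    "pw G g 2 = inv g" "pw G g (- 2) = g"
  by (simp_all add: pw_def)

lemma pw_closed [simp]: "g \<in> carrier G \<Longrightarrow> pw G g r \<in> carrier G"
  by (simp add: pw_def)

text \<open>Exponents are added as integers and reduced to balanced digits; each unit carried is
  worth one cube of \<open>g\<close>.\<close>

lemma pw_add_carry:
  assumes g: "g \<in> carrier G"
  shows "pw G g r \<otimes> pw G g r' = pw G g (r + r') \<otimes> pw G (g \<otimes> g \<otimes> g) (carry r r')"
proof -
  have "g \<otimes> g = inv g \<otimes> (g \<otimes> g \<otimes> g)" using g by (simp add: m_assoc[symmetric])
  moreover have "inv g \<otimes> inv g = g \<otimes> inv (g \<otimes> g \<otimes> g)"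
    using g by (simp add: inv_mult_group m_assoc[symmetric])
  ultimately show ?thesis
    using g cases_3[of r] cases_3[of r'] by (elim disjE) simp_all
qed

lemma pw_add:
  assumes g: "g \<in> carrier G" "g \<otimes> g \<otimes> g = \<one>"
  shows "pw G g (r + r') = pw G g r \<otimes> pw G g r'"
  using pw_add_carry[OF g(1), of r r'] g by (simp add: pw_def)

lemma pw_commute:
  assumes "g \<in> carrier G" "h \<in> carrier G" "g \<otimes> h = h \<otimes> g"
  shows "pw G g r \<otimes> h = h \<otimes> pw G g r"
proof -
  have "inv g \<otimes> h = inv g \<otimes> (h \<otimes> g) \<otimes> inv g" using assms(1,2) by (simp add: m_assoc)
  also have "\<dots> = inv g \<otimes> (g \<otimes> h) \<otimes> inv g" using assms(3) by simp
  also have "\<dots> = h \<otimes> inv g" using assms(1,2) by (simp add: m_assoc[symmetric])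
  finally show ?thesis using assms by (simp add: pw_def)
qed

text \<open>The elements that may be split off on the right of every argument of \<psi> are closed
  under products and inverses, so only generators have to be tested, and only as right
  factors.\<close>

lemma hom_of_generators:
  assumes M: "group H" and one: "\<psi> \<one>\<^bsub>H\<^esub> = \<one>" and cl: "\<And>v. v \<in> carrier H \<Longrightarrow> \<psi> v \<in> carrier G"
    and S: "S \<subseteq> carrier H" "generate H S = carrier H"
    and step: "\<And>v w. v \<in> carrier H \<Longrightarrow> w \<in> S \<Longrightarrow> \<psi> (v \<otimes>\<^bsub>H\<^esub> w) = \<psi> v \<otimes> \<psi> w"
  shows "\<psi> \<in> hom H G"
proof -
  interpret H: group H by fact
  have "\<forall>v\<in>carrier H. \<psi> (v \<otimes>\<^bsub>H\<^esub> w) = \<psi> v \<otimes> \<psi> w" if "w \<in> generate H S" for w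
    using that
  proof (induction rule: generate.induct)
    case one
    then show ?case using assms by simp
  next
    case (incl h)
    then show ?case using step by blast
  next
    case (inv h)
    then have h: "h \<in> carrier H" using S by blast
    have *: "\<psi> (v \<otimes>\<^bsub>H\<^esub> inv\<^bsub>H\<^esub> h) = \<psi> v \<otimes> inv (\<psi> h)" if v: "v \<in> carrier H" for v
    proof -
      have "\<psi> v = \<psi> (v \<otimes>\<^bsub>H\<^esub> inv\<^bsub>H\<^esub> h \<otimes>\<^bsub>H\<^esub> h)" using v h by (simp add: H.m_assoc)
      also have "\<dots> = \<psi> (v \<otimes>\<^bsub>H\<^esub> inv\<^bsub>H\<^esub> h) \<otimes> \<psi> h" using step inv v h by simp
      finally show ?thesis using v h cl by (simp add: m_assoc)
    qed
    have "\<psi> (inv\<^bsub>H\<^esub> h) = inv (\<psi> h)" using *[of "\<one>\<^bsub>H\<^esub>"] h cl one by simp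
    with * show ?case by simp
  next
    case (eng h1 h2)
    have "h1 \<in> carrier H" "h2 \<in> carrier H" using eng H.generate_in_carrier[OF S(1)] by blast+
    moreover have "\<psi> (h1 \<otimes>\<^bsub>H\<^esub> h2) = \<psi> h1 \<otimes> \<psi> h2" using eng calculation by simp
    ultimately show ?case using eng cl by (simp add: H.m_assoc[symmetric] m_assoc)
  qed
  with S cl show ?thesis by (simp add: hom_def Pi_iff)
qed

text \<open>Von Dyck's theorem for the presentation of \<^term>\<open>pc_group p q k l\<close>.\<close>

lemma pc_group_hom:
  assumes cl: "x \<in> carrier G" "y \<in> carrier G" "s \<in> carrier G" "t \<in> carrier G" "u \<in> carrier G"
    and yx: "y \<otimes> x = x \<otimes> y \<otimes> s" and sx: "s \<otimes> x = x \<otimes> s \<otimes> t" and sy: "s \<otimes> y = y \<otimes> s \<otimes> u"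
    and tx: "t \<otimes> x = x \<otimes> t" and ty: "t \<otimes> y = y \<otimes> t" and ux: "u \<otimes> x = x \<otimes> u" and uy: "u \<otimes> y = y \<otimes> u"
    and s3: "s \<otimes> s \<otimes> s = \<one>" and t3: "t \<otimes> t \<otimes> t = \<one>" and u3: "u \<otimes> u \<otimes> u = \<one>"
    and x3: "x \<otimes> x \<otimes> x = pw G t p \<otimes> pw G u q" and y3: "y \<otimes> y \<otimes> y = pw G t k \<otimes> pw G u l"
  shows "\<exists>\<psi>\<in>hom (pc_group p q k l) G. \<psi> (1, 0, 0, 0, 0) = x \<and> \<psi> (0, 1, 0, 0, 0) = y"
proof -
  have s: "s = inv (x \<otimes> y) \<otimes> (y \<otimes> x)"
    using cl yx by (simp add: m_assoc[symmetric] inv_mult_group) (simp add: m_assoc)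
  \<comment> \<open>\<open>s\<close> is determined by \<open>x y\<close> and \<open>y x\<close>, so
    an element commuting with \<open>x\<close> and \<open>y\<close> commutes with
    \<open>s\<close>.\<close>
  have comm_s: "z \<otimes> s = s \<otimes> z" if z: "z \<in> carrier G" "z \<otimes> x = x \<otimes> z" "z \<otimes> y = y \<otimes> z" for z
  proof -
    have a: "z \<otimes> (x \<otimes> y) = x \<otimes> y \<otimes> z" "z \<otimes> (y \<otimes> x) = y \<otimes> x \<otimes> z"
      using z cl by (metis m_assoc)+
    have "x \<otimes> y \<otimes> (z \<otimes> s) = z \<otimes> (x \<otimes> y \<otimes> s)"
      using a z cl by (metis m_assoc m_closed)
    also have "\<dots> = x \<otimes> y \<otimes> (s \<otimes> z)"
      using a z cl yx by (metis m_assoc m_closed)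
    finally show ?thesis using z cl by simp
  qed
  have ts: "t \<otimes> s = s \<otimes> t" and us: "u \<otimes> s = s \<otimes> u" using comm_s cl tx ty ux uy by simp_all
  have tu: "t \<otimes> u = u \<otimes> t"
  proof -
    have a: "t \<otimes> (s \<otimes> y) = s \<otimes> y \<otimes> t" "t \<otimes> (y \<otimes> s) = y \<otimes> s \<otimes> t"
      using cl ts ty by (metis m_assoc)+
    have "y \<otimes> s \<otimes> (t \<otimes> u) = t \<otimes> (y \<otimes> s \<otimes> u)" using a cl by (metis m_assoc m_closed)
    also have "\<dots> = y \<otimes> s \<otimes> (u \<otimes> t)" using a cl sy by (metis m_assoc m_closed)
    finally show ?thesis using cl by simp
  qed
  have ist: "inv (s \<otimes> t) = inv s \<otimes> inv t" and isu: "inv (s \<otimes> u) = inv s \<otimes> inv u"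
    using inv_mult_group[of t s] inv_mult_group[of u s] ts us cl by simp_all
  \<comment> \<open>The central part of the normal form. It is additive in both exponents because
    \<open>t\<close> and \<open>u\<close> commute and have trivial cubes.\<close>
  define Z where "Z d e = pw G t d \<otimes> pw G u e" for d e
  have Zcl [simp]: "Z d e \<in> carrier G" for d e using cl by (simp add: Z_def)
  have Zc: "Z d e \<otimes> g = g \<otimes> Z d e" if "g \<in> carrier G" "t \<otimes> g = g \<otimes> t" "u \<otimes> g = g \<otimes> u" for d e g
    using pw_commute[OF cl(4) that(1,2), of d] pw_commute[OF cl(5) that(1,3), of e] that(1) cl
    unfolding Z_def by (metis m_assoc pw_closed)
  have Zpw: "Z d e \<otimes> pw G g r = pw G g r \<otimes> Z d e" if "g \<in> {x, y, s}" for d e r g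
    using pw_commute[of g "Z d e" r] Zc[of g d e] that cl tx ty ts ux uy us by auto
  have Zmove: "Z d e \<otimes> (pw G g r \<otimes> w) = pw G g r \<otimes> (Z d e \<otimes> w)"
    if "g \<in> {x, y, s}" "w \<in> carrier G" for d e r g w
  proof -
    have "pw G g r \<in> carrier G" using that cl by auto
    then show ?thesis using Zpw[OF that(1), of d e r] that(2) by (simp add: m_assoc[symmetric])
  qed
  have Zadd: "Z d e \<otimes> Z d' e' = Z (d + d') (e + e')" for d e d' e'
  proof -
    have "pw G t r \<otimes> u = u \<otimes> pw G t r" for r using pw_commute[OF cl(4,5) tu] .
    then have "pw G u r' \<otimes> pw G t r = pw G t r \<otimes> pw G u r'" for r r'
      using pw_commute[of u "pw G t r" r'] cl by simp
    then show ?thesis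
      unfolding Z_def pw_add[OF cl(4) t3] pw_add[OF cl(5) u3]
      using cl by (metis m_assoc m_closed pw_closed)
  qed
  have Z0: "Z 0 0 = \<one>" by (simp add: Z_def)
  have sx_pw: "pw G s c \<otimes> x = x \<otimes> (pw G s c \<otimes> Z c 0)" for c
  proof -
    have "inv s \<otimes> x = x \<otimes> (inv s \<otimes> inv t)"
    proof -
      have "s \<otimes> (x \<otimes> (inv s \<otimes> inv t)) = x \<otimes> s \<otimes> t \<otimes> (inv s \<otimes> inv t)"
        using cl sx by (metis inv_closed m_assoc m_closed)
      also have "\<dots> = x \<otimes> (s \<otimes> t) \<otimes> inv (s \<otimes> t)" unfolding ist using cl by (simp add: m_assoc)
      also have "\<dots> = x" using cl by (simp add: m_assoc del: inv_mult_group)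
      finally show ?thesis using cl by (metis inv_closed inv_solve_left m_closed)
    qed
    then show ?thesis using cases_3[of c] cl sx by (auto simp: Z_def m_assoc)
  qed
  have sy_pw: "pw G s c \<otimes> y = y \<otimes> (pw G s c \<otimes> Z 0 c)" for c
  proof -
    have "inv s \<otimes> y = y \<otimes> (inv s \<otimes> inv u)"
    proof -
      have "s \<otimes> (y \<otimes> (inv s \<otimes> inv u)) = y \<otimes> s \<otimes> u \<otimes> (inv s \<otimes> inv u)"
        using cl sy by (metis inv_closed m_assoc m_closed)
      also have "\<dots> = y \<otimes> (s \<otimes> u) \<otimes> inv (s \<otimes> u)" unfolding isu using cl by (simp add: m_assoc)
      also have "\<dots> = y" using cl by (simp add: m_assoc del: inv_mult_group)
      finally show ?thesis using cl by (metis inv_closed inv_solve_left m_closed)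
    qed
    then show ?thesis using cases_3[of c] cl sy by (auto simp: Z_def m_assoc)
  qed
  \<comment> \<open>\<open>b - b * b\<close> is the binomial coefficient of \<open>b\<close> over 2:
    moving \<open>x\<close> to the left creates one \<open>s\<close> for each \<open>y\<close>, and
    every \<open>s\<close> then passes the \<open>y\<close> factors on its right, leaving a
    \<open>u\<close> each time.\<close>
  have yx_pw: "pw G y b \<otimes> x = x \<otimes> (pw G y b \<otimes> (pw G s b \<otimes> Z 0 (b - b * b)))" for b
  proof -
    have "y \<otimes> (x \<otimes> (inv y \<otimes> (inv s \<otimes> u))) = x"
    proof -
      have "s \<otimes> inv y = inv y \<otimes> (s \<otimes> inv u)"
      proof -
        have "y \<otimes> (s \<otimes> inv y) = y \<otimes> s \<otimes> u \<otimes> (inv u \<otimes> inv y)"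
          using cl by (simp add: m_assoc) (simp add: m_assoc[symmetric])
        also have "\<dots> = s \<otimes> y \<otimes> (inv u \<otimes> inv y)" using sy by simp
        also have "\<dots> = s \<otimes> (y \<otimes> inv (y \<otimes> u))" using cl by (simp add: m_assoc inv_mult_group)
        also have "\<dots> = s \<otimes> inv u" using cl uy[symmetric] by (simp add: inv_mult_group m_assoc[symmetric])
        finally show ?thesis using cl by (metis inv_closed inv_solve_left m_closed)
      qed
      have "y \<otimes> (x \<otimes> (inv y \<otimes> (inv s \<otimes> u))) = x \<otimes> y \<otimes> s \<otimes> (inv y \<otimes> (inv s \<otimes> u))"
        using cl yx by (metis inv_closed m_assoc m_closed)
      also have "\<dots> = x \<otimes> y \<otimes> (s \<otimes> inv y) \<otimes> (inv s \<otimes> u)" using cl by (simp add: m_assoc)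
      also have "\<dots> = x \<otimes> (s \<otimes> inv u) \<otimes> (inv s \<otimes> u)"
        unfolding \<open>s \<otimes> inv y = inv y \<otimes> (s \<otimes> inv u)\<close> using cl by (simp add: m_assoc) (simp add: m_assoc[symmetric])
      also have "\<dots> = x \<otimes> ((s \<otimes> inv u) \<otimes> inv (inv u \<otimes> s))" using cl by (simp add: m_assoc inv_mult_group)
      also have "inv u \<otimes> s = s \<otimes> inv u" using pw_commute[OF cl(5,3) us, of "- 1"] by simp
      finally show ?thesis using cl by (simp del: inv_mult_group)
    qed
    then have "inv y \<otimes> x = x \<otimes> (inv y \<otimes> (inv s \<otimes> u))"
      using cl by (metis inv_closed inv_solve_left m_closed)
    then show ?thesis using cases_3[of b] cl yx by (auto simp: Z_def m_assoc)
  qed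
  have Zpw_1: "pw G (Z d e) r = Z (d * r) (e * r)" for d e r
  proof -
    have "inv (Z d e) = Z (- d) (- e)"
      using Zadd[of "- d" "- e" d e] Z0 by (intro inv_equality) simp_all
    then show ?thesis using cases_3[of r] Z0 by auto
  qed
  have x3': "x \<otimes> x \<otimes> x = Z p q" and y3': "y \<otimes> y \<otimes> y = Z k l" using x3 y3 by (simp_all add: Z_def)
  \<comment> \<open>The normal form word. By \<open>hom_of_generators\<close> only right
    multiplication by the two generators has to be compared with the multiplication of the presented
    group.\<close>
  define \<psi> where "\<psi> = (\<lambda>(a, b, c, d, e). pw G x a \<otimes> (pw G y b \<otimes> (pw G s c \<otimes> Z d e)))"
  have \<psi>cl: "\<psi> v \<in> carrier G" for v using cl by (simp add: \<psi>_def split: prod.split)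
  have X: "\<psi> (v \<otimes>\<^bsub>pc_group p q k l\<^esub> (1, 0, 0, 0, 0)) = \<psi> v \<otimes> x" for v
  proof -
    obtain a b c d e where v: "v = (a, b, c, d, e)" by (metis surj_pair)
    have "\<psi> v \<otimes> x = pw G x a \<otimes> (pw G y b \<otimes> (pw G s c \<otimes> (Z d e \<otimes> x)))"
      using cl by (simp add: v \<psi>_def m_assoc)
    also have "\<dots> = pw G x a \<otimes> (pw G y b \<otimes> ((pw G s c \<otimes> x) \<otimes> Z d e))"
      using cl Zc[OF cl(1) tx ux] by (simp add: m_assoc)
    also have "\<dots> = pw G x a \<otimes> (pw G y b \<otimes> x \<otimes> (pw G s c \<otimes> (Z c 0 \<otimes> Z d e)))"
      unfolding sx_pw using cl by (simp add: m_assoc)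
    also have "\<dots> = pw G x a \<otimes> x \<otimes> (pw G y b \<otimes> (pw G s b \<otimes> (Z 0 (b - b * b) \<otimes> pw G s c) \<otimes> (Z c 0 \<otimes> Z d e)))"
      unfolding yx_pw using cl by (simp add: m_assoc)
    also have "Z 0 (b - b * b) \<otimes> pw G s c = pw G s c \<otimes> Z 0 (b - b * b)" by (rule Zpw) simp
    also have "pw G x a \<otimes> x = pw G x (a + 1) \<otimes> Z (p * carry a 1) (q * carry a 1)"
      using pw_add_carry[OF cl(1), of a 1] by (simp add: x3' Zpw_1)
    also have "pw G x (a + 1) \<otimes> Z (p * carry a 1) (q * carry a 1) \<otimes>
        (pw G y b \<otimes> (pw G s b \<otimes> (pw G s c \<otimes> Z 0 (b - b * b)) \<otimes> (Z c 0 \<otimes> Z d e)))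
      = pw G x (a + 1) \<otimes> (Z (p * carry a 1) (q * carry a 1) \<otimes>
        (pw G y b \<otimes> (pw G s b \<otimes> pw G s c \<otimes> (Z 0 (b - b * b) \<otimes> (Z c 0 \<otimes> Z d e)))))"
      using cl by (simp add: m_assoc)
    also have "pw G s b \<otimes> pw G s c = pw G s (c + b)" using pw_add[OF cl(3) s3, of b c] by (simp add: add.commute)
    also have "Z (p * carry a 1) (q * carry a 1) \<otimes>
        (pw G y b \<otimes> (pw G s (c + b) \<otimes> (Z 0 (b - b * b) \<otimes> (Z c 0 \<otimes> Z d e))))
      = pw G y b \<otimes> (pw G s (c + b) \<otimes> (Z (p * carry a 1) (q * carry a 1) \<otimes> (Z 0 (b - b * b) \<otimes> (Z c 0 \<otimes> Z d e))))"
      using cl by (simp add: Zmove)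
    finally show ?thesis
      by (simp add: v \<psi>_def mult_pc_group Zadd algebra_simps)
  qed
  have Y: "\<psi> (v \<otimes>\<^bsub>pc_group p q k l\<^esub> (0, 1, 0, 0, 0)) = \<psi> v \<otimes> y" for v
  proof -
    obtain a b c d e where v: "v = (a, b, c, d, e)" by (metis surj_pair)
    have "\<psi> v \<otimes> y = pw G x a \<otimes> (pw G y b \<otimes> (pw G s c \<otimes> (Z d e \<otimes> y)))"
      using cl by (simp add: v \<psi>_def m_assoc)
    also have "\<dots> = pw G x a \<otimes> (pw G y b \<otimes> ((pw G s c \<otimes> y) \<otimes> Z d e))"
      using cl Zc[OF cl(2) ty uy] by (simp add: m_assoc)
    also have "\<dots> = pw G x a \<otimes> ((pw G y b \<otimes> y) \<otimes> (pw G s c \<otimes> (Z 0 c \<otimes> Z d e)))"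
      unfolding sy_pw using cl by (simp add: m_assoc)
    also have "pw G y b \<otimes> y = pw G y (b + 1) \<otimes> Z (k * carry b 1) (l * carry b 1)"
      using pw_add_carry[OF cl(2), of b 1] by (simp add: y3' Zpw_1)
    also have "pw G y (b + 1) \<otimes> Z (k * carry b 1) (l * carry b 1) \<otimes> (pw G s c \<otimes> (Z 0 c \<otimes> Z d e))
      = pw G y (b + 1) \<otimes> (pw G s c \<otimes> (Z (k * carry b 1) (l * carry b 1) \<otimes> (Z 0 c \<otimes> Z d e)))"
      using cl by (simp add: Zmove m_assoc)
    finally show ?thesis
      by (simp add: v \<psi>_def mult_pc_group Zadd algebra_simps)
  qed
  have gens: "\<psi> (1, 0, 0, 0, 0) = x" "\<psi> (0, 1, 0, 0, 0) = y" "\<psi> (0, 0, 0, 0, 0) = \<one>"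
    using cl by (simp_all add: \<psi>_def Z0)
  have "\<psi> \<in> hom (pc_group p q k l) G"
  proof (rule hom_of_generators[OF group_pc_group _ \<psi>cl _ pc_group_generators])
    show "\<psi> \<one>\<^bsub>pc_group p q k l\<^esub> = \<one>" using gens by (simp add: pc_group_def)
    show "{(1, 0, 0, 0, 0), (0, 1, 0, 0, 0)} \<subseteq> carrier (pc_group p q k l)" by (simp add: pc_group_def)
  qed (auto simp: X Y gens)
  with gens show ?thesis by blast
qed

end

lemma carrier_pc_group [simp]: "carrier (pc_group p q k l) = UNIV"
  by (simp add: pc_group_def)

lemma one_pc_group: "\<one>\<^bsub>pc_group p q k l\<^esub> = (0, 0, 0, 0, 0)"
  by (simp add: pc_group_def)

lemma pw_pc_group_t: "pw (pc_group p q k l) (0, 0, 0, d, e) r = (0, 0, 0, d * r, e * r)"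
proof -
  interpret group "pc_group p q k l" by (rule group_pc_group)
  have "inv\<^bsub>pc_group p q k l\<^esub> (0, 0, 0, d, e) = (0, 0, 0, - d, - e)"
    by (rule inv_equality) (simp_all add: pc_group_def)
  then show ?thesis using cases_3[of r] by (auto simp: one_pc_group)
qed

section \<open>Changes of generators and classification of the parameters\<close>

lemma pc_group_subgroup_UNIV:
  assumes "subgroup H (pc_group p q k l)" "(1, 0, 0, 0, 0) \<in> H" "(0, 1, 0, 0, 0) \<in> H"
  shows "H = UNIV"
proof -
  interpret group "pc_group p q k l" by (rule group_pc_group)
  have "generate (pc_group p q k l) {(1, 0, 0, 0, 0), (0, 1, 0, 0, 0)} \<subseteq> H"
    using assms by (intro generate_subgroup_incl) auto
  then show ?thesis by (auto simp: pc_group_generators)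
qed

lemma hom_onto_imp_iso:
  assumes "\<psi> \<in> hom G H" "\<psi> ` carrier G = carrier H" "finite (carrier G)" "order G = order H"
  shows "\<psi> \<in> iso G H"
  using assms eq_card_imp_inj_on[of "carrier G" \<psi>]
  by (auto simp: iso_def bij_betw_def order_def)

lemma hom_pc_group_onto:
  assumes \<psi>: "\<psi> \<in> hom H (pc_group p q k l)" and H: "group H"
    and x: "\<psi> g = (1, 0, 0, 0, 0)" "g \<in> carrier H" and y: "\<psi> h = (0, 1, 0, 0, 0)" "h \<in> carrier H"
  shows "\<psi> ` carrier H = UNIV"
proof -
  interpret group_hom H "pc_group p q k l" \<psi>
    using \<psi> H group_pc_group by (simp add: group_hom_def group_hom_axioms_def)
  show ?thesis by (rule pc_group_subgroup_UNIV[OF img_is_subgroup]) (use x y in \<open>force simp: image_iff\<close>)+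
qed

lemma carry_minus_2 [simp]: "carry (- 2) (- 1) = 0"
  by (simp add: carry_def)

text \<open>The generators \<open>y\<close>, \<open>x\<close> of the right-hand group have the
  commutators s^-1, u^-1, t^-1 in place of s, t, u; rewriting the cubes in these gives the
  parameters on the left. The resulting homomorphism is onto and the orders agree. The next two
  lemmas follow the same pattern.\<close>

lemma pc_group_swap: "pc_group (- l) (- k) (- q) (- p) \<cong> pc_group p q k l"
proof -
  let ?G = "pc_group p q k l" and ?H = "pc_group (- l) (- k) (- q) (- p)"
  interpret group ?G by (rule group_pc_group)
  have "\<exists>\<psi>\<in>hom ?H ?G. \<psi> (1, 0, 0, 0, 0) = (0, 1, 0, 0, 0) \<and> \<psi> (0, 1, 0, 0, 0) = (1, 0, 0, 0, 0)"
    by (rule pc_group_hom[of "(0, 1, 0, 0, 0)" "(1, 0, 0, 0, 0)" "(0, 0, - 1, 0, 0)" "(0, 0, 0, 0, - 1)" "(0, 0, 0, - 1, 0)"])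
      (simp_all add: pw_pc_group_t mult_pc_group one_pc_group)
  then obtain \<psi> where \<psi>: "\<psi> \<in> hom ?H ?G" "\<psi> (1, 0, 0, 0, 0) = (0, 1, 0, 0, 0)" "\<psi> (0, 1, 0, 0, 0) = (1, 0, 0, 0, 0)"
    by blast
  have "\<psi> ` carrier ?H = UNIV"
    by (intro hom_pc_group_onto[OF \<psi>(1) group_pc_group \<psi>(3) _ \<psi>(2)]) simp_all
  then have "\<psi> \<in> iso ?H ?G"
    using \<psi>(1) by (intro hom_onto_imp_iso) (simp_all add: order_pc_group)
  then show ?thesis by (auto simp: is_iso_def)
qed

text \<open>Generators x^-1 and y, with the commutators s^-1 t, t and u^-1.\<close>

lemma pc_group_inv: "pc_group (- p) q k (- l) \<cong> pc_group p q k l"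
proof -
  let ?G = "pc_group p q k l" and ?H = "pc_group (- p) q k (- l)"
  interpret group ?G by (rule group_pc_group)
  have "\<exists>\<psi>\<in>hom ?H ?G. \<psi> (1, 0, 0, 0, 0) = (- 1, 0, 0, 0, 0) \<and> \<psi> (0, 1, 0, 0, 0) = (0, 1, 0, 0, 0)"
    by (rule pc_group_hom[of "(- 1, 0, 0, 0, 0)" "(0, 1, 0, 0, 0)" "(0, 0, - 1, 1, 0)" "(0, 0, 0, 1, 0)" "(0, 0, 0, 0, - 1)"])
      (simp_all add: pw_pc_group_t mult_pc_group one_pc_group)
  then obtain \<psi> where \<psi>: "\<psi> \<in> hom ?H ?G" "\<psi> (1, 0, 0, 0, 0) = (- 1, 0, 0, 0, 0)" "\<psi> (0, 1, 0, 0, 0) = (0, 1, 0, 0, 0)"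
    by blast
  have "\<psi> (inv\<^bsub>?H\<^esub> (1, 0, 0, 0, 0)) = inv\<^bsub>?G\<^esub> (- 1, 0, 0, 0, 0)"
    using group_hom.hom_inv[of ?H ?G \<psi> "(1, 0, 0, 0, 0)"] \<psi> group_pc_group
    by (simp add: group_hom_def group_hom_axioms_def)
  moreover have "inv\<^bsub>?G\<^esub> (- 1, 0, 0, 0, 0) = (1, 0, 0, 0, 0)"
    by (rule inv_equality) (simp_all add: mult_pc_group one_pc_group)
  ultimately have x: "\<psi> (inv\<^bsub>?H\<^esub> (1, 0, 0, 0, 0)) = (1, 0, 0, 0, 0)" by simp
  have "\<psi> ` carrier ?H = UNIV"
    by (intro hom_pc_group_onto[OF \<psi>(1) group_pc_group x _ \<psi>(3)]) simp_all
  then have "\<psi> \<in> iso ?H ?G"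
    using \<psi>(1) by (intro hom_onto_imp_iso) (simp_all add: order_pc_group)
  then show ?thesis by (auto simp: is_iso_def)
qed

text \<open>Generators x y and y, with the commutators s u, t u and u. Here
  \<open>(x y)^3 = t^(p+k+1) u^(q+l-1)\<close>, and replacing t by t u shifts the exponents of
  u.\<close>

lemma pc_group_mul:
  "pc_group (p + k + 1) (q - p - k + l + 1) k (l - k) \<cong> pc_group p q k l"
proof -
  let ?G = "pc_group p q k l" and ?H = "pc_group (p + k + 1) (q - p - k + l + 1) k (l - k)"
  interpret group ?G by (rule group_pc_group)
  have "\<exists>\<psi>\<in>hom ?H ?G. \<psi> (1, 0, 0, 0, 0) = (1, 1, 0, 0, 0) \<and> \<psi> (0, 1, 0, 0, 0) = (0, 1, 0, 0, 0)"
    by (rule pc_group_hom[of "(1, 1, 0, 0, 0)" "(0, 1, 0, 0, 0)" "(0, 0, 1, 0, 1)" "(0, 0, 0, 1, 1)" "(0, 0, 0, 0, 1)"])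
      (simp_all add: pw_pc_group_t mult_pc_group one_pc_group algebra_simps)
  then obtain \<psi> where \<psi>: "\<psi> \<in> hom ?H ?G" "\<psi> (1, 0, 0, 0, 0) = (1, 1, 0, 0, 0)" "\<psi> (0, 1, 0, 0, 0) = (0, 1, 0, 0, 0)"
    by blast
  have "\<psi> ((1, 0, 0, 0, 0) \<otimes>\<^bsub>?H\<^esub> inv\<^bsub>?H\<^esub> (0, 1, 0, 0, 0)) = (1, 1, 0, 0, 0) \<otimes>\<^bsub>?G\<^esub> inv\<^bsub>?G\<^esub> (0, 1, 0, 0, 0)"
    using group_hom.hom_inv[of ?H ?G \<psi> "(0, 1, 0, 0, 0)"] \<psi> group_pc_group hom_mult[OF \<psi>(1)]
    by (simp add: group_hom_def group_hom_axioms_def)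
  moreover have "(1, 1, 0, 0, 0) \<otimes>\<^bsub>?G\<^esub> inv\<^bsub>?G\<^esub> (0, 1, 0, 0, 0) = (1, 0, 0, 0, 0)"
    by (rule inv_solve_right'[THEN iffD2]) (simp_all add: mult_pc_group)
  ultimately have x: "\<psi> ((1, 0, 0, 0, 0) \<otimes>\<^bsub>?H\<^esub> inv\<^bsub>?H\<^esub> (0, 1, 0, 0, 0)) = (1, 0, 0, 0, 0)" by simp
  have "\<psi> ` carrier ?H = UNIV"
    by (intro hom_pc_group_onto[OF \<psi>(1) group_pc_group x _ \<psi>(3)]) simp_all
  then have "\<psi> \<in> iso ?H ?G"
    using \<psi>(1) by (intro hom_onto_imp_iso) (simp_all add: order_pc_group)
  then show ?thesis by (auto simp: is_iso_def)
qed

definition param_swap :: "3 \<times> 3 \<times> 3 \<times> 3 \<Rightarrow> 3 \<times> 3 \<times> 3 \<times> 3" where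
  "param_swap = (\<lambda>(p, q, k, l). (- l, - k, - q, - p))"

definition param_inv :: "3 \<times> 3 \<times> 3 \<times> 3 \<Rightarrow> 3 \<times> 3 \<times> 3 \<times> 3" where
  "param_inv = (\<lambda>(p, q, k, l). (- p, q, k, - l))"

definition param_mul :: "3 \<times> 3 \<times> 3 \<times> 3 \<Rightarrow> 3 \<times> 3 \<times> 3 \<times> 3" where
  "param_mul = (\<lambda>(p, q, k, l). (p + k + 1, q - p - k + l + 1, k, l - k))"

text \<open>The first two quadruples belong to \<open>SG243_5\<close> and \<open>SG243_7\<close>,
  the next three form the family F with \<open>q\<close> in \<open>{0, 1, - 1}\<close>, and the last
  two are G and O.\<close>

definition pc_reps :: "(3 \<times> 3 \<times> 3 \<times> 3) set" where
  "pc_reps = {(1, 0, 1, 0), (1, 0, 0, 1), (0, 0, - 1, 0), (0, 1, - 1, 0), (0, - 1, - 1, 0),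
     (1, 0, 0, - 1), (0, - 1, 1, 0)}"

lemma F3_table:
  "1 + 1 = (- 1 :: 3)" "- 1 + - 1 = (1 :: 3)" "1 + - 1 = (0 :: 3)" "- 1 + 1 = (0 :: 3)"
  "((0::3) = 1) = False" "((0::3) = - 1) = False" "((1::3) = 0) = False" "((1::3) = - 1) = False"
  "((- 1::3) = 0) = False" "((- 1::3) = 1) = False"
  by simp_all

text \<open>A check of all 81 quadruples. The words in the three changes of generators have length
  at most five, so no induction on words is needed.\<close>

lemma pc_reps_reached:
  "P \<in> pc_reps \<or>
    param_mul P \<in> pc_reps \<or>
    param_mul (param_swap P) \<in> pc_reps \<or>
    param_mul (param_mul P) \<in> pc_reps \<or>
    param_mul (param_mul (param_swap P)) \<in> pc_reps \<or>
    param_mul (param_swap (param_mul P)) \<in> pc_reps \<or>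
    param_swap P \<in> pc_reps \<or>
    param_swap (param_mul P) \<in> pc_reps \<or>
    param_swap (param_mul (param_swap P)) \<in> pc_reps \<or>
    param_swap (param_mul (param_mul P)) \<in> pc_reps \<or>
    param_swap (param_mul (param_mul (param_swap P))) \<in> pc_reps \<or>
    param_swap (param_mul (param_swap (param_mul P))) \<in> pc_reps \<or>
    param_inv P \<in> pc_reps \<or>
    param_inv (param_mul P) \<in> pc_reps \<or>
    param_mul (param_inv P) \<in> pc_reps \<or>
    param_inv (param_mul (param_swap P)) \<in> pc_reps \<or>
    param_mul (param_inv (param_swap P)) \<in> pc_reps \<or>
    param_mul (param_swap (param_mul (param_swap P))) \<in> pc_reps \<or>
    param_inv (param_swap P) \<in> pc_reps \<or>
    param_inv (param_swap (param_mul P)) \<in> pc_reps \<or>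
    param_swap (param_mul (param_inv P)) \<in> pc_reps \<or>
    param_inv (param_swap (param_mul (param_swap P))) \<in> pc_reps \<or>
    param_swap (param_mul (param_inv (param_swap P))) \<in> pc_reps \<or>
    param_swap (param_mul (param_swap (param_mul (param_swap P)))) \<in> pc_reps" (is "?R P")
proof -
  obtain p q k l where P: "P = (p, q, k, l)" by (metis surj_pair)
  show ?thesis
    unfolding P using cases_3[of p] cases_3[of q] cases_3[of k] cases_3[of l]
    by (elim disjE; hypsubst; simp only: param_swap_def param_inv_def param_mul_def pc_reps_def
        prod.case diff_conv_add_uminus minus_minus minus_zero add_0_left add_0_right F3_table
        insert_iff empty_iff prod.inject simp_thms)
qed

lemma pc_group_classification:
  obtains p' q' k' l' where "(p', q', k', l') \<in> pc_reps" "pc_group p q k l \<cong> pc_group p' q' k' l'"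
proof -
  define pc where "pc = (\<lambda>(p, q, k, l). pc_group p q k l)"
  define R where "R P \<longleftrightarrow> (\<exists>P'\<in>pc_reps. pc P' \<cong> pc P)" for P
  \<comment> \<open>The isomorphisms lead from the transformed parameters back to the original ones,
    so being isomorphic to a representative is inherited letter by letter along each word.\<close>
  have step: "R P" if "R P'" "pc P' \<cong> pc P" for P P'
    using that iso_trans unfolding R_def by blast
  have R: "R P" if "P \<in> pc_reps" for P
    using that iso_refl unfolding R_def by blast
  have swap: "R (param_swap P) \<Longrightarrow> R P" for P
    by (erule step) (simp add: pc_def param_swap_def pc_group_swap split: prod.split)
  have inv: "R (param_inv P) \<Longrightarrow> R P" for P
    by (erule step) (simp add: pc_def param_inv_def pc_group_inv split: prod.split)
  have mul: "R (param_mul P) \<Longrightarrow> R P" for P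
    by (erule step) (simp add: pc_def param_mul_def pc_group_mul split: prod.split)
  have "R (p, q, k, l)"
    using pc_reps_reached[of "(p, q, k, l)"]
    by (elim disjE) (blast dest!: R swap inv mul)+
  then obtain P' where P': "P' \<in> pc_reps" "pc P' \<cong> pc_group p q k l"
    by (auto simp: R_def pc_def)
  obtain p' q' k' l' where eq: "P' = (p', q', k', l')" by (metis surj_pair)
  have "pc_group p q k l \<cong> pc_group p' q' k' l'"
    using group.iso_sym[OF group_pc_group] P'(2) unfolding eq pc_def prod.case .
  then show ?thesis by (rule that[OF P'(1)[unfolded eq]])
qed

section \<open>Central extensions\<close>

context group
begin

lemma commute_generate:
  assumes "g \<in> carrier G" "S \<subseteq> carrier G" "\<And>h. h \<in> S \<Longrightarrow> g \<otimes> h = h \<otimes> g" "h \<in> generate G S"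
  shows "g \<otimes> h = h \<otimes> g"
  using assms(4)
proof (induction rule: generate.induct)
  case one
  then show ?case using assms by simp
next
  case (incl h)
  then show ?case using assms by blast
next
  case (inv h)
  then have "h \<otimes> g = g \<otimes> h" "h \<in> carrier G" using assms by auto
  then show ?case using pw_commute[of h g "- 1"] assms(1) by simp
next
  case (eng h1 h2)
  then have "h1 \<in> carrier G" "h2 \<in> carrier G" using generate_in_carrier[OF assms(2)] by blast+
  then show ?case using eng assms(1) by (metis m_assoc)
qed

lemma swap_assoc:
  assumes "g \<otimes> h = h \<otimes> g \<otimes> k" "g \<in> carrier G" "h \<in> carrier G" "k \<in> carrier G" "w \<in> carrier G"
  shows "g \<otimes> (h \<otimes> w) = h \<otimes> (g \<otimes> (k \<otimes> w))"
  using assms by (simp add: m_assoc[symmetric])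

lemma commute_assoc:
  assumes "g \<otimes> h = h \<otimes> g" "g \<in> carrier G" "h \<in> carrier G" "w \<in> carrier G"
  shows "g \<otimes> (h \<otimes> w) = h \<otimes> (g \<otimes> w)"
  using assms by (simp add: m_assoc[symmetric])

end

text \<open>The kernel is an arbitrary central subgroup. The instances below are quotients of
  \<open>V\<close>, extensions by a cocycle, and immediate descendants.\<close>

locale pc_extension = E: group E for E :: "('a, 'b) monoid_scheme" (structure) +
  fixes \<pi> :: "'a \<Rightarrow> 3 \<times> 3 \<times> 3 \<times> 3 \<times> 3" and p q k l :: 3
  assumes hom: "\<pi> \<in> hom E (pc_group p q k l)"
    and onto: "\<pi> ` carrier E = UNIV"
    and central: "\<And>z g. z \<in> carrier E \<Longrightarrow> \<pi> z = (0, 0, 0, 0, 0) \<Longrightarrow> g \<in> carrier E \<Longrightarrow> z \<otimes> g = g \<otimes> z"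
begin

sublocale group_hom E "pc_group p q k l" \<pi>
  using hom group_pc_group by (simp add: group_hom_def group_hom_axioms_def E.is_group)

abbreviation N where "N \<equiv> {z \<in> carrier E. \<pi> z = (0, 0, 0, 0, 0)}"

text \<open>The lifts generate a subgroup that maps onto the quotient, and adjoining the kernel
  fills every fibre.\<close>

lemma generated:
  assumes "x \<in> carrier E" "\<pi> x = (1, 0, 0, 0, 0)" "y \<in> carrier E" "\<pi> y = (0, 1, 0, 0, 0)"
  shows "generate E (insert x (insert y N)) = carrier E"
proof
  let ?S = "insert x (insert y N)"
  have S: "?S \<subseteq> carrier E" using assms by auto
  then show "generate E ?S \<subseteq> carrier E" by (rule E.generate_incl)
  have sub: "subgroup (generate E ?S) E" by (rule E.generate_is_subgroup[OF S])
  have im: "\<pi> ` generate E ?S = UNIV"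
  proof (rule pc_group_subgroup_UNIV)
    show "subgroup (\<pi> ` generate E ?S) (pc_group p q k l)" by (rule subgroup_img_is_subgroup[OF sub])
    show "(1, 0, 0, 0, 0) \<in> \<pi> ` generate E ?S"
      by (rule image_eqI[of _ _ x]) (auto simp: assms intro: generate.incl)
    show "(0, 1, 0, 0, 0) \<in> \<pi> ` generate E ?S"
      by (rule image_eqI[of _ _ y]) (auto simp: assms intro: generate.incl)
  qed
  show "carrier E \<subseteq> generate E ?S"
  proof
    fix g assume g: "g \<in> carrier E"
    have "\<pi> g \<in> \<pi> ` generate E ?S" unfolding im by simp
    then obtain h where h: "\<pi> g = \<pi> h" "h \<in> generate E ?S" by (rule imageE)
    have hc: "h \<in> carrier E" using E.generate_in_carrier[OF S h(2)] .
    have "\<pi> (inv h \<otimes> g) = inv\<^bsub>pc_group p q k l\<^esub> (\<pi> h) \<otimes>\<^bsub>pc_group p q k l\<^esub> \<pi> g"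
      using hc g by (simp del: carrier_pc_group)
    also have "\<dots> = (0, 0, 0, 0, 0)"
      unfolding h(1) using H.l_inv[of "\<pi> h"] by (simp add: one_pc_group)
    finally have "\<pi> (inv h \<otimes> g) = (0, 0, 0, 0, 0)" .
    then have "inv h \<otimes> g \<in> N" using hc g by simp
    then have "inv h \<otimes> g \<in> generate E ?S" by (intro generate.incl) auto
    then have "h \<otimes> (inv h \<otimes> g) \<in> generate E ?S" using h(2) subgroup.m_closed[OF sub] by blast
    then show "g \<in> generate E ?S" using hc g by (simp add: E.m_assoc[symmetric])
  qed
qed

text \<open>If lifts satisfy the relations apart from those for the cubes of \<open>x\<close> and
  \<open>y\<close>, the products of powers of \<open>s\<close>, \<open>t\<close>, \<open>u\<close>
  form a normal subgroup with commutative quotient. It contains the commutator subgroup and is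
  mapped injectively by \<pi>.\<close>

lemma derived_inter_kernel:
  assumes cl: "x \<in> carrier E" "y \<in> carrier E" "s \<in> carrier E" "t \<in> carrier E" "u \<in> carrier E"
    and x: "\<pi> x = (1, 0, 0, 0, 0)" and y: "\<pi> y = (0, 1, 0, 0, 0)" and s: "\<pi> s = (0, 0, 1, 0, 0)"
    and t: "\<pi> t = (0, 0, 0, 1, 0)" and u: "\<pi> u = (0, 0, 0, 0, 1)"
    and yx: "y \<otimes> x = x \<otimes> y \<otimes> s" and sx: "s \<otimes> x = x \<otimes> s \<otimes> t" and sy: "s \<otimes> y = y \<otimes> s \<otimes> u"
    and tx: "t \<otimes> x = x \<otimes> t" and ty: "t \<otimes> y = y \<otimes> t" and ux: "u \<otimes> x = x \<otimes> u" and uy: "u \<otimes> y = y \<otimes> u"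
    and s3: "s \<otimes> s \<otimes> s = \<one>" and t3: "t \<otimes> t \<otimes> t = \<one>" and u3: "u \<otimes> u \<otimes> u = \<one>"
    and z: "z \<in> derived E (carrier E)" "\<pi> z = (0, 0, 0, 0, 0)"
  shows "z = \<one>"
proof -
  let ?S = "insert x (insert y N)"
  have S: "?S \<subseteq> carrier E" using cl by auto
  note gen = generated[OF cl(1) x cl(2) y]
  have N: "z \<otimes> g = g \<otimes> z" if "z \<in> N" "g \<in> carrier E" for z g using central that by blast
  have comm: "c \<otimes> g = g \<otimes> c" if c: "c \<in> carrier E" "c \<otimes> x = x \<otimes> c" "c \<otimes> y = y \<otimes> c" and g: "g \<in> carrier E" for c g
  proof (rule E.commute_generate[OF c(1) S])
    show "g \<in> generate E ?S" using g gen by simp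
    show "c \<otimes> h = h \<otimes> c" if "h \<in> ?S" for h
      using that by (elim insertE) (use c N[of h c] in simp_all)
  qed
  have T: "t \<otimes> g = g \<otimes> t" "u \<otimes> g = g \<otimes> u" if "g \<in> carrier E" for g
    using comm cl tx ty ux uy that by blast+
  define Z where "Z d e = pw E t d \<otimes> pw E u e" for d e
  have Zcl [simp]: "Z d e \<in> carrier E" for d e using cl by (simp add: Z_def)
  have Zc: "Z d e \<otimes> g = g \<otimes> Z d e" if g: "g \<in> carrier E" for d e g
    using E.pw_commute[OF cl(4) g T(1)[OF g], of d] E.pw_commute[OF cl(5) g T(2)[OF g], of e] g cl
    unfolding Z_def by (metis E.m_assoc E.pw_closed)
  have Zadd: "Z d e \<otimes> Z d' e' = Z (d + d') (e + e')" for d e d' e'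
  proof -
    have "pw E u e \<otimes> pw E t d' = pw E t d' \<otimes> pw E u e"
      using E.pw_commute[of u "pw E t d'" e] T cl by simp
    then show ?thesis
      unfolding Z_def E.pw_add[OF cl(4) t3] E.pw_add[OF cl(5) u3]
      using cl by (metis E.m_assoc E.m_closed E.pw_closed)
  qed
  have Z0: "Z 0 0 = \<one>" by (simp add: Z_def)
  have Zinv: "inv (Z d e) = Z (- d) (- e)" for d e
    using Zadd[of "- d" "- e" d e] Z0 by (intro E.inv_equality) simp_all
  \<comment> \<open>The candidate for a normal subgroup above the commutator subgroup: all products
    of powers of \<open>s\<close>, \<open>t\<close>, \<open>u\<close>.\<close>
  define K where "K = (\<lambda>(c, d, e). pw E s c \<otimes> Z d e) ` UNIV"
  have K: "pw E s c \<otimes> Z d e \<in> K" for c d e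
    unfolding K_def by (rule image_eqI[of _ _ "(c, d, e)"]) simp_all
  have Kmult: "(pw E s c \<otimes> Z d e) \<otimes> (pw E s c' \<otimes> Z d' e') = pw E s (c + c') \<otimes> Z (d + d') (e + e')" for c d e c' d' e'
    using E.commute_assoc[OF Zc[of "pw E s c'" d e]] cl E.pw_add[OF cl(3) s3, of c c'] Zadd
    by (simp add: E.m_assoc)
  have K1: "pw E s 0 \<otimes> Z 0 0 = \<one>" using Z0 by simp
  have sub: "subgroup K E"
  proof (rule E.subgroupI)
    show "K \<subseteq> carrier E" using cl by (auto simp: K_def)
    show "K \<noteq> {}" by (auto simp: K_def)
  next
    fix g assume "g \<in> K"
    then obtain c d e where g: "g = pw E s c \<otimes> Z d e" by (auto simp: K_def)
    have "(pw E s (- c) \<otimes> Z (- d) (- e)) \<otimes> g = \<one>" unfolding g Kmult using K1 by simp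
    then have "inv g = pw E s (- c) \<otimes> Z (- d) (- e)" using cl g by (intro E.inv_equality) auto
    then show "inv g \<in> K" using K by simp
  next
    fix g h assume "g \<in> K" "h \<in> K"
    then show "g \<otimes> h \<in> K" using Kmult K by (auto simp: K_def)
  qed
  \<comment> \<open>Moving \<open>s\<close> past any element costs only a central factor
    \<open>Z d e\<close>; this is what makes \<open>K\<close> normal.\<close>
  have conj: "\<exists>d e. s \<otimes> g = g \<otimes> s \<otimes> Z d e" if "g \<in> carrier E" for g
  proof -
    have "g \<in> generate E ?S" using that gen by simp
    then show ?thesis
    proof (induction rule: generate.induct)
      case one
      show ?case using cl Z0 by (intro exI[of _ 0]) simp
    next
      case (incl h)
      then consider "h = x" | "h = y" | "h \<in> N" by blast
      then show ?case
      proof cases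
        case 1 then show ?thesis using sx cl by (intro exI[of _ 1] exI[of _ 0]) (simp add: Z_def)
      next
        case 2 then show ?thesis using sy cl by (intro exI[of _ 0] exI[of _ 1]) (simp add: Z_def)
      next
        case 3 then show ?thesis using N[OF 3 cl(3)] cl Z0 by (intro exI[of _ 0]) simp
      qed
    next
      case (inv h)
      then have hc: "h \<in> carrier E" using S by blast
      have "\<exists>d e. s \<otimes> h = h \<otimes> s \<otimes> Z d e"
      proof -
        consider "h = x" | "h = y" | "h \<in> N" using inv by blast
        then show ?thesis
        proof cases
          case 1 then show ?thesis using sx cl by (intro exI[of _ 1] exI[of _ 0]) (simp add: Z_def)
        next
          case 2 then show ?thesis using sy cl by (intro exI[of _ 0] exI[of _ 1]) (simp add: Z_def)
        next
          case 3 then show ?thesis using N[OF 3 cl(3)] cl Z0 by (intro exI[of _ 0]) simp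
        qed
      qed
      then obtain d e where de: "s \<otimes> h = h \<otimes> s \<otimes> Z d e" by blast
      have "h \<otimes> (inv h \<otimes> s \<otimes> Z (- d) (- e)) = s \<otimes> Z (- d) (- e)" using hc cl by (simp add: E.m_assoc[symmetric])
      also have "\<dots> = h \<otimes> (s \<otimes> inv h)"
      proof -
        have "h \<otimes> (s \<otimes> inv h) \<otimes> Z d e = h \<otimes> s \<otimes> Z d e \<otimes> inv h"
          using hc cl Zc[of "inv h" d e] by (simp add: E.m_assoc)
        also have "\<dots> = s" unfolding de[symmetric] using hc cl by (simp add: E.m_assoc)
        finally have "h \<otimes> (s \<otimes> inv h) = s \<otimes> inv (Z d e)"
          using hc cl by (metis E.inv_solve_right' E.m_closed E.inv_closed Zcl)
        then show ?thesis by (simp add: Zinv)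
      qed
      finally have "s \<otimes> inv h = inv h \<otimes> s \<otimes> Z (- d) (- e)" using hc cl by simp
      then show ?case by blast
    next
      case (eng h1 h2)
      then obtain d e d' e' where de: "s \<otimes> h1 = h1 \<otimes> s \<otimes> Z d e" "s \<otimes> h2 = h2 \<otimes> s \<otimes> Z d' e'" by blast
      have hc: "h1 \<in> carrier E" "h2 \<in> carrier E" using eng gen by simp_all
      have "s \<otimes> (h1 \<otimes> h2) = h1 \<otimes> (s \<otimes> (Z d e \<otimes> h2))" using E.swap_assoc[OF de(1)] hc cl by simp
      also have "\<dots> = h1 \<otimes> (s \<otimes> h2 \<otimes> Z d e)" using Zc hc cl by (simp add: E.m_assoc)
      also have "\<dots> = (h1 \<otimes> h2) \<otimes> s \<otimes> (Z d' e' \<otimes> Z d e)" unfolding de(2) using hc cl by (simp add: E.m_assoc)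
      finally show ?case unfolding Zadd by blast
    qed
  qed
  have normal: "K \<lhd> E"
  proof (rule E.normal_invI[OF sub])
    fix g h assume g: "g \<in> carrier E" and "h \<in> K"
    then obtain c d e where h: "h = pw E s c \<otimes> Z d e" by (auto simp: K_def)
    obtain d' e' where "s \<otimes> inv g = inv g \<otimes> s \<otimes> Z d' e'" using conj g by blast
    then have "g \<otimes> s \<otimes> inv g = s \<otimes> Z d' e'"
      using g cl by (simp add: E.m_assoc) (simp add: E.m_assoc[symmetric])
    moreover have "s \<otimes> Z d' e' \<in> K" using K[of 1 d' e'] cl by simp
    ultimately have s': "g \<otimes> s \<otimes> inv g \<in> K" by simp
    have inv_s: "g \<otimes> inv s \<otimes> inv g = inv (g \<otimes> s \<otimes> inv g)" using g cl by (simp add: E.inv_mult_group E.m_assoc)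
    have one: "\<one> \<in> K" using subgroup.one_closed[OF sub] .
    have "g \<otimes> pw E s c \<otimes> inv g \<in> K"
      using cases_3[of c] s' subgroup.m_inv_closed[OF sub s'] inv_s one g by auto
    moreover have "Z d e \<in> K" using K[of 0 d e] by simp
    moreover have "g \<otimes> h \<otimes> inv g = (g \<otimes> pw E s c \<otimes> inv g) \<otimes> Z d e"
      using g cl h Zc[of "inv g" d e] by (simp add: E.m_assoc)
    ultimately show "g \<otimes> h \<otimes> inv g \<in> K" using subgroup.m_closed[OF sub] by simp
  qed
  interpret K: normal K E by fact
  interpret Q: group "E Mod K" by (rule K.factorgroup_is_group)
  let ?q = "\<lambda>g. K #> g"
  interpret q: group_hom E "E Mod K" ?q
    using K.r_coset_hom_Mod by (simp add: group_hom_def group_hom_axioms_def E.is_group Q.is_group)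
  have qk: "?q k = \<one>\<^bsub>E Mod K\<^esub>" if "k \<in> K" for k
    using that K.rcos_const by (simp add: FactGroup_def)
  have s_K: "s \<in> K" using K[of 1 0 0] cl Z0 by simp
  \<comment> \<open>Modulo \<open>K\<close> the two lifts commute because \<open>s\<close> lies in
    \<open>K\<close>; the remaining generators are central already in \<open>E\<close>.\<close>
  have q_xy: "?q y \<otimes>\<^bsub>E Mod K\<^esub> ?q x = ?q x \<otimes>\<^bsub>E Mod K\<^esub> ?q y"
  proof -
    have "?q y \<otimes>\<^bsub>E Mod K\<^esub> ?q x = ?q (y \<otimes> x)" by (rule q.hom_mult[symmetric]) (use cl in simp_all)
    also have "\<dots> = ?q (x \<otimes> y) \<otimes>\<^bsub>E Mod K\<^esub> ?q s" unfolding yx by (rule q.hom_mult) (use cl in simp_all)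
    also have "\<dots> = ?q (x \<otimes> y)" unfolding qk[OF s_K] by (rule Q.r_one[OF q.hom_closed]) (use cl in simp)
    also have "\<dots> = ?q x \<otimes>\<^bsub>E Mod K\<^esub> ?q y" by (rule q.hom_mult) (use cl in simp_all)
    finally show ?thesis .
  qed
  have q_gen: "?q a \<otimes>\<^bsub>E Mod K\<^esub> ?q b = ?q b \<otimes>\<^bsub>E Mod K\<^esub> ?q a" if "a \<in> ?S" "b \<in> ?S" for a b
  proof (cases "a \<in> N \<or> b \<in> N")
    case True
    then have "a \<otimes> b = b \<otimes> a" using N[of a b] N[of b a] that S by (metis (no_types, lifting) subsetD)
    then show ?thesis using q.hom_mult that S by (metis (no_types, lifting) subsetD)
  next
    case False
    then show ?thesis using that q_xy by auto
  qed
  have car: "carrier (E Mod K) = ?q ` carrier E" by (auto simp: FactGroup_def RCOSETS_def)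
  have genq: "generate (E Mod K) (?q ` ?S) = carrier (E Mod K)"
    using q.generate_img[OF S] gen car by simp
  have Sq: "?q ` ?S \<subseteq> carrier (E Mod K)" using S car by blast
  have 1: "a \<otimes>\<^bsub>E Mod K\<^esub> b = b \<otimes>\<^bsub>E Mod K\<^esub> a" if "a \<in> ?q ` ?S" "b \<in> carrier (E Mod K)" for a b
    by (rule Q.commute_generate[OF _ Sq]) (use that Sq q_gen genq in auto)
  have 2: "a \<otimes>\<^bsub>E Mod K\<^esub> b = b \<otimes>\<^bsub>E Mod K\<^esub> a" if "a \<in> carrier (E Mod K)" "b \<in> carrier (E Mod K)" for a b
    by (rule Q.commute_generate[OF _ Sq]) (use that 1 genq in auto)
  have "comm_group (E Mod K)"
    by (rule Q.group_comm_groupI) (rule 2)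
  then have "z \<in> K" using E.derived_minimal[OF normal] z by blast
  then obtain c d e where zK: "z = pw E s c \<otimes> Z d e" by (auto simp: K_def)
  have pwh: "\<pi> (pw E g r) = pw (pc_group p q k l) (\<pi> g) r" if "g \<in> carrier E" for g r
    using that by (simp add: pw_def del: carrier_pc_group)
  have "\<pi> z = pw (pc_group p q k l) (0, 0, 1, 0, 0) c \<otimes>\<^bsub>pc_group p q k l\<^esub> ((0, 0, 0, d, 0) \<otimes>\<^bsub>pc_group p q k l\<^esub> (0, 0, 0, 0, e))"
    unfolding zK Z_def using cl by (simp add: pwh s t u pw_pc_group_t del: carrier_pc_group)
  moreover have "pw (pc_group p q k l) (0, 0, 1, 0, 0) c = (0, 0, c, 0, 0)"
  proof -
    have "inv\<^bsub>pc_group p q k l\<^esub> (0, 0, 1, 0, 0) = (0, 0, - 1, 0, 0)"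
      by (rule H.inv_equality) (simp_all add: mult_pc_group one_pc_group)
    then show ?thesis using cases_3[of c] by (auto simp: one_pc_group)
  qed
  ultimately have "c = 0 \<and> d = 0 \<and> e = 0" using z(2) by (simp add: mult_pc_group)
  then show ?thesis using zK Z0 by simp
qed

end

context pc_extension
begin

lemma ex_swap:
  assumes "g \<in> carrier E" "h \<in> carrier E" and c: "\<pi> g \<otimes>\<^bsub>pc_group p q k l\<^esub> \<pi> h = \<pi> h \<otimes>\<^bsub>pc_group p q k l\<^esub> \<pi> g \<otimes>\<^bsub>pc_group p q k l\<^esub> c"
  obtains r where "r \<in> carrier E" "\<pi> r = c" "g \<otimes> h = h \<otimes> g \<otimes> r"
proof -
  let ?P = "pc_group p q k l"
  define r where "r = inv (h \<otimes> g) \<otimes> (g \<otimes> h)"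
  have r: "r \<in> carrier E" using assms by (simp add: r_def)
  have eq: "g \<otimes> h = h \<otimes> g \<otimes> r"
    using assms by (simp add: r_def E.m_assoc[symmetric] del: E.inv_mult_group)
  have "\<pi> h \<otimes>\<^bsub>?P\<^esub> \<pi> g \<otimes>\<^bsub>?P\<^esub> c = \<pi> (g \<otimes> h)" using c assms(1,2) by (simp only: hom_mult)
  also have "\<dots> = \<pi> h \<otimes>\<^bsub>?P\<^esub> \<pi> g \<otimes>\<^bsub>?P\<^esub> \<pi> r"
    unfolding eq using assms(1,2) r by (simp only: hom_mult E.m_closed)
  finally have "c = \<pi> r"
    by (rule H.l_cancel) (simp_all only: carrier_pc_group UNIV_I)
  then show ?thesis by (intro that[OF r _ eq]) simp
qed

text \<open>The lifts of \<open>s\<close>, \<open>t\<close>, \<open>u\<close> are chosen as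
  commutators in \<open>E\<close> itself, so that the commutator relations of weight two and three
  hold exactly. What can deviate from the presentation are the central commutators of weight four
  and the cubes.\<close>

lemma extension_elements:
  obtains x y s t u w1 w2 w4 where
    "x \<in> carrier E" "y \<in> carrier E" "s \<in> carrier E" "t \<in> carrier E" "u \<in> carrier E"
    "w1 \<in> N" "w2 \<in> N" "w4 \<in> N"
    "\<pi> x = (1, 0, 0, 0, 0)" "\<pi> y = (0, 1, 0, 0, 0)" "\<pi> s = (0, 0, 1, 0, 0)" "\<pi> t = (0, 0, 0, 1, 0)" "\<pi> u = (0, 0, 0, 0, 1)"
    "y \<otimes> x = x \<otimes> y \<otimes> s" "s \<otimes> x = x \<otimes> s \<otimes> t" "s \<otimes> y = y \<otimes> s \<otimes> u"
    "t \<otimes> x = x \<otimes> t \<otimes> w1" "t \<otimes> y = y \<otimes> t \<otimes> w2" "u \<otimes> x = x \<otimes> u \<otimes> w2" "u \<otimes> y = y \<otimes> u \<otimes> w4"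
    "t \<otimes> s = s \<otimes> t" "u \<otimes> s = s \<otimes> u" "t \<otimes> u = u \<otimes> t"
proof -
  obtain x where x: "\<pi> x = (1, 0, 0, 0, 0)" "x \<in> carrier E" using onto by (metis UNIV_I imageE)
  obtain y where y: "\<pi> y = (0, 1, 0, 0, 0)" "y \<in> carrier E" using onto by (metis UNIV_I imageE)
  obtain s where s: "s \<in> carrier E" "\<pi> s = (0, 0, 1, 0, 0)" "y \<otimes> x = x \<otimes> y \<otimes> s"
    by (rule ex_swap[OF y(2) x(2), of "(0, 0, 1, 0, 0)"]) (simp_all add: x y mult_pc_group)
  obtain t where t: "t \<in> carrier E" "\<pi> t = (0, 0, 0, 1, 0)" "s \<otimes> x = x \<otimes> s \<otimes> t"
    by (rule ex_swap[OF s(1) x(2), of "(0, 0, 0, 1, 0)"]) (simp_all add: x s mult_pc_group)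
  obtain u where u: "u \<in> carrier E" "\<pi> u = (0, 0, 0, 0, 1)" "s \<otimes> y = y \<otimes> s \<otimes> u"
    by (rule ex_swap[OF s(1) y(2), of "(0, 0, 0, 0, 1)"]) (simp_all add: y s mult_pc_group)
  obtain w1 where w1: "w1 \<in> carrier E" "\<pi> w1 = (0, 0, 0, 0, 0)" "t \<otimes> x = x \<otimes> t \<otimes> w1"
    by (rule ex_swap[OF t(1) x(2), of "(0, 0, 0, 0, 0)"]) (simp_all add: x t mult_pc_group)
  obtain w2 where w2: "w2 \<in> carrier E" "\<pi> w2 = (0, 0, 0, 0, 0)" "t \<otimes> y = y \<otimes> t \<otimes> w2"
    by (rule ex_swap[OF t(1) y(2), of "(0, 0, 0, 0, 0)"]) (simp_all add: y t mult_pc_group)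
  obtain w3 where w3: "w3 \<in> carrier E" "\<pi> w3 = (0, 0, 0, 0, 0)" "u \<otimes> x = x \<otimes> u \<otimes> w3"
    by (rule ex_swap[OF u(1) x(2), of "(0, 0, 0, 0, 0)"]) (simp_all add: x u mult_pc_group)
  obtain w4 where w4: "w4 \<in> carrier E" "\<pi> w4 = (0, 0, 0, 0, 0)" "u \<otimes> y = y \<otimes> u \<otimes> w4"
    by (rule ex_swap[OF u(1) y(2), of "(0, 0, 0, 0, 0)"]) (simp_all add: y u mult_pc_group)
  \<comment> \<open>\<open>r\<close> commutes with \<open>x\<close> and \<open>y\<close> up to
    central factors, and these cancel in the commutator \<open>s\<close> of \<open>x\<close> and
    \<open>y\<close>.\<close>
  have comm_s: "r \<otimes> s = s \<otimes> r"
    if r: "r \<in> carrier E" and rx: "r \<otimes> x = x \<otimes> r \<otimes> v" and ry: "r \<otimes> y = y \<otimes> r \<otimes> v'"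
      and v: "v \<in> carrier E" "\<pi> v = (0, 0, 0, 0, 0)" "v' \<in> carrier E" "\<pi> v' = (0, 0, 0, 0, 0)" for r v v'
  proof -
    note cl = x(2) y(2) s(1) r v(1,3)
    note c = central[OF v(1,2)] central[OF v(3,4)]
    have "r \<otimes> (y \<otimes> x) = y \<otimes> (x \<otimes> (r \<otimes> (v \<otimes> v')))"
      using cl E.swap_assoc[OF ry] E.swap_assoc[OF rx] c(2)[of x] by (simp add: E.m_assoc)
    moreover have "r \<otimes> (x \<otimes> (y \<otimes> s)) = x \<otimes> (y \<otimes> (r \<otimes> (s \<otimes> (v \<otimes> v'))))"
      using cl E.swap_assoc[OF rx] E.swap_assoc[OF ry] c(1)[of y] c(1)[of s] c(2)[of s] c(2)[of v]
        E.commute_assoc[OF c(1), of y] E.commute_assoc[OF c(1), of s] E.commute_assoc[OF c(2), of s]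
      by (simp add: E.m_assoc)
    moreover have "y \<otimes> (x \<otimes> (r \<otimes> (v \<otimes> v'))) = x \<otimes> (y \<otimes> (s \<otimes> (r \<otimes> (v \<otimes> v'))))"
      using cl by (intro E.swap_assoc[OF s(3)]) simp_all
    ultimately have "x \<otimes> (y \<otimes> (s \<otimes> (r \<otimes> (v \<otimes> v')))) = x \<otimes> (y \<otimes> (r \<otimes> (s \<otimes> (v \<otimes> v'))))"
      using cl s(3) by (simp add: E.m_assoc)
    then have "s \<otimes> r \<otimes> (v \<otimes> v') = r \<otimes> s \<otimes> (v \<otimes> v')" using cl by (simp add: E.m_assoc)
    then show ?thesis using cl by simp
  qed
  note ts = comm_s[OF t(1) w1(3) w2(3) w1(1,2) w2(1,2)]
  note us = comm_s[OF u(1) w3(3) w4(3) w3(1,2) w4(1,2)]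
  note cl = x(2) y(2) s(1) t(1) u(1) w1(1) w2(1) w3(1) w4(1)
  note c2 = central[OF w2(1,2)] and c3 = central[OF w3(1,2)]
  \<comment> \<open>The same argument for \<open>t\<close>, with \<open>u\<close> as the commutator
    of \<open>s\<close> and \<open>y\<close>.\<close>
  have tu: "t \<otimes> u = u \<otimes> t"
  proof -
    have "t \<otimes> (s \<otimes> y) = s \<otimes> (y \<otimes> (t \<otimes> w2))"
      using cl ts w2(3) E.commute_assoc[OF ts] by (simp add: E.m_assoc)
    also have "\<dots> = y \<otimes> (s \<otimes> (u \<otimes> (t \<otimes> w2)))"
      using cl by (intro E.swap_assoc[OF u(3)]) simp_all
    finally have 1: "t \<otimes> (s \<otimes> y) = y \<otimes> (s \<otimes> (u \<otimes> (t \<otimes> w2)))" .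
    have "t \<otimes> (y \<otimes> (s \<otimes> u)) = y \<otimes> (s \<otimes> (t \<otimes> (u \<otimes> w2)))"
      using cl E.swap_assoc[OF w2(3)] c2[of s] c2[of u] E.commute_assoc[OF c2, of s] E.commute_assoc[OF ts]
      by (simp add: E.m_assoc)
    with 1 have "y \<otimes> (s \<otimes> (u \<otimes> (t \<otimes> w2))) = y \<otimes> (s \<otimes> (t \<otimes> (u \<otimes> w2)))"
      using cl u(3) by (simp add: E.m_assoc)
    then have "t \<otimes> u \<otimes> w2 = u \<otimes> t \<otimes> w2" using cl by (simp add: E.m_assoc)
    then show ?thesis using cl by simp
  qed
  text \<open>The Jacobi identity for \<open>x\<close>, \<open>y\<close>, \<open>s\<close> makes the two mixed commutators of weight four agree.\<close>
  have w23: "w2 = w3"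
  proof -
    have "s \<otimes> (y \<otimes> x) = y \<otimes> (s \<otimes> (u \<otimes> x))" using cl by (intro E.swap_assoc[OF u(3)])
    also have "\<dots> = y \<otimes> (x \<otimes> (s \<otimes> (t \<otimes> (u \<otimes> w3))))"
      using cl w3(3) E.swap_assoc[OF t(3)] by (simp add: E.m_assoc)
    also have "\<dots> = x \<otimes> (y \<otimes> (s \<otimes> (s \<otimes> (t \<otimes> (u \<otimes> w3)))))"
      using cl by (intro E.swap_assoc[OF s(3)]) simp_all
    finally have 1: "s \<otimes> (y \<otimes> x) = x \<otimes> (y \<otimes> (s \<otimes> (s \<otimes> (t \<otimes> (u \<otimes> w3)))))" .
    have "s \<otimes> (x \<otimes> (y \<otimes> s)) = x \<otimes> (s \<otimes> (t \<otimes> (y \<otimes> s)))" using cl by (intro E.swap_assoc[OF t(3)]) simp_all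
    also have "\<dots> = x \<otimes> (s \<otimes> (y \<otimes> (s \<otimes> (t \<otimes> w2))))"
      using cl E.swap_assoc[OF w2(3)] c2[of s] E.commute_assoc[OF ts] by simp
    also have "\<dots> = x \<otimes> (y \<otimes> (s \<otimes> (u \<otimes> (s \<otimes> (t \<otimes> w2)))))"
      using cl E.swap_assoc[OF u(3)] by simp
    also have "\<dots> = x \<otimes> (y \<otimes> (s \<otimes> (s \<otimes> (t \<otimes> (u \<otimes> w2)))))"
      using cl E.commute_assoc[OF us] E.commute_assoc[OF tu] by simp
    finally have "s \<otimes> (s \<otimes> (t \<otimes> (u \<otimes> w2))) = s \<otimes> (s \<otimes> (t \<otimes> (u \<otimes> w3)))"
      using 1 cl s(3) by (simp add: E.m_assoc)
    then show ?thesis using cl by simp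
  qed
  show ?thesis
    by (rule that[of x y s t u w1 w2 w4])
      (use x y s t u w1 w2 w3 w4 ts us tu w23 in simp_all)
qed

lemma same_image:
  assumes "g \<in> carrier E" "h \<in> carrier E" "\<pi> g = \<pi> h"
  obtains n where "n \<in> N" "g = h \<otimes> n"
proof (rule that[of "inv h \<otimes> g"])
  have "\<pi> (inv h \<otimes> g) = inv\<^bsub>pc_group p q k l\<^esub> (\<pi> h) \<otimes>\<^bsub>pc_group p q k l\<^esub> \<pi> g"
    using assms by (simp del: carrier_pc_group)
  also have "\<dots> = (0, 0, 0, 0, 0)"
    unfolding assms(3) using H.l_inv[of "\<pi> h"] by (simp add: one_pc_group)
  finally show "inv h \<otimes> g \<in> N" using assms by simp
  show "g = h \<otimes> (inv h \<otimes> g)" using assms by (simp add: E.m_assoc[symmetric])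
qed

end

section \<open>Collection formulas for cubes\<close>

lemma (in group) power_swap_left:
  assumes cl: "g \<in> carrier G" "h \<in> carrier G" "r \<in> carrier G"
    and gh: "g \<otimes> h = h \<otimes> g \<otimes> r" and gr: "r \<otimes> g = g \<otimes> r"
  shows "g \<otimes> g \<otimes> g \<otimes> h = h \<otimes> (g \<otimes> g \<otimes> g) \<otimes> (r \<otimes> r \<otimes> r)"
  using cl swap_assoc[OF gh] commute_assoc[OF gr] gr gh by (simp add: m_assoc)

text \<open>The exponents of \<open>r\<close> and \<open>v\<close> are the binomial coefficients of
  3 over 1 and 3 over 2.\<close>

lemma (in group) power_swap_right:
  assumes cl: "g \<in> carrier G" "h \<in> carrier G" "r \<in> carrier G" "v \<in> carrier G"
    and gh: "g \<otimes> h = h \<otimes> g \<otimes> r" and rh: "r \<otimes> h = h \<otimes> r \<otimes> v" and vh: "v \<otimes> h = h \<otimes> v"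
    and vr: "v \<otimes> r = r \<otimes> v"
  shows "g \<otimes> (h \<otimes> h \<otimes> h) = h \<otimes> h \<otimes> h \<otimes> (g \<otimes> (r \<otimes> r \<otimes> r) \<otimes> (v \<otimes> v \<otimes> v))"
  using cl swap_assoc[OF gh] swap_assoc[OF rh] commute_assoc[OF vh] commute_assoc[OF vr] gh rh vh vr
  by (simp add: m_assoc)

text \<open>Collecting the three factors \<open>g r\<close> produces \<open>r\<close>,
  \<open>v\<close>, \<open>w\<close> with the binomial exponents 3, 3, 1. The exponent 1 of
  \<open>w\<close> is what later allows a commutator of weight four to be determined.\<close>

lemma (in group) power_swap_collect:
  assumes cl: "g \<in> carrier G" "h \<in> carrier G" "r \<in> carrier G" "v \<in> carrier G" "w \<in> carrier G"
    and gh: "g \<otimes> h = h \<otimes> g \<otimes> r" and rg: "r \<otimes> g = g \<otimes> r \<otimes> v" and vg: "v \<otimes> g = g \<otimes> v \<otimes> w"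
    and vr: "v \<otimes> r = r \<otimes> v" and wg: "w \<otimes> g = g \<otimes> w" and wr: "w \<otimes> r = r \<otimes> w" and wv: "w \<otimes> v = v \<otimes> w"
  shows "g \<otimes> g \<otimes> g \<otimes> h = h \<otimes> (g \<otimes> g \<otimes> g) \<otimes> ((r \<otimes> r \<otimes> r) \<otimes> (v \<otimes> v \<otimes> v) \<otimes> w)"
  using cl swap_assoc[OF gh] swap_assoc[OF rg] swap_assoc[OF vg] commute_assoc[OF vr] commute_assoc[OF wg]
    commute_assoc[OF wr] commute_assoc[OF wv] gh rg vg vr wg wr wv
  by (simp add: m_assoc)

lemma (in group) commute_factor:
  assumes "t \<in> carrier G" "n \<in> carrier G" "g \<in> carrier G"
    and "t \<otimes> n \<otimes> g = g \<otimes> (t \<otimes> n)" "n \<otimes> g = g \<otimes> n"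
  shows "t \<otimes> g = g \<otimes> t"
proof -
  have "t \<otimes> g \<otimes> n = g \<otimes> t \<otimes> n" using assms by (simp add: m_assoc)
  then show ?thesis using assms by simp
qed

lemma (in group) cube_commute: "g \<in> carrier G \<Longrightarrow> g \<otimes> g \<otimes> g \<otimes> g = g \<otimes> (g \<otimes> g \<otimes> g)"
  by (simp add: m_assoc)

text \<open>The commutators of two elements in either order are inverse to each other.\<close>

lemma (in group) swap_twice:
  assumes cl: "g \<in> carrier G" "h \<in> carrier G" "r \<in> carrier G" "w \<in> carrier G"
    and "g \<otimes> h = h \<otimes> (g \<otimes> r \<otimes> \<one>)" "h \<otimes> g = g \<otimes> h \<otimes> w"
  shows "w \<otimes> r = \<one>"
proof -
  have "g \<otimes> h = h \<otimes> g \<otimes> r" using assms by (simp add: m_assoc)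
  also have "\<dots> = g \<otimes> h \<otimes> (w \<otimes> r)" unfolding assms(6) using cl by (simp add: m_assoc)
  finally show ?thesis using cl by simp
qed

text \<open>Any central extension of \<^const>\<open>SG243_5\<close> or \<^const>\<open>SG243_7\<close> splits off the kernel from the
  commutator subgroup: the relations make the central commutators of weight four and the cubes of
  \<open>s\<close>, \<open>t\<close>, \<open>u\<close> vanish. In other words, the Schur multiplier is trivial.\<close>

lemma derived_inter_kernel_5:
  assumes "pc_extension E \<pi> 1 0 1 0" "z \<in> derived E (carrier E)" "\<pi> z = (0, 0, 0, 0, 0)"
  shows "z = \<one>\<^bsub>E\<^esub>"
proof -
  interpret pc_extension E \<pi> 1 0 1 0 by fact
  obtain x y s t u w1 w2 w4 where cl: "x \<in> carrier E" "y \<in> carrier E" "s \<in> carrier E" "t \<in> carrier E" "u \<in> carrier E"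
    and w: "w1 \<in> N" "w2 \<in> N" "w4 \<in> N"
    and \<pi>: "\<pi> x = (1, 0, 0, 0, 0)" "\<pi> y = (0, 1, 0, 0, 0)" "\<pi> s = (0, 0, 1, 0, 0)" "\<pi> t = (0, 0, 0, 1, 0)" "\<pi> u = (0, 0, 0, 0, 1)"
    and yx: "y \<otimes>\<^bsub>E\<^esub> x = x \<otimes>\<^bsub>E\<^esub> y \<otimes>\<^bsub>E\<^esub> s" and sx: "s \<otimes>\<^bsub>E\<^esub> x = x \<otimes>\<^bsub>E\<^esub> s \<otimes>\<^bsub>E\<^esub> t" and sy: "s \<otimes>\<^bsub>E\<^esub> y = y \<otimes>\<^bsub>E\<^esub> s \<otimes>\<^bsub>E\<^esub> u"
    and tx: "t \<otimes>\<^bsub>E\<^esub> x = x \<otimes>\<^bsub>E\<^esub> t \<otimes>\<^bsub>E\<^esub> w1" and ty: "t \<otimes>\<^bsub>E\<^esub> y = y \<otimes>\<^bsub>E\<^esub> t \<otimes>\<^bsub>E\<^esub> w2"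
    and ux: "u \<otimes>\<^bsub>E\<^esub> x = x \<otimes>\<^bsub>E\<^esub> u \<otimes>\<^bsub>E\<^esub> w2" and uy: "u \<otimes>\<^bsub>E\<^esub> y = y \<otimes>\<^bsub>E\<^esub> u \<otimes>\<^bsub>E\<^esub> w4"
    and ts: "t \<otimes>\<^bsub>E\<^esub> s = s \<otimes>\<^bsub>E\<^esub> t" and us: "u \<otimes>\<^bsub>E\<^esub> s = s \<otimes>\<^bsub>E\<^esub> u" and tu: "t \<otimes>\<^bsub>E\<^esub> u = u \<otimes>\<^bsub>E\<^esub> t"
    by (rule extension_elements)
  have wcl: "w1 \<in> carrier E" "w2 \<in> carrier E" "w4 \<in> carrier E" using w by simp_all
  have N: "n \<otimes>\<^bsub>E\<^esub> g = g \<otimes>\<^bsub>E\<^esub> n" if "n \<in> N" "g \<in> carrier E" for n g using central that by blast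
  obtain z1 where z1: "z1 \<in> N" "x \<otimes>\<^bsub>E\<^esub> x \<otimes>\<^bsub>E\<^esub> x = t \<otimes>\<^bsub>E\<^esub> z1"
    by (rule same_image[of "x \<otimes>\<^bsub>E\<^esub> x \<otimes>\<^bsub>E\<^esub> x" t]) (use cl \<pi> in \<open>simp_all add: mult_pc_group\<close>)
  obtain z2 where z2: "z2 \<in> N" "y \<otimes>\<^bsub>E\<^esub> y \<otimes>\<^bsub>E\<^esub> y = t \<otimes>\<^bsub>E\<^esub> z2"
    by (rule same_image[of "y \<otimes>\<^bsub>E\<^esub> y \<otimes>\<^bsub>E\<^esub> y" t]) (use cl \<pi> in \<open>simp_all add: mult_pc_group\<close>)
  have zcl: "z1 \<in> carrier E" "z2 \<in> carrier E" using z1 z2 by simp_all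
  \<comment> \<open>\<open>x^3\<close> equals \<open>t\<close> up to a central factor, and
    \<open>x\<close> commutes with its own cube.\<close>
  have tx': "t \<otimes>\<^bsub>E\<^esub> x = x \<otimes>\<^bsub>E\<^esub> t"
    using E.commute_factor[OF cl(4) zcl(1) cl(1) _ N[OF z1(1) cl(1)]] E.cube_commute[OF cl(1)] z1(2) by simp
  \<comment> \<open>In this group \<open>y^3\<close> lies over \<open>t\<close> as well.\<close>
  have ty': "t \<otimes>\<^bsub>E\<^esub> y = y \<otimes>\<^bsub>E\<^esub> t"
    using E.commute_factor[OF cl(4) zcl(2) cl(2) _ N[OF z2(1) cl(2)]] E.cube_commute[OF cl(2)] z2(2) by simp
  have w2: "w2 = \<one>\<^bsub>E\<^esub>" using ty ty' cl wcl by simp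
  have ux': "u \<otimes>\<^bsub>E\<^esub> x = x \<otimes>\<^bsub>E\<^esub> u" using ux w2 cl by simp
  \<comment> \<open>Collection gives \<open>t^3\<close> as the commutator of \<open>s\<close> and
    \<open>x^3\<close>, but \<open>x^3\<close> acts by conjugation like \<open>t\<close>, which
    commutes with \<open>s\<close>.\<close>
  have t3: "t \<otimes>\<^bsub>E\<^esub> t \<otimes>\<^bsub>E\<^esub> t = \<one>\<^bsub>E\<^esub>"
  proof -
    have "s \<otimes>\<^bsub>E\<^esub> (x \<otimes>\<^bsub>E\<^esub> x \<otimes>\<^bsub>E\<^esub> x) = x \<otimes>\<^bsub>E\<^esub> x \<otimes>\<^bsub>E\<^esub> x \<otimes>\<^bsub>E\<^esub> (s \<otimes>\<^bsub>E\<^esub> (t \<otimes>\<^bsub>E\<^esub> t \<otimes>\<^bsub>E\<^esub> t) \<otimes>\<^bsub>E\<^esub> (\<one>\<^bsub>E\<^esub> \<otimes>\<^bsub>E\<^esub> \<one>\<^bsub>E\<^esub> \<otimes>\<^bsub>E\<^esub> \<one>\<^bsub>E\<^esub>))"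
      by (rule E.power_swap_right) (use cl sx tx' in simp_all)
    moreover have "s \<otimes>\<^bsub>E\<^esub> (x \<otimes>\<^bsub>E\<^esub> x \<otimes>\<^bsub>E\<^esub> x) = x \<otimes>\<^bsub>E\<^esub> x \<otimes>\<^bsub>E\<^esub> x \<otimes>\<^bsub>E\<^esub> s"
      unfolding z1(2) using cl zcl N[OF z1(1) cl(3)] ts E.commute_assoc[OF ts[symmetric]] by (simp add: E.m_assoc)
    ultimately show ?thesis using cl by (simp add: E.m_assoc)
  qed
  \<comment> \<open>The same comparison for \<open>y\<close> and \<open>x^3\<close>, where
    collection gives \<open>s^3 t^3\<close>.\<close>
  have s3: "s \<otimes>\<^bsub>E\<^esub> s \<otimes>\<^bsub>E\<^esub> s = \<one>\<^bsub>E\<^esub>"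
  proof -
    have "y \<otimes>\<^bsub>E\<^esub> (x \<otimes>\<^bsub>E\<^esub> x \<otimes>\<^bsub>E\<^esub> x) = x \<otimes>\<^bsub>E\<^esub> x \<otimes>\<^bsub>E\<^esub> x \<otimes>\<^bsub>E\<^esub> (y \<otimes>\<^bsub>E\<^esub> (s \<otimes>\<^bsub>E\<^esub> s \<otimes>\<^bsub>E\<^esub> s) \<otimes>\<^bsub>E\<^esub> (t \<otimes>\<^bsub>E\<^esub> t \<otimes>\<^bsub>E\<^esub> t))"
      by (rule E.power_swap_right) (use cl yx sx tx' ts in simp_all)
    moreover have "y \<otimes>\<^bsub>E\<^esub> (x \<otimes>\<^bsub>E\<^esub> x \<otimes>\<^bsub>E\<^esub> x) = x \<otimes>\<^bsub>E\<^esub> x \<otimes>\<^bsub>E\<^esub> x \<otimes>\<^bsub>E\<^esub> y"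
      unfolding z1(2) using cl zcl N[OF z1(1) cl(2)] ty' E.commute_assoc[OF ty'[symmetric]] by (simp add: E.m_assoc)
    ultimately show ?thesis using cl t3 by (simp add: E.m_assoc)
  qed
  have u3: "u \<otimes>\<^bsub>E\<^esub> u \<otimes>\<^bsub>E\<^esub> u = \<one>\<^bsub>E\<^esub>"
    using E.power_swap_left[OF cl(3) cl(2) cl(5) sy us] s3 cl by simp
  \<comment> \<open>The commutator of \<open>y^3\<close> and \<open>x\<close> is
    \<open>s^3 u^3 w4\<close>; since \<open>y^3\<close> acts like \<open>t\<close> and the cubes are
    trivial, \<open>w4\<close> vanishes.\<close>
  have uy': "u \<otimes>\<^bsub>E\<^esub> y = y \<otimes>\<^bsub>E\<^esub> u"
  proof -
    have "y \<otimes>\<^bsub>E\<^esub> y \<otimes>\<^bsub>E\<^esub> y \<otimes>\<^bsub>E\<^esub> x = x \<otimes>\<^bsub>E\<^esub> (y \<otimes>\<^bsub>E\<^esub> y \<otimes>\<^bsub>E\<^esub> y) \<otimes>\<^bsub>E\<^esub> ((s \<otimes>\<^bsub>E\<^esub> s \<otimes>\<^bsub>E\<^esub> s) \<otimes>\<^bsub>E\<^esub> (u \<otimes>\<^bsub>E\<^esub> u \<otimes>\<^bsub>E\<^esub> u) \<otimes>\<^bsub>E\<^esub> w4)"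
      by (rule E.power_swap_collect) (use cl wcl yx sy uy us N[OF w(3)] in simp_all)
    moreover have "y \<otimes>\<^bsub>E\<^esub> y \<otimes>\<^bsub>E\<^esub> y \<otimes>\<^bsub>E\<^esub> x = x \<otimes>\<^bsub>E\<^esub> (y \<otimes>\<^bsub>E\<^esub> y \<otimes>\<^bsub>E\<^esub> y)"
      unfolding z2(2) using cl zcl N[OF z2(1) cl(1)] tx' E.commute_assoc[OF tx'] by (simp add: E.m_assoc)
    ultimately have "w4 = \<one>\<^bsub>E\<^esub>" using cl wcl s3 u3 by (simp add: E.m_assoc)
    then show ?thesis using uy cl by simp
  qed
  show ?thesis
    by (rule derived_inter_kernel[OF cl \<pi> yx sx sy tx' ty' ux' uy' s3 t3 u3 assms(2,3)])
qed

lemma derived_inter_kernel_7: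
  assumes "pc_extension E \<pi> 1 0 0 1" "z \<in> derived E (carrier E)" "\<pi> z = (0, 0, 0, 0, 0)"
  shows "z = \<one>\<^bsub>E\<^esub>"
proof -
  interpret pc_extension E \<pi> 1 0 0 1 by fact
  obtain x y s t u w1 w2 w4 where cl: "x \<in> carrier E" "y \<in> carrier E" "s \<in> carrier E" "t \<in> carrier E" "u \<in> carrier E"
    and w: "w1 \<in> N" "w2 \<in> N" "w4 \<in> N"
    and \<pi>: "\<pi> x = (1, 0, 0, 0, 0)" "\<pi> y = (0, 1, 0, 0, 0)" "\<pi> s = (0, 0, 1, 0, 0)" "\<pi> t = (0, 0, 0, 1, 0)" "\<pi> u = (0, 0, 0, 0, 1)"
    and yx: "y \<otimes>\<^bsub>E\<^esub> x = x \<otimes>\<^bsub>E\<^esub> y \<otimes>\<^bsub>E\<^esub> s" and sx: "s \<otimes>\<^bsub>E\<^esub> x = x \<otimes>\<^bsub>E\<^esub> s \<otimes>\<^bsub>E\<^esub> t" and sy: "s \<otimes>\<^bsub>E\<^esub> y = y \<otimes>\<^bsub>E\<^esub> s \<otimes>\<^bsub>E\<^esub> u"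
    and tx: "t \<otimes>\<^bsub>E\<^esub> x = x \<otimes>\<^bsub>E\<^esub> t \<otimes>\<^bsub>E\<^esub> w1" and ty: "t \<otimes>\<^bsub>E\<^esub> y = y \<otimes>\<^bsub>E\<^esub> t \<otimes>\<^bsub>E\<^esub> w2"
    and ux: "u \<otimes>\<^bsub>E\<^esub> x = x \<otimes>\<^bsub>E\<^esub> u \<otimes>\<^bsub>E\<^esub> w2" and uy: "u \<otimes>\<^bsub>E\<^esub> y = y \<otimes>\<^bsub>E\<^esub> u \<otimes>\<^bsub>E\<^esub> w4"
    and ts: "t \<otimes>\<^bsub>E\<^esub> s = s \<otimes>\<^bsub>E\<^esub> t" and us: "u \<otimes>\<^bsub>E\<^esub> s = s \<otimes>\<^bsub>E\<^esub> u" and tu: "t \<otimes>\<^bsub>E\<^esub> u = u \<otimes>\<^bsub>E\<^esub> t"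
    by (rule extension_elements)
  have wcl: "w1 \<in> carrier E" "w2 \<in> carrier E" "w4 \<in> carrier E" using w by simp_all
  have N: "n \<otimes>\<^bsub>E\<^esub> g = g \<otimes>\<^bsub>E\<^esub> n" if "n \<in> N" "g \<in> carrier E" for n g using central that by blast
  obtain z1 where z1: "z1 \<in> N" "x \<otimes>\<^bsub>E\<^esub> x \<otimes>\<^bsub>E\<^esub> x = t \<otimes>\<^bsub>E\<^esub> z1"
    by (rule same_image[of "x \<otimes>\<^bsub>E\<^esub> x \<otimes>\<^bsub>E\<^esub> x" t]) (use cl \<pi> in \<open>simp_all add: mult_pc_group\<close>)
  \<comment> \<open>Here \<open>y^3\<close> lies over \<open>u\<close> and not over
    \<open>t\<close>, so \<open>t\<close> need not commute with \<open>y\<close> at once: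
    \<open>w2\<close> has to be killed in another way.\<close>
  obtain z2 where z2: "z2 \<in> N" "y \<otimes>\<^bsub>E\<^esub> y \<otimes>\<^bsub>E\<^esub> y = u \<otimes>\<^bsub>E\<^esub> z2"
    by (rule same_image[of "y \<otimes>\<^bsub>E\<^esub> y \<otimes>\<^bsub>E\<^esub> y" u]) (use cl \<pi> in \<open>simp_all add: mult_pc_group\<close>)
  have zcl: "z1 \<in> carrier E" "z2 \<in> carrier E" using z1 z2 by simp_all
  have tx': "t \<otimes>\<^bsub>E\<^esub> x = x \<otimes>\<^bsub>E\<^esub> t"
    using E.commute_factor[OF cl(4) zcl(1) cl(1) _ N[OF z1(1) cl(1)]] E.cube_commute[OF cl(1)] z1(2) by simp
  have uy': "u \<otimes>\<^bsub>E\<^esub> y = y \<otimes>\<^bsub>E\<^esub> u"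
    using E.commute_factor[OF cl(5) zcl(2) cl(2) _ N[OF z2(1) cl(2)]] E.cube_commute[OF cl(2)] z2(2) by simp
  have t3: "t \<otimes>\<^bsub>E\<^esub> t \<otimes>\<^bsub>E\<^esub> t = \<one>\<^bsub>E\<^esub>"
  proof -
    have "s \<otimes>\<^bsub>E\<^esub> (x \<otimes>\<^bsub>E\<^esub> x \<otimes>\<^bsub>E\<^esub> x) = x \<otimes>\<^bsub>E\<^esub> x \<otimes>\<^bsub>E\<^esub> x \<otimes>\<^bsub>E\<^esub> (s \<otimes>\<^bsub>E\<^esub> (t \<otimes>\<^bsub>E\<^esub> t \<otimes>\<^bsub>E\<^esub> t) \<otimes>\<^bsub>E\<^esub> (\<one>\<^bsub>E\<^esub> \<otimes>\<^bsub>E\<^esub> \<one>\<^bsub>E\<^esub> \<otimes>\<^bsub>E\<^esub> \<one>\<^bsub>E\<^esub>))"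
      by (rule E.power_swap_right) (use cl sx tx' in simp_all)
    moreover have "s \<otimes>\<^bsub>E\<^esub> (x \<otimes>\<^bsub>E\<^esub> x \<otimes>\<^bsub>E\<^esub> x) = x \<otimes>\<^bsub>E\<^esub> x \<otimes>\<^bsub>E\<^esub> x \<otimes>\<^bsub>E\<^esub> s"
      unfolding z1(2) using cl zcl N[OF z1(1) cl(3)] ts E.commute_assoc[OF ts[symmetric]] by (simp add: E.m_assoc)
    ultimately show ?thesis using cl by (simp add: E.m_assoc)
  qed
  have u3: "u \<otimes>\<^bsub>E\<^esub> u \<otimes>\<^bsub>E\<^esub> u = \<one>\<^bsub>E\<^esub>"
  proof -
    have "s \<otimes>\<^bsub>E\<^esub> (y \<otimes>\<^bsub>E\<^esub> y \<otimes>\<^bsub>E\<^esub> y) = y \<otimes>\<^bsub>E\<^esub> y \<otimes>\<^bsub>E\<^esub> y \<otimes>\<^bsub>E\<^esub> (s \<otimes>\<^bsub>E\<^esub> (u \<otimes>\<^bsub>E\<^esub> u \<otimes>\<^bsub>E\<^esub> u) \<otimes>\<^bsub>E\<^esub> (\<one>\<^bsub>E\<^esub> \<otimes>\<^bsub>E\<^esub> \<one>\<^bsub>E\<^esub> \<otimes>\<^bsub>E\<^esub> \<one>\<^bsub>E\<^esub>))"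
      by (rule E.power_swap_right) (use cl sy uy' in simp_all)
    moreover have "s \<otimes>\<^bsub>E\<^esub> (y \<otimes>\<^bsub>E\<^esub> y \<otimes>\<^bsub>E\<^esub> y) = y \<otimes>\<^bsub>E\<^esub> y \<otimes>\<^bsub>E\<^esub> y \<otimes>\<^bsub>E\<^esub> s"
      unfolding z2(2) using cl zcl N[OF z2(1) cl(3)] us E.commute_assoc[OF us[symmetric]] by (simp add: E.m_assoc)
    ultimately show ?thesis using cl by (simp add: E.m_assoc)
  qed
  \<comment> \<open>First evaluation of \<open>w2\<close>: \<open>x^3\<close> acts like
    \<open>t\<close>, and comparison with collection makes \<open>w2\<close> inverse to
    \<open>s^3\<close>.\<close>
  have 1: "w2 \<otimes>\<^bsub>E\<^esub> (s \<otimes>\<^bsub>E\<^esub> s \<otimes>\<^bsub>E\<^esub> s) = \<one>\<^bsub>E\<^esub>"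
  proof -
    have "y \<otimes>\<^bsub>E\<^esub> (x \<otimes>\<^bsub>E\<^esub> x \<otimes>\<^bsub>E\<^esub> x) = x \<otimes>\<^bsub>E\<^esub> x \<otimes>\<^bsub>E\<^esub> x \<otimes>\<^bsub>E\<^esub> (y \<otimes>\<^bsub>E\<^esub> (s \<otimes>\<^bsub>E\<^esub> s \<otimes>\<^bsub>E\<^esub> s) \<otimes>\<^bsub>E\<^esub> (t \<otimes>\<^bsub>E\<^esub> t \<otimes>\<^bsub>E\<^esub> t))"
      by (rule E.power_swap_right) (use cl yx sx tx' ts in simp_all)
    moreover have "x \<otimes>\<^bsub>E\<^esub> x \<otimes>\<^bsub>E\<^esub> x \<otimes>\<^bsub>E\<^esub> y = y \<otimes>\<^bsub>E\<^esub> (x \<otimes>\<^bsub>E\<^esub> x \<otimes>\<^bsub>E\<^esub> x) \<otimes>\<^bsub>E\<^esub> w2"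
      unfolding z1(2) using cl zcl wcl N[OF z1(1) cl(2)] E.swap_assoc[OF ty] N[OF w(2) zcl(1)] by (simp add: E.m_assoc)
    ultimately show ?thesis
      unfolding t3 by (intro E.swap_twice[of y "x \<otimes>\<^bsub>E\<^esub> x \<otimes>\<^bsub>E\<^esub> x"]) (use cl wcl in simp_all)
  qed
  \<comment> \<open>Second evaluation: \<open>y^3\<close> acts like \<open>u\<close>, which gives
    \<open>w2 = s^3\<close>. Together they yield \<open>w2^2 = 1\<close>, while
    \<open>t^3 = 1\<close> yields \<open>w2^3 = 1\<close>.\<close>
  have 2: "w2 = s \<otimes>\<^bsub>E\<^esub> s \<otimes>\<^bsub>E\<^esub> s"
  proof -
    have "y \<otimes>\<^bsub>E\<^esub> y \<otimes>\<^bsub>E\<^esub> y \<otimes>\<^bsub>E\<^esub> x = x \<otimes>\<^bsub>E\<^esub> (y \<otimes>\<^bsub>E\<^esub> y \<otimes>\<^bsub>E\<^esub> y) \<otimes>\<^bsub>E\<^esub> ((s \<otimes>\<^bsub>E\<^esub> s \<otimes>\<^bsub>E\<^esub> s) \<otimes>\<^bsub>E\<^esub> (u \<otimes>\<^bsub>E\<^esub> u \<otimes>\<^bsub>E\<^esub> u) \<otimes>\<^bsub>E\<^esub> \<one>\<^bsub>E\<^esub>)"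
      by (rule E.power_swap_collect) (use cl wcl yx sy uy' us in simp_all)
    moreover have "y \<otimes>\<^bsub>E\<^esub> y \<otimes>\<^bsub>E\<^esub> y \<otimes>\<^bsub>E\<^esub> x = x \<otimes>\<^bsub>E\<^esub> (y \<otimes>\<^bsub>E\<^esub> y \<otimes>\<^bsub>E\<^esub> y) \<otimes>\<^bsub>E\<^esub> w2"
      unfolding z2(2) using cl zcl wcl N[OF z2(1) cl(1)] E.swap_assoc[OF ux] N[OF w(2) zcl(2)] by (simp add: E.m_assoc)
    ultimately show ?thesis using cl wcl u3 by simp
  qed
  have "t \<otimes>\<^bsub>E\<^esub> t \<otimes>\<^bsub>E\<^esub> t \<otimes>\<^bsub>E\<^esub> y = y \<otimes>\<^bsub>E\<^esub> (t \<otimes>\<^bsub>E\<^esub> t \<otimes>\<^bsub>E\<^esub> t) \<otimes>\<^bsub>E\<^esub> (w2 \<otimes>\<^bsub>E\<^esub> w2 \<otimes>\<^bsub>E\<^esub> w2)"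
    by (rule E.power_swap_left) (use cl wcl ty N[OF w(2)] in simp_all)
  then have "w2 \<otimes>\<^bsub>E\<^esub> w2 \<otimes>\<^bsub>E\<^esub> w2 = \<one>\<^bsub>E\<^esub>" using t3 cl wcl by simp
  moreover have "w2 \<otimes>\<^bsub>E\<^esub> w2 = \<one>\<^bsub>E\<^esub>" using 1 2 by simp
  ultimately have w2: "w2 = \<one>\<^bsub>E\<^esub>" using wcl by simp
  then have s3: "s \<otimes>\<^bsub>E\<^esub> s \<otimes>\<^bsub>E\<^esub> s = \<one>\<^bsub>E\<^esub>" using 2 by simp
  have ty': "t \<otimes>\<^bsub>E\<^esub> y = y \<otimes>\<^bsub>E\<^esub> t" and ux': "u \<otimes>\<^bsub>E\<^esub> x = x \<otimes>\<^bsub>E\<^esub> u" using ty ux w2 cl by simp_all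
  show ?thesis
    by (rule derived_inter_kernel[OF cl \<pi> yx sx sy tx' ty' ux' uy' s3 t3 u3 assms(2,3)])
qed

section \<open>Central elements and central factors in finite 3-groups\<close>

lemma divides_power_3:
  assumes "(m::nat) dvd 3 ^ n"
  obtains i where "m = 3 ^ i"
proof -
  have "Factorial_Ring.prime (3::nat)" by simp
  then show ?thesis using that assms divides_primepow_nat by blast
qed

context group
begin

text \<open>Class equation for the conjugation action on \<open>N\<close>: if the unit were the only
  central element in \<open>N\<close>, the order of \<open>N\<close> would be 1 modulo 3, hence 1 as
  a power of 3.\<close>

lemma finite_3_group_central_element:
  assumes ord: "order G = 3 ^ n" and N: "N \<lhd> G" "N \<noteq> {\<one>}"
  shows "\<exists>z\<in>N. z \<noteq> \<one> \<and> (\<forall>g\<in>carrier G. z \<otimes> g = g \<otimes> z)"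
proof (rule ccontr)
  assume no: "\<not> ?thesis"
  let ?\<phi> = "\<lambda>g. \<lambda>h\<in>carrier G. g \<otimes> h \<otimes> inv g"
  interpret A: group_action G "carrier G" ?\<phi> by (rule action_by_conjugation)
  interpret N: normal N G by fact
  have fin: "finite (carrier G)" using ord order_gt_0_iff_finite by simp
  have Nc: "N \<subseteq> carrier G" by (rule N.subset)
  have orbit: "orbit G ?\<phi> x = {g \<otimes> x \<otimes> inv g | g. g \<in> carrier G}" if "x \<in> carrier G" for x
    using that by (auto simp: orbit_def)
  have fin_orbits: "finite (orbits G (carrier G) ?\<phi>)" using fin by (auto simp: orbits_def)
  have "(\<Sum>orb\<in>orbits G (carrier G) ?\<phi>. \<Sum>x\<in>orb. if x \<in> N then 1 else 0) = (\<Sum>x\<in>carrier G. if x \<in> N then 1 else 0 :: nat)"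
    by (rule A.disjoint_sum[OF fin])
  also have "\<dots> = card N" using Nc fin by (simp add: sum.If_cases Int_absorb1)
  finally have sum: "(\<Sum>orb\<in>orbits G (carrier G) ?\<phi>. \<Sum>x\<in>orb. if x \<in> N then 1 else 0) = card N" .
  \<comment> \<open>A class outside \<open>N\<close> contributes 0. A class inside has a power of 3
    as its size, and size 1 would give a nontrivial central element.\<close>
  have cong: "3 dvd (\<Sum>x\<in>orb. if x \<in> N then 1 else 0 :: nat)" if orb: "orb \<in> orbits G (carrier G) ?\<phi> - {{\<one>}}" for orb
  proof -
    obtain x where x: "x \<in> carrier G" "orb = orbit G ?\<phi> x" using orb by (auto simp: orbits_def)
    have in_N: "g \<otimes> x \<otimes> inv g \<in> N \<longleftrightarrow> x \<in> N" if g: "g \<in> carrier G" for g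
    proof
      assume "g \<otimes> x \<otimes> inv g \<in> N"
      then have "inv g \<otimes> (g \<otimes> x \<otimes> inv g) \<otimes> g \<in> N" using N.inv_op_closed1[OF g] by blast
      then show "x \<in> N" using g x by (simp add: m_assoc) (simp add: m_assoc[symmetric])
    next
      assume "x \<in> N"
      then show "g \<otimes> x \<otimes> inv g \<in> N" using N.inv_op_closed2[OF g] by blast
    qed
    show ?thesis
    proof (cases "x \<in> N")
      case False
      then have "(\<Sum>x\<in>orb. if x \<in> N then 1 else 0 :: nat) = 0"
        using in_N x by (intro sum.neutral) (auto simp: orbit)
      then show ?thesis by (simp only: dvd_0_right)
    next
      case True
      then have "(\<Sum>x\<in>orb. if x \<in> N then 1 else 0 :: nat) = (\<Sum>x\<in>orb. 1)"
        using in_N x by (intro sum.cong) (auto simp: orbit)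
      then have sc: "(\<Sum>x\<in>orb. if x \<in> N then 1 else 0 :: nat) = card orb" by simp
      have "card orb * card (stabilizer G ?\<phi> x) = 3 ^ n"
        using A.orbit_stabilizer_theorem[OF x(1)] unfolding x(2) ord .
      then have "card orb dvd 3 ^ n" by (intro dvdI) (rule sym)
      then obtain i where i: "card orb = 3 ^ i" using divides_power_3 by blast
      have "i \<noteq> 0"
      proof
        assume "i = 0"
        then obtain y where y: "orb = {y}" using i by (auto simp: card_1_singleton_iff)
        have "x \<in> orb" using A.orbit_refl x by simp
        then have stable: "g \<otimes> x \<otimes> inv g = x" if "g \<in> carrier G" for g
          using y x that orbit[OF x(1)] by auto
        have "x \<otimes> g = g \<otimes> x" if g: "g \<in> carrier G" for g
        proof -
          have "x \<otimes> g = g \<otimes> x \<otimes> inv g \<otimes> g" using stable[OF g] by simp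
          then show ?thesis using g x by (simp add: m_assoc)
        qed
        then have "x = \<one>" using no True by blast
        then show False using orb y \<open>x \<in> orb\<close> by simp
      qed
      then show ?thesis using sc i by simp
    qed
  qed
  have one: "{\<one>} \<in> orbits G (carrier G) ?\<phi>"
    unfolding orbits_def using orbit[OF one_closed] one_closed by (auto intro!: exI[of _ \<one>])
  have "(\<Sum>orb\<in>orbits G (carrier G) ?\<phi>. \<Sum>x\<in>orb. if x \<in> N then 1 else 0 :: nat)
      = 1 + (\<Sum>orb\<in>orbits G (carrier G) ?\<phi> - {{\<one>}}. \<Sum>x\<in>orb. if x \<in> N then 1 else 0)"
    using sum.remove[OF fin_orbits one, of "\<lambda>orb. \<Sum>x\<in>orb. if x \<in> N then 1 else 0 :: nat"] N.one_closed by simp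
  moreover have "3 dvd (\<Sum>orb\<in>orbits G (carrier G) ?\<phi> - {{\<one>}}. \<Sum>x\<in>orb. if x \<in> N then 1 else 0 :: nat)"
    by (rule dvd_sum) (rule cong)
  ultimately have not3: "\<not> 3 dvd card N" using sum by presburger
  have "card N * card (rcosets N) = 3 ^ n" using lagrange[OF N.subgroup_axioms] ord by (simp add: mult.commute)
  then have "card N dvd 3 ^ n" by (intro dvdI) (rule sym)
  then obtain i where i: "card N = 3 ^ i" using divides_power_3 by blast
  then have "i = 0" using not3 by (cases i) auto
  then have "card N = 1" using i by simp
  then obtain x where "N = {x}" by (auto simp: card_1_singleton_iff)
  then show False using N(2) N.one_closed by blast
qed

text \<open>\<open>M\<close> is a largest normal subgroup of the whole group properly contained in
  \<open>N\<close>. Such a choice makes the factor \<open>N/M\<close> central.\<close>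

lemma finite_3_group_central_factor:
  assumes ord: "order G = 3 ^ n" and N: "N \<lhd> G" "N \<noteq> {\<one>}"
  obtains M where "M \<lhd> G" "M \<subset> N"
    "\<And>h g. h \<in> N \<Longrightarrow> g \<in> carrier G \<Longrightarrow> M #> (h \<otimes> g) = M #> (g \<otimes> h)"
proof -
  interpret N: normal N G by fact
  have fin: "finite (carrier G)" using ord order_gt_0_iff_finite by simp
  let ?P = "\<lambda>M. M \<lhd> G \<and> M \<subset> N"
  have "?P {\<one>}" using N N.one_closed one_is_normal by blast
  moreover have "card M \<le> card N" if "?P M" for M
    using that finite_subset[OF N.subset fin] by (intro card_mono) auto
  ultimately have "\<exists>M. ?P M \<and> (\<forall>M'. ?P M' \<longrightarrow> card M' \<le> card M)"
    using ex_has_greatest_nat[of ?P "{\<one>}" card "Suc (card N)"] by (simp add: less_Suc_eq_le)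
  then obtain M where M: "?P M" "\<And>M'. ?P M' \<Longrightarrow> card M' \<le> card M" by blast
  interpret M: normal M G using M by simp
  interpret Q: group "G Mod M" by (rule M.factorgroup_is_group)
  interpret q: group_hom G "G Mod M" "\<lambda>g. M #> g"
    using M.r_coset_hom_Mod by (simp add: group_hom_def group_hom_axioms_def is_group Q.is_group)
  let ?q = "\<lambda>g. M #> g"
  have q_mult: "?q (g \<otimes> h) = ?q g \<otimes>\<^bsub>G Mod M\<^esub> ?q h" if "g \<in> carrier G" "h \<in> carrier G" for g h
    using q.hom_mult that by simp
  have q_one: "?q h = \<one>\<^bsub>G Mod M\<^esub> \<longleftrightarrow> h \<in> M" if "h \<in> carrier G" for h
    using that M.rcos_const rcos_self[OF that M.subgroup_axioms] by (auto simp: FactGroup_def)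
  \<comment> \<open>The part of \<open>N\<close> that is central modulo \<open>M\<close>. It is
    normal, and a nontrivial central element in \<open>N/M\<close> makes it larger than
    \<open>M\<close>, so maximality forces \<open>C = N\<close>.\<close>
  define C where "C = {h \<in> N. \<forall>g\<in>carrier G. ?q (h \<otimes> g) = ?q (g \<otimes> h)}"
  have Cc: "C \<subseteq> carrier G" using N.subset by (auto simp: C_def)
  have qc: "?q g \<in> carrier (G Mod M)" if "g \<in> carrier G" for g using that by (rule q.hom_closed)
  have comm: "?q h \<otimes>\<^bsub>G Mod M\<^esub> ?q g = ?q g \<otimes>\<^bsub>G Mod M\<^esub> ?q h" if "h \<in> C" "g \<in> carrier G" for h g
  proof -
    have h: "h \<in> carrier G" using that(1) Cc by blast
    have "?q (h \<otimes> g) = ?q (g \<otimes> h)" using that unfolding C_def by blast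
    then show ?thesis unfolding q_mult[OF h that(2)] q_mult[OF that(2) h] .
  qed
  have CI: "h \<in> C" if "h \<in> N" "\<And>g. g \<in> carrier G \<Longrightarrow> ?q h \<otimes>\<^bsub>G Mod M\<^esub> ?q g = ?q g \<otimes>\<^bsub>G Mod M\<^esub> ?q h" for h
  proof -
    note * = that(2)
    have h: "h \<in> carrier G" using that N.subset by blast
    have "?q (h \<otimes> g) = ?q (g \<otimes> h)" if g: "g \<in> carrier G" for g
      unfolding q_mult[OF h g] q_mult[OF g h] using *[OF g] .
    then show ?thesis using that(1) unfolding C_def by blast
  qed
  have sub: "subgroup C G"
  proof (rule subgroupI[OF Cc])
    have "\<one> \<in> C" using N.one_closed by (simp add: C_def)
    then show "C \<noteq> {}" by blast
  next
    fix h assume h: "h \<in> C"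
    then have hc: "h \<in> carrier G" using Cc by blast
    have hi: "?q (inv h) = inv\<^bsub>G Mod M\<^esub> ?q h" using hc by (rule q.hom_inv)
    show "inv h \<in> C"
    proof (rule CI)
      show "inv h \<in> N" using h by (simp add: C_def)
      show "?q (inv h) \<otimes>\<^bsub>G Mod M\<^esub> ?q g = ?q g \<otimes>\<^bsub>G Mod M\<^esub> ?q (inv h)" if g: "g \<in> carrier G" for g
        using Q.pw_commute[OF qc[OF hc] qc[OF g] comm[OF h g], of "- 1"] unfolding hi Q.pw_simps .
    qed
  next
    fix h h' assume h: "h \<in> C" "h' \<in> C"
    then have hc: "h \<in> carrier G" "h' \<in> carrier G" using Cc by auto
    show "h \<otimes> h' \<in> C"
    proof (rule CI)
      show "h \<otimes> h' \<in> N" using h by (simp add: C_def)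
      show "?q (h \<otimes> h') \<otimes>\<^bsub>G Mod M\<^esub> ?q g = ?q g \<otimes>\<^bsub>G Mod M\<^esub> ?q (h \<otimes> h')" if g: "g \<in> carrier G" for g
        unfolding q_mult[OF hc]
        using comm[OF h(1) g] comm[OF h(2) g] qc[OF g] qc[OF hc(1)] qc[OF hc(2)] Q.m_assoc by metis
    qed
  qed
  have normal: "C \<lhd> G"
  proof (rule normal_invI[OF sub])
    fix g h assume g: "g \<in> carrier G" and h: "h \<in> C"
    have hc: "h \<in> carrier G" using h Cc by auto
    have "?q (g \<otimes> h \<otimes> inv g) = ?q (g \<otimes> h) \<otimes>\<^bsub>G Mod M\<^esub> ?q (inv g)"
      using g hc by (intro q_mult) simp_all
    also have "?q (g \<otimes> h) = ?q (h \<otimes> g)" using g h unfolding C_def by blast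
    also have "?q (h \<otimes> g) \<otimes>\<^bsub>G Mod M\<^esub> ?q (inv g) = ?q (h \<otimes> g \<otimes> inv g)"
      using g hc by (intro q_mult[symmetric]) simp_all
    also have "h \<otimes> g \<otimes> inv g = h" using g hc by (simp add: m_assoc)
    finally have eq: "?q (g \<otimes> h \<otimes> inv g) = ?q h" .
    show "g \<otimes> h \<otimes> inv g \<in> C"
    proof (rule CI)
      show "g \<otimes> h \<otimes> inv g \<in> N" using h g N.inv_op_closed2 by (simp add: C_def)
    qed (unfold eq, rule comm[OF h])
  qed
  have "M \<subseteq> C"
  proof
    fix h assume h: "h \<in> M"
    then have h': "?q h = \<one>\<^bsub>G Mod M\<^esub>" "h \<in> N" using q_one M M.subset by auto
    show "h \<in> C" by (rule CI[OF h'(2)]) (unfold h'(1), use qc in \<open>metis Q.l_one Q.r_one\<close>)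
  qed
  have "C \<noteq> M"
  proof -
    let ?N = "?q ` N"
    have nN: "?N \<lhd> (G Mod M)"
    proof (rule Q.normal_invI)
      show "subgroup ?N (G Mod M)" by (rule q.subgroup_img_is_subgroup[OF N.subgroup_axioms])
    next
      fix g h assume "g \<in> carrier (G Mod M)" "h \<in> ?N"
      then obtain g' h' where gh: "g' \<in> carrier G" "g = ?q g'" "h' \<in> N" "h = ?q h'"
        by (auto simp: FactGroup_def RCOSETS_def)
      then have hc: "h' \<in> carrier G" using N.subset by blast
      have "g \<otimes>\<^bsub>G Mod M\<^esub> h \<otimes>\<^bsub>G Mod M\<^esub> inv\<^bsub>G Mod M\<^esub> g = ?q (g' \<otimes> h' \<otimes> inv g')"
        unfolding gh(2,4) using gh(1) hc by (simp only: q_mult q.hom_inv m_closed inv_closed)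
      then show "g \<otimes>\<^bsub>G Mod M\<^esub> h \<otimes>\<^bsub>G Mod M\<^esub> inv\<^bsub>G Mod M\<^esub> g \<in> ?N"
        using N.inv_op_closed2[OF gh(1,3)] by auto
    qed
    have neN: "?N \<noteq> {\<one>\<^bsub>G Mod M\<^esub>}"
    proof -
      obtain h where "h \<in> N" "h \<notin> M" using M by blast
      then have "?q h \<noteq> \<one>\<^bsub>G Mod M\<^esub>" "?q h \<in> ?N" using q_one N.subset by auto
      then show ?thesis by auto
    qed
    have "order (G Mod M) * card M = 3 ^ n"
      using lagrange[OF M.subgroup_axioms] ord by (simp add: order_def FactGroup_def)
    then have "order (G Mod M) dvd 3 ^ n" by (intro dvdI) (rule sym)
    then obtain i where i: "order (G Mod M) = 3 ^ i" using divides_power_3 by blast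
    obtain z where z: "z \<in> ?N" "z \<noteq> \<one>\<^bsub>G Mod M\<^esub>" "\<forall>g\<in>carrier (G Mod M). z \<otimes>\<^bsub>G Mod M\<^esub> g = g \<otimes>\<^bsub>G Mod M\<^esub> z"
      using Q.finite_3_group_central_element[OF i nN neN] by blast
    then obtain h where h: "h \<in> N" "z = ?q h" by blast
    have "h \<in> C" by (rule CI[OF h(1)]) (use z(3) qc h in blast)
    moreover have "h \<notin> M" using h z q_one N.subset by auto
    ultimately show ?thesis by blast
  qed
  have "C = N"
  proof (rule ccontr)
    assume "C \<noteq> N"
    then have "C \<subset> N" by (auto simp: C_def)
    then have "card C \<le> card M" using M(2)[of C] normal by blast
    then have "M = C"
      using \<open>M \<subseteq> C\<close> finite_subset[OF Cc fin] by (intro card_seteq) auto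
    with \<open>C \<noteq> M\<close> show False by simp
  qed
  show ?thesis
  proof (rule that[of M])
    show "M \<lhd> G" "M \<subset> N" using M by auto
    fix h g assume "h \<in> N" "g \<in> carrier G"
    moreover from this have "h \<in> C" "h \<in> carrier G" using \<open>C = N\<close> N.subset by auto
    ultimately show "M #> (h \<otimes> g) = M #> (g \<otimes> h)" by (unfold C_def) blast
  qed
qed

end

text \<open>The parameters of \<open>SG243_5\<close> and \<open>SG243_7\<close>; the name
  anticipates \<open>terminal_of_iso_terminal\<close>.\<close>

definition terminal_params :: "(3 \<times> 3 \<times> 3 \<times> 3) set" where
  "terminal_params = {(1, 0, 1, 0), (1, 0, 0, 1)}"

lemma derived_inter_kernel_terminal:
  assumes "(p, q, k, l) \<in> terminal_params" "pc_extension E \<pi> p q k l" "z \<in> derived E (carrier E)"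
    "\<pi> z = (0, 0, 0, 0, 0)"
  shows "z = \<one>\<^bsub>E\<^esub>"
  using assms derived_inter_kernel_5 derived_inter_kernel_7 by (auto simp: terminal_params_def)

text \<open>If the kernel \<open>N\<close> were nontrivial, a central factor \<open>N/M\<close>
  would make \<open>V/M\<close> a central extension of the presented group. There the kernel
  \<open>N/M\<close> meets the commutator subgroup trivially, yet \<open>N\<close> lies in the
  commutator subgroup of \<open>V\<close>, so \<open>N\<close> would be contained in
  \<open>M\<close>.\<close>

lemma hom_terminal_inj:
  assumes P: "(p, q, k, l) \<in> terminal_params" and V: "group V" "order V = 3 ^ n"
    and \<phi>: "\<phi> \<in> hom V (pc_group p q k l)" "\<phi> ` carrier V = UNIV"
    and ker: "\<And>g. g \<in> carrier V \<Longrightarrow> \<phi> g = (0, 0, 0, 0, 0) \<Longrightarrow> g \<in> derived V (carrier V)"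
  shows "\<phi> \<in> iso V (pc_group p q k l)"
proof -
  let ?P = "pc_group p q k l"
  interpret V: group V by fact
  interpret \<phi>: group_hom V ?P \<phi>
    using \<phi>(1) group_pc_group V by (simp add: group_hom_def group_hom_axioms_def)
  let ?N = "kernel V ?P \<phi>"
  have N: "?N \<lhd> V" by (rule \<phi>.normal_kernel)
  have "?N = {\<one>\<^bsub>V\<^esub>}"
  proof (rule ccontr)
    assume "?N \<noteq> {\<one>\<^bsub>V\<^esub>}"
    then obtain M where M: "M \<lhd> V" "M \<subset> ?N"
      and c: "\<And>h g. h \<in> ?N \<Longrightarrow> g \<in> carrier V \<Longrightarrow> M #>\<^bsub>V\<^esub> (h \<otimes>\<^bsub>V\<^esub> g) = M #>\<^bsub>V\<^esub> (g \<otimes>\<^bsub>V\<^esub> h)"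
      using V.finite_3_group_central_factor[OF V(2) N] by blast
    interpret M: normal M V by fact
    let ?E = "V Mod M"
    interpret E: group ?E by (rule M.factorgroup_is_group)
    let ?q = "\<lambda>g. M #>\<^bsub>V\<^esub> g"
    interpret q: group_hom V ?E ?q
      using M.r_coset_hom_Mod by (simp add: group_hom_def group_hom_axioms_def V E.is_group)
    have q_mult: "?q (g \<otimes>\<^bsub>V\<^esub> h) = ?q g \<otimes>\<^bsub>?E\<^esub> ?q h" if "g \<in> carrier V" "h \<in> carrier V" for g h
      using q.hom_mult that by blast
    have car: "carrier ?E = ?q ` carrier V" by (auto simp: FactGroup_def RCOSETS_def)
    define \<pi> where "\<pi> C = the_elem (\<phi> ` C)" for C
    have \<pi>: "\<pi> (?q g) = \<phi> g" if g: "g \<in> carrier V" for g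
    proof -
      have "\<phi> (m \<otimes>\<^bsub>V\<^esub> g) = \<phi> g" if "m \<in> M" for m
        using that M(2) g group.is_monoid[OF group_pc_group, THEN monoid.l_one, of "\<phi> g"]
        by (auto simp: kernel_def)
      then have "\<phi> ` ?q g = {\<phi> g}"
        using M.one_closed g by (auto simp: r_coset_def image_iff)
      then show ?thesis by (simp add: \<pi>_def)
    qed
    have ext: "pc_extension ?E \<pi> p q k l"
    proof (intro pc_extension.intro pc_extension_axioms.intro E.is_group)
      show "\<pi> \<in> hom ?E ?P"
      proof (rule homI)
        fix C D assume "C \<in> carrier ?E" "D \<in> carrier ?E"
        then obtain g h where "g \<in> carrier V" "h \<in> carrier V" "C = ?q g" "D = ?q h" unfolding car by blast
        then show "\<pi> (C \<otimes>\<^bsub>?E\<^esub> D) = \<pi> C \<otimes>\<^bsub>?P\<^esub> \<pi> D"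
          by (simp only: q_mult[symmetric] \<pi> V.m_closed \<phi>.hom_mult)
      qed simp
      show "\<pi> ` carrier ?E = UNIV"
        unfolding car image_image using \<phi>(2) by (simp add: \<pi> cong: image_cong_simp)
      fix z g assume "z \<in> carrier ?E" "\<pi> z = (0, 0, 0, 0, 0)" "g \<in> carrier ?E"
      then obtain z' g' where zg: "z' \<in> carrier V" "g' \<in> carrier V" "z = ?q z'" "g = ?q g'" "\<phi> z' = (0, 0, 0, 0, 0)"
        unfolding car using \<pi> by auto
      then have "z' \<in> ?N" by (simp add: kernel_def one_pc_group)
      from c[OF this zg(2)] show "z \<otimes>\<^bsub>?E\<^esub> g = g \<otimes>\<^bsub>?E\<^esub> z"
        unfolding zg(3,4) q_mult[OF zg(1,2), symmetric] q_mult[OF zg(2,1), symmetric] .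
    qed
    have "?N \<subseteq> M"
    proof
      fix h assume h: "h \<in> ?N"
      then have hc: "h \<in> carrier V" "\<phi> h = (0, 0, 0, 0, 0)" by (simp_all add: kernel_def one_pc_group)
      have "?q h \<in> ?q ` derived V (carrier V)" using ker[OF hc] by blast
      then have "?q h \<in> derived ?E (carrier ?E)"
        using q.derived_img[of "carrier V"] unfolding car by simp
      then have "?q h = \<one>\<^bsub>?E\<^esub>"
        using derived_inter_kernel_terminal[OF P ext] \<pi>[OF hc(1)] hc(2) by simp
      then show "h \<in> M"
        using V.rcos_self[OF hc(1) M.subgroup_axioms] by (simp add: FactGroup_def)
    qed
    with M(2) show False by blast
  qed
  then have "inj_on \<phi> (carrier V)" by (simp add: \<phi>.inj_iff_trivial_ker)
  with \<phi> show ?thesis by (simp add: iso_def bij_betw_def)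
qed

section \<open>From central extensions to the second cohomology group\<close>

lemma (in group) group_ext_group:
  assumes f: "cocycle G f"
  shows "group (ext_group G f)"
proof -
  have f': "f x y + f (x \<otimes> y) z = f y z + f x (y \<otimes> z)" if "x \<in> carrier G" "y \<in> carrier G" "z \<in> carrier G" for x y z
    using f that by (simp add: cocycle_def)
  have f1: "f \<one> x = f \<one> \<one>" if "x \<in> carrier G" for x using f'[of \<one> \<one> x] that by simp
  show ?thesis
  proof (rule groupI)
    fix u v w assume "u \<in> carrier (ext_group G f)" "v \<in> carrier (ext_group G f)" "w \<in> carrier (ext_group G f)"
    then show "u \<otimes>\<^bsub>ext_group G f\<^esub> v \<otimes>\<^bsub>ext_group G f\<^esub> w = u \<otimes>\<^bsub>ext_group G f\<^esub> (v \<otimes>\<^bsub>ext_group G f\<^esub> w)"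
      using f' by (auto simp: ext_group_def m_assoc algebra_simps)
  next
    fix u assume "u \<in> carrier (ext_group G f)"
    then obtain x i where u: "u = (x, i)" "x \<in> carrier G" by (auto simp: ext_group_def)
    then show "\<exists>v\<in>carrier (ext_group G f). v \<otimes>\<^bsub>ext_group G f\<^esub> u = \<one>\<^bsub>ext_group G f\<^esub>"
      by (intro bexI[of _ "(inv x, - i - f (inv x) x - f \<one> \<one>)"]) (simp_all add: ext_group_def)
  next
    fix u assume "u \<in> carrier (ext_group G f)"
    then obtain x i where u: "u = (x, i)" "x \<in> carrier G" by (auto simp: ext_group_def)
    then show "\<one>\<^bsub>ext_group G f\<^esub> \<otimes>\<^bsub>ext_group G f\<^esub> u = u"
      using f1[of x] by (simp add: ext_group_def)
  qed (auto simp: ext_group_def)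
qed

lemma carrier_ext_group [simp]: "carrier (ext_group G f) = carrier G \<times> UNIV"
  and one_ext_group: "\<one>\<^bsub>ext_group G f\<^esub> = (\<one>\<^bsub>G\<^esub>, - f \<one>\<^bsub>G\<^esub> \<one>\<^bsub>G\<^esub>)"
  by (simp_all add: ext_group_def)

lemma fst_hom_ext_group: "fst \<in> hom (ext_group G f) G"
  by (rule homI) (auto simp: ext_group_def)

lemma (in group) cocycle_one:
  assumes f: "cocycle G f" and x: "x \<in> carrier G"
  shows "f \<one> x = f \<one> \<one>" "f x \<one> = f \<one> \<one>"
proof -
  have f': "f x y + f (x \<otimes> y) z = f y z + f x (y \<otimes> z)" if "x \<in> carrier G" "y \<in> carrier G" "z \<in> carrier G" for x y z
    using f that by (simp add: cocycle_def)
  show "f \<one> x = f \<one> \<one>" "f x \<one> = f \<one> \<one>" using f'[of \<one> \<one> x] f'[of x \<one> \<one>] x by simp_all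
qed

context C3_C3_group
begin

text \<open>If the kernel of the extension \<open>E\<close> meets the commutator subgroup of
  \<open>E\<close> trivially, it embeds into the abelianization of \<open>E\<close>, so the class of
  \<open>f\<close> already comes from an abelian extension of \<open>C3 x C3\<close>. Such an
  extension is described by the cubes of two lifts, which are the coefficients of the
  carries.\<close>

lemma balancedI:
  assumes triv: "\<And>f z. cocycle V f \<Longrightarrow> z \<in> derived (ext_group V f) (carrier (ext_group V f)) \<Longrightarrow> fst z = \<one> \<Longrightarrow>
    z = \<one>\<^bsub>ext_group V f\<^esub>"
  shows balanced
  unfolding balanced_def
proof (intro allI impI)
  fix f assume f: "cocycle V f"
  let ?E = "ext_group V f"
  interpret E: group ?E by (rule group_ext_group[OF f])
  interpret fst: group_hom ?E V fst
    using fst_hom_ext_group is_group E.is_group by (simp add: group_hom_def group_hom_axioms_def)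
  define K where "K = derived ?E (carrier ?E)"
  interpret K: normal K ?E unfolding K_def by (rule E.derived_self_is_normal)
  interpret B: comm_group "?E Mod K" unfolding K_def by (rule E.derived_quot_is_comm_group)
  note mult_FactGroup [simp del] and one_FactGroup [simp del]
  let ?B = "?E Mod K" and ?q = "\<lambda>e. K #>\<^bsub>?E\<^esub> e"
  interpret q: group_hom ?E ?B ?q
    using K.r_coset_hom_Mod by (simp add: group_hom_def group_hom_axioms_def E.is_group B.is_group)
  have q_mult: "?q (d \<otimes>\<^bsub>?E\<^esub> e) = ?q d \<otimes>\<^bsub>?B\<^esub> ?q e" if "d \<in> carrier ?E" "e \<in> carrier ?E" for d e
    using q.hom_mult that by blast
  have qc: "?q e \<in> carrier ?B" if "e \<in> carrier ?E" for e using that by (rule q.hom_closed)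
  have qK: "?q e = \<one>\<^bsub>?B\<^esub>" if "e \<in> K" for e using that K.rcos_const by (simp add: FactGroup_def)
  have K_img: "fst ` K = commutator_subgroup V"
  proof -
    have "fst ` carrier ?E = carrier V" by force
    then show ?thesis
      using fst.derived_img[of "carrier ?E"] by (simp add: K_def commutator_subgroup_def)
  qed
  \<comment> \<open>The image of the kernel in the abelianization; the shift by \<open>f 1 1\<close>
    makes \<gamma> additive.\<close>
  define \<gamma> where "\<gamma> i = ?q (\<one>, i - f \<one> \<one>)" for i
  have central: "(g, i + j) = (g, i) \<otimes>\<^bsub>?E\<^esub> (\<one>, j - f \<one> \<one>)" if "g \<in> carrier V" for g i j
    using that cocycle_one[OF f that] by (simp add: mult_ext_group)
  have q_shift: "?q (g, i + j) = ?q (g, i) \<otimes>\<^bsub>?B\<^esub> \<gamma> j" if "g \<in> carrier V" for g i j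
    unfolding \<gamma>_def central[OF that] using that by (intro q_mult) simp_all
  have \<gamma>_add: "\<gamma> (i + j) = \<gamma> i \<otimes>\<^bsub>?B\<^esub> \<gamma> j" for i j
    using q_shift[of \<one> "i - f \<one> \<one>" j] by (simp add: \<gamma>_def algebra_simps)
  have \<gamma>c: "\<gamma> i \<in> carrier ?B" for i unfolding \<gamma>_def by (rule qc) simp
  \<comment> \<open>Here the hypothesis on the commutator subgroup enters: the kernel is not lost in
    the abelianization.\<close>
  have \<gamma>_0: "i = 0" if "\<gamma> i = \<one>\<^bsub>?B\<^esub>" for i
  proof -
    have "(\<one>, i - f \<one> \<one>) \<in> K"
      using that E.rcos_self[OF _ K.subgroup_axioms, of "(\<one>, i - f \<one> \<one>)"] by (simp add: \<gamma>_def FactGroup_def)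
    then have "(\<one>, i - f \<one> \<one>) = \<one>\<^bsub>?E\<^esub>" unfolding K_def by (intro triv[OF f]) simp_all
    then show ?thesis by (simp add: one_ext_group)
  qed
  have \<gamma>_zero: "\<gamma> 0 = \<one>\<^bsub>?B\<^esub>" using \<gamma>_add[of 0 0] \<gamma>c[of 0] by simp
  have \<gamma>_pw: "pw ?B (\<gamma> i) r = \<gamma> (i * r)" for i r
  proof -
    have "inv\<^bsub>?B\<^esub> \<gamma> i = \<gamma> (- i)"
      using \<gamma>_add[of "- i" i] \<gamma>_zero by (intro B.inv_equality) (simp_all add: \<gamma>c)
    then show ?thesis using cases_3[of r] \<gamma>_zero by auto
  qed
  obtain x where x: "x \<in> carrier V" "a x = 1" "b x = 0" using ex_10 by blast
  obtain y where y: "y \<in> carrier V" "a y = 0" "b y = 1" using ex_01 by blast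
  define u where "u = ?q (x, 0)"
  define v where "v = ?q (y, 0)"
  have uv: "u \<in> carrier ?B" "v \<in> carrier ?B" unfolding u_def v_def by (rule qc, use x y in simp)+
  \<comment> \<open>The cube of \<open>g\<close> lies in the commutator subgroup of
    \<open>V\<close>, hence has a lift in \<open>K\<close>. So the cube of any lift of
    \<open>g\<close> is, modulo \<open>K\<close>, an element of the kernel.\<close>
  have cube: "\<exists>m. ?q (g, 0) \<otimes>\<^bsub>?B\<^esub> ?q (g, 0) \<otimes>\<^bsub>?B\<^esub> ?q (g, 0) = \<gamma> m" if g: "g \<in> carrier V" for g
  proof -
    have "g \<otimes> g \<otimes> g \<in> fst ` K" unfolding K_img using g by (simp add: derived_iff triple_mult_eq_0)
    then obtain j where j: "(g \<otimes> g \<otimes> g, j) \<in> K" by force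
    obtain i where i: "(g, 0) \<otimes>\<^bsub>?E\<^esub> (g, 0) \<otimes>\<^bsub>?E\<^esub> (g, 0) = (g \<otimes> g \<otimes> g, i)" by (simp add: mult_ext_group)
    have "?q (g, 0) \<otimes>\<^bsub>?B\<^esub> ?q (g, 0) \<otimes>\<^bsub>?B\<^esub> ?q (g, 0) = ?q (g \<otimes> g \<otimes> g, j + (i - j))"
    proof -
      have gc: "(g, 0) \<in> carrier ?E" using g by simp
      show ?thesis using i by (simp only: q_mult[symmetric] gc E.m_closed add_diff_cancel_left' diff_add_cancel add_diff_eq)
    qed
    also have "\<dots> = \<gamma> (i - j)"
      using q_shift[of "g \<otimes> g \<otimes> g" j "i - j"] g qK[OF j] \<gamma>c by simp
    finally show ?thesis by blast
  qed
  obtain m where m: "u \<otimes>\<^bsub>?B\<^esub> u \<otimes>\<^bsub>?B\<^esub> u = \<gamma> m" using cube[OF x(1)] unfolding u_def by blast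
  obtain n where n: "v \<otimes>\<^bsub>?B\<^esub> v \<otimes>\<^bsub>?B\<^esub> v = \<gamma> n" using cube[OF y(1)] unfolding v_def by blast
  \<comment> \<open>Normal forms in the abelianization of \<open>E\<close>; multiplying two of them
    produces exactly the two carries, weighted by the cubes \<open>m\<close> and
    \<open>n\<close>.\<close>
  define Q where "Q r r' = pw ?B u r \<otimes>\<^bsub>?B\<^esub> pw ?B v r'" for r r'
  have Qc: "Q r r' \<in> carrier ?B" for r r' using uv by (simp add: Q_def)
  have Q_mult: "Q r r' \<otimes>\<^bsub>?B\<^esub> Q t t' = Q (r + t) (r' + t') \<otimes>\<^bsub>?B\<^esub> \<gamma> (m * carry r t + n * carry r' t')" for r r' t t'
  proof -
    have "Q r r' \<otimes>\<^bsub>?B\<^esub> Q t t' = (pw ?B u r \<otimes>\<^bsub>?B\<^esub> pw ?B u t) \<otimes>\<^bsub>?B\<^esub> (pw ?B v r' \<otimes>\<^bsub>?B\<^esub> pw ?B v t')"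
      using uv by (simp add: Q_def B.m_ac)
    also have "\<dots> = Q (r + t) (r' + t') \<otimes>\<^bsub>?B\<^esub> (\<gamma> (m * carry r t) \<otimes>\<^bsub>?B\<^esub> \<gamma> (n * carry r' t'))"
      unfolding B.pw_add_carry[OF uv(1)] B.pw_add_carry[OF uv(2)] m n \<gamma>_pw Q_def
      using uv \<gamma>c by (simp add: B.m_ac)
    finally show ?thesis by (simp add: \<gamma>_add)
  qed
  \<comment> \<open>Each \<open>g\<close> has a lift whose image is in normal form. Its last
    coordinate defines the function \<open>h\<close> that cobounds \<open>f\<close> up to
    carries.\<close>
  have ex_h: "\<exists>i. ?q (g, i) = Q (a g) (b g)" if g: "g \<in> carrier V" for g
  proof -
    define e where "e = pw ?E (x, 0) (a g) \<otimes>\<^bsub>?E\<^esub> pw ?E (y, 0) (b g)"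
    have xc: "(x, 0) \<in> carrier ?E" and yc: "(y, 0) \<in> carrier ?E" using x y by simp_all
    have ec: "e \<in> carrier ?E" unfolding e_def by (intro E.m_closed E.pw_closed xc yc)
    have pwq: "?q (pw ?E d r) = pw ?B (?q d) r" if "d \<in> carrier ?E" for d r
      using that q.hom_inv[OF that] q.hom_one unfolding pw_def by presburger
    have qe: "?q e = Q (a g) (b g)"
      unfolding e_def Q_def u_def v_def by (simp only: q_mult pwq xc yc E.pw_closed)
    have pwf: "fst (pw ?E d r) = pw V (fst d) r" if "d \<in> carrier ?E" for d r
      using that fst.hom_inv[OF that] fst.hom_one by (simp add: pw_def)
    have pwa: "a (pw V d r) = a d * r" "b (pw V d r) = b d * r" if "d \<in> carrier V" for d r
      using that cases_3[of r] by auto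
    have fc: "fst e \<in> carrier V" using ec by (metis fst.hom_closed)
    have "fst e = pw V x (a g) \<otimes> pw V y (b g)"
      unfolding e_def by (simp only: fst.hom_mult pwf xc yc E.pw_closed fst_conv)
    then have "a (fst e) = a g" "b (fst e) = b g" using x y by (simp_all add: pwa)
    then have "inv (fst e) \<otimes> g \<in> fst ` K" unfolding K_img using fc g by (simp add: derived_iff)
    then obtain j where j: "(inv (fst e) \<otimes> g, j) \<in> K" by force
    have jc: "(inv (fst e) \<otimes> g, j) \<in> carrier ?E" using j K.subset by blast
    have "fst (e \<otimes>\<^bsub>?E\<^esub> (inv (fst e) \<otimes> g, j)) = g"
      using fst.hom_mult[OF ec jc] fc g by (simp add: m_assoc[symmetric])
    then obtain i where i: "e \<otimes>\<^bsub>?E\<^esub> (inv (fst e) \<otimes> g, j) = (g, i)" by (metis prod.collapse)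
    have "?q (g, i) = ?q e" unfolding i[symmetric] q_mult[OF ec jc] qK[OF j] by (rule B.r_one[OF qc[OF ec]])
    then show ?thesis using qe by metis
  qed
  then obtain h where h: "\<And>g. g \<in> carrier V \<Longrightarrow> ?q (g, h g) = Q (a g) (b g)" by metis
  have "cobounds V h (\<lambda>g g'. f g g' + (- m * carry (a g) (a g') + - n * carry (b g) (b g')))"
    unfolding cobounds_def
  proof (intro ballI)
    fix g g' assume g: "g \<in> carrier V" "g' \<in> carrier V"
    define \<delta> where "\<delta> = h g + h g' + f g g' - h (g \<otimes> g')"
    let ?c = "m * carry (a g) (a g') + n * carry (b g) (b g')"
    have "Q (a (g \<otimes> g')) (b (g \<otimes> g')) \<otimes>\<^bsub>?B\<^esub> \<gamma> ?c = ?q (g, h g) \<otimes>\<^bsub>?B\<^esub> ?q (g', h g')"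
      using g by (simp only: h Q_mult a_mult b_mult)
    also have "\<dots> = ?q (g \<otimes> g', h (g \<otimes> g') + \<delta>)"
      using g by (subst q_mult[symmetric]) (simp_all add: mult_ext_group \<delta>_def add.assoc)
    also have "\<dots> = Q (a (g \<otimes> g')) (b (g \<otimes> g')) \<otimes>\<^bsub>?B\<^esub> \<gamma> \<delta>"
      using g by (simp only: q_shift m_closed h)
    finally have "\<gamma> ?c = \<gamma> \<delta>" by (rule B.l_cancel) (simp_all add: Qc \<gamma>c)
    moreover have "\<gamma> (\<delta> - ?c) \<otimes>\<^bsub>?B\<^esub> \<gamma> ?c = \<gamma> \<delta>" using \<gamma>_add[of "\<delta> - ?c" ?c] by simp
    ultimately have "\<gamma> (\<delta> - ?c) = \<one>\<^bsub>?B\<^esub>" by (metis B.r_cancel_one' \<gamma>c)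
    then have "\<delta> - ?c = 0" by (rule \<gamma>_0)
    then show "h (g \<otimes> g') = h g + h g' + (f g g' + (- m * carry (a g) (a g') + - n * carry (b g) (b g')))"
      by (simp add: \<delta>_def algebra_simps)
  qed
  then show "\<exists>h m n. cobounds V h (\<lambda>x y. f x y + (m * carry (a x) (a y) + n * carry (b x) (b y)))" by blast
qed

text \<open>Composed with the isomorphism, the projection of an extension by a cocycle becomes a
  central extension of the presented group.\<close>

lemma balanced_of_terminal:
  assumes P: "(p, q, k, l) \<in> terminal_params" and \<phi>: "\<phi> \<in> iso V (pc_group p q k l)"
  shows balanced
proof (rule balancedI)
  fix f z assume f: "cocycle V f" and z: "z \<in> derived (ext_group V f) (carrier (ext_group V f))" "fst z = \<one>"
  let ?E = "ext_group V f"
  interpret E: group ?E by (rule group_ext_group[OF f])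
  have \<phi>': "\<phi> \<in> hom V (pc_group p q k l)" "\<phi> ` carrier V = UNIV" "inj_on \<phi> (carrier V)"
    using \<phi> by (auto simp: iso_def bij_betw_def)
  interpret \<phi>: group_hom V "pc_group p q k l" \<phi>
    using \<phi>'(1) group_pc_group is_group by (simp add: group_hom_def group_hom_axioms_def)
  have \<phi>1: "\<phi> \<one> = (0, 0, 0, 0, 0)" using \<phi>.hom_one by (simp add: one_pc_group)
  have "pc_extension ?E (\<phi> \<circ> fst) p q k l"
  proof (intro pc_extension.intro pc_extension_axioms.intro E.is_group)
    show "\<phi> \<circ> fst \<in> hom ?E (pc_group p q k l)"
      by (rule homI) (auto simp: mult_ext_group \<phi>.hom_mult)
    show "(\<phi> \<circ> fst) ` carrier ?E = UNIV"
      unfolding carrier_ext_group image_comp[symmetric] fst_image_times using \<phi>'(2) by simp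
    fix w g assume w: "w \<in> carrier ?E" "(\<phi> \<circ> fst) w = (0, 0, 0, 0, 0)" and g: "g \<in> carrier ?E"
    then have "fst w = \<one>" using \<phi>1 inj_onD[OF \<phi>'(3), of "fst w" \<one>] by auto
    then show "w \<otimes>\<^bsub>?E\<^esub> g = g \<otimes>\<^bsub>?E\<^esub> w"
      using g cocycle_one[OF f, of "fst g"] by (cases w; cases g) (simp add: mult_ext_group)
  qed
  then show "z = \<one>\<^bsub>?E\<^esub>"
    using derived_inter_kernel_terminal[OF P _ z(1)] z(2) \<phi>1 by simp
qed

end

section \<open>Groups with an inverting automorphism\<close>

lemma cobounds_minus:
  "cobounds G h f \<Longrightarrow> cobounds G h' f' \<Longrightarrow> cobounds G (\<lambda>x. h x - h' x) (\<lambda>x y. f x y - f' x y)"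
  by (simp add: cobounds_def algebra_simps)

lemma cobounds_cong:
  "cobounds G h f \<Longrightarrow> (\<And>x y. x \<in> carrier G \<Longrightarrow> y \<in> carrier G \<Longrightarrow> f x y = f' x y) \<Longrightarrow> cobounds G h f'"
  by (simp add: cobounds_def)

locale schur_sigma = C3_C3_group +
  fixes \<sigma> :: "'a \<Rightarrow> 'a"
  assumes balanced: balanced
    and \<sigma>_hom: "\<sigma> \<in> hom V V"
    and a_\<sigma> [simp]: "x \<in> carrier V \<Longrightarrow> a (\<sigma> x) = - a x"
    and b_\<sigma> [simp]: "x \<in> carrier V \<Longrightarrow> b (\<sigma> x) = - b x"
begin

lemma \<sigma>_closed [simp]: "x \<in> carrier V \<Longrightarrow> \<sigma> x \<in> carrier V"
  using \<sigma>_hom by (auto simp: hom_def)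

lemma \<sigma>_mult [simp]: "x \<in> carrier V \<Longrightarrow> y \<in> carrier V \<Longrightarrow> \<sigma> (x \<otimes> y) = \<sigma> x \<otimes> \<sigma> y"
  using \<sigma>_hom by (auto simp: hom_def)

lemma cobounds_\<sigma>: "cobounds V h f \<Longrightarrow> cobounds V (\<lambda>x. h (\<sigma> x)) (\<lambda>x y. f (\<sigma> x) (\<sigma> y))"
  by (simp add: cobounds_def)

text \<open>The classes of \<open>carry\<close> are odd under \<open>\<sigma>\<close>, so a cocycle whose class is even has no component there.\<close>

lemma even_cobounds:
  assumes f: "cocycle V f" and g: "cobounds V g (\<lambda>x y. f (\<sigma> x) (\<sigma> y) - f x y)"
  obtains h where "cobounds V h f"
proof -
  obtain h m n where h: "cobounds V h (\<lambda>x y. f x y + (m * carry (a x) (a y) + n * carry (b x) (b y)))"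
    using balanced f unfolding balanced_def by blast
  \<comment> \<open>Oddness of the carries gives \<open>- 2\<close> times their combination, which
    modulo 3 is the combination itself.\<close>
  have "cobounds V (\<lambda>x. h (\<sigma> x) - h x - g x) (\<lambda>x y. m * carry (a x) (a y) + n * carry (b x) (b y))"
  proof (rule cobounds_cong[OF cobounds_minus[OF cobounds_minus[OF cobounds_\<sigma>[OF h] h] g]])
    fix x y assume "x \<in> carrier V" "y \<in> carrier V"
    then show "f (\<sigma> x) (\<sigma> y) + (m * carry (a (\<sigma> x)) (a (\<sigma> y)) + n * carry (b (\<sigma> x)) (b (\<sigma> y)))
        - (f x y + (m * carry (a x) (a y) + n * carry (b x) (b y))) - (f (\<sigma> x) (\<sigma> y) - f x y)
      = m * carry (a x) (a y) + n * carry (b x) (b y)"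
      by (simp add: carry_uminus algebra_simps triple_mult_eq_0)
  qed
  then have "m = 0 \<and> n = 0" by (rule carry_independent)
  then show ?thesis using h that by simp
qed

text \<open>The laws are the third to fifth coordinates of the product in
  \<open>pc_group p q k l\<close>, without the summands that belong to one factor only. Thus
  cobounding them means being the corresponding coordinate of a homomorphism.\<close>

definition law_c where "law_c = (\<lambda>x y. b x * a y)"
definition law_d where "law_d c p k = (\<lambda>x y. c x * a y + b x * (a y - a y * a y)
  + (p * carry (a x) (a y) + k * carry (b x) (b y)))"
definition law_e where "law_e c q l = (\<lambda>x y. c x * b y + a y * (b x - b x * b x) + a y * b x * b y
  + (q * carry (a x) (a y) + l * carry (b x) (b y)))"

lemma hom_laws:
  assumes "cobounds V c law_c" "cobounds V d (law_d c p k)" "cobounds V e (law_e c q l)"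
  shows "(\<lambda>x. (a x, b x, c x, d x, e x)) \<in> hom V (pc_group p q k l)"
  using assms by (intro homI) (simp_all add: cobounds_def law_c_def law_d_def law_e_def mult_pc_group algebra_simps)

text \<open>The coordinates are found one after the other, since each law contains the preceding
  coordinates. The parameters are not prescribed but read off from the carries.\<close>

lemma exists_hom:
  obtains c d e p q k l where "(\<lambda>x. (a x, b x, c x, d x, e x)) \<in> hom V (pc_group p q k l)"
proof -
  have "cocycle V law_c" by (simp add: cocycle_def law_c_def algebra_simps)
  \<comment> \<open>\<open>law_c\<close> is a product of two odd functions, hence even, so its
    carries have coefficient zero.\<close>
  moreover have "cobounds V (\<lambda>x. 0) (\<lambda>x y. law_c (\<sigma> x) (\<sigma> y) - law_c x y)"
    by (simp add: cobounds_def law_c_def)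
  ultimately obtain c where c: "cobounds V c law_c" by (rule even_cobounds)
  have c_mult: "c (x \<otimes> y) = c x + c y + b x * a y" if "x \<in> carrier V" "y \<in> carrier V" for x y
    using cobounds_D[OF c that] by (simp add: law_c_def)
  have "cocycle V (\<lambda>x y. c x * a y + b x * (a y - a y * a y))"
    unfolding cocycle_def by (simp add: c_mult algebra_simps) (simp add: triple_mult_eq_0)
  \<comment> \<open>In weight three carries can occur. Their coefficients become the exponents of
    \<open>t\<close> in the cubes of the two generators.\<close>
  then obtain d p k where d: "cobounds V d (law_d c p k)"
    using balanced unfolding balanced_def law_d_def by blast
  have "cocycle V (\<lambda>x y. c x * b y + a y * (b x - b x * b x) + a y * b x * b y)"
    unfolding cocycle_def by (simp add: c_mult algebra_simps) (simp add: triple_mult_eq_0)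
  then obtain e q l where e: "cobounds V e (law_e c q l)"
    using balanced unfolding balanced_def law_e_def by blast
  show ?thesis by (rule that[OF hom_laws[OF c d e]])
qed

lemma laws_of_hom:
  assumes "(\<lambda>x. (a x, b x, c x, d x, e x)) \<in> hom V (pc_group p q k l)"
  shows "cobounds V c law_c" "cobounds V d (law_d c p k)" "cobounds V e (law_e c q l)"
  using assms
  by (simp_all add: cobounds_def law_c_def law_d_def law_e_def hom_def mult_pc_group algebra_simps)

text \<open>A homomorphism may be added to \<open>c\<close> without changing its law, and averaging
  over \<sigma> makes \<open>c\<close> exactly invariant. Then the sums
  \<open>d (\<sigma> x) + d x + c x\<close> and \<open>e (\<sigma> x) + e x + c x\<close> are
  homomorphisms, which determines the action of \<sigma> on \<open>d\<close> and
  \<open>e\<close>.\<close>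

lemma normalised_laws:
  assumes hom: "(\<lambda>x. (a x, b x, c0 x, d0 x, e0 x)) \<in> hom V (pc_group p q k l)"
  obtains c d e \<mu> \<mu>' \<nu> \<nu>' where
    "cobounds V c law_c" "cobounds V d (law_d c p k)" "cobounds V e (law_e c q l)"
    "\<And>x. x \<in> carrier V \<Longrightarrow> c (\<sigma> x) = c x"
    "\<And>x. x \<in> carrier V \<Longrightarrow> d (\<sigma> x) = - d x - c x + (\<mu> * a x + \<mu>' * b x)"
    "\<And>x. x \<in> carrier V \<Longrightarrow> e (\<sigma> x) = - e x - c x + (\<nu> * a x + \<nu>' * b x)"
proof -
  note l0 = laws_of_hom[OF hom]
  have c0: "c0 (x \<otimes> y) = c0 x + c0 y + b x * a y" if "x \<in> carrier V" "y \<in> carrier V" for x y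
    using cobounds_D[OF l0(1) that] by (simp add: law_c_def)
  have "cobounds V (\<lambda>x. c0 (\<sigma> x) - c0 x) (\<lambda>_ _. 0)"
    by (simp add: cobounds_def c0)
  then obtain i j where ij0: "\<And>x. x \<in> carrier V \<Longrightarrow> c0 (\<sigma> x) - c0 x = i * a x + j * b x"
    by (rule hom_combination) blast
  have ij: "c0 (\<sigma> x) = c0 x + (i * a x + j * b x)" if "x \<in> carrier V" for x
    using ij0[OF that] by (simp add: diff_eq_eq add.commute)
  \<comment> \<open>Half of the deviation is added to \<open>c0\<close>; modulo 3 one half is
    \<open>- 1\<close>.\<close>
  define c where "c x = c0 x - (i * a x + j * b x)" for x
  \<comment> \<open>Corrections for the changed \<open>c\<close> in the laws of \<open>d\<close> and
    \<open>e\<close>: up to sign, \<open>a * a\<close>, \<open>c0\<close>, \<open>a * b - c0\<close>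
    and \<open>b * b\<close> cobound the products \<open>a x * a y\<close>,
    \<open>b x * a y\<close>, \<open>a x * b y\<close> and \<open>b x * b y\<close>.\<close>
  define d where "d x = d0 x + i * (a x * a x) - j * c0 x" for x
  define e where "e x = e0 x - i * (a x * b x - c0 x) + j * (b x * b x)" for x
  have c: "cobounds V c law_c"
    by (simp add: cobounds_def law_c_def c_def c0 algebra_simps)
  have d: "cobounds V d (law_d c p k)"
    using l0(2) by (simp add: cobounds_def law_d_def d_def c_def c0, simp only: F3_poly_mult, simp only: F3_uminus, simp only: F3_poly_add, simp)
  have e: "cobounds V e (law_e c q l)"
    using l0(3) by (simp add: cobounds_def law_e_def e_def c_def c0, simp only: F3_poly_mult, simp only: F3_uminus, simp only: F3_poly_add, simp)
  have c_mult: "c (x \<otimes> y) = c x + c y + b x * a y" if "x \<in> carrier V" "y \<in> carrier V" for x y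
    using cobounds_D[OF c that] by (simp add: law_c_def)
  have c\<sigma>: "c (\<sigma> x) = c x" if "x \<in> carrier V" for x
    using that ij[OF that] by (simp add: c_def algebra_simps) (simp add: triple_mult_eq_0)
  have d_mult: "d (x \<otimes> y) = d x + d y + law_d c p k x y" if "x \<in> carrier V" "y \<in> carrier V" for x y
    using cobounds_D[OF d that] .
  have e_mult: "e (x \<otimes> y) = e x + e y + law_e c q l x y" if "x \<in> carrier V" "y \<in> carrier V" for x y
    using cobounds_D[OF e that] .
  have "cobounds V (\<lambda>x. d (\<sigma> x) + d x + c x) (\<lambda>_ _. 0)"
    by (simp add: cobounds_def c_mult d_mult law_d_def carry_uminus c\<sigma> algebra_simps triple_mult_eq_0)
  then obtain \<mu> \<mu>' where \<mu>: "\<And>x. x \<in> carrier V \<Longrightarrow> d (\<sigma> x) + d x + c x = \<mu> * a x + \<mu>' * b x"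
    by (rule hom_combination) blast
  have "cobounds V (\<lambda>x. e (\<sigma> x) + e x + c x) (\<lambda>_ _. 0)"
    by (simp add: cobounds_def c_mult e_mult law_e_def carry_uminus c\<sigma> algebra_simps triple_mult_eq_0)
  then obtain \<nu> \<nu>' where \<nu>: "\<And>x. x \<in> carrier V \<Longrightarrow> e (\<sigma> x) + e x + c x = \<nu> * a x + \<nu>' * b x"
    by (rule hom_combination) blast
  show ?thesis
  proof (rule that[OF c d e c\<sigma>])
    fix x assume x: "x \<in> carrier V"
    show "d (\<sigma> x) = - d x - c x + (\<mu> * a x + \<mu>' * b x)" unfolding \<mu>[OF x, symmetric] by simp
    show "e (\<sigma> x) = - e x - c x + (\<nu> * a x + \<nu>' * b x)" unfolding \<nu>[OF x, symmetric] by simp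
  qed
qed

text \<open>Up to carries \<open>f\<close> is cobounded by some \<open>h\<close>, the carries vanish
  on the commutator subgroup, and \<open>h\<close> cannot distinguish \<open>s t\<close> from
  \<open>t s\<close> if these are equal. An asymmetric cocycle thus refutes metabelianity.\<close>

lemma commuting_cocycle:
  assumes "metabelian V" "cocycle V f" "s \<in> commutator_subgroup V" "t \<in> commutator_subgroup V"
  shows "f s t = f t s"
proof -
  obtain h m n where h: "cobounds V h (\<lambda>x y. f x y + (m * carry (a x) (a y) + n * carry (b x) (b y)))"
    using balanced assms(2) unfolding balanced_def by blast
  have st: "s \<in> carrier V" "t \<in> carrier V" "a s = 0" "b s = 0" "a t = 0" "b t = 0"
    using assms(3,4) by (simp_all add: ab_derived)
  have "s \<otimes> t \<otimes> inv s \<otimes> inv t \<in> derived V (commutator_subgroup V)"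
    unfolding derived_def using assms(3,4) by (intro generate.incl) blast
  then have "s \<otimes> t \<otimes> inv s \<otimes> inv t = \<one>" using assms(1) by (simp add: metabelian_def)
  then have "s \<otimes> t \<otimes> inv (t \<otimes> s) = \<one>" using st by (simp add: inv_mult_group m_assoc)
  then have "s \<otimes> t = t \<otimes> s" using st by (metis inv_equality inv_inv inv_closed m_closed)
  then show ?thesis using cobounds_D[OF h st(1,2)] cobounds_D[OF h st(2,1)] st by (simp add: add.commute)
qed

text \<open>\<open>s\<close>, \<open>t\<close>, \<open>u\<close> are the commutators of weight two
  and three in lifts of the basis vectors; evaluating the laws on both sides of the relations gives
  their coordinates.\<close>

lemma derived_elements:
  assumes laws: "cobounds V c law_c" "cobounds V d (law_d c p k)" "cobounds V e (law_e c q l)"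
  obtains s t u where "s \<in> commutator_subgroup V" "t \<in> commutator_subgroup V" "u \<in> commutator_subgroup V"
    "c s = 1" "c t = 0" "d t = 1" "e t = 0" "c u = 0" "d u = 0" "e u = 1"
proof -
  obtain x where x: "x \<in> carrier V" "a x = 1" "b x = 0" using ex_10 by blast
  obtain y where y: "y \<in> carrier V" "a y = 0" "b y = 1" using ex_01 by blast
  have swap: "\<exists>r\<in>commutator_subgroup V. g \<otimes> h = h \<otimes> g \<otimes> r" if "g \<in> carrier V" "h \<in> carrier V" for g h
    using that by (intro bexI[of _ "inv (h \<otimes> g) \<otimes> (g \<otimes> h)"])
      (simp_all add: derived_iff m_assoc[symmetric] del: inv_mult_group)
  obtain s where s: "s \<in> commutator_subgroup V" "y \<otimes> x = x \<otimes> y \<otimes> s" using swap x y by blast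
  note s' = ab_derived[OF s(1)]
  obtain t where t: "t \<in> commutator_subgroup V" "s \<otimes> x = x \<otimes> s \<otimes> t" using swap x s' by blast
  note t' = ab_derived[OF t(1)]
  obtain u where u: "u \<in> commutator_subgroup V" "s \<otimes> y = y \<otimes> s \<otimes> u" using swap y s' by blast
  note u' = ab_derived[OF u(1)]
  note c = cobounds_D[OF laws(1)] note d = cobounds_D[OF laws(2)] note e = cobounds_D[OF laws(3)]
  note defs = law_c_def law_d_def law_e_def
  have cs: "c s = 1" using arg_cong[OF s(2), of c] x y s' by (simp add: c defs)
  have ct: "c t = 0" using arg_cong[OF t(2), of c] x s' t' by (simp add: c defs)
  have cu: "c u = 0" using arg_cong[OF u(2), of c] y s' u' by (simp add: c defs)
  have "d t = 1" using arg_cong[OF t(2), of d] x s' t' cs by (simp add: c d defs)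
  moreover have "e t = 0" using arg_cong[OF t(2), of e] x s' t' cs by (simp add: c e defs)
  moreover have "d u = 0" using arg_cong[OF u(2), of d] y s' u' cs by (simp add: c d defs)
  moreover have "e u = 1" using arg_cong[OF u(2), of e] y s' u' cs by (simp add: c e defs)
  ultimately show ?thesis using that s t u cs ct cu by blast
qed

end

context schur_sigma
begin

lemma not_metabelian_F:
  assumes hom: "(\<lambda>x. (a x, b x, c0 x, d0 x, e0 x)) \<in> hom V (pc_group 0 q (- 1) 0)"
    and metab: "metabelian V"
  shows False
proof -
  let ?P = "pc_group 0 q (- 1) 0"
  obtain c d e \<mu> \<mu>' \<nu> \<nu>' where laws: "cobounds V c law_c" "cobounds V d (law_d c 0 (- 1))" "cobounds V e (law_e c q 0)"
    and c\<sigma>: "\<And>x. x \<in> carrier V \<Longrightarrow> c (\<sigma> x) = c x"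
    and d\<sigma>: "\<And>x. x \<in> carrier V \<Longrightarrow> d (\<sigma> x) = - d x - c x + (\<mu> * a x + \<mu>' * b x)"
    and e\<sigma>: "\<And>x. x \<in> carrier V \<Longrightarrow> e (\<sigma> x) = - e x - c x + (\<nu> * a x + \<nu>' * b x)"
    by (rule normalised_laws[OF hom]) blast
  let ?\<phi> = "\<lambda>x. (a x, b x, c x, d x, e x)"
  have \<phi>: "?\<phi> \<in> hom V ?P" by (rule hom_laws[OF laws])
  have c_mult: "c (x \<otimes> y) = c x + c y + b x * a y" if "x \<in> carrier V" "y \<in> carrier V" for x y
    using cobounds_D[OF laws(1) that] by (simp add: law_c_def)
  have d_mult: "d (x \<otimes> y) = d x + d y + law_d c 0 (- 1) x y" if "x \<in> carrier V" "y \<in> carrier V" for x y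
    using cobounds_D[OF laws(2) that] .
  \<comment> \<open>Explicit witness that the pullback of \<open>vF\<close> is even up to a
    coboundary. The terms with \<mu> compensate the homomorphism that appears when \<sigma> is
    applied to \<open>d\<close> in the product \<open>d * a'\<close>.\<close>
  have "cobounds V (\<lambda>x. d x - c x + \<mu> * (a x * a x) - \<mu>' * c x)
    (\<lambda>x y. vF (?\<phi> (\<sigma> x)) (?\<phi> (\<sigma> y)) - vF (?\<phi> x) (?\<phi> y))"
    unfolding cobounds_def
  proof (intro ballI)
    fix x y assume xy: "x \<in> carrier V" "y \<in> carrier V"
    show "d (x \<otimes> y) - c (x \<otimes> y) + \<mu> * (a (x \<otimes> y) * a (x \<otimes> y)) - \<mu>' * c (x \<otimes> y) =
      d x - c x + \<mu> * (a x * a x) - \<mu>' * c x + (d y - c y + \<mu> * (a y * a y) - \<mu>' * c y) +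
      (vF (?\<phi> (\<sigma> x)) (?\<phi> (\<sigma> y)) - vF (?\<phi> x) (?\<phi> y))"
      unfolding vF_def prod.case carry_list.simps law_d_def carry_def
        c_mult[OF xy] d_mult[OF xy] a_mult[OF xy] b_mult[OF xy]
        a_\<sigma>[OF xy(1)] a_\<sigma>[OF xy(2)] b_\<sigma>[OF xy(1)] b_\<sigma>[OF xy(2)] c\<sigma>[OF xy(1)] c\<sigma>[OF xy(2)] d\<sigma>[OF xy(1)] d\<sigma>[OF xy(2)]
      by (simp only: F3_poly_mult, simp only: F3_uminus, simp only: F3_poly_add)
  qed
  then obtain v where v: "cobounds V v (\<lambda>x y. vF (?\<phi> x) (?\<phi> y))"
    by (rule even_cobounds[OF cocycle_pullback[OF cocycle_vF \<phi>]])
  have \<psi>: "(\<lambda>x. (?\<phi> x, v x)) \<in> hom V (ext_group ?P vF)"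
    using \<phi> v by (auto simp: hom_def cobounds_def mult_ext_group)
  obtain s t where st: "s \<in> commutator_subgroup V" "t \<in> commutator_subgroup V"
    and cd: "c s = 1" "c t = 0" "d t = 1" "e t = 0"
    by (rule derived_elements[OF laws]) blast
  have "zF q (?\<phi> s, v s) (?\<phi> t, v t) = zF q (?\<phi> t, v t) (?\<phi> s, v s)"
    by (rule commuting_cocycle[OF metab cocycle_pullback[OF cocycle_zF \<psi>] st])
  \<comment> \<open>Where \<open>a\<close> and \<open>b\<close> vanish, \<open>d * c'\<close> is the
    only asymmetric term of \<open>zF\<close>. It is 1 at \<open>(t, s)\<close> and 0 at
    \<open>(s, t)\<close>.\<close>
  then show False
    using cd ab_derived[OF st(1)] ab_derived[OF st(2)] by (simp add: zF_def zF_rest_def)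
qed

lemma not_metabelian_G:
  assumes hom: "(\<lambda>x. (a x, b x, c0 x, d0 x, e0 x)) \<in> hom V (pc_group 1 0 0 (- 1))"
    and metab: "metabelian V"
  shows False
proof -
  let ?P = "pc_group 1 0 0 (- 1)"
  obtain c d e \<mu> \<mu>' \<nu> \<nu>' where laws: "cobounds V c law_c" "cobounds V d (law_d c 1 0)" "cobounds V e (law_e c 0 (- 1))"
    and c\<sigma>: "\<And>x. x \<in> carrier V \<Longrightarrow> c (\<sigma> x) = c x"
    and d\<sigma>: "\<And>x. x \<in> carrier V \<Longrightarrow> d (\<sigma> x) = - d x - c x + (\<mu> * a x + \<mu>' * b x)"
    and e\<sigma>: "\<And>x. x \<in> carrier V \<Longrightarrow> e (\<sigma> x) = - e x - c x + (\<nu> * a x + \<nu>' * b x)"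
    by (rule normalised_laws[OF hom]) blast
  let ?\<phi> = "\<lambda>x. (a x, b x, c x, d x, e x)"
  have \<phi>: "?\<phi> \<in> hom V ?P" by (rule hom_laws[OF laws])
  have c_mult: "c (x \<otimes> y) = c x + c y + b x * a y" if "x \<in> carrier V" "y \<in> carrier V" for x y
    using cobounds_D[OF laws(1) that] by (simp add: law_c_def)
  have d_mult: "d (x \<otimes> y) = d x + d y + law_d c 1 0 x y" if "x \<in> carrier V" "y \<in> carrier V" for x y
    using cobounds_D[OF laws(2) that] .
  have e_mult: "e (x \<otimes> y) = e x + e y + law_e c 0 (- 1) x y" if "x \<in> carrier V" "y \<in> carrier V" for x y
    using cobounds_D[OF laws(3) that] .
  \<comment> \<open>In \<open>vG\<close> the coordinate \<open>d\<close> is multiplied by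
    \<open>b'\<close> and \<open>e\<close> by \<open>a'\<close>, which dictates the corrections for
    \<mu> and \<nu>: \<open>a * b - c\<close> and \<open>b * b\<close> for the former,
    \<open>a * a\<close> and \<open>c\<close> for the latter.\<close>
  let ?g = "\<lambda>x. d x + e x + c x - \<mu> * (a x * b x - c x) + \<mu>' * (b x * b x) + \<nu> * (a x * a x) - \<nu>' * c x"
  have "cobounds V ?g (\<lambda>x y. vG (?\<phi> (\<sigma> x)) (?\<phi> (\<sigma> y)) - vG (?\<phi> x) (?\<phi> y))"
    unfolding cobounds_def
  proof (intro ballI)
    fix x y assume xy: "x \<in> carrier V" "y \<in> carrier V"
    show "?g (x \<otimes> y) = ?g x + ?g y + (vG (?\<phi> (\<sigma> x)) (?\<phi> (\<sigma> y)) - vG (?\<phi> x) (?\<phi> y))"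
      unfolding vG_def prod.case carry_list.simps law_d_def law_e_def carry_def
        c_mult[OF xy] d_mult[OF xy] e_mult[OF xy] a_mult[OF xy] b_mult[OF xy]
        a_\<sigma>[OF xy(1)] a_\<sigma>[OF xy(2)] b_\<sigma>[OF xy(1)] b_\<sigma>[OF xy(2)] c\<sigma>[OF xy(1)] c\<sigma>[OF xy(2)] d\<sigma>[OF xy(1)] d\<sigma>[OF xy(2)]
        e\<sigma>[OF xy(1)] e\<sigma>[OF xy(2)]
      by (simp only: F3_poly_mult, simp only: F3_uminus, simp only: F3_poly_add)
  qed
  then obtain v where v: "cobounds V v (\<lambda>x y. vG (?\<phi> x) (?\<phi> y))"
    by (rule even_cobounds[OF cocycle_pullback[OF cocycle_vG \<phi>]])
  have \<psi>: "(\<lambda>x. (?\<phi> x, v x)) \<in> hom V (ext_group ?P vG)"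
    using \<phi> v by (auto simp: hom_def cobounds_def mult_ext_group)
  obtain s t where st: "s \<in> commutator_subgroup V" "t \<in> commutator_subgroup V"
    and cd: "c s = 1" "c t = 0" "d t = 1" "e t = 0"
    by (rule derived_elements[OF laws]) blast
  have "zG (?\<phi> s, v s) (?\<phi> t, v t) = zG (?\<phi> t, v t) (?\<phi> s, v s)"
    by (rule commuting_cocycle[OF metab cocycle_pullback[OF cocycle_zG \<psi>] st])
  \<comment> \<open>Again \<open>d * c'\<close> is the only asymmetric term on the commutator
    subgroup.\<close>
  then show False
    using cd ab_derived[OF st(1)] ab_derived[OF st(2)] by (simp add: zG_def carry_commute)
qed

lemma not_metabelian_O:
  assumes hom: "(\<lambda>x. (a x, b x, c0 x, d0 x, e0 x)) \<in> hom V (pc_group 0 (- 1) 1 0)"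
    and metab: "metabelian V"
  shows False
proof -
  let ?P = "pc_group 0 (- 1) 1 0"
  obtain c d e \<mu> \<mu>' \<nu> \<nu>' where laws: "cobounds V c law_c" "cobounds V d (law_d c 0 1)" "cobounds V e (law_e c (- 1) 0)"
    and c\<sigma>: "\<And>x. x \<in> carrier V \<Longrightarrow> c (\<sigma> x) = c x"
    and d\<sigma>: "\<And>x. x \<in> carrier V \<Longrightarrow> d (\<sigma> x) = - d x - c x + (\<mu> * a x + \<mu>' * b x)"
    and e\<sigma>: "\<And>x. x \<in> carrier V \<Longrightarrow> e (\<sigma> x) = - e x - c x + (\<nu> * a x + \<nu>' * b x)"
    by (rule normalised_laws[OF hom]) blast
  let ?\<phi> = "\<lambda>x. (a x, b x, c x, d x, e x)"
  have \<phi>: "?\<phi> \<in> hom V ?P" by (rule hom_laws[OF laws])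
  have c_mult: "c (x \<otimes> y) = c x + c y + b x * a y" if "x \<in> carrier V" "y \<in> carrier V" for x y
    using cobounds_D[OF laws(1) that] by (simp add: law_c_def)
  have d_mult: "d (x \<otimes> y) = d x + d y + law_d c 0 1 x y" if "x \<in> carrier V" "y \<in> carrier V" for x y
    using cobounds_D[OF laws(2) that] .
  have e_mult: "e (x \<otimes> y) = e x + e y + law_e c (- 1) 0 x y" if "x \<in> carrier V" "y \<in> carrier V" for x y
    using cobounds_D[OF laws(3) that] .
  \<comment> \<open>Compared with \<open>vG\<close> the factors \<open>a'\<close> and
    \<open>b'\<close> of \<open>d\<close> and \<open>e\<close> are exchanged in \<open>vO\<close>,
    and so are the corrections.\<close>
  let ?g = "\<lambda>x. d x + e x + c x + \<mu> * (a x * a x) - \<mu>' * c x - \<nu> * (a x * b x - c x) + \<nu>' * (b x * b x)"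
  have "cobounds V ?g (\<lambda>x y. vO (?\<phi> (\<sigma> x)) (?\<phi> (\<sigma> y)) - vO (?\<phi> x) (?\<phi> y))"
    unfolding cobounds_def
  proof (intro ballI)
    fix x y assume xy: "x \<in> carrier V" "y \<in> carrier V"
    show "?g (x \<otimes> y) = ?g x + ?g y + (vO (?\<phi> (\<sigma> x)) (?\<phi> (\<sigma> y)) - vO (?\<phi> x) (?\<phi> y))"
      unfolding vO_def prod.case carry_list.simps law_d_def law_e_def carry_def
        c_mult[OF xy] d_mult[OF xy] e_mult[OF xy] a_mult[OF xy] b_mult[OF xy]
        a_\<sigma>[OF xy(1)] a_\<sigma>[OF xy(2)] b_\<sigma>[OF xy(1)] b_\<sigma>[OF xy(2)] c\<sigma>[OF xy(1)] c\<sigma>[OF xy(2)] d\<sigma>[OF xy(1)] d\<sigma>[OF xy(2)]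
        e\<sigma>[OF xy(1)] e\<sigma>[OF xy(2)]
      by (simp only: F3_poly_mult, simp only: F3_uminus, simp only: F3_poly_add)
  qed
  then obtain v where v: "cobounds V v (\<lambda>x y. vO (?\<phi> x) (?\<phi> y))"
    by (rule even_cobounds[OF cocycle_pullback[OF cocycle_vO \<phi>]])
  have \<psi>: "(\<lambda>x. (?\<phi> x, v x)) \<in> hom V (ext_group ?P vO)"
    using \<phi> v by (auto simp: hom_def cobounds_def mult_ext_group)
  obtain s u where st: "s \<in> commutator_subgroup V" "u \<in> commutator_subgroup V"
    and cd: "c s = 1" "c u = 0" "d u = 0" "e u = 1"
    by (rule derived_elements[OF laws]) blast
  have "zO (?\<phi> s, v s) (?\<phi> u, v u) = zO (?\<phi> u, v u) (?\<phi> s, v s)"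
    by (rule commuting_cocycle[OF metab cocycle_pullback[OF cocycle_zO \<psi>] st])
  \<comment> \<open>The asymmetric term of \<open>zO\<close> on the commutator subgroup is
    \<open>e * c'\<close>, so \<open>u\<close> takes the place of \<open>t\<close>.\<close>
  then show False
    using cd ab_derived[OF st(1)] ab_derived[OF st(2)] by (simp add: zO_def)
qed

end

section \<open>Translation between the abelianization and its coordinates\<close>

lemma of_int_mod_3: "(of_int (x mod 3) :: 3) = of_int x"
proof -
  have "(of_int x :: 3) = of_int (3 * (x div 3) + x mod 3)" by simp
  also have "\<dots> = of_int (x mod 3)" by (simp only: of_int_add of_int_mult of_int_numeral triple_mult_eq_0 add_0_left)
  finally show ?thesis ..
qed

definition int_of_F3 :: "3 \<Rightarrow> int" where
  "int_of_F3 r = (if r = 0 then 0 else if r = 1 then 1 else 2)"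

lemma of_int_int_of_F3: "of_int (int_of_F3 r) = r"
  using cases_3[of r] by (auto simp: int_of_F3_def)

lemma of_int_inj_3: "x \<in> {0..<3} \<Longrightarrow> y \<in> {0..<3} \<Longrightarrow> (of_int x :: 3) = of_int y \<Longrightarrow> x = y"
proof -
  assume "x \<in> {0..<3::int}" "y \<in> {0..<3}" "(of_int x :: 3) = of_int y"
  moreover have "x = 0 \<or> x = 1 \<or> x = 2" "y = 0 \<or> y = 1 \<or> y = 2" using calculation by auto
  ultimately show "x = y" by auto
qed

lemma carrier_mod_3: "carrier (integer_mod_group 3) = {0..<3}"
  by (simp add: carrier_integer_mod_group)

lemma mult_mod_3: "x \<otimes>\<^bsub>integer_mod_group 3\<^esub> y = (x + y) mod 3"
  by (simp add: mult_integer_mod_group)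

lemma abelianization_imp_C3_C3_group:
  assumes V: "group V" "finite (carrier V)" and ab: "abelianization_C3_C3 V"
  obtains a b where "C3_C3_group V a b"
proof -
  let ?Z = "integer_mod_group 3 \<times>\<times> integer_mod_group 3"
  interpret V: group V by fact
  let ?K = "commutator_subgroup V"
  interpret K: normal ?K V unfolding commutator_subgroup_def by (rule V.derived_self_is_normal)
  interpret Q: group "V Mod ?K" by (rule K.factorgroup_is_group)
  interpret Z: group ?Z by (intro DirProd_group group_integer_mod_group)
  obtain \<theta> where \<theta>: "\<theta> \<in> iso (V Mod ?K) ?Z"
    using ab by (auto simp: abelianization_C3_C3_def abelianization_def is_iso_def)
  then have \<theta>h: "\<theta> \<in> hom (V Mod ?K) ?Z" and \<theta>b: "bij_betw \<theta> (carrier (V Mod ?K)) (carrier ?Z)"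
    by (auto simp: iso_def)
  let ?q = "\<lambda>g. ?K #>\<^bsub>V\<^esub> g"
  have car: "carrier (V Mod ?K) = ?q ` carrier V" by (auto simp: FactGroup_def RCOSETS_def)
  define h where "h g = \<theta> (?q g)" for g
  have h_mult: "h (g \<otimes>\<^bsub>V\<^esub> g') = h g \<otimes>\<^bsub>?Z\<^esub> h g'" if "g \<in> carrier V" "g' \<in> carrier V" for g g'
  proof -
    have m: "?q g \<in> carrier (V Mod ?K)" "?q g' \<in> carrier (V Mod ?K)" using that unfolding car by blast+
    show ?thesis
      using hom_mult[OF \<theta>h m] K.rcos_sum[OF that] unfolding h_def mult_FactGroup by (simp only:)
  qed
  have hc: "h g \<in> {0..<3} \<times> {0..<3}" if "g \<in> carrier V" for g
    using that \<theta>h car by (auto simp: h_def hom_def Pi_iff carrier_mod_3)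
  have h_onto: "h ` carrier V = {0..<3} \<times> {0..<3}"
    using \<theta>b by (simp add: h_def bij_betw_def car image_image carrier_mod_3)
  define a where "a g = (of_int (fst (h g)) :: 3)" for g
  define b where "b g = (of_int (snd (h g)) :: 3)" for g
  have Z_mult: "u \<otimes>\<^bsub>?Z\<^esub> v = ((fst u + fst v) mod 3, (snd u + snd v) mod 3)" for u v
    by (cases u; cases v) (simp add: mult_mod_3)
  have h1: "h \<one>\<^bsub>V\<^esub> = (0, 0)"
  proof -
    have "?q \<one>\<^bsub>V\<^esub> = \<one>\<^bsub>V Mod ?K\<^esub>" using K.subset by (simp add: FactGroup_def V.coset_mult_one)
    then have "h \<one>\<^bsub>V\<^esub> = \<one>\<^bsub>?Z\<^esub>" using hom_one[OF \<theta>h Q.is_group Z.is_group] by (simp add: h_def)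
    then show ?thesis by (simp add: one_integer_mod_group)
  qed
  have "C3_C3_group V a b"
  proof (intro C3_C3_group.intro C3_C3_group_axioms.intro V V.is_group)
    show "a (x \<otimes>\<^bsub>V\<^esub> y) = a x + a y" if "x \<in> carrier V" "y \<in> carrier V" for x y
      unfolding a_def h_mult[OF that] Z_mult by (simp add: of_int_mod_3)
    show "b (x \<otimes>\<^bsub>V\<^esub> y) = b x + b y" if "x \<in> carrier V" "y \<in> carrier V" for x y
      unfolding b_def h_mult[OF that] Z_mult by (simp add: of_int_mod_3)
    have "a g = 0 \<and> b g = 0 \<longleftrightarrow> g \<in> ?K" if g: "g \<in> carrier V" for g
    proof -
      have "a g = 0 \<and> b g = 0 \<longleftrightarrow> h g = (0, 0)"
        using hc[OF g] of_int_inj_3[of "fst (h g)" 0] of_int_inj_3[of "snd (h g)" 0]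
        by (auto simp: a_def b_def prod_eq_iff mem_Times_iff)
      also have "\<dots> \<longleftrightarrow> ?q g = ?q \<one>\<^bsub>V\<^esub>"
        using h1 \<theta>b g car unfolding h_def bij_betw_def inj_on_def by (metis V.one_closed imageI)
      also have "\<dots> \<longleftrightarrow> g \<in> ?K"
        using K.rcos_const[OF V.is_group, of g] V.rcos_self[OF g K.subgroup_axioms] V.coset_mult_one[OF K.subset]
        by (intro iffI) simp_all
      finally show ?thesis .
    qed
    then show "{g \<in> carrier V. a g = 0 \<and> b g = 0} = ?K" using K.subset by blast
    have "(1, 0) \<in> h ` carrier V" "(0, 1) \<in> h ` carrier V" unfolding h_onto by simp_all
    then obtain x y where "x \<in> carrier V" "h x = (1, 0)" "y \<in> carrier V" "h y = (0, 1)"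
      by (elim imageE) simp
    then have "x \<in> carrier V \<and> a x = 1 \<and> b x = 0" "y \<in> carrier V \<and> a y = 0 \<and> b y = 1"
      by (simp_all add: a_def b_def)
    then show "\<exists>x\<in>carrier V. a x = 1 \<and> b x = 0" "\<exists>x\<in>carrier V. a x = 0 \<and> b x = 1" by blast+
  qed
  then show ?thesis by (rule that)
qed

lemma (in C3_C3_group) abelianization_C3_C3: "abelianization_C3_C3 V"
proof -
  let ?Z = "integer_mod_group 3 \<times>\<times> integer_mod_group 3"
  let ?h = "\<lambda>g. (int_of_F3 (a g), int_of_F3 (b g))"
  have add: "int_of_F3 (r + r') = (int_of_F3 r + int_of_F3 r') mod 3" for r r'
    using cases_3[of r] cases_3[of r'] by (elim disjE) (simp_all add: int_of_F3_def)
  interpret h: group_hom V ?Z ?h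
  proof (intro group_hom.intro group_hom_axioms.intro is_group DirProd_group group_integer_mod_group homI)
    show "?h x \<in> carrier ?Z" for x by (simp add: int_of_F3_def carrier_mod_3)
  qed (simp add: add mult_mod_3)
  have "?h ` carrier V = carrier ?Z"
  proof -
    have "(i, j) \<in> ?h ` carrier V" if ij: "i \<in> {0..<3}" "j \<in> {0..<3}" for i j
    proof -
      obtain g where g: "g \<in> carrier V" "a g = of_int i" "b g = of_int j" using ex_ab by blast
      have "int_of_F3 (of_int i) = i" "int_of_F3 (of_int j) = j"
        using ij by (auto intro!: of_int_inj_3 simp: of_int_int_of_F3) (simp_all add: int_of_F3_def)
      then show ?thesis using g by (intro image_eqI[of _ _ g]) simp_all
    qed
    moreover have "?h g \<in> {0..<3} \<times> {0..<3}" for g by (simp add: int_of_F3_def)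
    ultimately show ?thesis by (auto simp: carrier_mod_3)
  qed
  from h.FactGroup_iso[OF this] show ?thesis
  proof -
    have "kernel V ?Z ?h = commutator_subgroup V"
      unfolding kernel_def kernel_ab[symmetric]
      by (auto simp: one_integer_mod_group int_of_F3_def split: if_splits)
    then show ?thesis using h.FactGroup_iso[OF \<open>?h ` carrier V = carrier ?Z\<close>]
      by (simp add: abelianization_C3_C3_def abelianization_def)
  qed
qed

section \<open>Commutator subgroup and inverting automorphism of the groups of order 243\<close>

lemma pc_group_commutator:
  assumes "g \<otimes>\<^bsub>pc_group p q k l\<^esub> h = h \<otimes>\<^bsub>pc_group p q k l\<^esub> g \<otimes>\<^bsub>pc_group p q k l\<^esub> r"
  shows "r \<in> commutator_subgroup (pc_group p q k l)"
proof -
  interpret group "pc_group p q k l" by (rule group_pc_group)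
  let ?P = "pc_group p q k l"
  have "r = inv\<^bsub>?P\<^esub> (h \<otimes>\<^bsub>?P\<^esub> g) \<otimes>\<^bsub>?P\<^esub> (g \<otimes>\<^bsub>?P\<^esub> h)"
    unfolding assms using m_assoc[of "inv\<^bsub>?P\<^esub> (h \<otimes>\<^bsub>?P\<^esub> g)" "h \<otimes>\<^bsub>?P\<^esub> g" r] by simp
  \<comment> \<open>Commutators in \<open>derived\<close> have the form x y x^-1 y^-1, so
    \<open>r\<close> is the commutator of g^-1 and h^-1.\<close>
  also have "\<dots> = inv\<^bsub>?P\<^esub> g \<otimes>\<^bsub>?P\<^esub> inv\<^bsub>?P\<^esub> h \<otimes>\<^bsub>?P\<^esub> inv\<^bsub>?P\<^esub> (inv\<^bsub>?P\<^esub> g) \<otimes>\<^bsub>?P\<^esub> inv\<^bsub>?P\<^esub> (inv\<^bsub>?P\<^esub> h)"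
    by (simp add: inv_mult_group m_assoc)
  finally show ?thesis
    unfolding commutator_subgroup_def derived_def by (intro generate.incl) (simp only: carrier_pc_group UN_iff, blast)
qed

lemma fst_mult_pc_group:
  "fst (v \<otimes>\<^bsub>pc_group p q k l\<^esub> w) = fst v + fst w"
  "fst (snd (v \<otimes>\<^bsub>pc_group p q k l\<^esub> w)) = fst (snd v) + fst (snd w)"
  by (cases v; cases w; simp add: mult_pc_group)+

lemma fst_inv_pc_group:
  "fst (inv\<^bsub>pc_group p q k l\<^esub> v) = - fst v"
  "fst (snd (inv\<^bsub>pc_group p q k l\<^esub> v)) = - fst (snd v)"
proof -
  interpret group "pc_group p q k l" by (rule group_pc_group)
  show "fst (inv\<^bsub>pc_group p q k l\<^esub> v) = - fst v"
    "fst (snd (inv\<^bsub>pc_group p q k l\<^esub> v)) = - fst (snd v)"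
    using fst_mult_pc_group[of p q k l "inv\<^bsub>pc_group p q k l\<^esub> v" v]
    by (simp_all add: one_pc_group eq_neg_iff_add_eq_0)
qed

lemma commutator_subgroup_pc_group:
  "commutator_subgroup (pc_group p q k l) = {v. fst v = 0 \<and> fst (snd v) = 0}"
proof
  let ?P = "pc_group p q k l" and ?H = "{v::3\<times>3\<times>3\<times>3\<times>3. fst v = 0 \<and> fst (snd v) = 0}"
  interpret group ?P by (rule group_pc_group)
  have sub: "subgroup ?H ?P"
    by (rule subgroupI) (auto simp: fst_mult_pc_group fst_inv_pc_group)
  show "commutator_subgroup ?P \<subseteq> ?H"
    unfolding commutator_subgroup_def derived_def
    by (rule generate_subgroup_incl[OF _ sub]) (auto simp: fst_mult_pc_group fst_inv_pc_group)
  let ?D = "commutator_subgroup ?P"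
  have D: "subgroup ?D ?P" unfolding commutator_subgroup_def by (rule derived_is_subgroup) simp
  have s: "(0, 0, 1, 0, 0) \<in> ?D" by (rule pc_group_commutator[of _ _ _ _ "(0, 1, 0, 0, 0)" "(1, 0, 0, 0, 0)"]) (simp add: mult_pc_group)
  have t: "(0, 0, 0, 1, 0) \<in> ?D" by (rule pc_group_commutator[of _ _ _ _ "(0, 0, 1, 0, 0)" "(1, 0, 0, 0, 0)"]) (simp add: mult_pc_group)
  have u: "(0, 0, 0, 0, 1) \<in> ?D" by (rule pc_group_commutator[of _ _ _ _ "(0, 0, 1, 0, 0)" "(0, 1, 0, 0, 0)"]) (simp add: mult_pc_group)
  have pwD: "pw ?P v r \<in> ?D" if "v \<in> ?D" for v r
    using that subgroup.one_closed[OF D] subgroup.m_inv_closed[OF D] by (simp add: pw_def)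
  have inv_s: "inv\<^bsub>?P\<^esub> (0, 0, 1, 0, 0) = (0, 0, - 1, 0, 0)"
    by (rule inv_equality) (simp_all add: mult_pc_group one_pc_group)
  have pw_s: "pw ?P (0, 0, 1, 0, 0) c = (0, 0, c, 0, 0)" for c
    using cases_3[of c] inv_s by (auto simp: one_pc_group)
  show "?H \<subseteq> ?D"
  proof
    fix v assume "v \<in> ?H"
    then obtain c d e where v: "v = (0, 0, c, d, e)" by (cases v) auto
    have "pw ?P (0, 0, 1, 0, 0) c \<otimes>\<^bsub>?P\<^esub> (pw ?P (0, 0, 0, 1, 0) d \<otimes>\<^bsub>?P\<^esub> pw ?P (0, 0, 0, 0, 1) e) \<in> ?D"
      by (intro subgroup.m_closed[OF D] pwD s t u)
    then show "v \<in> ?D" by (simp add: v pw_s pw_pc_group_t mult_pc_group)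
  qed
qed

lemma C3_C3_group_pc_group: "C3_C3_group (pc_group p q k l) fst (\<lambda>v. fst (snd v))"
proof (intro C3_C3_group.intro C3_C3_group_axioms.intro group_pc_group)
  show "{v \<in> carrier (pc_group p q k l). fst v = 0 \<and> fst (snd v) = 0} = commutator_subgroup (pc_group p q k l)"
    by (simp add: commutator_subgroup_pc_group)
  show "\<exists>x\<in>carrier (pc_group p q k l). fst x = 1 \<and> fst (snd x) = 0"
    by (rule bexI[of _ "(1, 0, 0, 0, 0)"]) simp_all
  show "\<exists>x\<in>carrier (pc_group p q k l). fst x = 0 \<and> fst (snd x) = 1"
    by (rule bexI[of _ "(0, 1, 0, 0, 0)"]) simp_all
qed (auto simp: pc_group_def)

lemma metabelianI:
  assumes "group V" "\<And>x y. x \<in> commutator_subgroup V \<Longrightarrow> y \<in> commutator_subgroup V \<Longrightarrow> x \<otimes>\<^bsub>V\<^esub> y = y \<otimes>\<^bsub>V\<^esub> x"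
  shows "metabelian V"
proof -
  interpret group V by fact
  let ?D = "commutator_subgroup V"
  have D: "?D \<subseteq> carrier V" unfolding commutator_subgroup_def by (rule derived_in_carrier) simp
  have "x \<otimes>\<^bsub>V\<^esub> y \<otimes>\<^bsub>V\<^esub> inv\<^bsub>V\<^esub> x \<otimes>\<^bsub>V\<^esub> inv\<^bsub>V\<^esub> y = \<one>\<^bsub>V\<^esub>" if "x \<in> ?D" "y \<in> ?D" for x y
  proof -
    have xy: "x \<in> carrier V" "y \<in> carrier V" using that D by auto
    have "x \<otimes>\<^bsub>V\<^esub> y \<otimes>\<^bsub>V\<^esub> inv\<^bsub>V\<^esub> x \<otimes>\<^bsub>V\<^esub> inv\<^bsub>V\<^esub> y = y \<otimes>\<^bsub>V\<^esub> x \<otimes>\<^bsub>V\<^esub> inv\<^bsub>V\<^esub> x \<otimes>\<^bsub>V\<^esub> inv\<^bsub>V\<^esub> y"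
      using assms(2)[OF that] by simp
    then show ?thesis using xy by (simp add: m_assoc)
  qed
  then have "derived_set V ?D \<subseteq> {\<one>\<^bsub>V\<^esub>}" by blast
  then have "derived V ?D \<subseteq> {\<one>\<^bsub>V\<^esub>}"
    unfolding derived_def by (rule generate_subgroup_incl) (rule triv_subgroup)
  moreover have "\<one>\<^bsub>V\<^esub> \<in> derived V ?D" unfolding derived_def by (rule generate.one)
  ultimately show ?thesis unfolding metabelian_def by blast
qed

lemma metabelian_pc_group: "metabelian (pc_group p q k l)"
  by (rule metabelianI[OF group_pc_group]) (auto simp: commutator_subgroup_pc_group mult_pc_group)

lemma hom_derived_image:
  assumes "\<phi> \<in> hom V W" "\<phi> ` carrier V = carrier W" "group V" "group W"
  shows "\<phi> ` commutator_subgroup V = commutator_subgroup W"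
proof -
  interpret group_hom V W \<phi> using assms by (simp add: group_hom_def group_hom_axioms_def)
  show ?thesis using derived_img[of "carrier V"] assms(2) by (simp add: commutator_subgroup_def)
qed

lemma metabelian_iso:
  assumes "\<phi> \<in> iso V W" "group V" "group W" "metabelian W"
  shows "metabelian V"
proof -
  interpret group_hom V W \<phi> using assms by (simp add: group_hom_def group_hom_axioms_def iso_def)
  have onto: "\<phi> ` carrier V = carrier W" using assms(1) by (simp add: iso_def bij_betw_def)
  have D: "commutator_subgroup V \<subseteq> carrier V" unfolding commutator_subgroup_def by (rule G.derived_in_carrier) simp
  have "\<phi> ` derived V (commutator_subgroup V) = {\<one>\<^bsub>W\<^esub>}"
    using derived_img[OF D] hom_derived_image[OF homh _ assms(2,3)] onto assms(4) by (simp add: metabelian_def)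
  moreover have "inj_on \<phi> (carrier V)" using assms(1) by (simp add: iso_def bij_betw_def)
  moreover have "derived V (commutator_subgroup V) \<subseteq> carrier V" by (rule G.derived_in_carrier[OF D])
  moreover have "\<one>\<^bsub>V\<^esub> \<in> derived V (commutator_subgroup V)" unfolding derived_def by (rule generate.one)
  ultimately have "derived V (commutator_subgroup V) = {\<one>\<^bsub>V\<^esub>}"
    by (auto simp: inj_on_def) (metis G.one_closed hom_one imageI singletonD subsetD)
  then show ?thesis by (simp add: metabelian_def)
qed

text \<open>The inverses of \<open>x\<close> and \<open>y\<close> satisfy the same relations for all
  parameters: their commutators are s t^-1 u^-1, t^-1 and u^-1, so the cubes and the central
  commutators are inverted alike.\<close>

lemma inverting_automorphism_pc_group:
  obtains \<sigma> where "\<sigma> \<in> auto (pc_group p q k l)"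
    "\<And>v. fst (\<sigma> v) = - fst v" "\<And>v. fst (snd (\<sigma> v)) = - fst (snd v)"
proof -
  let ?G = "pc_group p q k l"
  interpret group ?G by (rule group_pc_group)
  interpret C: C3_C3_group ?G fst "\<lambda>v. fst (snd v)" by (rule C3_C3_group_pc_group)
  have "\<exists>\<psi>\<in>hom ?G ?G. \<psi> (1, 0, 0, 0, 0) = (- 1, 0, 0, 0, 0) \<and> \<psi> (0, 1, 0, 0, 0) = (0, - 1, 0, 0, 0)"
    by (rule pc_group_hom[of "(- 1, 0, 0, 0, 0)" "(0, - 1, 0, 0, 0)" "(0, 0, 1, - 1, - 1)" "(0, 0, 0, - 1, 0)" "(0, 0, 0, 0, - 1)"])
      (simp_all add: pw_pc_group_t mult_pc_group one_pc_group)
  then obtain \<psi> where \<psi>: "\<psi> \<in> hom ?G ?G" "\<psi> (1, 0, 0, 0, 0) = (- 1, 0, 0, 0, 0)" "\<psi> (0, 1, 0, 0, 0) = (0, - 1, 0, 0, 0)"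
    by blast
  interpret \<psi>: group_hom ?G ?G \<psi> using \<psi>(1) is_group by (simp add: group_hom_def group_hom_axioms_def)
  have i: "inv\<^bsub>?G\<^esub> (- 1, 0, 0, 0, 0) = (1, 0, 0, 0, 0)" "inv\<^bsub>?G\<^esub> (0, - 1, 0, 0, 0) = (0, 1, 0, 0, 0)"
    by (rule inv_equality; simp add: mult_pc_group one_pc_group)+
  have onto: "\<psi> ` carrier ?G = UNIV"
    by (rule hom_pc_group_onto[OF \<psi>(1) is_group, of "inv\<^bsub>?G\<^esub> (1, 0, 0, 0, 0)" "inv\<^bsub>?G\<^esub> (0, 1, 0, 0, 0)"])
      (use \<psi>.hom_inv \<psi> i in simp_all)
  have iso: "\<psi> \<in> iso ?G ?G" by (rule hom_onto_imp_iso[OF \<psi>(1)]) (use onto in simp_all)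
  have auto: "\<psi> \<in> auto ?G"
    using iso by (simp add: auto_def Bij_def iso_def extensional_def)
  have h1: "cobounds ?G (\<lambda>v. fst (\<psi> v)) (\<lambda>_ _. 0)" "cobounds ?G (\<lambda>v. fst (snd (\<psi> v))) (\<lambda>_ _. 0)"
    using \<psi>.hom_mult by (simp_all add: cobounds_def)
  obtain i j where ij: "\<And>v. v \<in> carrier ?G \<Longrightarrow> fst (\<psi> v) = i * fst v + j * fst (snd v)"
    by (rule C.hom_combination[OF h1(1)]) blast
  obtain i' j' where ij': "\<And>v. v \<in> carrier ?G \<Longrightarrow> fst (snd (\<psi> v)) = i' * fst v + j' * fst (snd v)"
    by (rule C.hom_combination[OF h1(2)]) blast
  have "i = - 1" "j = 0" "i' = 0" "j' = - 1"
    using ij[of "(1, 0, 0, 0, 0)"] ij[of "(0, 1, 0, 0, 0)"] ij'[of "(1, 0, 0, 0, 0)"] ij'[of "(0, 1, 0, 0, 0)"] \<psi> by simp_all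
  with ij ij' have "fst (\<psi> v) = - fst v" "fst (snd (\<psi> v)) = - fst (snd v)" for v by simp_all
  with auto show ?thesis by (rule that)
qed

text \<open>Lifts of a basis of the abelianization generate: their commutator is \<open>s\<close> up
  to central factors, and its commutators with the two lifts are exactly \<open>t\<close> and
  \<open>u\<close>.\<close>

lemma pc_group_subgroup_UNIV_mod_derived:
  assumes H: "subgroup H (pc_group p q k l)" and v: "(1, 0, c, d, e) \<in> H" and w: "(0, 1, c', d', e') \<in> H"
  shows "H = UNIV"
proof -
  let ?P = "pc_group p q k l"
  interpret group ?P by (rule group_pc_group)
  note closed = subgroup.m_closed[OF H] subgroup.m_inv_closed[OF H]
  have swap: "r \<in> H" if "g \<in> H" "h \<in> H" "g \<otimes>\<^bsub>?P\<^esub> h = h \<otimes>\<^bsub>?P\<^esub> g \<otimes>\<^bsub>?P\<^esub> r" for g h r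
  proof -
    have "inv\<^bsub>?P\<^esub> (h \<otimes>\<^bsub>?P\<^esub> g) \<otimes>\<^bsub>?P\<^esub> (g \<otimes>\<^bsub>?P\<^esub> h) = r"
      unfolding that using m_assoc[of "inv\<^bsub>?P\<^esub> (h \<otimes>\<^bsub>?P\<^esub> g)" "h \<otimes>\<^bsub>?P\<^esub> g" r] by simp
    moreover have "inv\<^bsub>?P\<^esub> (h \<otimes>\<^bsub>?P\<^esub> g) \<otimes>\<^bsub>?P\<^esub> (g \<otimes>\<^bsub>?P\<^esub> h) \<in> H"
      by (intro closed that)
    ultimately show ?thesis by simp
  qed
  have pwH: "pw ?P g r \<in> H" if "g \<in> H" for g r
    using that subgroup.one_closed[OF H] closed by (simp add: pw_def)
  have r: "(0, 0, 1, c', - c) \<in> H"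
    by (rule swap[OF w v]) (simp add: mult_pc_group algebra_simps)
  have t: "(0, 0, 0, 1, 0) \<in> H" by (rule swap[OF r v]) (simp add: mult_pc_group)
  have u: "(0, 0, 0, 0, 1) \<in> H" by (rule swap[OF r w]) (simp add: mult_pc_group)
  have tu: "(0, 0, 0, i, j) \<in> H" for i j
    using closed(1)[OF pwH[OF t, of i] pwH[OF u, of j]] by (simp add: pw_pc_group_t mult_pc_group)
  have s: "(0, 0, 1, 0, 0) \<in> H"
    using closed(1)[OF r tu[of "- c'" c]] by (simp add: mult_pc_group)
  have "pw ?P (0, 0, 1, 0, 0) i = (0, 0, i, 0, 0)" for i
    using cases_3[of i] inv_equality[of "(0, 0, - 1, 0, 0)" "(0, 0, 1, 0, 0)"]
    by (auto simp: mult_pc_group one_pc_group)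
  then have stu: "(0, 0, i, j, m) \<in> H" for i j m
    using closed(1)[OF pwH[OF s, of i] tu[of j m]] by (simp add: mult_pc_group)
  have "(1, 0, 0, 0, 0) \<in> H" "(0, 1, 0, 0, 0) \<in> H"
    using closed(1)[OF v stu[of "- c" "- d" "- e"]] closed(1)[OF w stu[of "- c'" "- d'" "- e'"]]
    by (simp_all add: mult_pc_group)
  then show ?thesis by (rule pc_group_subgroup_UNIV[OF H])
qed

text \<open>A surjection whose kernel lies in the commutator subgroup induces an isomorphism of
  abelianizations, so the first two coordinates of \<phi> serve for \<open>V\<close>.\<close>

lemma C3_C3_group_of_hom:
  assumes V: "group V" "finite (carrier V)"
    and \<phi>: "\<phi> \<in> hom V (pc_group p q k l)" "\<phi> ` carrier V = UNIV"
    and ker: "\<And>g. g \<in> carrier V \<Longrightarrow> \<phi> g = (0, 0, 0, 0, 0) \<Longrightarrow> g \<in> commutator_subgroup V"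
  shows "C3_C3_group V (\<lambda>x. fst (\<phi> x)) (\<lambda>x. fst (snd (\<phi> x)))"
proof (intro C3_C3_group.intro C3_C3_group_axioms.intro V)
  let ?P = "pc_group p q k l"
  interpret P: group ?P by (rule group_pc_group)
  interpret group_hom V ?P \<phi> using \<phi> V P.is_group by (simp add: group_hom_def group_hom_axioms_def)
  show "fst (\<phi> (x \<otimes>\<^bsub>V\<^esub> y)) = fst (\<phi> x) + fst (\<phi> y)"
    "fst (snd (\<phi> (x \<otimes>\<^bsub>V\<^esub> y))) = fst (snd (\<phi> x)) + fst (snd (\<phi> y))" if "x \<in> carrier V" "y \<in> carrier V" for x y
    using that by (simp_all add: fst_mult_pc_group)
  have img: "\<phi> ` commutator_subgroup V = {v. fst v = 0 \<and> fst (snd v) = 0}"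
    using hom_derived_image[OF \<phi>(1) _ V(1) P.is_group] \<phi>(2) by (simp add: commutator_subgroup_pc_group)
  have D: "subgroup (commutator_subgroup V) V"
    unfolding commutator_subgroup_def by (rule G.derived_is_subgroup) simp
  show "{g \<in> carrier V. fst (\<phi> g) = 0 \<and> fst (snd (\<phi> g)) = 0} = commutator_subgroup V"
  proof safe
    fix g assume g: "g \<in> carrier V" "fst (\<phi> g) = 0" "fst (snd (\<phi> g)) = 0"
    then have "\<phi> g \<in> \<phi> ` commutator_subgroup V" unfolding img by simp
    then obtain h where h: "h \<in> commutator_subgroup V" "\<phi> g = \<phi> h" by auto
    have hc: "h \<in> carrier V" by (rule subgroup.mem_carrier[OF D h(1)])
    have "\<phi> (g \<otimes>\<^bsub>V\<^esub> inv\<^bsub>V\<^esub> h) = \<one>\<^bsub>?P\<^esub>"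
      using g(1) hc h(2) by simp
    then have "g \<otimes>\<^bsub>V\<^esub> inv\<^bsub>V\<^esub> h \<in> commutator_subgroup V"
      using ker g(1) hc by (simp add: one_pc_group)
    then have "g \<otimes>\<^bsub>V\<^esub> inv\<^bsub>V\<^esub> h \<otimes>\<^bsub>V\<^esub> h \<in> commutator_subgroup V"
      by (rule subgroup.m_closed[OF D _ h(1)])
    then show "g \<in> commutator_subgroup V" using g(1) hc by (simp add: G.m_assoc)
  next
    fix g assume g: "g \<in> commutator_subgroup V"
    then show "g \<in> carrier V" by (rule subgroup.mem_carrier[OF D])
    have "\<phi> g \<in> {v. fst v = 0 \<and> fst (snd v) = 0}" using g img by blast
    then show "fst (\<phi> g) = 0" "fst (snd (\<phi> g)) = 0" by simp_all
  qed
  have "(1, 0, 0, 0, 0) \<in> \<phi> ` carrier V" "(0, 1, 0, 0, 0) \<in> \<phi> ` carrier V" using \<phi>(2) by simp_all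
  then show "\<exists>x\<in>carrier V. fst (\<phi> x) = 1 \<and> fst (snd (\<phi> x)) = 0"
    "\<exists>x\<in>carrier V. fst (\<phi> x) = 0 \<and> fst (snd (\<phi> x)) = 1"
    by (metis (no_types, lifting) fst_conv imageE snd_conv)+
qed

context C3_C3_group
begin

lemma inverts_abelianization_iff:
  assumes x: "x \<in> carrier V" and y: "y \<in> carrier V"
  shows "commutator_subgroup V #> y = inv\<^bsub>abelianization V\<^esub> (commutator_subgroup V #> x)
    \<longleftrightarrow> a y = - a x \<and> b y = - b x"
proof -
  let ?D = "commutator_subgroup V"
  interpret D: normal ?D V unfolding commutator_subgroup_def by (rule derived_self_is_normal)
  have "inv\<^bsub>abelianization V\<^esub> (?D #> x) = ?D #> inv x"
    unfolding abelianization_def using x D.inv_FactGroup[of "?D #> x"] by (simp add: D.rcos_inv FactGroup_def RCOSETS_def) blast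
  moreover have "?D #> y = ?D #> inv x \<longleftrightarrow> y \<in> ?D #> inv x"
  proof
    show "y \<in> ?D #> inv x" if "?D #> y = ?D #> inv x"
      using rcos_self[OF y D.subgroup_axioms] that by simp
    show "?D #> y = ?D #> inv x" if "y \<in> ?D #> inv x"
      by (rule repr_independence[OF that _ D.subgroup_axioms, symmetric]) (simp add: x)
  qed
  moreover have "y \<in> ?D #> inv x \<longleftrightarrow> y \<otimes> inv (inv x) \<in> ?D"
    using x y by (intro D.rcos_module is_group) simp_all
  ultimately show ?thesis
    using x y by (simp add: derived_iff eq_neg_iff_add_eq_0)
qed

text \<open>Since the left side does not mention coordinates, this allows \<open>a\<close> and
  \<open>b\<close> to be replaced later by those of another generating pair.\<close>

lemma schur_sigma_iff:
  "schur_sigma_group V \<longleftrightarrow> finite_3_group V \<and> (\<exists>\<sigma>\<in>auto V. schur_sigma V a b \<sigma>)"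
proof -
  have hom: "\<sigma> \<in> hom V V" if "\<sigma> \<in> auto V" for \<sigma> using that by (simp add: auto_def)
  have "schur_sigma V a b \<sigma> \<longleftrightarrow> cohomology_dim V 2 = cohomology_dim V 1 \<and>
     (\<forall>x\<in>carrier V. commutator_subgroup V #> \<sigma> x = inv\<^bsub>abelianization V\<^esub> (commutator_subgroup V #> x))"
    if "\<sigma> \<in> auto V" for \<sigma>
  proof -
    have "\<sigma> x \<in> carrier V" if "x \<in> carrier V" for x
      using hom[OF \<open>\<sigma> \<in> auto V\<close>] that by (auto simp: hom_def)
    then show ?thesis
      using hom[OF that] C3_C3_group_axioms
      by (auto simp: schur_sigma_def schur_sigma_axioms_def inverts_abelianization_iff cohomology_dim_2_iff simp del: One_nat_def)
  qed
  then show ?thesis unfolding schur_sigma_group_def by blast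
qed

end

lemma metabelian_schur_sigma_imp_terminal:
  assumes V: "finite_3_group V" "abelianization_C3_C3 V" and m: "metabelian V" and s: "schur_sigma_group V"
  obtains p q k l where "(p, q, k, l) \<in> terminal_params" "V \<cong> pc_group p q k l"
proof -
  interpret V: group V using V(1) by (simp add: finite_3_group_def)
  obtain n where n: "order V = 3 ^ n" using V(1) by (auto simp: finite_3_group_def)
  then have fin: "finite (carrier V)" using V.order_gt_0_iff_finite by simp
  obtain a b where "C3_C3_group V a b"
    by (rule abelianization_imp_C3_C3_group[OF V.is_group fin V(2)])
  then interpret C: C3_C3_group V a b .
  obtain \<sigma> where "schur_sigma V a b \<sigma>" using s C.schur_sigma_iff by blast
  then interpret S: schur_sigma V a b \<sigma> .
  obtain c d e p0 q0 k0 l0 where \<phi>0: "(\<lambda>x. (a x, b x, c x, d x, e x)) \<in> hom V (pc_group p0 q0 k0 l0)"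
    by (rule S.exists_hom)
  let ?\<phi> = "\<lambda>x. (a x, b x, c x, d x, e x)" and ?Q = "pc_group p0 q0 k0 l0"
  interpret \<phi>: group_hom V ?Q ?\<phi>
    using \<phi>0 group_pc_group V.is_group by (simp add: group_hom_def group_hom_axioms_def)
  obtain x where x: "x \<in> carrier V" "a x = 1" "b x = 0" using C.ex_10 by blast
  obtain y where y: "y \<in> carrier V" "a y = 0" "b y = 1" using C.ex_01 by blast
  have onto: "?\<phi> ` carrier V = UNIV"
    by (rule pc_group_subgroup_UNIV_mod_derived[OF \<phi>.img_is_subgroup, of "c x" "d x" "e x" "c y" "d y" "e y"])
      (use x y in \<open>force simp: image_iff\<close>)+
  obtain p q k l where P: "(p, q, k, l) \<in> pc_reps" "?Q \<cong> pc_group p q k l"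
    by (rule pc_group_classification)
  let ?P = "pc_group p q k l"
  obtain \<psi> where \<psi>: "\<psi> \<in> iso ?Q ?P" using P(2) by (auto simp: is_iso_def)
  then have \<psi>': "\<psi> \<in> hom ?Q ?P" "\<psi> ` UNIV = UNIV" "inj \<psi>" by (simp_all add: iso_def bij_betw_def)
  have \<psi>1: "\<psi> (0, 0, 0, 0, 0) = (0, 0, 0, 0, 0)"
    using hom_one[OF \<psi>'(1) group_pc_group group_pc_group] by (simp add: one_pc_group)
  let ?\<theta> = "\<lambda>x. \<psi> (?\<phi> x)"
  have \<theta>: "?\<theta> \<in> hom V ?P" using hom_compose[OF \<phi>0 \<psi>'(1)] by (simp add: comp_def)
  have \<theta>_onto: "?\<theta> ` carrier V = UNIV" using onto \<psi>'(2) by (metis image_image)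
  have ker: "g \<in> commutator_subgroup V" if "g \<in> carrier V" "?\<theta> g = (0, 0, 0, 0, 0)" for g
  proof -
    have "?\<phi> g = (0, 0, 0, 0, 0)" by (rule injD[OF \<psi>'(3)]) (simp add: that(2) \<psi>1)
    then show ?thesis using that(1) by (simp add: C.derived_iff)
  qed
  \<comment> \<open>Passing to a representative changes the generators, so \<open>V\<close> gets new
    coordinates and the cohomological condition is translated afresh.\<close>
  interpret C': C3_C3_group V "\<lambda>x. fst (?\<theta> x)" "\<lambda>x. fst (snd (?\<theta> x))"
    by (rule C3_C3_group_of_hom[OF V.is_group fin \<theta> \<theta>_onto ker])
  obtain \<sigma>' where "schur_sigma V (\<lambda>x. fst (?\<theta> x)) (\<lambda>x. fst (snd (?\<theta> x))) \<sigma>'"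
    using s C'.schur_sigma_iff by blast
  then interpret S': schur_sigma V "\<lambda>x. fst (?\<theta> x)" "\<lambda>x. fst (snd (?\<theta> x))" \<sigma>' .
  have \<theta>': "(\<lambda>x. (fst (?\<theta> x), fst (snd (?\<theta> x)), fst (snd (snd (?\<theta> x))), fst (snd (snd (snd (?\<theta> x)))),
      snd (snd (snd (snd (?\<theta> x)))))) \<in> hom V ?P"
    using \<theta> by simp
  have "(p, q, k, l) \<in> terminal_params"
  proof (rule ccontr)
    assume "(p, q, k, l) \<notin> terminal_params"
    then consider "p = 0" "k = - 1" "l = 0" | "p = 1" "q = 0" "k = 0" "l = - 1" | "p = 0" "q = - 1" "k = 1" "l = 0"
      using P(1) unfolding pc_reps_def terminal_params_def by auto
    then show False
    proof cases
      case 1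
      show False by (rule S'.not_metabelian_F[OF _ m]) (rule \<theta>'[unfolded 1])
    next
      case 2
      show False by (rule S'.not_metabelian_G[OF _ m]) (rule \<theta>'[unfolded 2])
    next
      case 3
      show False by (rule S'.not_metabelian_O[OF _ m]) (rule \<theta>'[unfolded 3])
    qed
  qed
  moreover from this have "?\<theta> \<in> iso V ?P"
    by (rule hom_terminal_inj[OF _ V.is_group n \<theta> \<theta>_onto]) (use ker in \<open>simp add: commutator_subgroup_def\<close>)
  ultimately show ?thesis by (intro that) (auto simp: is_iso_def)
qed

lemma schur_sigma_of_terminal:
  assumes P: "(p, q, k, l) \<in> terminal_params" and V: "group V" "V \<cong> pc_group p q k l"
  shows "finite_3_group V" "abelianization_C3_C3 V" "metabelian V" "schur_sigma_group V"
proof -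
  let ?P = "pc_group p q k l"
  interpret V: group V by fact
  interpret P: group ?P by (rule group_pc_group)
  obtain \<phi> where \<phi>: "\<phi> \<in> iso V ?P" using V(2) by (auto simp: is_iso_def)
  then have \<phi>': "\<phi> \<in> hom V ?P" "\<phi> ` carrier V = UNIV" "inj_on \<phi> (carrier V)"
    by (simp_all add: iso_def bij_betw_def)
  interpret \<phi>: group_hom V ?P \<phi>
    using \<phi>' V(1) P.is_group by (simp add: group_hom_def group_hom_axioms_def)
  have fin: "finite (carrier V)" using \<phi>'(2,3) by (metis finite finite_imageD)
  have ord: "order V = 3 ^ 5"
    using iso_same_card[OF V(2)] order_pc_group by (simp add: order_def)
  show f3: "finite_3_group V" using V(1) ord unfolding finite_3_group_def by blast
  have ker: "g \<in> commutator_subgroup V" if "g \<in> carrier V" "\<phi> g = (0, 0, 0, 0, 0)" for g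
  proof -
    have "g = \<one>\<^bsub>V\<^esub>" using \<phi>'(3) that \<phi>.hom_one V.one_closed by (auto simp: inj_on_def one_pc_group)
    then show ?thesis by (simp add: commutator_subgroup_def derived_def generate.one)
  qed
  interpret C: C3_C3_group V "\<lambda>x. fst (\<phi> x)" "\<lambda>x. fst (snd (\<phi> x))"
    by (rule C3_C3_group_of_hom[OF V(1) fin \<phi>'(1,2) ker])
  show "abelianization_C3_C3 V" by (rule C.abelianization_C3_C3)
  show "metabelian V" by (rule metabelian_iso[OF \<phi> V(1) P.is_group metabelian_pc_group])
  obtain \<sigma> where \<sigma>: "\<sigma> \<in> auto ?P" "\<And>v. fst (\<sigma> v) = - fst v" "\<And>v. fst (snd (\<sigma> v)) = - fst (snd v)"
    by (rule inverting_automorphism_pc_group[where p = p and q = q and k = k and l = l]) blast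
  have \<sigma>i: "\<sigma> \<in> iso ?P ?P" using \<sigma>(1) by (simp add: auto_def iso_def Bij_def)
  define \<psi> where "\<psi> = inv_into (carrier V) \<phi>"
  have \<psi>: "\<psi> \<in> iso ?P V" unfolding \<psi>_def by (rule V.iso_set_sym[OF \<phi>])
  \<comment> \<open>The restriction is due to \<open>auto\<close>, whose members are undefined
    outside the carrier.\<close>
  define \<tau> where "\<tau> = restrict (\<lambda>x. \<psi> (\<sigma> (\<phi> x))) (carrier V)"
  have "(\<psi> \<circ> (\<sigma> \<circ> \<phi>)) \<in> iso V V" by (intro iso_set_trans[OF iso_set_trans[OF \<phi> \<sigma>i] \<psi>])
  then have "\<tau> \<in> iso V V"
    by (rule V.iso_eq) (simp add: \<tau>_def)
  then have \<tau>: "\<tau> \<in> auto V"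
    by (simp add: auto_def Bij_def iso_def \<tau>_def)
  have \<phi>\<tau>: "\<phi> (\<tau> x) = \<sigma> (\<phi> x)" if "x \<in> carrier V" for x
    using that \<phi>'(2) unfolding \<tau>_def \<psi>_def by (simp add: f_inv_into_f)
  have "schur_sigma V (\<lambda>x. fst (\<phi> x)) (\<lambda>x. fst (snd (\<phi> x))) \<tau>"
    using \<tau> C.balanced_of_terminal[OF P \<phi>] C.C3_C3_group_axioms
    by (simp add: schur_sigma_def schur_sigma_axioms_def \<phi>\<tau> \<sigma>(2,3) auto_def)
  then show "schur_sigma_group V" using C.schur_sigma_iff f3 \<tau> by blast
qed

section \<open>Lower central series and descendants\<close>

context group
begin

lemma lower_central_Suc:
  "j \<noteq> 0 \<Longrightarrow> lower_central G (Suc j)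
    = generate G {x \<otimes> y \<otimes> inv x \<otimes> inv y | x y. x \<in> lower_central G j \<and> y \<in> carrier G}"
  by (cases j) simp_all

lemma normal_lower_central: "lower_central G j \<lhd> G"
proof (induction j)
  case 0
  show ?case by (simp add: normal_inv_iff subgroup_self)
next
  case (Suc j)
  show ?case
  proof (cases "j = 0")
    case True
    then show ?thesis by (simp add: normal_inv_iff subgroup_self)
  next
    case False
    interpret N: normal "lower_central G j" G by (rule Suc)
    have sub: "x \<in> carrier G" if "x \<in> lower_central G j" for x using that by (rule N.mem_carrier)
    show ?thesis
      unfolding lower_central_Suc[OF False]
    proof (rule normal_generateI)
      show "{x \<otimes> y \<otimes> inv x \<otimes> inv y | x y. x \<in> lower_central G j \<and> y \<in> carrier G} \<subseteq> carrier G"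
        using sub by auto
      fix h g assume h: "h \<in> {x \<otimes> y \<otimes> inv x \<otimes> inv y | x y. x \<in> lower_central G j \<and> y \<in> carrier G}"
        and g: "g \<in> carrier G"
      then obtain x y where xy: "x \<in> lower_central G j" "y \<in> carrier G" and h: "h = x \<otimes> y \<otimes> inv x \<otimes> inv y"
        by blast
      note cl = sub[OF xy(1)] xy(2) g
      have "g \<otimes> h \<otimes> inv g = (g \<otimes> x \<otimes> inv g) \<otimes> (g \<otimes> y \<otimes> inv g) \<otimes> inv (g \<otimes> x \<otimes> inv g) \<otimes> inv (g \<otimes> y \<otimes> inv g)"
        using cl unfolding h by (simp add: m_assoc inv_mult_group inv_solve_left) (simp add: m_assoc[symmetric])
      moreover have "g \<otimes> x \<otimes> inv g \<in> lower_central G j" by (rule N.inv_op_closed2[OF g xy(1)])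
      moreover have "g \<otimes> y \<otimes> inv g \<in> carrier G" using cl by simp
      ultimately show "g \<otimes> h \<otimes> inv g \<in> {x \<otimes> y \<otimes> inv x \<otimes> inv y | x y. x \<in> lower_central G j \<and> y \<in> carrier G}"
        by blast
    qed
  qed
qed

lemma subgroup_lower_central: "subgroup (lower_central G j) G"
  using normal_lower_central by (rule normal_imp_subgroup)

lemma lower_central_closed: "x \<in> lower_central G j \<Longrightarrow> x \<in> carrier G"
  by (rule subgroup.mem_carrier[OF subgroup_lower_central])

lemma commutator_in_lower_central:
  "j \<noteq> 0 \<Longrightarrow> x \<in> lower_central G j \<Longrightarrow> y \<in> carrier G \<Longrightarrow> x \<otimes> y \<otimes> inv x \<otimes> inv y \<in> lower_central G (Suc j)"
  unfolding lower_central_Suc by (rule generate.incl) blast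

lemma lower_central_Suc_subset:
  assumes "j \<noteq> 0" "subgroup M G"
    and "\<And>x y. x \<in> lower_central G j \<Longrightarrow> y \<in> carrier G \<Longrightarrow> x \<otimes> y \<otimes> inv x \<otimes> inv y \<in> M"
  shows "lower_central G (Suc j) \<subseteq> M"
  unfolding lower_central_Suc[OF assms(1)]
  by (rule generate_subgroup_incl[OF _ assms(2)]) (use assms(3) in blast)

lemma lower_central_decreasing: "lower_central G (Suc j) \<subseteq> lower_central G j"
proof (cases "j = 0")
  case False
  interpret N: normal "lower_central G j" G by (rule normal_lower_central)
  show ?thesis
  proof (rule lower_central_Suc_subset[OF False N.subgroup_axioms])
    fix x y assume xy: "x \<in> lower_central G j" "y \<in> carrier G"
    have "x \<otimes> (y \<otimes> inv x \<otimes> inv y) \<in> lower_central G j"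
      by (intro N.m_closed xy(1) N.inv_op_closed2 N.m_inv_closed xy(2))
    then show "x \<otimes> y \<otimes> inv x \<otimes> inv y \<in> lower_central G j"
      using xy N.mem_carrier by (simp add: m_assoc)
  qed
qed simp

lemma lower_central_antimono: "i \<le> j \<Longrightarrow> lower_central G j \<subseteq> lower_central G i"
  by (induction rule: dec_induct) (use lower_central_decreasing in blast)+

lemma lower_central_2: "lower_central G 2 = commutator_subgroup G"
proof -
  have "{x \<otimes> y \<otimes> inv x \<otimes> inv y | x y. x \<in> carrier G \<and> y \<in> carrier G} = derived_set G (carrier G)" by blast
  then show ?thesis
    by (simp add: numeral_2_eq_2 commutator_subgroup_def derived_def)
qed

lemma lower_central_central:
  assumes "j \<noteq> 0" "lower_central G (Suc j) = {\<one>}" "x \<in> lower_central G j" "y \<in> carrier G"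
  shows "x \<otimes> y = y \<otimes> x"
proof -
  have x: "x \<in> carrier G" by (rule lower_central_closed[OF assms(3)])
  have "x \<otimes> y \<otimes> inv x \<otimes> inv y = \<one>"
    using commutator_in_lower_central[OF assms(1,3,4)] assms(2) by simp
  then have "x \<otimes> y \<otimes> inv (y \<otimes> x) = \<one>" using x assms(4) by (simp add: inv_mult_group m_assoc)
  then show ?thesis using x assms(4) by (metis inv_equality inv_inv m_closed inv_closed)
qed

lemma nilpotency_classI:
  assumes "lower_central G (Suc c) = {\<one>}" "lower_central G c \<noteq> {\<one>}"
  shows "nilpotency_class G = c"
  unfolding nilpotency_class_def
proof (rule Least_equality)
  show "lower_central G (c + 1) = {\<one>}" using assms(1) by simp
  fix c' assume c': "lower_central G (c' + 1) = {\<one>}"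
  show "c \<le> c'"
  proof (rule ccontr)
    assume "\<not> c \<le> c'"
    then have "lower_central G c \<subseteq> {\<one>}" using lower_central_antimono[of "c' + 1" c] c' by simp
    then show False using assms(2) subgroup.one_closed[OF subgroup_lower_central[of c]] by blast
  qed
qed

text \<open>By \<open>finite_3_group_central_factor\<close> every nontrivial term properly contains
  the next one, so the trivial group is reached after at most \<open>order G\<close> steps.\<close>

lemma finite_3_group_nilpotent:
  assumes "order G = 3 ^ n"
  shows "lower_central G (nilpotency_class G + 1) = {\<one>}"
proof -
  have fin: "finite (carrier G)" using assms order_gt_0_iff_finite by simp
  have "lower_central G (j + 1) = {\<one>} \<or> card (lower_central G (j + 1)) + j \<le> order G" for j
  proof (induction j)
    case 0
    show ?case by (simp add: order_def)
  next
    case (Suc j)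
    let ?N = "lower_central G (j + 1)"
    have one: "\<one> \<in> lower_central G i" for i by (rule subgroup.one_closed[OF subgroup_lower_central])
    show ?case
    proof (cases "?N = {\<one>}")
      case True
      then have "lower_central G (Suc j + 1) \<subseteq> {\<one>}" using lower_central_decreasing[of "j + 1"] by simp
      with one show ?thesis by blast
    next
      case False
      obtain M where M: "M \<lhd> G" "M \<subset> ?N"
        and c: "\<And>h g. h \<in> ?N \<Longrightarrow> g \<in> carrier G \<Longrightarrow> M #> (h \<otimes> g) = M #> (g \<otimes> h)"
        using finite_3_group_central_factor[OF assms normal_lower_central False] by blast
      have "lower_central G (Suc (j + 1)) \<subseteq> M"
      proof (rule lower_central_Suc_subset)
        show "subgroup M G" using M(1) by (rule normal_imp_subgroup)
        fix x y assume xy: "x \<in> lower_central G (j + 1)" "y \<in> carrier G"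
        have x: "x \<in> carrier G" by (rule lower_central_closed[OF xy(1)])
        have "x \<otimes> y \<in> M #> (y \<otimes> x)"
          using c[OF xy] rcos_self[OF _ normal_imp_subgroup[OF M(1)], of "x \<otimes> y"] x xy(2) by simp
        then have "x \<otimes> y \<otimes> inv (y \<otimes> x) \<in> M"
          using subgroup.rcos_module[OF normal_imp_subgroup[OF M(1)] is_group] x xy(2) by simp
        then show "x \<otimes> y \<otimes> inv x \<otimes> inv y \<in> M" using x xy(2) by (simp add: inv_mult_group m_assoc)
      qed simp
      with M(2) have "lower_central G (Suc j + 1) \<subset> ?N" by auto
      moreover have "finite ?N" by (rule finite_subset[OF _ fin]) (use lower_central_closed in blast)
      ultimately have "card (lower_central G (Suc j + 1)) < card ?N" by (simp add: psubset_card_mono)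
      with Suc False show ?thesis by linarith
    qed
  qed
  from this[of "order G"] have "lower_central G (order G + 1) = {\<one>}"
  proof
    assume "card (lower_central G (order G + 1)) + order G \<le> order G"
    moreover have "finite (lower_central G (order G + 1))"
      by (rule finite_subset[OF _ fin]) (use lower_central_closed in blast)
    ultimately have "lower_central G (order G + 1) = {}" by simp
    then show ?thesis using subgroup.one_closed[OF subgroup_lower_central[of "order G + 1"]] by blast
  qed
  then show ?thesis unfolding nilpotency_class_def by (rule LeastI)
qed

text \<open>Collects what makes a group a central extension of its parent with kernel inside the
  commutator subgroup: the last nontrivial term \<open>Z\<close> of the series is central and lies
  in every earlier term.\<close>

lemma finite_3_group_last_term:
  assumes "order G = 3 ^ n" "lower_central G (Suc c) \<noteq> {\<one>}"
  defines "Z \<equiv> lower_central G (nilpotency_class G)"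
  shows "c < nilpotency_class G" "Z \<subseteq> lower_central G (Suc c)" "Z \<noteq> {\<one>}" "Z \<lhd> G"
    "\<And>z g. z \<in> Z \<Longrightarrow> g \<in> carrier G \<Longrightarrow> z \<otimes> g = g \<otimes> z"
proof -
  let ?c = "nilpotency_class G"
  have one: "\<one> \<in> lower_central G i" for i by (rule subgroup.one_closed[OF subgroup_lower_central])
  have end': "lower_central G (?c + 1) = {\<one>}" by (rule finite_3_group_nilpotent[OF assms(1)])
  show c: "c < ?c"
  proof (rule ccontr)
    assume "\<not> c < ?c"
    then have "lower_central G (Suc c) \<subseteq> {\<one>}" using lower_central_antimono[of "?c + 1" "Suc c"] end' by simp
    then show False using assms(2) one by blast
  qed
  show "Z \<subseteq> lower_central G (Suc c)" unfolding Z_def by (rule lower_central_antimono) (use c in simp)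
  show "Z \<lhd> G" unfolding Z_def by (rule normal_lower_central)
  show "z \<otimes> g = g \<otimes> z" if "z \<in> Z" "g \<in> carrier G" for z g
    by (rule lower_central_central[of ?c]) (use c end' that in \<open>simp_all add: Z_def\<close>)
  show "Z \<noteq> {\<one>}"
  proof
    assume "Z = {\<one>}"
    then have "lower_central G ((?c - 1) + 1) = {\<one>}" using c by (simp add: Z_def)
    then have "?c \<le> ?c - 1" unfolding nilpotency_class_def by (rule Least_le)
    then show False using c by simp
  qed
qed

end

lemma lower_central_image:
  assumes "\<phi> \<in> hom V W" "\<phi> ` carrier V = carrier W" "group V" "group W"
  shows "\<phi> ` lower_central V j = lower_central W j"
proof -
  interpret group_hom V W \<phi> using assms by (simp add: group_hom_def group_hom_axioms_def)
  show ?thesis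
  proof (induction j)
    case 0
    show ?case by (simp add: assms(2))
  next
    case (Suc j)
    show ?case
    proof (cases "j = 0")
      case True
      then show ?thesis by (simp add: assms(2))
    next
      case False
      let ?C = "\<lambda>G j. {x \<otimes>\<^bsub>G\<^esub> y \<otimes>\<^bsub>G\<^esub> inv\<^bsub>G\<^esub> x \<otimes>\<^bsub>G\<^esub> inv\<^bsub>G\<^esub> y | x y. x \<in> lower_central G j \<and> y \<in> carrier G}"
      have C: "?C V j \<subseteq> carrier V" using G.lower_central_closed by auto
      have h: "\<phi> (x \<otimes>\<^bsub>V\<^esub> y \<otimes>\<^bsub>V\<^esub> inv\<^bsub>V\<^esub> x \<otimes>\<^bsub>V\<^esub> inv\<^bsub>V\<^esub> y) = \<phi> x \<otimes>\<^bsub>W\<^esub> \<phi> y \<otimes>\<^bsub>W\<^esub> inv\<^bsub>W\<^esub> \<phi> x \<otimes>\<^bsub>W\<^esub> inv\<^bsub>W\<^esub> \<phi> y"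
        if "x \<in> lower_central V j" "y \<in> carrier V" for x y
        using that G.lower_central_closed[OF that(1)] by simp
      have "\<phi> ` ?C V j = ?C W j"
      proof (intro equalityI subsetI)
        fix w assume "w \<in> \<phi> ` ?C V j"
        then obtain v where v: "w = \<phi> v" "v \<in> ?C V j" by (rule imageE)
        then obtain x y where xy: "x \<in> lower_central V j" "y \<in> carrier V"
          and "v = x \<otimes>\<^bsub>V\<^esub> y \<otimes>\<^bsub>V\<^esub> inv\<^bsub>V\<^esub> x \<otimes>\<^bsub>V\<^esub> inv\<^bsub>V\<^esub> y"
          by blast
        then have w: "w = \<phi> x \<otimes>\<^bsub>W\<^esub> \<phi> y \<otimes>\<^bsub>W\<^esub> inv\<^bsub>W\<^esub> \<phi> x \<otimes>\<^bsub>W\<^esub> inv\<^bsub>W\<^esub> \<phi> y"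
          using v(1) h[OF xy] by (simp only:)
        have "\<phi> x \<in> lower_central W j" "\<phi> y \<in> carrier W"
          using imageI[OF xy(1), of \<phi>] Suc xy(2) by simp_all
        then show "w \<in> ?C W j" unfolding w mem_Collect_eq by blast
      next
        fix w assume "w \<in> ?C W j"
        then obtain x' y' where w: "x' \<in> lower_central W j" "y' \<in> carrier W" "w = x' \<otimes>\<^bsub>W\<^esub> y' \<otimes>\<^bsub>W\<^esub> inv\<^bsub>W\<^esub> x' \<otimes>\<^bsub>W\<^esub> inv\<^bsub>W\<^esub> y'"
          by blast
        obtain x where x: "x' = \<phi> x" "x \<in> lower_central V j" by (rule imageE[OF w(1)[folded Suc]])
        obtain y where y: "y' = \<phi> y" "y \<in> carrier V" by (rule imageE[OF w(2)[folded assms(2)]])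
        have "w = \<phi> (x \<otimes>\<^bsub>V\<^esub> y \<otimes>\<^bsub>V\<^esub> inv\<^bsub>V\<^esub> x \<otimes>\<^bsub>V\<^esub> inv\<^bsub>V\<^esub> y)"
          using w(3) h[OF x(2) y(2)] by (simp only: x(1) y(1))
        then show "w \<in> \<phi> ` ?C V j" by (rule image_eqI) (use x(2) y(2) in blast)
      qed
      then show ?thesis
        using generate_img[OF C] by (simp add: G.lower_central_Suc[OF False] H.lower_central_Suc[OF False])
    qed
  qed
qed

lemma nilpotency_class_iso:
  assumes "V \<cong> W" "group V" "group W"
  shows "nilpotency_class V = nilpotency_class W"
proof -
  obtain \<phi> where \<phi>: "\<phi> \<in> iso V W" using assms(1) by (auto simp: is_iso_def)
  interpret group_hom V W \<phi> using assms \<phi> by (simp add: group_hom_def group_hom_axioms_def iso_def)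
  have inj: "inj_on \<phi> (carrier V)" and onto: "\<phi> ` carrier V = carrier W" using \<phi> by (simp_all add: iso_def bij_betw_def)
  have "lower_central V j = {\<one>\<^bsub>V\<^esub>} \<longleftrightarrow> lower_central W j = {\<one>\<^bsub>W\<^esub>}" for j
  proof -
    have "\<phi> ` lower_central V j = lower_central W j" by (rule lower_central_image[OF homh onto assms(2,3)])
    moreover have "\<phi> ` lower_central V j = \<phi> ` {\<one>\<^bsub>V\<^esub>} \<longleftrightarrow> lower_central V j = {\<one>\<^bsub>V\<^esub>}"
      by (rule inj_on_image_eq_iff[OF inj]) (use G.lower_central_closed in auto)
    ultimately show ?thesis by simp
  qed
  then show ?thesis by (simp add: nilpotency_class_def)
qed

lemma parent_iso_of_hom:
  assumes \<phi>: "\<phi> \<in> hom V W" "\<phi> ` carrier V = carrier W" and V: "group V" "group W"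
    and ker: "kernel V W \<phi> = lower_central V (nilpotency_class V)"
  shows "parent V \<cong> W"
proof -
  interpret group_hom V W \<phi> using \<phi> V by (simp add: group_hom_def group_hom_axioms_def)
  show ?thesis unfolding parent_def ker[symmetric] by (rule FactGroup_iso[OF \<phi>(2)])
qed

lemma group_parent: "group V \<Longrightarrow> group (parent V)"
  unfolding parent_def by (rule normal.factorgroup_is_group[OF group.normal_lower_central])

lemma parent_projection:
  assumes "group V"
  defines "\<pi> \<equiv> \<lambda>x. lower_central V (nilpotency_class V) #>\<^bsub>V\<^esub> x"
  shows "\<pi> \<in> hom V (parent V)" "\<pi> ` carrier V = carrier (parent V)"
    "kernel V (parent V) \<pi> = lower_central V (nilpotency_class V)"
proof -
  interpret group V by fact
  let ?Z = "lower_central V (nilpotency_class V)"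
  interpret N: normal ?Z V by (rule normal_lower_central)
  show "\<pi> \<in> hom V (parent V)" unfolding \<pi>_def parent_def by (rule N.r_coset_hom_Mod)
  show "\<pi> ` carrier V = carrier (parent V)" by (auto simp: \<pi>_def parent_def FactGroup_def RCOSETS_def)
  show "kernel V (parent V) \<pi> = ?Z"
  proof (intro equalityI subsetI)
    fix x assume "x \<in> kernel V (parent V) \<pi>"
    then have x: "x \<in> carrier V" "?Z #>\<^bsub>V\<^esub> x = ?Z" by (simp_all add: kernel_def \<pi>_def parent_def FactGroup_def)
    then show "x \<in> ?Z" using rcos_self[OF x(1) N.subgroup_axioms] by simp
  next
    fix x assume x: "x \<in> ?Z"
    then show "x \<in> kernel V (parent V) \<pi>"
      using N.rcos_const[OF is_group x] N.mem_carrier[OF x] by (simp add: kernel_def \<pi>_def parent_def FactGroup_def)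
  qed
qed

lemma parent_cong:
  assumes "V \<cong> W" "group V" "group W"
  shows "parent V \<cong> parent W"
proof -
  obtain \<phi> where \<phi>: "\<phi> \<in> iso V W" using assms(1) by (auto simp: is_iso_def)
  interpret group_hom V W \<phi> using assms \<phi> by (simp add: group_hom_def group_hom_axioms_def iso_def)
  have inj: "inj_on \<phi> (carrier V)" and onto: "\<phi> ` carrier V = carrier W" using \<phi> by (simp_all add: iso_def bij_betw_def)
  let ?\<pi> = "\<lambda>x. lower_central W (nilpotency_class W) #>\<^bsub>W\<^esub> x"
  note \<pi> = parent_projection[OF assms(3)]
  have eq: "nilpotency_class V = nilpotency_class W" by (rule nilpotency_class_iso[OF assms])
  have img: "\<phi> ` lower_central V (nilpotency_class V) = lower_central W (nilpotency_class W)"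
    unfolding eq by (rule lower_central_image[OF homh onto assms(2,3)])
  show ?thesis
  proof (rule parent_iso_of_hom[OF Group.hom_compose[OF homh \<pi>(1)] _ assms(2) group_parent[OF assms(3)]])
    show "(?\<pi> \<circ> \<phi>) ` carrier V = carrier (parent W)"
      unfolding image_comp[symmetric] onto by (rule \<pi>(2))
    have "kernel V (parent W) (?\<pi> \<circ> \<phi>) = {x \<in> carrier V. \<phi> x \<in> kernel W (parent W) ?\<pi>}"
      by (auto simp: kernel_def)
    also have "\<dots> = {x \<in> carrier V. \<phi> x \<in> \<phi> ` lower_central V (nilpotency_class V)}"
      by (simp only: \<pi>(3) img)
    also have "\<dots> = lower_central V (nilpotency_class V)"
      using inj_on_image_mem_iff[OF inj] G.lower_central_closed by blast
    finally show "kernel V (parent W) (?\<pi> \<circ> \<phi>) = lower_central V (nilpotency_class V)" .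
  qed
qed

text \<open>Presentations state commutators as \<open>g h = h g r\<close>; in the convention of
  \<open>lower_central\<close> this \<open>r\<close> is the commutator of the inverses, and these
  lie in the same terms.\<close>

lemma (in group) swap_in_lower_central:
  assumes "j \<noteq> 0" "g \<in> lower_central G j" "h \<in> carrier G" "r \<in> carrier G" "g \<otimes> h = h \<otimes> g \<otimes> r"
  shows "r \<in> lower_central G (Suc j)"
proof -
  have g: "g \<in> carrier G" by (rule lower_central_closed[OF assms(2)])
  have "r = inv (h \<otimes> g) \<otimes> (g \<otimes> h)"
    unfolding assms(5) using m_assoc[of "inv (h \<otimes> g)" "h \<otimes> g" r] g assms(3,4) by simp
  also have "\<dots> = inv g \<otimes> inv h \<otimes> inv (inv g) \<otimes> inv (inv h)"
    using g assms(3) by (simp add: inv_mult_group m_assoc)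
  finally show ?thesis
    using commutator_in_lower_central[OF assms(1) subgroup.m_inv_closed[OF subgroup_lower_central assms(2)] inv_closed[OF assms(3)]]
    by simp
qed

lemma (in group) commutator_eq_one:
  "x \<in> carrier G \<Longrightarrow> y \<in> carrier G \<Longrightarrow> x \<otimes> y = y \<otimes> x \<Longrightarrow> x \<otimes> y \<otimes> inv x \<otimes> inv y = \<one>"
  by (simp add: m_assoc)

lemma (in group) lower_central_Suc_trivial:
  assumes "j \<noteq> 0" "\<And>x y. x \<in> lower_central G j \<Longrightarrow> y \<in> carrier G \<Longrightarrow> x \<otimes> y = y \<otimes> x"
  shows "lower_central G (Suc j) = {\<one>}"
proof
  show "lower_central G (Suc j) \<subseteq> {\<one>}"
  proof (rule lower_central_Suc_subset[OF assms(1) triv_subgroup])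
    fix x y assume xy: "x \<in> lower_central G j" "y \<in> carrier G"
    show "x \<otimes> y \<otimes> inv x \<otimes> inv y \<in> {\<one>}"
      using commutator_eq_one[OF lower_central_closed[OF xy(1)] xy(2) assms(2)[OF xy]] by (simp only: singleton_iff)
  qed
  show "{\<one>} \<subseteq> lower_central G (Suc j)"
    using subgroup.one_closed[OF subgroup_lower_central] by blast
qed

section \<open>Lower central series of the groups of order 27 and 243\<close>

lemma carrier_SG27_3 [simp]: "carrier SG27_3 = UNIV"
  by (simp add: SG27_3_def)

lemma one_SG27_3: "\<one>\<^bsub>SG27_3\<^esub> = (0, 0, 0)"
  by (simp add: SG27_3_def)

lemma mult_SG27_3: "(a, b, c) \<otimes>\<^bsub>SG27_3\<^esub> (a', b', c') = (a + a', b + b', c + c' + b * a')"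
  by (simp add: SG27_3_def)

lemma lower_central_SG27_3:
  "lower_central SG27_3 2 = {(0, 0, c) | c. True}" "lower_central SG27_3 3 = {(0, 0, 0)}"
proof -
  interpret group SG27_3 by (rule group_SG27_3)
  show g2: "lower_central SG27_3 2 = {(0, 0, c) | c. True}"
    by (simp only: lower_central_2 commutator_subgroup_SG27_3)
  have "lower_central SG27_3 (Suc 2) = {\<one>\<^bsub>SG27_3\<^esub>}"
  proof (rule lower_central_Suc_trivial)
    fix x y assume "x \<in> lower_central SG27_3 2"
    then show "x \<otimes>\<^bsub>SG27_3\<^esub> y = y \<otimes>\<^bsub>SG27_3\<^esub> x"
      unfolding g2 by (cases y) (auto simp: mult_SG27_3)
  qed simp
  moreover have "Suc 2 = 3" by simp
  ultimately show "lower_central SG27_3 3 = {(0, 0, 0)}" by (simp only: one_SG27_3)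
qed

lemma nilpotency_class_SG27_3: "nilpotency_class SG27_3 = 2"
proof -
  interpret group SG27_3 by (rule group_SG27_3)
  show ?thesis
  proof (rule nilpotency_classI)
    have "Suc 2 = 3" by simp
    then show "lower_central SG27_3 (Suc 2) = {\<one>\<^bsub>SG27_3\<^esub>}" by (simp only: lower_central_SG27_3(2) one_SG27_3)
    have "(0, 0, 1) \<in> lower_central SG27_3 2" by (simp add: lower_central_SG27_3(1))
    then show "lower_central SG27_3 2 \<noteq> {\<one>\<^bsub>SG27_3\<^esub>}" by (auto simp: one_SG27_3)
  qed
qed

definition pc_quotient :: "3 \<times> 3 \<times> 3 \<times> 3 \<times> 3 \<Rightarrow> 3 \<times> 3 \<times> 3" where
  "pc_quotient = (\<lambda>(a, b, c, d, e). (a, b, c))"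

lemma pc_quotient_hom: "pc_quotient \<in> hom (pc_group p q k l) SG27_3" "range pc_quotient = UNIV"
proof -
  show "pc_quotient \<in> hom (pc_group p q k l) SG27_3"
    by (rule homI) (auto simp: pc_quotient_def mult_pc_group mult_SG27_3)
  have "v = pc_quotient (fst v, fst (snd v), snd (snd v), 0, 0)" for v by (simp add: pc_quotient_def)
  then show "range pc_quotient = UNIV" by blast
qed

text \<open>The upper bound for the third term comes from the quotient \<open>SG27_3\<close>, whose
  third term is trivial; the lower bound comes from \<open>t\<close> and \<open>u\<close> being
  commutators with \<open>s\<close>.\<close>

lemma lower_central_pc_group:
  "lower_central (pc_group p q k l) 3 = {(0, 0, 0, d, e) | d e. True}"
  "lower_central (pc_group p q k l) 4 = {(0, 0, 0, 0, 0)}"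
proof -
  let ?P = "pc_group p q k l"
  interpret group ?P by (rule group_pc_group)
  show g3: "lower_central ?P 3 = {(0, 0, 0, d, e) | d e. True}"
  proof (intro equalityI subsetI)
    fix v assume v: "v \<in> lower_central ?P 3"
    have "pc_quotient ` lower_central ?P 3 = lower_central SG27_3 3"
      by (rule lower_central_image[OF pc_quotient_hom(1) _ is_group group_SG27_3]) (simp add: pc_quotient_hom(2))
    then have "pc_quotient v = (0, 0, 0)" using v lower_central_SG27_3(2) by blast
    then show "v \<in> {(0, 0, 0, d, e) | d e. True}" by (cases v) (simp add: pc_quotient_def)
  next
    fix v assume "v \<in> {(0::3, 0::3, 0::3, d::3, e::3) | d e. True}"
    then obtain d e where v: "v = (0, 0, 0, d, e)" by blast
    have s: "(0, 0, c, 0, 0) \<in> lower_central ?P 2" for c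
      by (simp add: lower_central_2 commutator_subgroup_pc_group)
    have t: "(0, 0, 0, d, 0) \<in> lower_central ?P (Suc 2)"
      by (rule swap_in_lower_central[OF _ s[of d], of "(1, 0, 0, 0, 0)"]) (simp_all add: mult_pc_group)
    have u: "(0, 0, 0, 0, e) \<in> lower_central ?P (Suc 2)"
      by (rule swap_in_lower_central[OF _ s[of e], of "(0, 1, 0, 0, 0)"]) (simp_all add: mult_pc_group)
    have "(0, 0, 0, d, 0) \<otimes>\<^bsub>?P\<^esub> (0, 0, 0, 0, e) \<in> lower_central ?P (Suc 2)"
      by (rule subgroup.m_closed[OF subgroup_lower_central t u])
    moreover have "Suc 2 = 3" by simp
    ultimately show "v \<in> lower_central ?P 3"
      by (simp only: v mult_pc_group) simp
  qed
  have "lower_central ?P (Suc 3) = {\<one>\<^bsub>?P\<^esub>}"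
  proof (rule lower_central_Suc_trivial)
    fix x y assume "x \<in> lower_central ?P 3"
    then show "x \<otimes>\<^bsub>?P\<^esub> y = y \<otimes>\<^bsub>?P\<^esub> x"
      unfolding g3 by (cases y) (auto simp: mult_pc_group)
  qed simp
  moreover have "Suc 3 = 4" by simp
  ultimately show "lower_central ?P 4 = {(0, 0, 0, 0, 0)}" by (simp only: one_pc_group)
qed

lemma nilpotency_class_pc_group: "nilpotency_class (pc_group p q k l) = 3"
proof (rule group.nilpotency_classI[OF group_pc_group])
  have "Suc 3 = (4::nat)" by simp
  then show "lower_central (pc_group p q k l) (Suc 3) = {\<one>\<^bsub>pc_group p q k l\<^esub>}"
    by (simp only: lower_central_pc_group(2) one_pc_group)
  have "(0, 0, 0, 1, 0) \<in> lower_central (pc_group p q k l) 3" by (simp add: lower_central_pc_group(1))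
  then show "lower_central (pc_group p q k l) 3 \<noteq> {\<one>\<^bsub>pc_group p q k l\<^esub>}" by (auto simp: one_pc_group)
qed

lemma has_coclass_pc_group: "has_coclass (pc_group p q k l) 2"
  unfolding has_coclass_def nilpotency_class_pc_group order_pc_group by (intro exI[of _ 5]) simp

lemma parent_pc_group: "parent (pc_group p q k l) \<cong> SG27_3"
proof (rule parent_iso_of_hom[OF pc_quotient_hom(1) _ group_pc_group group_SG27_3])
  show "kernel (pc_group p q k l) SG27_3 pc_quotient
      = lower_central (pc_group p q k l) (nilpotency_class (pc_group p q k l))"
    unfolding nilpotency_class_pc_group lower_central_pc_group
    by (auto simp: kernel_def pc_quotient_def one_SG27_3)
qed (simp add: pc_quotient_hom(2))

lemma parent_of_iso_pc_group:
  assumes "group V" "V \<cong> pc_group p q k l"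
  shows "SG27_3 \<cong> parent V"
  using iso_trans[OF parent_cong[OF assms(2,1) group_pc_group] parent_pc_group]
  by (rule group.iso_sym[OF group_parent[OF assms(1)]])

lemma not_comm_pc_group: "\<not> comm_group (pc_group p q k l)"
proof
  assume "comm_group (pc_group p q k l)"
  then interpret comm_group "pc_group p q k l" .
  have "(1, 0, 0, 0, 0) \<otimes>\<^bsub>pc_group p q k l\<^esub> (0, 1, 0, 0, 0) = (0, 1, 0, 0, 0) \<otimes>\<^bsub>pc_group p q k l\<^esub> (1, 0, 0, 0, 0)"
    by (rule m_comm) simp_all
  then show False by (simp add: mult_pc_group)
qed

lemma comm_group_iso:
  assumes "V \<cong> W" "comm_group V" "group W"
  shows "comm_group W"
proof -
  interpret V: comm_group V by fact
  interpret W: group W by fact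
  obtain \<phi> where \<phi>: "\<phi> \<in> hom V W" "\<phi> ` carrier V = carrier W"
    using assms(1) by (auto simp: is_iso_def iso_def bij_betw_def)
  show ?thesis
  proof (rule W.group_comm_groupI)
    fix x y assume "x \<in> carrier W" "y \<in> carrier W"
    then obtain x' y' where xy: "x' \<in> carrier V" "x = \<phi> x'" "y' \<in> carrier V" "y = \<phi> y'"
      using \<phi>(2) by (metis imageE)
    show "x \<otimes>\<^bsub>W\<^esub> y = y \<otimes>\<^bsub>W\<^esub> x"
      unfolding xy hom_mult[OF \<phi>(1) xy(1,3), symmetric] hom_mult[OF \<phi>(1) xy(3,1), symmetric]
      by (simp only: V.m_comm[OF xy(1,3)])
  qed
qed

lemma immediate_descendant_of_iso_pc_group:
  assumes "group V" "V \<cong> pc_group p q k l"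
  shows "immediate_descendant V SG27_3" "step_size V SG27_3 = 2"
proof -
  have ord: "order V = 3 ^ 5" using iso_same_card[OF assms(2)] order_pc_group by (simp add: order_def)
  have "finite_3_group V" using assms(1) ord unfolding finite_3_group_def by blast
  moreover have "\<not> comm_group V"
    using comm_group_iso[OF assms(2) _ group_pc_group] not_comm_pc_group by blast
  ultimately show "immediate_descendant V SG27_3"
    unfolding immediate_descendant_def using parent_of_iso_pc_group[OF assms] by blast
  have "real (order V) / real (order SG27_3) = 3 powr 2"
    by (simp add: ord order_SG27_3)
  then show "step_size V SG27_3 = 2" unfolding step_size_def by (simp only: log_powr_cancel)
qed

text \<open>An immediate descendant \<open>D\<close> would be a central extension whose kernel, the
  last nontrivial lower central term, lies in the commutator subgroup. The kernel would then be
  trivial by \<open>derived_inter_kernel_terminal\<close>.\<close>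

lemma terminal_of_iso_terminal:
  assumes P: "(p, q, k, l) \<in> terminal_params" and V: "group V" "V \<cong> pc_group p q k l"
  shows "terminal V"
  unfolding terminal_def
proof
  assume "\<exists>D :: nat monoid. immediate_descendant D V"
  then obtain D :: "nat monoid" where D: "finite_3_group D" "\<not> comm_group D" "V \<cong> parent D"
    unfolding immediate_descendant_def by blast
  interpret D: group D using D(1) by (simp add: finite_3_group_def)
  obtain n where n: "order D = 3 ^ n" using D(1) by (auto simp: finite_3_group_def)
  have "parent D \<cong> V" by (rule group.iso_sym[OF V(1) D(3)])
  then have "parent D \<cong> pc_group p q k l" using V(2) iso_trans by blast
  then obtain \<theta> where \<theta>: "\<theta> \<in> iso (parent D) (pc_group p q k l)" by (auto simp: is_iso_def)
  let ?\<pi> = "\<lambda>x. lower_central D (nilpotency_class D) #>\<^bsub>D\<^esub> x"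
  note \<pi> = parent_projection[OF D.is_group]
  have \<theta>': "\<theta> \<in> hom (parent D) (pc_group p q k l)" "\<theta> ` carrier (parent D) = UNIV" "inj_on \<theta> (carrier (parent D))"
    using \<theta> by (simp_all add: iso_def bij_betw_def)
  interpret \<theta>: group_hom "parent D" "pc_group p q k l" \<theta>
    using \<theta>'(1) group_parent[OF D.is_group] group_pc_group by (simp add: group_hom_def group_hom_axioms_def)
  have "lower_central D 2 \<noteq> {\<one>\<^bsub>D\<^esub>}"
  proof
    assume "lower_central D 2 = {\<one>\<^bsub>D\<^esub>}"
    then have "x \<otimes>\<^bsub>D\<^esub> y = y \<otimes>\<^bsub>D\<^esub> x" if "x \<in> carrier D" "y \<in> carrier D" for x y
      using D.lower_central_central[of 1 x y] that by (simp only: Suc_1) simp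
    then show False using D(2) D.group_comm_groupI by blast
  qed
  then have "lower_central D (Suc 1) \<noteq> {\<one>\<^bsub>D\<^esub>}" unfolding Suc_1 .
  note last = D.finite_3_group_last_term[OF n this]
  have ker: "x \<in> lower_central D (nilpotency_class D) \<longleftrightarrow> (\<theta> \<circ> ?\<pi>) x = (0, 0, 0, 0, 0)" if x: "x \<in> carrier D" for x
  proof -
    have c: "?\<pi> x \<in> carrier (parent D)" using \<pi>(2) x by blast
    have "x \<in> lower_central D (nilpotency_class D) \<longleftrightarrow> ?\<pi> x = \<one>\<^bsub>parent D\<^esub>"
      using x \<pi>(3) by (auto simp: kernel_def)
    also have "\<dots> \<longleftrightarrow> \<theta> (?\<pi> x) = \<one>\<^bsub>pc_group p q k l\<^esub>"
      using inj_on_eq_iff[OF \<theta>'(3) c \<theta>.G.one_closed] \<theta>.hom_one by simp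
    finally show ?thesis by (simp add: one_pc_group)
  qed
  have "pc_extension D (\<theta> \<circ> ?\<pi>) p q k l"
  proof (intro pc_extension.intro pc_extension_axioms.intro D.is_group)
    show "\<theta> \<circ> ?\<pi> \<in> hom D (pc_group p q k l)" by (rule Group.hom_compose[OF \<pi>(1) \<theta>'(1)])
    show "(\<theta> \<circ> ?\<pi>) ` carrier D = UNIV" unfolding image_comp[symmetric] \<pi>(2) by (rule \<theta>'(2))
    fix z g assume "z \<in> carrier D" "(\<theta> \<circ> ?\<pi>) z = (0, 0, 0, 0, 0)" "g \<in> carrier D"
    then show "z \<otimes>\<^bsub>D\<^esub> g = g \<otimes>\<^bsub>D\<^esub> z" using ker last(5) by blast
  qed
  note E = derived_inter_kernel_terminal[OF P this]
  have "z = \<one>\<^bsub>D\<^esub>" if z: "z \<in> lower_central D (nilpotency_class D)" for z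
  proof (rule E)
    show "z \<in> derived D (carrier D)"
      using z last(2) D.lower_central_2 unfolding commutator_subgroup_def Suc_1 by blast
    show "(\<theta> \<circ> ?\<pi>) z = (0, 0, 0, 0, 0)" using ker D.lower_central_closed[OF z] z by blast
  qed
  then have "lower_central D (nilpotency_class D) = {\<one>\<^bsub>D\<^esub>}"
    using subgroup.one_closed[OF D.subgroup_lower_central] by blast
  then show False using last(3) by blast
qed

section \<open>Descendants of order 243 of the extraspecial group\<close>

context group
begin

lemma inv_assoc: "x \<in> carrier G \<Longrightarrow> y \<in> carrier G \<Longrightarrow> inv x \<otimes> (x \<otimes> y) = y"
    "x \<in> carrier G \<Longrightarrow> y \<in> carrier G \<Longrightarrow> x \<otimes> (inv x \<otimes> y) = y"
  by (simp_all add: m_assoc[symmetric])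

text \<open>The preimage of the centralizer of the class of \<open>g\<close> in the quotient by
  \<open>T\<close>, described without the quotient.\<close>

lemma subgroup_centralizer_mod:
  assumes T: "T \<lhd> G" and g: "g \<in> carrier G"
  shows "subgroup {h \<in> carrier G. g \<otimes> h \<otimes> inv g \<otimes> inv h \<in> T} G"
proof -
  interpret T: normal T G by fact
  show ?thesis
  proof (rule subgroupI)
    have "\<one> \<in> {h \<in> carrier G. g \<otimes> h \<otimes> inv g \<otimes> inv h \<in> T}" using g by simp
    then show "{h \<in> carrier G. g \<otimes> h \<otimes> inv g \<otimes> inv h \<in> T} \<noteq> {}" by blast
    fix h assume h: "h \<in> {h \<in> carrier G. g \<otimes> h \<otimes> inv g \<otimes> inv h \<in> T}"
    have "inv h \<otimes> inv (g \<otimes> h \<otimes> inv g \<otimes> inv h) \<otimes> h \<in> T"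
      by (rule T.inv_op_closed1[OF _ T.m_inv_closed]) (use h in simp_all)
    moreover have "inv h \<otimes> inv (g \<otimes> h \<otimes> inv g \<otimes> inv h) \<otimes> h = g \<otimes> inv h \<otimes> inv g \<otimes> inv (inv h)"
      using g h by (simp add: inv_mult_group m_assoc inv_assoc)
    ultimately show "inv h \<in> {h \<in> carrier G. g \<otimes> h \<otimes> inv g \<otimes> inv h \<in> T}" using h by simp
    fix k assume k: "k \<in> {h \<in> carrier G. g \<otimes> h \<otimes> inv g \<otimes> inv h \<in> T}"
    have "(g \<otimes> h \<otimes> inv g \<otimes> inv h) \<otimes> (h \<otimes> (g \<otimes> k \<otimes> inv g \<otimes> inv k) \<otimes> inv h) \<in> T"
      by (rule T.m_closed[OF _ T.inv_op_closed2]) (use h k in simp_all)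
    moreover have "(g \<otimes> h \<otimes> inv g \<otimes> inv h) \<otimes> (h \<otimes> (g \<otimes> k \<otimes> inv g \<otimes> inv k) \<otimes> inv h)
        = g \<otimes> (h \<otimes> k) \<otimes> inv g \<otimes> inv (h \<otimes> k)"
      using g h k by (simp add: inv_mult_group m_assoc inv_assoc)
    ultimately show "h \<otimes> k \<in> {h \<in> carrier G. g \<otimes> h \<otimes> inv g \<otimes> inv h \<in> T}" using h k by simp
  qed blast
qed

lemma pw_in_subgroup: "subgroup H G \<Longrightarrow> g \<in> H \<Longrightarrow> pw G g r \<in> H"
  by (simp add: pw_def subgroup.one_closed subgroup.m_inv_closed)

text \<open>If \<open>r\<close> commutes with both factors, the two commutator conventions
  agree.\<close>

lemma swap_commutator:
  assumes "g \<in> carrier G" "h \<in> carrier G" "r \<in> carrier G" "g \<otimes> h = h \<otimes> g \<otimes> r"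
    and "r \<otimes> g = g \<otimes> r" "r \<otimes> h = h \<otimes> r"
  shows "g \<otimes> h \<otimes> inv g \<otimes> inv h = r"
proof -
  have "g \<otimes> h = r \<otimes> (h \<otimes> g)"
    using assms(1-3) unfolding assms(4) by (simp add: m_assoc assms(5)[symmetric]) (simp add: m_assoc[symmetric] assms(6))
  then have "g \<otimes> h \<otimes> inv g \<otimes> inv h = r \<otimes> (h \<otimes> g) \<otimes> inv g \<otimes> inv h" by (simp only:)
  then show ?thesis using assms(1-3) by (simp add: m_assoc)
qed

lemma inverse_commutator:
  assumes "subgroup T G" "g \<in> carrier G" "h \<in> carrier G" "g \<otimes> h \<otimes> inv g \<otimes> inv h \<in> T"
  shows "h \<otimes> g \<otimes> inv h \<otimes> inv g \<in> T"
proof -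
  have "inv (g \<otimes> h \<otimes> inv g \<otimes> inv h) \<in> T" by (rule subgroup.m_inv_closed[OF assms(1,4)])
  then show ?thesis using assms(2,3) by (simp add: inv_mult_group m_assoc)
qed

lemma subgroup_pw_pw:
  assumes "t \<in> carrier G" "u \<in> carrier G" "t \<otimes> t \<otimes> t = \<one>" "u \<otimes> u \<otimes> u = \<one>" "t \<otimes> u = u \<otimes> t"
  shows "subgroup {pw G t i \<otimes> pw G u j | i j. True} G"
proof (rule subgroupI)
  have tu: "pw G t i \<otimes> pw G u j = pw G u j \<otimes> pw G t i" for i j
    using assms by (intro pw_commute pw_commute[symmetric]) simp_all
  have mult: "(pw G t i \<otimes> pw G u j) \<otimes> (pw G t i' \<otimes> pw G u j') = pw G t (i + i') \<otimes> pw G u (j + j')" for i j i' j'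
    using assms tu[of i' j] commute_assoc[OF tu[of i' j]]
    by (simp add: pw_add m_assoc)
  show "{pw G t i \<otimes> pw G u j | i j. True} \<noteq> {}" by blast
  show "{pw G t i \<otimes> pw G u j | i j. True} \<subseteq> carrier G" using assms by auto
  fix g assume "g \<in> {pw G t i \<otimes> pw G u j | i j. True}"
  then obtain i j where g: "g = pw G t i \<otimes> pw G u j" by blast
  have "inv g = pw G t (- i) \<otimes> pw G u (- j)"
    by (rule inv_equality) (use assms mult[of "- i" "- j" i j] in \<open>simp_all add: g\<close>)
  then show "inv g \<in> {pw G t i \<otimes> pw G u j | i j. True}" by blast
  fix h assume "h \<in> {pw G t i \<otimes> pw G u j | i j. True}"
  then obtain i' j' where h: "h = pw G t i' \<otimes> pw G u j'" by blast
  show "g \<otimes> h \<in> {pw G t i \<otimes> pw G u j | i j. True}" unfolding g h mult by blast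
qed

end

lemma pw_SG27_3:
  "pw SG27_3 (1, 0, 0) r = (r, 0, 0)" "pw SG27_3 (0, 1, 0) r = (0, r, 0)" "pw SG27_3 (0, 0, 1) r = (0, 0, r)"
proof -
  interpret group SG27_3 by (rule group_SG27_3)
  have "inv\<^bsub>SG27_3\<^esub> (1, 0, 0) = (- 1, 0, 0)" "inv\<^bsub>SG27_3\<^esub> (0, 1, 0) = (0, - 1, 0)" "inv\<^bsub>SG27_3\<^esub> (0, 0, 1) = (0, 0, - 1)"
    by (rule inv_equality; simp add: mult_SG27_3 one_SG27_3)+
  then show "pw SG27_3 (1, 0, 0) r = (r, 0, 0)" "pw SG27_3 (0, 1, 0) r = (0, r, 0)" "pw SG27_3 (0, 0, 1) r = (0, 0, r)"
    using cases_3[of r] by (auto simp: one_SG27_3)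
qed

lemma (in group_hom) hom_pw: "g \<in> carrier G \<Longrightarrow> h (pw G g r) = pw H (h g) r"
  by (simp add: pw_def)

text \<open>Lifts \<open>x\<close>, \<open>y\<close> of the generators and their commutators
  \<open>s\<close>, \<open>t\<close>, \<open>u\<close> satisfy a presentation of
  \<open>pc_group\<close>, because the kernel is central and spanned by \<open>t\<close> and
  \<open>u\<close>. The order then turns the surjection from the presented group into an
  isomorphism.\<close>

lemma descendant_SG27_3_imp_pc_group:
  assumes W: "immediate_descendant W SG27_3" and ord: "order W = 3 ^ 5"
  obtains p q k l where "W \<cong> pc_group p q k l"
proof -
  interpret W: group W using W by (simp add: immediate_descendant_def finite_3_group_def)
  note \<pi>0 = parent_projection[OF W.is_group]
  have "parent W \<cong> SG27_3"
    using W by (intro group.iso_sym[OF group_SG27_3]) (simp add: immediate_descendant_def)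
  then obtain \<theta> where \<theta>: "\<theta> \<in> iso (parent W) SG27_3" by (auto simp: is_iso_def)
  have \<theta>': "\<theta> \<in> hom (parent W) SG27_3" "\<theta> ` carrier (parent W) = UNIV" "inj_on \<theta> (carrier (parent W))"
    using \<theta> by (simp_all add: iso_def bij_betw_def)
  interpret \<theta>: group_hom "parent W" SG27_3 \<theta>
    using \<theta>'(1) group_parent[OF W.is_group] group_SG27_3 by (simp add: group_hom_def group_hom_axioms_def)
  let ?Z = "lower_central W (nilpotency_class W)"
  define \<pi> where "\<pi> x = \<theta> (?Z #>\<^bsub>W\<^esub> x)" for x
  have \<pi>: "\<pi> \<in> hom W SG27_3" using Group.hom_compose[OF \<pi>0(1) \<theta>'(1)] unfolding \<pi>_def[abs_def] by (simp add: comp_def)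
  have onto: "\<pi> ` carrier W = UNIV"
    using \<theta>'(2) unfolding \<pi>0(2)[symmetric] by (simp add: \<pi>_def image_image)
  have ker: "\<pi> x = (0, 0, 0) \<longleftrightarrow> x \<in> ?Z" if x: "x \<in> carrier W" for x
  proof -
    have c: "?Z #>\<^bsub>W\<^esub> x \<in> carrier (parent W)" using \<pi>0(2) x by blast
    have "x \<in> ?Z \<longleftrightarrow> ?Z #>\<^bsub>W\<^esub> x = \<one>\<^bsub>parent W\<^esub>"
      using x \<pi>0(3) by (auto simp: kernel_def)
    also have "\<dots> \<longleftrightarrow> \<pi> x = \<one>\<^bsub>SG27_3\<^esub>"
      using inj_on_eq_iff[OF \<theta>'(3) c \<theta>.G.one_closed] \<theta>.hom_one by (simp add: \<pi>_def)
    finally show ?thesis by (simp add: one_SG27_3)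
  qed
  interpret \<pi>: group_hom W SG27_3 \<pi>
    using \<pi> W.is_group group_SG27_3 by (simp add: group_hom_def group_hom_axioms_def)
  have img: "\<pi> ` lower_central W j = lower_central SG27_3 j" for j
    by (rule lower_central_image[OF \<pi> _ W.is_group group_SG27_3]) (simp add: onto)
  \<comment> \<open>Otherwise the commutator subgroup would lie in the kernel, although it maps onto
    the nontrivial commutator subgroup of \<open>SG27_3\<close>.\<close>
  have c: "3 \<le> nilpotency_class W"
  proof (rule ccontr)
    assume "\<not> 3 \<le> nilpotency_class W"
    then have "lower_central W 2 \<subseteq> ?Z" by (intro W.lower_central_antimono) simp
    moreover have "(0, 0, 1) \<in> \<pi> ` lower_central W 2" unfolding img lower_central_SG27_3 by simp
    then obtain x where "x \<in> lower_central W 2" "\<pi> x = (0, 0, 1)" by auto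
    ultimately show False using ker[of x] W.lower_central_closed[of x 2] by auto
  qed
  have Z3: "?Z \<subseteq> lower_central W 3" by (rule W.lower_central_antimono[OF c])
  have Z: "lower_central W 3 \<subseteq> ?Z"
  proof
    fix x assume x: "x \<in> lower_central W 3"
    then have "\<pi> x \<in> lower_central SG27_3 3" using img by blast
    then show "x \<in> ?Z" using ker[OF W.lower_central_closed[OF x]] by (simp add: lower_central_SG27_3)
  qed
  have central: "z \<otimes>\<^bsub>W\<^esub> g = g \<otimes>\<^bsub>W\<^esub> z" if "z \<in> ?Z" "g \<in> carrier W" for z g
    by (rule W.lower_central_central[of "nilpotency_class W"])
      (use c W.finite_3_group_nilpotent[OF ord] that in simp_all)
  have Zc: "z \<in> carrier W" if "z \<in> ?Z" for z using that by (rule W.lower_central_closed)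
  have "(1, 0, 0) \<in> \<pi> ` carrier W" "(0, 1, 0) \<in> \<pi> ` carrier W" using onto by simp_all
  then obtain x y where x: "x \<in> carrier W" "\<pi> x = (1, 0, 0)" and y: "y \<in> carrier W" "\<pi> y = (0, 1, 0)"
    by (metis imageE)
  define s where "s = inv\<^bsub>W\<^esub> (x \<otimes>\<^bsub>W\<^esub> y) \<otimes>\<^bsub>W\<^esub> (y \<otimes>\<^bsub>W\<^esub> x)"
  define t where "t = inv\<^bsub>W\<^esub> (x \<otimes>\<^bsub>W\<^esub> s) \<otimes>\<^bsub>W\<^esub> (s \<otimes>\<^bsub>W\<^esub> x)"
  define u where "u = inv\<^bsub>W\<^esub> (y \<otimes>\<^bsub>W\<^esub> s) \<otimes>\<^bsub>W\<^esub> (s \<otimes>\<^bsub>W\<^esub> y)"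
  have sc: "s \<in> carrier W" using x y by (simp add: s_def)
  have tuc: "t \<in> carrier W" "u \<in> carrier W" using x y sc by (simp_all add: t_def u_def)
  have yx: "y \<otimes>\<^bsub>W\<^esub> x = x \<otimes>\<^bsub>W\<^esub> y \<otimes>\<^bsub>W\<^esub> s"
    unfolding s_def using x(1) y(1) by (intro W.inv_assoc(2)[symmetric]) simp_all
  have sx: "s \<otimes>\<^bsub>W\<^esub> x = x \<otimes>\<^bsub>W\<^esub> s \<otimes>\<^bsub>W\<^esub> t"
    unfolding t_def using x(1) sc by (intro W.inv_assoc(2)[symmetric]) simp_all
  have sy: "s \<otimes>\<^bsub>W\<^esub> y = y \<otimes>\<^bsub>W\<^esub> s \<otimes>\<^bsub>W\<^esub> u"
    unfolding u_def using y(1) sc by (intro W.inv_assoc(2)[symmetric]) simp_all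
  have \<pi>s: "\<pi> s = (0, 0, 1)"
  proof -
    have "\<pi> (y \<otimes>\<^bsub>W\<^esub> x) = \<pi> (x \<otimes>\<^bsub>W\<^esub> y \<otimes>\<^bsub>W\<^esub> s)" by (simp only: yx)
    then show ?thesis using x y sc by (cases "\<pi> s") (simp add: mult_SG27_3)
  qed
  have s2: "s \<in> lower_central W (Suc 1)"
    by (rule W.swap_in_lower_central[OF _ _ x(1) sc yx]) (simp_all add: y(1))
  have "t \<in> lower_central W (Suc 2)"
    by (rule W.swap_in_lower_central[OF _ _ x(1) tuc(1) sx]) (use s2 in \<open>simp_all only: Suc_1 zero_neq_numeral[symmetric] not_False_eq_True\<close>)
  then have tZ: "t \<in> ?Z" using Z by auto
  have "u \<in> lower_central W (Suc 2)"
    by (rule W.swap_in_lower_central[OF _ _ y(1) tuc(2) sy]) (use s2 in \<open>simp_all only: Suc_1 zero_neq_numeral[symmetric] not_False_eq_True\<close>)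
  then have uZ: "u \<in> ?Z" using Z by auto
  \<comment> \<open>Exponent 3 of \<open>SG27_3\<close> puts all cubes into the central kernel;
    collection against such cubes then makes \<open>s^3\<close>, \<open>t^3\<close> and
    \<open>u^3\<close> trivial.\<close>
  have cube: "g \<otimes>\<^bsub>W\<^esub> g \<otimes>\<^bsub>W\<^esub> g \<in> ?Z" if "g \<in> carrier W" for g
    using that exponent_SG27_3[of "\<pi> g"] by (intro ker[THEN iffD1]) (simp_all add: one_SG27_3)
  have cancel: "z = \<one>\<^bsub>W\<^esub>" if "g \<otimes>\<^bsub>W\<^esub> h = h \<otimes>\<^bsub>W\<^esub> (g \<otimes>\<^bsub>W\<^esub> z)" "h \<in> ?Z" "g \<in> carrier W" "z \<in> carrier W" for g h z
  proof -
    have "h \<otimes>\<^bsub>W\<^esub> (g \<otimes>\<^bsub>W\<^esub> z) = h \<otimes>\<^bsub>W\<^esub> g"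
      using that(1) central[OF that(2,3)] by simp
    then have "g \<otimes>\<^bsub>W\<^esub> z = g"
      by (rule W.l_cancel) (use that Zc[OF that(2)] in simp_all)
    then show ?thesis using that(3,4) by simp
  qed
  have t3: "t \<otimes>\<^bsub>W\<^esub> t \<otimes>\<^bsub>W\<^esub> t = \<one>\<^bsub>W\<^esub>"
  proof (rule cancel[OF _ cube[OF x(1)] sc])
    show "s \<otimes>\<^bsub>W\<^esub> (x \<otimes>\<^bsub>W\<^esub> x \<otimes>\<^bsub>W\<^esub> x) = x \<otimes>\<^bsub>W\<^esub> x \<otimes>\<^bsub>W\<^esub> x \<otimes>\<^bsub>W\<^esub> (s \<otimes>\<^bsub>W\<^esub> (t \<otimes>\<^bsub>W\<^esub> t \<otimes>\<^bsub>W\<^esub> t))"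
    proof -
      have "t \<otimes>\<^bsub>W\<^esub> x = x \<otimes>\<^bsub>W\<^esub> t \<otimes>\<^bsub>W\<^esub> \<one>\<^bsub>W\<^esub>" using central[OF tZ x(1)] x tuc by simp
      from W.power_swap_right[OF sc x(1) tuc(1) W.one_closed sx this] show ?thesis using x(1) sc tuc by simp
    qed
  qed (simp add: tuc)
  have u3: "u \<otimes>\<^bsub>W\<^esub> u \<otimes>\<^bsub>W\<^esub> u = \<one>\<^bsub>W\<^esub>"
  proof (rule cancel[OF _ cube[OF y(1)] sc])
    show "s \<otimes>\<^bsub>W\<^esub> (y \<otimes>\<^bsub>W\<^esub> y \<otimes>\<^bsub>W\<^esub> y) = y \<otimes>\<^bsub>W\<^esub> y \<otimes>\<^bsub>W\<^esub> y \<otimes>\<^bsub>W\<^esub> (s \<otimes>\<^bsub>W\<^esub> (u \<otimes>\<^bsub>W\<^esub> u \<otimes>\<^bsub>W\<^esub> u))"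
    proof -
      have "u \<otimes>\<^bsub>W\<^esub> y = y \<otimes>\<^bsub>W\<^esub> u \<otimes>\<^bsub>W\<^esub> \<one>\<^bsub>W\<^esub>" using central[OF uZ y(1)] y tuc by simp
      from W.power_swap_right[OF sc y(1) tuc(2) W.one_closed sy this] show ?thesis using y(1) sc tuc by simp
    qed
  qed (simp add: tuc)
  have s3: "s \<otimes>\<^bsub>W\<^esub> s \<otimes>\<^bsub>W\<^esub> s = \<one>\<^bsub>W\<^esub>"
  proof (rule cancel[OF _ cube[OF x(1)] y(1)])
    show "y \<otimes>\<^bsub>W\<^esub> (x \<otimes>\<^bsub>W\<^esub> x \<otimes>\<^bsub>W\<^esub> x) = x \<otimes>\<^bsub>W\<^esub> x \<otimes>\<^bsub>W\<^esub> x \<otimes>\<^bsub>W\<^esub> (y \<otimes>\<^bsub>W\<^esub> (s \<otimes>\<^bsub>W\<^esub> s \<otimes>\<^bsub>W\<^esub> s))"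
      using W.power_swap_right[OF y(1) x(1) sc tuc(1) yx sx central[OF tZ x(1)] central[OF tZ sc]]
        x(1) y(1) sc by (simp add: t3)
  qed (simp add: sc)
  \<comment> \<open>The subgroup generated by \<open>t\<close> and \<open>u\<close>. It remains to
    show that it is the whole kernel, since only then are the cubes of \<open>x\<close> and
    \<open>y\<close> words in \<open>t\<close> and \<open>u\<close>.\<close>
  define T where "T = {pw W t i \<otimes>\<^bsub>W\<^esub> pw W u j | i j. True}"
  have T: "subgroup T W"
    unfolding T_def by (rule W.subgroup_pw_pw[OF tuc t3 u3 central[OF tZ tuc(2)]])
  have TZ: "T \<subseteq> ?Z"
    using subgroup.m_closed[OF W.subgroup_lower_central] W.pw_in_subgroup[OF W.subgroup_lower_central] tZ uZ
    unfolding T_def by auto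
  have "T \<lhd> W"
  proof (rule W.normal_invI[OF T])
    fix g z assume g: "g \<in> carrier W" and z: "z \<in> T"
    have zZ: "z \<in> ?Z" using z TZ by blast
    have "g \<otimes>\<^bsub>W\<^esub> z \<otimes>\<^bsub>W\<^esub> inv\<^bsub>W\<^esub> g = z"
      using g Zc[OF zZ] by (simp add: central[OF zZ g, symmetric] W.m_assoc)
    then show "g \<otimes>\<^bsub>W\<^esub> z \<otimes>\<^bsub>W\<^esub> inv\<^bsub>W\<^esub> g \<in> T" using z by simp
  qed
  note K = W.subgroup_centralizer_mod[OF this]
  have tT: "t \<in> T" and uT: "u \<in> T"
  proof -
    have "t = pw W t 1 \<otimes>\<^bsub>W\<^esub> pw W u 0" "u = pw W t 0 \<otimes>\<^bsub>W\<^esub> pw W u 1" using tuc by simp_all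
    then show "t \<in> T" "u \<in> T" unfolding T_def by blast+
  qed
  have T1: "\<one>\<^bsub>W\<^esub> \<in> T" by (rule subgroup.one_closed[OF T])
  \<comment> \<open>An element is determined by its image in \<open>SG27_3\<close> up to the
    kernel.\<close>
  have normal_form: "\<exists>a b c. \<exists>z\<in>?Z. h = pw W x a \<otimes>\<^bsub>W\<^esub> pw W y b \<otimes>\<^bsub>W\<^esub> pw W s c \<otimes>\<^bsub>W\<^esub> z \<and> \<pi> h = (a, b, c)"
    if h: "h \<in> carrier W" for h
  proof -
    obtain a b c where abc: "\<pi> h = (a, b, c)" by (cases "\<pi> h")
    let ?g = "pw W x a \<otimes>\<^bsub>W\<^esub> pw W y b \<otimes>\<^bsub>W\<^esub> pw W s c"
    have g: "?g \<in> carrier W" using x y sc by simp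
    have "\<pi> ?g = (a, b, c)"
      using x y sc by (simp add: \<pi>.hom_pw \<pi>s pw_SG27_3 mult_SG27_3)
    then have "\<pi> (inv\<^bsub>W\<^esub> ?g \<otimes>\<^bsub>W\<^esub> h) = \<one>\<^bsub>SG27_3\<^esub>" using g h abc by simp
    then have "inv\<^bsub>W\<^esub> ?g \<otimes>\<^bsub>W\<^esub> h \<in> ?Z" unfolding one_SG27_3 by (rule ker[THEN iffD1, rotated]) (intro W.m_closed W.inv_closed g h)
    moreover have "h = ?g \<otimes>\<^bsub>W\<^esub> (inv\<^bsub>W\<^esub> ?g \<otimes>\<^bsub>W\<^esub> h)" by (rule W.inv_assoc(2)[OF g h, symmetric])
    ultimately show ?thesis using abc by blast
  qed
  have whole: "carrier W \<subseteq> H" if H: "subgroup H W" "x \<in> H" "y \<in> H" "s \<in> H" "?Z \<subseteq> H" for H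
  proof
    fix h assume "h \<in> carrier W"
    then obtain a b c z where "z \<in> ?Z" "h = pw W x a \<otimes>\<^bsub>W\<^esub> pw W y b \<otimes>\<^bsub>W\<^esub> pw W s c \<otimes>\<^bsub>W\<^esub> z"
      using normal_form by blast
    then show "h \<in> H" using H by (auto intro!: subgroup.m_closed[OF H(1)] W.pw_in_subgroup[OF H(1)])
  qed
  \<comment> \<open>Modulo \<open>T\<close> the element \<open>s\<close> commutes with
    \<open>x\<close>, \<open>y\<close>, itself and the central kernel, hence with
    everything.\<close>
  have s_comm: "s \<otimes>\<^bsub>W\<^esub> h \<otimes>\<^bsub>W\<^esub> inv\<^bsub>W\<^esub> s \<otimes>\<^bsub>W\<^esub> inv\<^bsub>W\<^esub> h \<in> T" if h: "h \<in> carrier W" for h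
  proof -
    have "carrier W \<subseteq> {h \<in> carrier W. s \<otimes>\<^bsub>W\<^esub> h \<otimes>\<^bsub>W\<^esub> inv\<^bsub>W\<^esub> s \<otimes>\<^bsub>W\<^esub> inv\<^bsub>W\<^esub> h \<in> T}"
    proof (rule whole[OF K[OF sc]])
      have "s \<otimes>\<^bsub>W\<^esub> x \<otimes>\<^bsub>W\<^esub> inv\<^bsub>W\<^esub> s \<otimes>\<^bsub>W\<^esub> inv\<^bsub>W\<^esub> x = t"
        by (rule W.swap_commutator[OF sc x(1) tuc(1) sx central[OF tZ sc] central[OF tZ x(1)]])
      then show "x \<in> {h \<in> carrier W. s \<otimes>\<^bsub>W\<^esub> h \<otimes>\<^bsub>W\<^esub> inv\<^bsub>W\<^esub> s \<otimes>\<^bsub>W\<^esub> inv\<^bsub>W\<^esub> h \<in> T}" using x(1) tT by simp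
      have "s \<otimes>\<^bsub>W\<^esub> y \<otimes>\<^bsub>W\<^esub> inv\<^bsub>W\<^esub> s \<otimes>\<^bsub>W\<^esub> inv\<^bsub>W\<^esub> y = u"
        by (rule W.swap_commutator[OF sc y(1) tuc(2) sy central[OF uZ sc] central[OF uZ y(1)]])
      then show "y \<in> {h \<in> carrier W. s \<otimes>\<^bsub>W\<^esub> h \<otimes>\<^bsub>W\<^esub> inv\<^bsub>W\<^esub> s \<otimes>\<^bsub>W\<^esub> inv\<^bsub>W\<^esub> h \<in> T}" using y(1) uT by simp
      show "s \<in> {h \<in> carrier W. s \<otimes>\<^bsub>W\<^esub> h \<otimes>\<^bsub>W\<^esub> inv\<^bsub>W\<^esub> s \<otimes>\<^bsub>W\<^esub> inv\<^bsub>W\<^esub> h \<in> T}"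
        using sc T1 W.commutator_eq_one[OF sc sc] by simp
      show "?Z \<subseteq> {h \<in> carrier W. s \<otimes>\<^bsub>W\<^esub> h \<otimes>\<^bsub>W\<^esub> inv\<^bsub>W\<^esub> s \<otimes>\<^bsub>W\<^esub> inv\<^bsub>W\<^esub> h \<in> T}"
        using T1 W.commutator_eq_one[OF sc Zc central[symmetric, OF _ sc]] Zc by (simp add: subset_iff)
    qed
    with h show ?thesis by blast
  qed
  \<comment> \<open>Elements of the second term are powers of \<open>s\<close> times central
    elements, so their commutators lie in \<open>T\<close>.\<close>
  have "lower_central W (Suc 2) \<subseteq> T"
  proof (rule W.lower_central_Suc_subset[OF _ T])
    fix g h assume g: "g \<in> lower_central W 2" and h: "h \<in> carrier W"
    have gc: "g \<in> carrier W" by (rule W.lower_central_closed[OF g])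
    have "\<pi> g \<in> lower_central SG27_3 2" using g img by blast
    then obtain c where "\<pi> g = (0, 0, c)" by (auto simp: lower_central_SG27_3)
    then obtain z where z: "z \<in> ?Z" and gz: "g = pw W s c \<otimes>\<^bsub>W\<^esub> z" using normal_form[OF gc] sc by auto
    have "pw W s c \<otimes>\<^bsub>W\<^esub> z \<in> {g \<in> carrier W. h \<otimes>\<^bsub>W\<^esub> g \<otimes>\<^bsub>W\<^esub> inv\<^bsub>W\<^esub> h \<otimes>\<^bsub>W\<^esub> inv\<^bsub>W\<^esub> g \<in> T}"
    proof (intro subgroup.m_closed[OF K[OF h]] W.pw_in_subgroup[OF K[OF h]])
      show "s \<in> {g \<in> carrier W. h \<otimes>\<^bsub>W\<^esub> g \<otimes>\<^bsub>W\<^esub> inv\<^bsub>W\<^esub> h \<otimes>\<^bsub>W\<^esub> inv\<^bsub>W\<^esub> g \<in> T}"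
        using sc W.inverse_commutator[OF T sc h s_comm[OF h]] by simp
      show "z \<in> {g \<in> carrier W. h \<otimes>\<^bsub>W\<^esub> g \<otimes>\<^bsub>W\<^esub> inv\<^bsub>W\<^esub> h \<otimes>\<^bsub>W\<^esub> inv\<^bsub>W\<^esub> g \<in> T}"
        using T1 Zc[OF z] W.commutator_eq_one[OF h Zc[OF z] central[symmetric, OF z h]] by simp
    qed
    then show "g \<otimes>\<^bsub>W\<^esub> h \<otimes>\<^bsub>W\<^esub> inv\<^bsub>W\<^esub> g \<otimes>\<^bsub>W\<^esub> inv\<^bsub>W\<^esub> h \<in> T"
      using W.inverse_commutator[OF T h gc] by (simp add: gz)
  qed simp
  then have ZT: "?Z \<subseteq> T" using Z3 by auto
  obtain p q where pq: "x \<otimes>\<^bsub>W\<^esub> x \<otimes>\<^bsub>W\<^esub> x = pw W t p \<otimes>\<^bsub>W\<^esub> pw W u q" using cube[OF x(1)] ZT unfolding T_def by blast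
  obtain k l where kl: "y \<otimes>\<^bsub>W\<^esub> y \<otimes>\<^bsub>W\<^esub> y = pw W t k \<otimes>\<^bsub>W\<^esub> pw W u l" using cube[OF y(1)] ZT unfolding T_def by blast
  obtain \<psi> where \<psi>: "\<psi> \<in> hom (pc_group p q k l) W" "\<psi> (1, 0, 0, 0, 0) = x" "\<psi> (0, 1, 0, 0, 0) = y"
    using W.pc_group_hom[OF x(1) y(1) sc tuc yx sx sy central[OF tZ x(1)] central[OF tZ y(1)]
        central[OF uZ x(1)] central[OF uZ y(1)] s3 t3 u3 pq kl] by blast
  interpret \<psi>: group_hom "pc_group p q k l" W \<psi>
    using \<psi>(1) W.is_group group_pc_group by (simp add: group_hom_def group_hom_axioms_def)
  let ?I = "\<psi> ` carrier (pc_group p q k l)"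
  have I: "subgroup ?I W" by (rule \<psi>.img_is_subgroup)
  have xI: "x \<in> ?I" and yI: "y \<in> ?I" using \<psi>(2,3) by (metis UNIV_I carrier_pc_group imageI)+
  have sI: "s \<in> ?I" unfolding s_def by (intro subgroup.m_closed[OF I] subgroup.m_inv_closed[OF I] xI yI)
  have tI: "t \<in> ?I" unfolding t_def by (intro subgroup.m_closed[OF I] subgroup.m_inv_closed[OF I] xI sI)
  have uI: "u \<in> ?I" unfolding u_def by (intro subgroup.m_closed[OF I] subgroup.m_inv_closed[OF I] yI sI)
  have "T \<subseteq> ?I"
    unfolding T_def using subgroup.m_closed[OF I W.pw_in_subgroup[OF I tI] W.pw_in_subgroup[OF I uI]] by blast
  then have "carrier W \<subseteq> ?I" using ZT by (intro whole I xI yI sI) blast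
  then have "?I = carrier W" using subgroup.subset[OF I] by blast
  then have "\<psi> \<in> iso (pc_group p q k l) W"
    by (intro hom_onto_imp_iso[OF \<psi>(1)]) (simp_all add: ord order_pc_group)
  then have "pc_group p q k l \<cong> W" by (auto simp: is_iso_def)
  then show ?thesis by (rule that[OF group.iso_sym[OF group_pc_group]])
qed

section \<open>Descendants of order 729 and terminality\<close>

lemma nat_copy:
  assumes "group G" "finite (carrier G)"
  obtains H :: "nat monoid" where "group H" "G \<cong> H"
proof -
  interpret group G by fact
  obtain f :: "_ \<Rightarrow> nat" where "inj_on f (carrier G)"
    using finite_imp_inj_to_nat_seg[OF assms(2)] by blast
  then show ?thesis
    using inj_imp_image_group_is_group inj_imp_image_group_iso by (intro that) (auto simp: is_iso_def)
qed

lemma finite_3_group_iso: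
  assumes "finite_3_group V" "V \<cong> W" "group W"
  shows "finite_3_group W"
  using assms iso_same_card[OF assms(2)] by (simp add: finite_3_group_def order_def)

lemma immediate_descendant_cong:
  assumes "V \<cong> V'" "W \<cong> W'" "group V" "group V'" "group W" "group W'" "immediate_descendant V W"
  shows "immediate_descendant V' W'"
proof -
  have V: "V' \<cong> V" by (rule group.iso_sym[OF assms(3,1)])
  have W: "W' \<cong> W" by (rule group.iso_sym[OF assms(5,2)])
  have "W' \<cong> parent V'"
    using iso_trans[OF W iso_trans[OF _ parent_cong[OF assms(1,3,4)]]] assms(7)
    by (simp add: immediate_descendant_def)
  moreover have "\<not> comm_group V'"
    using comm_group_iso[OF V _ assms(3)] assms(7) by (auto simp: immediate_descendant_def)
  ultimately show ?thesis
    using finite_3_group_iso[OF _ assms(1,4)] assms(7) by (simp add: immediate_descendant_def)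
qed

lemma not_terminalI:
  assumes "immediate_descendant D W" "group W" "group V" "V \<cong> W"
  shows "\<not> terminal V"
proof -
  have D: "group D" using assms(1) by (simp add: immediate_descendant_def finite_3_group_def)
  have "finite (carrier D)"
    using assms(1) monoid.order_gt_0_iff_finite[OF group.is_monoid[OF D]]
    by (auto simp: immediate_descendant_def finite_3_group_def)
  then obtain D' :: "nat monoid" where D': "group D'" "D \<cong> D'" by (rule nat_copy[OF D])
  have "immediate_descendant D' V"
    by (rule immediate_descendant_cong[OF D'(2) group.iso_sym[OF assms(3,4)] D D'(1) assms(2,3,1)])
  then show ?thesis unfolding terminal_def by blast
qed

text \<open>The two values of \<open>f\<close> differ, so lifts of \<open>g\<close> and
  \<open>h\<close> no longer commute. Their commutator is a nontrivial element of the kernel and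
  lies in the fourth term, which therefore is the whole kernel of order 3.\<close>

lemma ext_group_descendant:
  assumes f: "cocycle (pc_group p q k l) f" and g: "g \<in> lower_central (pc_group p q k l) 3"
    and gh: "g \<otimes>\<^bsub>pc_group p q k l\<^esub> h = h \<otimes>\<^bsub>pc_group p q k l\<^esub> g" and ne: "f g h \<noteq> f h g"
  shows "immediate_descendant (ext_group (pc_group p q k l) f) (pc_group p q k l)"
proof -
  let ?P = "pc_group p q k l" and ?D = "ext_group (pc_group p q k l) f"
  interpret P: group ?P by (rule group_pc_group)
  interpret D: group ?D by (rule P.group_ext_group[OF f])
  interpret fst: group_hom ?D ?P fst
    using fst_hom_ext_group D.is_group P.is_group by (simp add: group_hom_def group_hom_axioms_def)
  have onto: "fst ` carrier ?D = carrier ?P" by (simp add: fst_image_times)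
  note img = lower_central_image[OF fst_hom_ext_group onto D.is_group P.is_group]
  define f1 where "f1 = f \<one>\<^bsub>?P\<^esub> \<one>\<^bsub>?P\<^esub>"
  have f1: "f \<one>\<^bsub>?P\<^esub> v = f1" "f v \<one>\<^bsub>?P\<^esub> = f1" for v
    using P.cocycle_one[OF f, of v] by (simp_all add: f1_def)
  have one: "\<one>\<^bsub>?D\<^esub> = (\<one>\<^bsub>?P\<^esub>, - f1)" by (simp add: one_ext_group f1_def)
  define w where "w = f g h - f h g"
  have "g \<in> fst ` lower_central ?D 3" using img g by simp
  then obtain m where G: "(g, m) \<in> lower_central ?D 3" by auto
  \<comment> \<open>The kernel element with value \<open>w\<close> is written with second entry
    \<open>w - f1\<close>, because the unit of the extension has second entry
    \<open>- f1\<close>.\<close>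
  have swap: "(g, m) \<otimes>\<^bsub>?D\<^esub> (h, 0) = (h, 0) \<otimes>\<^bsub>?D\<^esub> (g, m) \<otimes>\<^bsub>?D\<^esub> (\<one>\<^bsub>?P\<^esub>, w - f1)"
    using P.r_one[of "h \<otimes>\<^bsub>?P\<^esub> g"] by (simp add: mult_ext_group gh f1 w_def)
  have "(\<one>\<^bsub>?P\<^esub>, w - f1) \<in> lower_central ?D (Suc 3)"
    by (rule D.swap_in_lower_central[OF _ G _ _ swap]) simp_all
  then have r: "(\<one>\<^bsub>?P\<^esub>, w - f1) \<in> lower_central ?D 4" by simp
  have r1: "(\<one>\<^bsub>?P\<^esub>, w - f1) \<noteq> \<one>\<^bsub>?D\<^esub>" using ne by (simp add: one w_def)
  have sub: "\<exists>v. z = (\<one>\<^bsub>?P\<^esub>, v)" if "z \<in> lower_central ?D 4" for z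
  proof -
    have "fst z \<in> lower_central ?P 4" using img that by blast
    then show ?thesis by (cases z) (simp add: lower_central_pc_group one_pc_group)
  qed
  have "lower_central ?D (Suc 4) = {\<one>\<^bsub>?D\<^esub>}"
  proof (rule D.lower_central_Suc_trivial)
    fix x y assume x: "x \<in> lower_central ?D 4" and y: "y \<in> carrier ?D"
    obtain v where "x = (\<one>\<^bsub>?P\<^esub>, v)" using sub[OF x] by blast
    then show "x \<otimes>\<^bsub>?D\<^esub> y = y \<otimes>\<^bsub>?D\<^esub> x"
      using P.l_one[of "fst y"] P.r_one[of "fst y"] by (cases y) (simp add: mult_ext_group f1)
  qed simp
  then have cls: "nilpotency_class ?D = 4"
    by (rule D.nilpotency_classI) (use r r1 in blast)
  have "kernel ?D ?P fst = lower_central ?D 4"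
  proof (intro equalityI subsetI)
    fix z assume "z \<in> lower_central ?D 4"
    then obtain v where "z = (\<one>\<^bsub>?P\<^esub>, v)" using sub by blast
    then show "z \<in> kernel ?D ?P fst" by (simp add: kernel_def)
  next
    fix z assume "z \<in> kernel ?D ?P fst"
    then obtain v where "z = (\<one>\<^bsub>?P\<^esub>, v)" by (cases z) (simp add: kernel_def)
    then have "z = (\<one>\<^bsub>?P\<^esub>, (v + f1) - f1)" by simp
    then obtain i where z: "z = (\<one>\<^bsub>?P\<^esub>, i - f1)" by blast
    have mult: "(\<one>\<^bsub>?P\<^esub>, i - f1) \<otimes>\<^bsub>?D\<^esub> (\<one>\<^bsub>?P\<^esub>, j - f1) = (\<one>\<^bsub>?P\<^esub>, (i + j) - f1)" for i j
      using P.r_one[of "\<one>\<^bsub>?P\<^esub>"] by (simp add: mult_ext_group f1)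
    \<comment> \<open>A nonzero \<open>w\<close> generates the kernel of order 3, so one commutator
      suffices.\<close>
    have "w \<noteq> 0" using ne by (simp add: w_def)
    then have "i = 0 \<or> i = w \<or> i = w + w"
      using cases_3[of i] cases_3[of w] by auto
    moreover have "\<one>\<^bsub>?D\<^esub> \<in> lower_central ?D 4" by (rule subgroup.one_closed[OF D.subgroup_lower_central])
    moreover have "(\<one>\<^bsub>?P\<^esub>, w + w - f1) \<in> lower_central ?D 4"
      using subgroup.m_closed[OF D.subgroup_lower_central r r] by (simp only: mult)
    ultimately show "z \<in> lower_central ?D 4" using r by (auto simp: z one)
  qed
  then have "parent ?D \<cong> ?P"
    by (intro parent_iso_of_hom[OF fst_hom_ext_group onto D.is_group P.is_group]) (simp only: cls)
  then have "?P \<cong> parent ?D" by (rule group.iso_sym[OF group_parent[OF D.is_group]])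
  moreover have "order ?D = 3 ^ 6" by (simp add: order_def card_cartesian_product)
  then have "finite_3_group ?D" using D.is_group unfolding finite_3_group_def by blast
  moreover have "\<not> comm_group ?D"
  proof
    assume "comm_group ?D"
    then interpret DC: comm_group ?D .
    have "(h, 0) \<otimes>\<^bsub>?D\<^esub> (g, m) = (h, 0) \<otimes>\<^bsub>?D\<^esub> (g, m) \<otimes>\<^bsub>?D\<^esub> (\<one>\<^bsub>?P\<^esub>, w - f1)"
      using swap DC.m_comm[of "(g, m)" "(h, 0)"] by simp
    then have "w - f1 = - f1"
      using P.r_one[of "h \<otimes>\<^bsub>?P\<^esub> g"] by (simp add: mult_ext_group f1)
    then show False using ne by (simp add: w_def)
  qed
  ultimately show ?thesis by (simp add: immediate_descendant_def)
qed

text \<open>The term \<open>d * a'\<close> in \<open>vF\<close> and \<open>vO\<close>, respectively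
  \<open>d * b'\<close> in \<open>vG\<close>, makes \<open>t\<close> and one of the generators fail
  to commute in the extension.\<close>

lemma terminal_imp_terminal_params:
  assumes "terminal V" "group V" "V \<cong> pc_group p q k l" "(p, q, k, l) \<in> pc_reps"
  shows "(p, q, k, l) \<in> terminal_params"
proof (rule ccontr)
  assume "(p, q, k, l) \<notin> terminal_params"
  then consider "p = 0" "k = - 1" "l = 0" | "p = 1" "q = 0" "k = 0" "l = - 1" | "p = 0" "q = - 1" "k = 1" "l = 0"
    using assms(4) unfolding pc_reps_def terminal_params_def by auto
  then have "\<exists>f. immediate_descendant (ext_group (pc_group p q k l) f) (pc_group p q k l)"
  proof cases
    case 1
    have "immediate_descendant (ext_group (pc_group 0 q (- 1) 0) vF) (pc_group 0 q (- 1) 0)"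
      by (rule ext_group_descendant[OF cocycle_vF, of "(0, 0, 0, 1, 0)" _ "(1, 0, 0, 0, 0)"])
        (simp_all add: lower_central_pc_group mult_pc_group vF_def)
    with 1 show ?thesis by blast
  next
    case 2
    have "immediate_descendant (ext_group (pc_group 1 0 0 (- 1)) vG) (pc_group 1 0 0 (- 1))"
      by (rule ext_group_descendant[OF cocycle_vG, of "(0, 0, 0, 1, 0)" "(0, 1, 0, 0, 0)"])
        (simp_all add: lower_central_pc_group mult_pc_group vG_def)
    with 2 show ?thesis by blast
  next
    case 3
    have "immediate_descendant (ext_group (pc_group 0 (- 1) 1 0) vO) (pc_group 0 (- 1) 1 0)"
      by (rule ext_group_descendant[OF cocycle_vO, of "(0, 0, 0, 1, 0)" "(1, 0, 0, 0, 0)"])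
        (simp_all add: lower_central_pc_group mult_pc_group vO_def)
    with 3 show ?thesis by blast
  qed
  then show False using not_terminalI[OF _ group_pc_group assms(2,3)] assms(1) by blast
qed

lemma terminal_descendant_imp:
  assumes V: "group V" and imm: "immediate_descendant V SG27_3" and step: "step_size V SG27_3 = 2" and t: "terminal V"
  obtains p q k l where "(p, q, k, l) \<in> terminal_params" "V \<cong> pc_group p q k l"
proof -
  have "order V > 0"
    using imm by (auto simp: immediate_descendant_def finite_3_group_def)
  \<comment> \<open>Exponentiating the step size recovers the order \<open>27 * 9\<close>.\<close>
  then have "3 powr log 3 (real (order V) / real (order SG27_3)) = real (order V) / real (order SG27_3)"
    by (intro powr_log_cancel) (simp_all add: order_SG27_3)
  then have "real (order V) / real (order SG27_3) = 3 powr 2"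
    using step by (simp only: step_size_def)
  then have "order V = 3 ^ 5" by (simp add: order_SG27_3)
  then obtain p0 q0 k0 l0 where V0: "V \<cong> pc_group p0 q0 k0 l0"
    by (rule descendant_SG27_3_imp_pc_group[OF imm])
  obtain p q k l where P: "(p, q, k, l) \<in> pc_reps" "pc_group p0 q0 k0 l0 \<cong> pc_group p q k l"
    by (rule pc_group_classification)
  have "V \<cong> pc_group p q k l" by (rule iso_trans[OF V0 P(2)])
  with terminal_imp_terminal_params[OF t V this P(1)] show ?thesis by (intro that)
qed

section \<open>Vertices and edges of the coclass forest\<close>

lemma iso_class_eq_iff:
  assumes "group V" "group W" "finite (carrier V)"
  shows "iso_class V = iso_class W \<longleftrightarrow> V \<cong> W"
proof
  assume eq: "iso_class V = iso_class W"
  \<comment> \<open>Classes have only groups on natural numbers as members, so a copy of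
    \<open>V\<close> serves as a common member.\<close>
  obtain H :: "nat monoid" where H: "group H" "V \<cong> H" by (rule nat_copy[OF assms(1,3)])
  then have "H \<in> iso_class V" using group.iso_sym[OF assms(1)] by (simp add: iso_class_def)
  then have "H \<cong> W" unfolding eq by (simp add: iso_class_def)
  then show "V \<cong> W" using H(2) iso_trans by blast
next
  assume VW: "V \<cong> W"
  have "H \<cong> V \<longleftrightarrow> H \<cong> W" for H :: "nat monoid"
    using iso_trans[OF _ VW, of H] iso_trans[OF _ group.iso_sym[OF assms(1) VW], of H] by (rule iffI)
  then show "iso_class V = iso_class W" unfolding iso_class_def by simp
qed

lemma has_coclass_iso:
  assumes "V \<cong> W" "group V" "group W" "has_coclass V r"
  shows "has_coclass W r"
  using assms(4) nilpotency_class_iso[OF assms(1-3)] iso_same_card[OF assms(1)]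
  by (simp add: has_coclass_def order_def)

lemma finite_3_group_finite: "finite_3_group V \<Longrightarrow> finite (carrier V)"
  unfolding finite_3_group_def by (metis card.infinite order_def zero_neq_numeral power_eq_0_iff)

text \<open>No edge starts at the vertex because the parent \<open>SG27_3\<close> has order 3^3,
  class 2 and thus coclass 1. No edge ends there because the group is terminal.\<close>

lemma terminal_isolated:
  assumes P: "(p, q, k, l) \<in> terminal_params"
  shows "isolated_vertex 2 (iso_class (pc_group p q k l))" "without_parent 2 (iso_class (pc_group p q k l))"
proof -
  let ?P = "pc_group p q k l"
  have fin: "finite (carrier ?P)" by simp
  obtain V :: "nat monoid" where V: "group V" "?P \<cong> V" by (rule nat_copy[OF group_pc_group fin])
  have V': "V \<cong> ?P" by (rule group.iso_sym[OF group_pc_group V(2)])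
  have "forest_member 2 V"
    unfolding forest_member_def using schur_sigma_of_terminal(1,2)[OF P V(1) V']
      has_coclass_iso[OF V(2) group_pc_group V(1) has_coclass_pc_group] by blast
  moreover have "iso_class ?P = iso_class V" by (simp add: iso_class_eq_iff[OF group_pc_group V(1) fin] V(2))
  ultimately have vertex: "iso_class ?P \<in> forest_vertices 2" unfolding forest_vertices_def by blast
  have out: "(iso_class ?P, w) \<notin> forest_edges 2" for w
  proof
    assume "(iso_class ?P, w) \<in> forest_edges 2"
    then obtain U :: "nat monoid" where U: "iso_class ?P = iso_class U" "forest_member 2 U"
      "iso_class (parent U) \<in> forest_vertices 2"
      unfolding forest_edges_def by blast
    then obtain M :: "nat monoid" where M: "iso_class (parent U) = iso_class M" "forest_member 2 M"
      unfolding forest_vertices_def by blast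
    have gU: "group U" and gM: "group M" using U(2) M(2) by (simp_all add: forest_member_def finite_3_group_def)
    have finM: "finite (carrier M)" using M(2) by (simp add: forest_member_def finite_3_group_finite)
    have "?P \<cong> U" using U(1) iso_class_eq_iff[OF group_pc_group gU fin] by simp
    then have "U \<cong> ?P" by (rule group.iso_sym[OF group_pc_group])
    then have "SG27_3 \<cong> parent U" by (rule parent_of_iso_pc_group[OF gU])
    moreover have "M \<cong> parent U"
      using M(1) iso_class_eq_iff[OF gM group_parent[OF gU] finM] by simp
    then have "parent U \<cong> M" by (rule group.iso_sym[OF gM])
    ultimately have "SG27_3 \<cong> M" by (rule iso_trans)
    then have "M \<cong> SG27_3" by (rule group.iso_sym[OF group_SG27_3])
    then have "has_coclass SG27_3 2"
      by (rule has_coclass_iso[OF _ gM group_SG27_3]) (use M(2) in \<open>simp add: forest_member_def\<close>)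
    \<comment> \<open>Coclass 2 together with class 2 would require order 3^4.\<close>
    then obtain n where "(27::nat) = 3 ^ n" "n = 4"
      by (auto simp: has_coclass_def order_SG27_3 nilpotency_class_SG27_3)
    then show False by simp
  qed
  have "(w, iso_class ?P) \<notin> forest_edges 2" for w
  proof
    assume "(w, iso_class ?P) \<in> forest_edges 2"
    then obtain U :: "nat monoid" where U: "iso_class ?P = iso_class (parent U)" "forest_member 2 U" "\<not> comm_group U"
      unfolding forest_edges_def by blast
    have gU: "group U" using U(2) by (simp add: forest_member_def finite_3_group_def)
    have "?P \<cong> parent U" using U(1) iso_class_eq_iff[OF group_pc_group group_parent[OF gU] fin] by simp
    then have "immediate_descendant U ?P"
      using U(2,3) by (simp add: immediate_descendant_def forest_member_def)
    moreover have "terminal ?P" by (rule terminal_of_iso_terminal[OF P group_pc_group iso_refl])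
    ultimately show False unfolding terminal_def by blast
  qed
  with vertex out show "isolated_vertex 2 (iso_class ?P)" unfolding isolated_vertex_def by blast
  from vertex out show "without_parent 2 (iso_class ?P)" unfolding without_parent_def by blast
qed

section \<open>Transfer kernels\<close>

text \<open>The preimage of a line of the abelianization, given by the coefficients of an equation
  in the first two coordinates.\<close>

definition line :: "3 \<Rightarrow> 3 \<Rightarrow> F3_5 set" where
  "line m n = {v. m * fst v + n * fst (snd v) = 0}"

text \<open>One equation for each of the four lines through the origin of the plane over the field
  with three elements.\<close>

definition lines :: "(3 \<times> 3) set" where
  "lines = {(1, 1), (1, - 1), (1, 0), (0, 1)}"

lemma fst_pw_pc_group:
  "fst (pw (pc_group p q k l) v r) = fst v * r" "fst (snd (pw (pc_group p q k l) v r)) = fst (snd v) * r"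
  using cases_3[of r] by (auto simp: pw_def fst_inv_pc_group one_pc_group)

lemma subgroup_line: "subgroup (line m n) (pc_group p q k l)"
proof -
  interpret group "pc_group p q k l" by (rule group_pc_group)
  have *: "m * (x + x') + n * (y + y') = (m * x + n * y) + (m * x' + n * y')" "m * - x + n * - y = - (m * x + n * y)" for x y x' y' :: 3
    by (simp_all add: algebra_simps)
  have "(0, 0, 0, 0, 0) \<in> line m n" by (simp add: line_def)
  then have "line m n \<noteq> {}" by blast
  then show ?thesis
    by (intro subgroupI) (simp_all add: line_def fst_mult_pc_group fst_inv_pc_group * del: mult_minus_right)
qed

text \<open>If \<open>H\<close> lies in no line, Gaussian elimination with elements outside suitable
  lines produces elements of \<open>H\<close> over both basis vectors, and these generate the
  group.\<close>

lemma proper_subgroup_in_line: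
  assumes H: "subgroup H (pc_group p q k l)" "H \<noteq> UNIV"
  obtains m n where "(m, n) \<in> lines" "H \<subseteq> line m n"
proof (cases "\<exists>(m, n)\<in>lines. H \<subseteq> line m n")
  case True
  then show ?thesis using that by blast
next
  case False
  let ?P = "pc_group p q k l"
  interpret group ?P by (rule group_pc_group)
  have pwH: "pw ?P v r \<in> H" if "v \<in> H" for v r using pw_in_subgroup[OF H(1) that] .
  have multH: "v \<otimes>\<^bsub>?P\<^esub> w \<in> H" if "v \<in> H" "w \<in> H" for v w using subgroup.m_closed[OF H(1) that] .
  have sq: "r * r = 1" if "r \<noteq> 0" for r :: 3 using cases_3[of r] that by auto
  have no: "\<not> H \<subseteq> line m n" if "(m, n) \<in> lines" for m n using False that by blast
  have outside: "\<exists>v\<in>H. m * fst v + n * fst (snd v) \<noteq> 0" if "(m, n) \<in> lines" for m n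
    using no[OF that] unfolding line_def by blast
  obtain g0 where g0: "g0 \<in> H" "fst g0 \<noteq> 0" using outside[of 1 0] unfolding lines_def by fastforce
  \<comment> \<open>A nonzero element of the field is its own inverse, so this power normalises the
    first coordinate to 1; \<open>h\<close> below is obtained in the same way.\<close>
  define g where "g = pw ?P g0 (fst g0)"
  have g: "g \<in> H" "fst g = 1" using pwH[OF g0(1)] sq[OF g0(2)] by (simp_all add: g_def fst_pw_pc_group)
  define r where "r = fst (snd g)"
  have "\<exists>h\<in>H. fst (snd h) \<noteq> r * fst h"
  proof -
    consider "r = 0" | "r = 1" | "r = - 1" using cases_3[of r] by blast
    then have "\<exists>m n. (m, n) \<in> lines \<and> n \<noteq> 0 \<and> m = - n * r"
      by cases (rule exI[of _ 0], rule exI[of _ 1], simp add: lines_def,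
        rule exI[of _ 1], rule exI[of _ "- 1"], simp add: lines_def,
        rule exI[of _ 1], rule exI[of _ 1], simp add: lines_def)
    then obtain m n where mn: "(m, n) \<in> lines" "m = - n * r" by blast
    obtain v where v: "v \<in> H" "m * fst v + n * fst (snd v) \<noteq> 0" using outside[OF mn(1)] by blast
    have "m * fst v + n * fst (snd v) = n * (fst (snd v) - r * fst v)" by (simp add: mn(2) algebra_simps)
    then have "fst (snd v) \<noteq> r * fst v" using v(2) by auto
    then show ?thesis using v(1) by blast
  qed
  then obtain h0 where h0: "h0 \<in> H" "fst (snd h0) \<noteq> r * fst h0" by blast
  define h1 where "h1 = h0 \<otimes>\<^bsub>?P\<^esub> pw ?P g (- fst h0)"
  have h1: "h1 \<in> H" "fst h1 = 0" "fst (snd h1) \<noteq> 0"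
    using multH[OF h0(1) pwH[OF g(1)]] h0(2) g(2)
    by (simp_all add: h1_def fst_pw_pc_group fst_mult_pc_group r_def[symmetric])
  define h where "h = pw ?P h1 (fst (snd h1))"
  have h: "h \<in> H" "fst h = 0" "fst (snd h) = 1"
    using pwH[OF h1(1)] h1(2) sq[OF h1(3)] by (simp_all add: h_def fst_pw_pc_group)
  define g' where "g' = g \<otimes>\<^bsub>?P\<^esub> pw ?P h (- r)"
  have g': "g' \<in> H" "fst g' = 1" "fst (snd g') = 0"
    using multH[OF g(1) pwH[OF h(1)]] g h by (simp_all add: g'_def fst_pw_pc_group fst_mult_pc_group r_def)
  obtain c d e c' d' e' where "(1, 0, c, d, e) \<in> H" "(0, 1, c', d', e') \<in> H"
    using g' h by (cases g'; cases h) auto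
  then have "H = UNIV" by (rule pc_group_subgroup_UNIV_mod_derived[OF H(1)])
  then show ?thesis using H(2) by blast
qed

lemma line_subset_imp_eq:
  assumes "(m, n) \<in> lines" "(m', n') \<in> lines" "line m n \<subseteq> line m' n'"
  shows "m = m' \<and> n = n'"
proof -
  have "(n, - m, 0, 0, 0) \<in> line m n" by (simp add: line_def mult.commute)
  then have "(n, - m, 0, 0, 0) \<in> line m' n'" using assms(3) by blast
  then show ?thesis using assms(1,2) by (auto simp: lines_def line_def)
qed

lemma line_proper: "(m, n) \<in> lines \<Longrightarrow> line m n \<noteq> UNIV"
proof
  assume mn: "(m, n) \<in> lines" "line m n = UNIV"
  then have "(m, n, 0, 0, 0) \<in> line m n" "(1, 0, 0, 0, 0) \<in> line m n" "(0, 1, 0, 0, 0) \<in> line m n" by blast+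
  then show False using mn(1) by (auto simp: lines_def line_def)
qed

lemma maximal_subgroups_pc_group:
  "maximal_subgroups (pc_group p q k l) = {line 1 1, line 1 (- 1), line 1 0, line 0 1}"
proof -
  have "maximal_subgroups (pc_group p q k l) = (\<lambda>(m, n). line m n) ` lines"
  proof (intro equalityI subsetI)
    fix H assume "H \<in> maximal_subgroups (pc_group p q k l)"
    then have H: "subgroup H (pc_group p q k l)" "H \<noteq> UNIV"
      "\<And>K. subgroup K (pc_group p q k l) \<Longrightarrow> H \<subseteq> K \<Longrightarrow> K = H \<or> K = UNIV"
      by (auto simp: maximal_subgroups_def)
    obtain m n where mn: "(m, n) \<in> lines" "H \<subseteq> line m n" by (rule proper_subgroup_in_line[OF H(1,2)])
    have "line m n = H" using H(3)[OF subgroup_line mn(2)] line_proper[OF mn(1)] by blast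
    then show "H \<in> (\<lambda>(m, n). line m n) ` lines" using mn(1) by force
  next
    fix H assume "H \<in> (\<lambda>(m, n). line m n) ` lines"
    then obtain m n where mn: "(m, n) \<in> lines" and H: "H = line m n" by auto
    have "K = line m n \<or> K = UNIV" if K: "subgroup K (pc_group p q k l)" "line m n \<subseteq> K" for K
    proof (rule disjCI)
      assume "K \<noteq> UNIV"
      then obtain m' n' where mn': "(m', n') \<in> lines" "K \<subseteq> line m' n'" by (rule proper_subgroup_in_line[OF K(1)])
      then have "m = m' \<and> n = n'" using K(2) by (intro line_subset_imp_eq[OF mn mn'(1)]) blast
      then show "K = line m n" using K(2) mn'(2) by blast
    qed
    then show "H \<in> maximal_subgroups (pc_group p q k l)"
      using line_proper[OF mn] subgroup_line by (simp add: maximal_subgroups_def H)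
  qed
  then show ?thesis by (simp add: lines_def)
qed

definition line_derived :: "3 \<Rightarrow> 3 \<Rightarrow> F3_5 set" where
  "line_derived m n = {(0, 0, 0, d, e) | d e. m * d + n * e = 0}"

text \<open>Modulo the commutator subgroup the line is generated by \<open>x^n y^(-m)\<close>, so
  its derived subgroup consists of the powers of the commutator of \<open>s\<close> with this
  element, which is \<open>t^n u^(-m)\<close>.\<close>

lemma derived_line:
  assumes mn: "(m, n) \<in> lines"
  shows "derived (pc_group p q k l) (line m n) = line_derived m n"
proof
  let ?P = "pc_group p q k l"
  interpret group ?P by (rule group_pc_group)
  have inv: "inv\<^bsub>?P\<^esub> (0, 0, 0, d, e) = (0, 0, 0, - d, - e)" for d e
    by (rule inv_equality) (simp_all add: mult_pc_group one_pc_group)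
  have D: "subgroup (line_derived m n) ?P"
  proof (rule subgroupI)
    have "(0, 0, 0, 0, 0) \<in> line_derived m n" by (simp add: line_derived_def)
    then show "line_derived m n \<noteq> {}" by blast
    fix v assume "v \<in> line_derived m n"
    then obtain d e where v: "v = (0, 0, 0, d, e)" "m * d + n * e = 0" by (auto simp: line_derived_def)
    have "m * - d + n * - e = - (m * d + n * e)" by simp
    then show "inv\<^bsub>?P\<^esub> v \<in> line_derived m n" using v by (simp add: inv line_derived_def)
    fix w assume "w \<in> line_derived m n"
    then obtain d' e' where w: "w = (0, 0, 0, d', e')" "m * d' + n * e' = 0" by (auto simp: line_derived_def)
    have "m * (d + d') + n * (e + e') = (m * d + n * e) + (m * d' + n * e')" by (simp add: algebra_simps)
    then show "v \<otimes>\<^bsub>?P\<^esub> w \<in> line_derived m n" using v w by (simp add: mult_pc_group line_derived_def)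
  qed simp
  have "v \<otimes>\<^bsub>?P\<^esub> w \<otimes>\<^bsub>?P\<^esub> inv\<^bsub>?P\<^esub> v \<otimes>\<^bsub>?P\<^esub> inv\<^bsub>?P\<^esub> w \<in> line_derived m n" if "v \<in> line m n" "w \<in> line m n" for v w
  proof -
    obtain a b c d e where v: "v = (a, b, c, d, e)" by (cases v)
    obtain a' b' c' d' e' where w: "w = (a', b', c', d', e')" by (cases w)
    let ?d = "c * a' + b * (a' - a' * a') - c' * a - b' * (a - a * a)"
    let ?e = "c * b' + a' * (b - b * b) + a' * b * b' - c' * b - a * (b' - b' * b') - a * b' * b"
    have ab: "m * a + n * b = 0" "m * a' + n * b' = 0" using that by (simp_all add: v w line_def)
    \<comment> \<open>Two vectors on one line are proportional, so the commutator has no component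
      at \<open>s\<close> and is central.\<close>
    have "b * a' = b' * a"
      using mn ab by (auto simp: lines_def add_eq_0_iff)
    then have "v \<otimes>\<^bsub>?P\<^esub> w = w \<otimes>\<^bsub>?P\<^esub> v \<otimes>\<^bsub>?P\<^esub> (0, 0, 0, ?d, ?e)"
      by (simp add: v w mult_pc_group carry_commute algebra_simps)
    then have "v \<otimes>\<^bsub>?P\<^esub> w \<otimes>\<^bsub>?P\<^esub> inv\<^bsub>?P\<^esub> v \<otimes>\<^bsub>?P\<^esub> inv\<^bsub>?P\<^esub> w = (0, 0, 0, ?d, ?e)"
      by (intro swap_commutator) (simp_all add: v w mult_pc_group algebra_simps)
    moreover have "m * ?d + n * ?e = 0"
      using mn ab by (auto simp: lines_def eq_neg_iff_add_eq_0[symmetric] algebra_simps triple_mult_eq_0)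
    ultimately show ?thesis by (simp add: line_derived_def)
  qed
  then have "derived_set ?P (line m n) \<subseteq> line_derived m n" by blast
  then show "derived ?P (line m n) \<subseteq> line_derived m n"
    unfolding derived_def by (rule generate_subgroup_incl[OF _ D])
  show "line_derived m n \<subseteq> derived ?P (line m n)"
  proof
    fix v assume "v \<in> line_derived m n"
    then obtain d e where v: "v = (0, 0, 0, d, e)" "m * d + n * e = 0" by (auto simp: line_derived_def)
    \<comment> \<open>The solutions of the equation are the multiples of \<open>(n, - m)\<close>;
      \<open>r\<close> becomes the exponent of \<open>s\<close> in the commutator.\<close>
    have "\<exists>r. d = r * n \<and> e = - (r * m)"
    proof (cases "m = 0")
      case True
      then show ?thesis using mn v(2) by (intro exI[of _ d]) (auto simp: lines_def)
    next
      case False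
      then show ?thesis using mn v(2) by (intro exI[of _ "- e"]) (auto simp: lines_def add_eq_0_iff)
    qed
    then obtain r where r: "d = r * n" "e = - (r * m)" by blast
    have "(0, 0, r, 0, 0) \<otimes>\<^bsub>?P\<^esub> (n, - m, 0, 0, 0) = (n, - m, 0, 0, 0) \<otimes>\<^bsub>?P\<^esub> (0, 0, r, 0, 0) \<otimes>\<^bsub>?P\<^esub> v"
      by (simp add: v r mult_pc_group)
    then have "(0, 0, r, 0, 0) \<otimes>\<^bsub>?P\<^esub> (n, - m, 0, 0, 0) \<otimes>\<^bsub>?P\<^esub> inv\<^bsub>?P\<^esub> (0, 0, r, 0, 0) \<otimes>\<^bsub>?P\<^esub> inv\<^bsub>?P\<^esub> (n, - m, 0, 0, 0) = v"
      by (intro swap_commutator) (simp_all add: v mult_pc_group algebra_simps)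
    moreover have "(0, 0, r, 0, 0) \<in> line m n" "(n, - m, 0, 0, 0) \<in> line m n" by (simp_all add: line_def mult.commute)
    ultimately have "v \<in> derived_set ?P (line m n)" by blast
    then show "v \<in> derived ?P (line m n)" unfolding derived_def by (rule generate.incl)
  qed
qed

section \<open>Evaluation of the transfers\<close>

lemma cube_pc_group:
  "(a, b, c, d, e) \<otimes>\<^bsub>pc_group p q k l\<^esub> (a, b, c, d, e) \<otimes>\<^bsub>pc_group p q k l\<^esub> (a, b, c, d, e)
    = (0, 0, 0, p * a + k * b + a * a * b, q * a + l * b - a * b * b)"
proof -
  have z: "(3::3) = 0" "(6::3) = 0" "(15::3) = 0" by simp_all
  show ?thesis
    by (simp add: mult_pc_group carry_def, (simp only: F3_poly_mult)?, (simp only: F3_uminus)?) (simp add: F3_poly_add z)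
qed

lemma conj_pc_group:
  "inv\<^bsub>pc_group p q k l\<^esub> (a', b', c', d', e') \<otimes>\<^bsub>pc_group p q k l\<^esub> (a, b, c, d, e)
      \<otimes>\<^bsub>pc_group p q k l\<^esub> (a', b', c', d', e')
    = (a, b, c + b * a' - b' * a,
       d + c * a' - c' * a + b * (a' - a' * a') - b' * (a - a * a),
       e + c * b' - c' * b + a' * (b - b * b) + a' * b * b' - a * (b' - b' * b') - a * b' * b)"
    (is "inv\<^bsub>?P\<^esub> ?r \<otimes>\<^bsub>?P\<^esub> ?g \<otimes>\<^bsub>?P\<^esub> ?r = ?h")
proof -
  interpret group ?P by (rule group_pc_group)
  have "?g \<otimes>\<^bsub>?P\<^esub> ?r = ?r \<otimes>\<^bsub>?P\<^esub> ?h"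
    by (simp add: mult_pc_group carry_commute algebra_simps)
  then show ?thesis by (simp add: m_assoc inv_assoc)
qed

text \<open>A linear form whose fibres are the cosets of the line; its values index the three
  cosets.\<close>

definition line_form :: "3 \<Rightarrow> 3 \<Rightarrow> F3_5 \<Rightarrow> 3" where
  "line_form m n v = m * fst v + n * fst (snd v)"

lemma line_form_mult: "line_form m n (v \<otimes>\<^bsub>pc_group p q k l\<^esub> w) = line_form m n v + line_form m n w"
  by (simp add: line_form_def fst_mult_pc_group algebra_simps)

lemma line_form_inv: "line_form m n (inv\<^bsub>pc_group p q k l\<^esub> v) = - line_form m n v"
  by (simp add: line_form_def fst_inv_pc_group algebra_simps)

lemma line_iff: "v \<in> line m n \<longleftrightarrow> line_form m n v = 0"
  by (simp add: line_def line_form_def)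

lemma l_coset_line_form:
  "g <#\<^bsub>pc_group p q k l\<^esub> {v. line_form m n v = i} = {v. line_form m n v = line_form m n g + i}"
proof (intro equalityI subsetI)
  let ?P = "pc_group p q k l"
  interpret group ?P by (rule group_pc_group)
  fix v assume "v \<in> {v. line_form m n v = line_form m n g + i}"
  then have "line_form m n (inv\<^bsub>?P\<^esub> g \<otimes>\<^bsub>?P\<^esub> v) = i" by (simp add: line_form_mult line_form_inv)
  moreover have "v = g \<otimes>\<^bsub>?P\<^esub> (inv\<^bsub>?P\<^esub> g \<otimes>\<^bsub>?P\<^esub> v)" by (rule inv_assoc(2)[symmetric]) simp_all
  ultimately show "v \<in> g <#\<^bsub>?P\<^esub> {v. line_form m n v = i}" unfolding l_coset_def by blast
next
  fix v assume "v \<in> g <#\<^bsub>pc_group p q k l\<^esub> {v. line_form m n v = i}"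
  then obtain h where "line_form m n h = i" "v = g \<otimes>\<^bsub>pc_group p q k l\<^esub> h" unfolding l_coset_def by blast
  then show "v \<in> {v. line_form m n v = line_form m n g + i}" by (simp add: line_form_mult)
qed

lemma line_form_onto:
  assumes "(m, n) \<in> lines"
  obtains v where "line_form m n v = i"
proof (cases "m = 1")
  case True
  then show ?thesis using that[of "(i, 0, 0, 0, 0)"] by (simp add: line_form_def)
next
  case False
  then show ?thesis using that[of "(0, i, 0, 0, 0)"] assms by (auto simp: line_form_def lines_def)
qed

lemma lcosets_line:
  assumes "(m, n) \<in> lines"
  shows "lcosets\<^bsub>pc_group p q k l\<^esub> line m n = range (\<lambda>i. {v. line_form m n v = i})"
proof -
  have eq: "g <#\<^bsub>pc_group p q k l\<^esub> line m n = {v. line_form m n v = line_form m n g}" for g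
    using l_coset_line_form[of p q k l g m n 0] by (simp add: line_def line_form_def)
  have "\<exists>g. {v. line_form m n v = i} = {v. line_form m n v = line_form m n g}" for i
    by (rule line_form_onto[OF assms, of i]) blast
  then show ?thesis by (auto simp: LCOSETS_def eq)
qed

lemma central_pc_group: "(0, 0, 0, d, e) \<otimes>\<^bsub>pc_group p q k l\<^esub> v = v \<otimes>\<^bsub>pc_group p q k l\<^esub> (0, 0, 0, d, e)"
  by (cases v) (simp add: mult_pc_group)

lemma normal_line_derived:
  assumes "(m, n) \<in> lines"
  shows "line_derived m n \<lhd> pc_group p q k l"
proof -
  let ?P = "pc_group p q k l"
  interpret group ?P by (rule group_pc_group)
  have "subgroup (line_derived m n) ?P"
    using derived_is_subgroup[of "line m n"] derived_line[OF assms] by simp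
  then show ?thesis
  proof (rule normal_invI)
    fix g v assume v: "v \<in> line_derived m n"
    then have "g \<otimes>\<^bsub>?P\<^esub> v \<otimes>\<^bsub>?P\<^esub> inv\<^bsub>?P\<^esub> g = v \<otimes>\<^bsub>?P\<^esub> g \<otimes>\<^bsub>?P\<^esub> inv\<^bsub>?P\<^esub> g"
      unfolding line_derived_def by (auto simp only: central_pc_group)
    then show "g \<otimes>\<^bsub>?P\<^esub> v \<otimes>\<^bsub>?P\<^esub> inv\<^bsub>?P\<^esub> g \<in> line_derived m n" using v by (simp add: m_assoc)
  qed
qed

text \<open>Expresses that the line modulo its derived subgroup is commutative, but through cosets
  taken in the ambient group.\<close>

lemma line_quotient_commute:
  assumes "(m, n) \<in> lines" "v \<in> line m n" "w \<in> line m n"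
  shows "line_derived m n #>\<^bsub>pc_group p q k l\<^esub> (v \<otimes>\<^bsub>pc_group p q k l\<^esub> w)
    = line_derived m n #>\<^bsub>pc_group p q k l\<^esub> (w \<otimes>\<^bsub>pc_group p q k l\<^esub> v)"
proof -
  let ?P = "pc_group p q k l" and ?K = "line_derived m n"
  interpret group ?P by (rule group_pc_group)
  interpret K: normal ?K ?P by (rule normal_line_derived[OF assms(1)])
  let ?Q = "?P\<lparr>carrier := line m n\<rparr> Mod derived ?P (line m n)"
  interpret Q: comm_group ?Q by (rule derived_quot_of_subgroup_is_comm_group[OF subgroup_line])
  have "?K #>\<^bsub>?P\<^esub> v \<in> carrier ?Q" if "v \<in> line m n" for v
    using that derived_line[OF assms(1)] by (auto simp: FactGroup_def RCOSETS_def r_coset_def)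
  then have "(?K #>\<^bsub>?P\<^esub> v) \<otimes>\<^bsub>?Q\<^esub> (?K #>\<^bsub>?P\<^esub> w) = (?K #>\<^bsub>?P\<^esub> w) \<otimes>\<^bsub>?Q\<^esub> (?K #>\<^bsub>?P\<^esub> v)"
    using assms(2,3) Q.m_comm by blast
  moreover have "(?K #>\<^bsub>?P\<^esub> v) \<otimes>\<^bsub>?Q\<^esub> (?K #>\<^bsub>?P\<^esub> w) = ?K #>\<^bsub>?P\<^esub> (v \<otimes>\<^bsub>?P\<^esub> w)" for v w
    using K.rcos_sum[of v w] by (simp add: FactGroup_def set_mult_def)
  ultimately show ?thesis by simp
qed

text \<open>The transversal in \<open>artin_transfer\<close> is picked by choice, so \<rho> is known
  only through its value under \<open>line_form\<close>. The product over cosets becomes one over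
  the indices 0, 1 and \<open>- 1\<close>, with factors \<open>t i\<close>.\<close>

lemma artin_transfer_line:
  assumes mn: "(m, n) \<in> lines"
  obtains \<rho> where "\<And>i. line_form m n (\<rho> i) = i"
    "\<And>g t. (\<And>i. t i = inv\<^bsub>pc_group p q k l\<^esub> (\<rho> (line_form m n g + i)) \<otimes>\<^bsub>pc_group p q k l\<^esub> g \<otimes>\<^bsub>pc_group p q k l\<^esub> \<rho> i) \<Longrightarrow>
      artin_transfer (pc_group p q k l) (line m n) g
        = line_derived m n #>\<^bsub>pc_group p q k l\<^esub> (t 0 \<otimes>\<^bsub>pc_group p q k l\<^esub> (t 1 \<otimes>\<^bsub>pc_group p q k l\<^esub> t (- 1)))"
proof -
  let ?P = "pc_group p q k l" and ?K = "line_derived m n"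
  interpret group ?P by (rule group_pc_group)
  interpret K: normal ?K ?P by (rule normal_line_derived[OF mn])
  let ?Q = "?P\<lparr>carrier := line m n\<rparr> Mod derived ?P (line m n)"
  interpret Q: comm_group ?Q by (rule derived_quot_of_subgroup_is_comm_group[OF subgroup_line])
  have Q_mult: "(?K #>\<^bsub>?P\<^esub> v) \<otimes>\<^bsub>?Q\<^esub> (?K #>\<^bsub>?P\<^esub> w) = ?K #>\<^bsub>?P\<^esub> (v \<otimes>\<^bsub>?P\<^esub> w)" for v w
    using K.rcos_sum[of v w] by (simp add: FactGroup_def set_mult_def)
  have Q_carrier: "?K #>\<^bsub>?P\<^esub> v \<in> carrier ?Q" if "v \<in> line m n" for v
    using that derived_line[OF mn] by (auto simp: FactGroup_def RCOSETS_def r_coset_def)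
  define C where "C i = {v. line_form m n v = i}" for i
  define \<rho> where "\<rho> i = (SOME v. v \<in> C i)" for i
  have \<rho>: "line_form m n (\<rho> i) = i" for i
  proof -
    obtain v where "v \<in> C i" using line_form_onto[OF mn, of i] unfolding C_def by blast
    then have "\<rho> i \<in> C i" unfolding \<rho>_def by (rule someI)
    then show ?thesis by (simp add: C_def)
  qed
  have inj: "inj C"
  proof (rule injI)
    fix i j assume "C i = C j"
    then have "\<rho> i \<in> C j" using \<rho>[of i] by (auto simp: C_def)
    then show "i = j" using \<rho>[of i] by (simp add: C_def)
  qed
  have UNIV3: "(UNIV :: 3 set) = {0, 1, - 1}" using cases_3 by auto
  show ?thesis
  proof (rule that[OF \<rho>])
    fix g t assume t: "\<And>i. t i = inv\<^bsub>?P\<^esub> (\<rho> (line_form m n g + i)) \<otimes>\<^bsub>?P\<^esub> g \<otimes>\<^bsub>?P\<^esub> \<rho> i"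
    have tH: "t i \<in> line m n" for i
      by (simp add: t line_iff line_form_mult line_form_inv \<rho>)
    let ?F = "\<lambda>D. ?K #>\<^bsub>?P\<^esub> (inv\<^bsub>?P\<^esub> (SOME v. v \<in> g <#\<^bsub>?P\<^esub> D) \<otimes>\<^bsub>?P\<^esub> g \<otimes>\<^bsub>?P\<^esub> (SOME v. v \<in> D))"
    have F: "?F (C i) = ?K #>\<^bsub>?P\<^esub> t i" for i
    proof -
      have "g <#\<^bsub>?P\<^esub> C i = C (line_form m n g + i)" unfolding C_def by (rule l_coset_line_form)
      then show ?thesis by (simp add: t \<rho>_def)
    qed
    have "artin_transfer ?P (line m n) g = finprod ?Q ?F (range C)"
      unfolding artin_transfer_def Let_def lcosets_line[OF mn] C_def[symmetric] derived_line[OF mn] ..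
    also have "\<dots> = finprod ?Q (\<lambda>i. ?F (C i)) UNIV"
      by (rule Q.finprod_reindex) (use F Q_carrier[OF tH] inj in auto)
    also have "\<dots> = finprod ?Q (\<lambda>i. ?K #>\<^bsub>?P\<^esub> t i) {0, 1, - 1}"
      unfolding F UNIV3 ..
    also have "\<dots> = (?K #>\<^bsub>?P\<^esub> t 0) \<otimes>\<^bsub>?Q\<^esub> ((?K #>\<^bsub>?P\<^esub> t 1) \<otimes>\<^bsub>?Q\<^esub> (?K #>\<^bsub>?P\<^esub> t (- 1)))"
      using Q_carrier[OF tH] by (simp del: mult_FactGroup one_FactGroup)
    finally show "artin_transfer ?P (line m n) g = ?K #>\<^bsub>?P\<^esub> (t 0 \<otimes>\<^bsub>?P\<^esub> (t 1 \<otimes>\<^bsub>?P\<^esub> t (- 1)))"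
      by (simp only: Q_mult)
  qed
qed

text \<open>The transfer of \<open>g\<close> is represented by a central element
  \<open>t^d u^e\<close>, which is trivial modulo the derived subgroup of the line iff
  \<open>m * d + n * e = 0\<close>; this is that value as a linear form in the coordinates of
  \<open>g\<close>. The factor \<open>1 - m * m * n * n\<close> is 1 for the lines with a zero
  coefficient and 0 for the other two.\<close>

definition transfer_form :: "3 \<Rightarrow> 3 \<Rightarrow> 3 \<Rightarrow> 3 \<Rightarrow> 3 \<Rightarrow> 3 \<Rightarrow> 3 \<times> 3 \<Rightarrow> 3" where
  "transfer_form p q k l m n = (\<lambda>(a, b). m * (p * a + k * b) + n * (q * a + l * b) + (1 - m * m * n * n) * (m * b - n * a))"

text \<open>Outside the line the transfer is the cube of \<open>g\<close>, and there the cubic terms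
  of the cube formula agree with the linear correction in \<open>transfer_form\<close>.\<close>

lemma transfer_form_outside:
  assumes "(m, n) \<in> lines" "m * a + n * b \<noteq> 0"
  shows "m * (p * a + k * b + a * a * b) + n * (q * a + l * b - a * b * b) = transfer_form p q k l m n (a, b)"
  using assms cases_3[of a] cases_3[of b]
  by (elim disjE) (auto simp: lines_def transfer_form_def algebra_simps)

text \<open>On the line the transfer is the product of the conjugates of \<open>g\<close> by the
  transversal. Only the index of each representative matters, so the unknown remaining coordinates
  drop out.\<close>

lemma norm_line:
  fixes p q k l :: 3
  assumes mn: "(m, n) \<in> lines" and g: "line_form m n g = 0" and r: "\<And>i. line_form m n (\<rho> i) = i"
  defines "t \<equiv> \<lambda>i. inv\<^bsub>pc_group p q k l\<^esub> (\<rho> i) \<otimes>\<^bsub>pc_group p q k l\<^esub> g \<otimes>\<^bsub>pc_group p q k l\<^esub> \<rho> i"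
  obtains d e where "t 0 \<otimes>\<^bsub>pc_group p q k l\<^esub> (t 1 \<otimes>\<^bsub>pc_group p q k l\<^esub> t (- 1)) = (0, 0, 0, d, e)"
    "m * d + n * e = transfer_form p q k l m n (fst g, fst (snd g))"
proof -
  obtain a b c d e where g': "g = (a, b, c, d, e)" by (cases g)
  obtain a0 b0 c0 d0 e0 where 0: "\<rho> 0 = (a0, b0, c0, d0, e0)" by (cases "\<rho> 0")
  obtain a1 b1 c1 d1 e1 where 1: "\<rho> 1 = (a1, b1, c1, d1, e1)" by (cases "\<rho> 1")
  obtain a2 b2 c2 d2 e2 where 2: "\<rho> (- 1) = (a2, b2, c2, d2, e2)" by (cases "\<rho> (- 1)")
  have z: "(3::3) = 0" "(6::3) = 0" "(9::3) = 0" "(12::3) = 0" "(15::3) = 0" "(18::3) = 0" "(21::3) = 0" "(24::3) = 0" "(27::3) = 0" "(30::3) = 0" "(33::3) = 0" "(36::3) = 0" by simp_all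
  have eqs: "m * a + n * b = 0" "m * a0 + n * b0 = 0" "m * a1 + n * b1 = 1" "m * a2 + n * b2 = - 1"
    using g r[of 0] r[of 1] r[of "- 1"] by (simp_all add: line_form_def g' 0 1 2)
  have "\<exists>d e. t 0 \<otimes>\<^bsub>pc_group p q k l\<^esub> (t 1 \<otimes>\<^bsub>pc_group p q k l\<^esub> t (- 1)) = (0, 0, 0, d, e)
    \<and> m * d + n * e = transfer_form p q k l m n (a, b)"
  proof -
    \<comment> \<open>Each line allows one coordinate of \<open>g\<close> and of the three
      representatives to be eliminated, after which the claim is a polynomial identity.\<close>
    consider "m = 1" "n = 0" | "m = 0" "n = 1" | "m = 1" "n = 1" | "m = 1" "n = - 1"
      using mn by (auto simp: lines_def)
    then show ?thesis
    proof cases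
      case 1
      then have e: "a = 0" "a0 = 0" "a1 = 1" "a2 = - 1" using eqs by simp_all
      show ?thesis
        unfolding t_def g' 0 \<open>\<rho> 1 = _\<close> \<open>\<rho> (- 1) = _\<close> conj_pc_group mult_pc_group
        unfolding 1 e transfer_form_def carry_def
        apply (simp)
        apply (simp only: F3_poly_mult) apply (simp only: F3_uminus) apply (simp add: F3_poly_add z)
        done
    next
      case 2
      then have e: "b = 0" "b0 = 0" "b1 = 1" "b2 = - 1" using eqs by simp_all
      show ?thesis
        unfolding t_def g' 0 \<open>\<rho> 1 = _\<close> \<open>\<rho> (- 1) = _\<close> conj_pc_group mult_pc_group
        unfolding 2 e transfer_form_def carry_def
        apply (simp)
        apply (simp only: F3_poly_mult) apply (simp only: F3_uminus) apply (simp add: F3_poly_add z)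
        done
    next
      case 3
      then have e: "b = 0 - a" "b0 = 0 - a0" "b1 = 1 - a1" "b2 = - 1 - a2"
        using eqs by (simp_all only: eq_diff_eq mult_1 add.commute)
      show ?thesis
        unfolding t_def g' 0 \<open>\<rho> 1 = _\<close> \<open>\<rho> (- 1) = _\<close> conj_pc_group mult_pc_group
        unfolding 3 e transfer_form_def carry_def
        apply (simp)
        apply (simp only: F3_poly_mult) apply (simp only: F3_uminus) apply (simp add: F3_poly_add z)
        done
    next
      case 4
      then have "a - b = 0" "a0 - b0 = 0" "a1 - b1 = 1" "a2 - b2 = - 1" using eqs by simp_all
      then have e: "a = b" "a0 = b0" "a1 = 1 + b1" "a2 = - 1 + b2" by (simp_all only: diff_eq_eq add_0_left)
      show ?thesis
        unfolding t_def g' 0 \<open>\<rho> 1 = _\<close> \<open>\<rho> (- 1) = _\<close> conj_pc_group mult_pc_group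
        unfolding 4 e transfer_form_def carry_def
        apply (simp)
        apply (simp only: F3_poly_mult) apply (simp only: F3_uminus) apply (simp add: F3_poly_add z)
        done
    qed
  qed
  then show ?thesis using that by (auto simp: g')
qed

text \<open>Two cases: for \<open>g\<close> on the line every coset is fixed and
  \<open>norm_line\<close> applies; for \<open>g\<close> outside, the cosets form one cycle of
  length three and the factors telescope to the cube of \<open>g\<close>.\<close>

lemma artin_transfer_trivial_iff:
  assumes mn: "(m, n) \<in> lines"
  shows "artin_transfer (pc_group p q k l) (line m n) g
      = \<one>\<^bsub>pc_group p q k l\<lparr>carrier := line m n\<rparr> Mod derived (pc_group p q k l) (line m n)\<^esub>
    \<longleftrightarrow> transfer_form p q k l m n (fst g, fst (snd g)) = 0"
proof -
  let ?P = "pc_group p q k l" and ?K = "line_derived m n"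
  interpret group ?P by (rule group_pc_group)
  interpret K: normal ?K ?P by (rule normal_line_derived[OF mn])
  obtain \<rho> where \<rho>: "\<And>i. line_form m n (\<rho> i) = i"
    and T: "\<And>g t. (\<And>i. t i = inv\<^bsub>?P\<^esub> (\<rho> (line_form m n g + i)) \<otimes>\<^bsub>?P\<^esub> g \<otimes>\<^bsub>?P\<^esub> \<rho> i) \<Longrightarrow>
      artin_transfer ?P (line m n) g = ?K #>\<^bsub>?P\<^esub> (t 0 \<otimes>\<^bsub>?P\<^esub> (t 1 \<otimes>\<^bsub>?P\<^esub> t (- 1)))"
    using artin_transfer_line[OF mn, of p q k l] by blast
  define t where "t i = inv\<^bsub>?P\<^esub> (\<rho> (line_form m n g + i)) \<otimes>\<^bsub>?P\<^esub> g \<otimes>\<^bsub>?P\<^esub> \<rho> i" for i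
  have tH: "t i \<in> line m n" for i
    by (simp add: t_def line_iff line_form_mult line_form_inv \<rho>)
  have tt: "t i \<otimes>\<^bsub>?P\<^esub> t j \<in> line m n" for i j
    by (rule subgroup.m_closed[OF subgroup_line tH tH])
  have "\<exists>d e. artin_transfer ?P (line m n) g = ?K #>\<^bsub>?P\<^esub> (0, 0, 0, d, e)
      \<and> m * d + n * e = transfer_form p q k l m n (fst g, fst (snd g))"
  proof (cases "line_form m n g = 0")
    case True
    obtain d e where "t 0 \<otimes>\<^bsub>?P\<^esub> (t 1 \<otimes>\<^bsub>?P\<^esub> t (- 1)) = (0, 0, 0, d, e)"
      "m * d + n * e = transfer_form p q k l m n (fst g, fst (snd g))"
      unfolding t_def True add_0_left by (rule norm_line[OF mn True \<rho>])
    then show ?thesis using T[of t g, OF t_def] by auto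
  next
    case False
    let ?c = "g \<otimes>\<^bsub>?P\<^esub> g \<otimes>\<^bsub>?P\<^esub> g"
    obtain a b c d e where g: "g = (a, b, c, d, e)" by (cases g)
    have cube: "?c = (0, 0, 0, p * a + k * b + a * a * b, q * a + l * b - a * b * b)"
      unfolding g by (rule cube_pc_group)
    \<comment> \<open>Cubes are central, so conjugation by the representative of the base coset is
      invisible.\<close>
    have "inv\<^bsub>?P\<^esub> (\<rho> 0) \<otimes>\<^bsub>?P\<^esub> ?c \<otimes>\<^bsub>?P\<^esub> \<rho> 0 = inv\<^bsub>?P\<^esub> (\<rho> 0) \<otimes>\<^bsub>?P\<^esub> (?c \<otimes>\<^bsub>?P\<^esub> \<rho> 0)"
      by (rule m_assoc) simp_all
    also have "?c \<otimes>\<^bsub>?P\<^esub> \<rho> 0 = \<rho> 0 \<otimes>\<^bsub>?P\<^esub> ?c" unfolding cube by (rule central_pc_group)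
    also have "inv\<^bsub>?P\<^esub> (\<rho> 0) \<otimes>\<^bsub>?P\<^esub> (\<rho> 0 \<otimes>\<^bsub>?P\<^esub> ?c) = ?c" by (rule inv_assoc) simp_all
    finally have "inv\<^bsub>?P\<^esub> (\<rho> 0) \<otimes>\<^bsub>?P\<^esub> ?c \<otimes>\<^bsub>?P\<^esub> \<rho> 0 = ?c" .
    then have conj: "inv\<^bsub>?P\<^esub> (\<rho> 0) \<otimes>\<^bsub>?P\<^esub> g \<otimes>\<^bsub>?P\<^esub> g \<otimes>\<^bsub>?P\<^esub> g \<otimes>\<^bsub>?P\<^esub> \<rho> 0 = ?c"
      by (simp add: m_assoc)
    have "?K #>\<^bsub>?P\<^esub> (t 0 \<otimes>\<^bsub>?P\<^esub> (t 1 \<otimes>\<^bsub>?P\<^esub> t (- 1))) = ?K #>\<^bsub>?P\<^esub> ?c"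
    proof -
      consider "line_form m n g = 1" | "line_form m n g = - 1" using False cases_3 by blast
      then show ?thesis
      proof cases
        case 1
        have "?K #>\<^bsub>?P\<^esub> (t 0 \<otimes>\<^bsub>?P\<^esub> (t 1 \<otimes>\<^bsub>?P\<^esub> t (- 1))) = (?K #>\<^bsub>?P\<^esub> t 0) <#>\<^bsub>?P\<^esub> (?K #>\<^bsub>?P\<^esub> (t 1 \<otimes>\<^bsub>?P\<^esub> t (- 1)))"
          by (rule K.rcos_sum[symmetric]) simp_all
        also have "\<dots> = (?K #>\<^bsub>?P\<^esub> t 0) <#>\<^bsub>?P\<^esub> (?K #>\<^bsub>?P\<^esub> (t (- 1) \<otimes>\<^bsub>?P\<^esub> t 1))"
          by (simp only: line_quotient_commute[OF mn tH tH])
        also have "\<dots> = ?K #>\<^bsub>?P\<^esub> (t 0 \<otimes>\<^bsub>?P\<^esub> (t (- 1) \<otimes>\<^bsub>?P\<^esub> t 1))"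
          by (rule K.rcos_sum) simp_all
        also have "\<dots> = ?K #>\<^bsub>?P\<^esub> (t (- 1) \<otimes>\<^bsub>?P\<^esub> t 1 \<otimes>\<^bsub>?P\<^esub> t 0)"
          by (rule line_quotient_commute[OF mn tH tt])
        \<comment> \<open>In this order the representatives between neighbouring factors cancel; the
          reordering is allowed modulo the derived subgroup of the line.\<close>
        also have "t (- 1) \<otimes>\<^bsub>?P\<^esub> t 1 \<otimes>\<^bsub>?P\<^esub> t 0 = ?c"
          unfolding t_def 1 F3_table add_0_right using conj by (simp add: m_assoc inv_assoc)
        finally show ?thesis .
      next
        case 2
        have "?K #>\<^bsub>?P\<^esub> (t 0 \<otimes>\<^bsub>?P\<^esub> (t 1 \<otimes>\<^bsub>?P\<^esub> t (- 1))) = ?K #>\<^bsub>?P\<^esub> (t 1 \<otimes>\<^bsub>?P\<^esub> t (- 1) \<otimes>\<^bsub>?P\<^esub> t 0)"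
          by (rule line_quotient_commute[OF mn tH tt])
        also have "t 1 \<otimes>\<^bsub>?P\<^esub> t (- 1) \<otimes>\<^bsub>?P\<^esub> t 0 = ?c"
          unfolding t_def 2 F3_table add_0_right using conj by (simp add: m_assoc inv_assoc)
        finally show ?thesis .
      qed
    qed
    with T[of t g, OF t_def] have "artin_transfer ?P (line m n) g
        = ?K #>\<^bsub>?P\<^esub> (0, 0, 0, p * a + k * b + a * a * b, q * a + l * b - a * b * b)"
      by (simp only: cube)
    moreover have "m * (p * a + k * b + a * a * b) + n * (q * a + l * b - a * b * b)
        = transfer_form p q k l m n (fst g, fst (snd g))"
      using transfer_form_outside[OF mn] False by (simp add: line_form_def g)
    ultimately show ?thesis by blast
  qed
  then obtain d e where A: "artin_transfer ?P (line m n) g = ?K #>\<^bsub>?P\<^esub> (0, 0, 0, d, e)"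
    and de: "m * d + n * e = transfer_form p q k l m n (fst g, fst (snd g))" by blast
  have "?K #>\<^bsub>?P\<^esub> (0, 0, 0, d, e) = ?K \<longleftrightarrow> (0, 0, 0, d, e) \<in> ?K"
    using K.rcos_const[OF is_group, of "(0, 0, 0, d, e)"] rcos_self[OF _ K.subgroup_axioms, of "(0, 0, 0, d, e)"] by auto
  also have "\<dots> \<longleftrightarrow> m * d + n * e = 0" by (simp add: line_derived_def)
  finally show ?thesis
    unfolding A de[symmetric] by (simp add: FactGroup_def derived_line[OF mn])
qed

lemma transfer_kernel_line:
  assumes mn: "(m, n) \<in> lines"
    and ker: "\<And>a b. transfer_form p q k l m n (a, b) = 0 \<longleftrightarrow> m' * a + n' * b = 0"
  shows "transfer_kernel (pc_group p q k l) (line m n)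
    = carrier (pc_group p q k l\<lparr>carrier := line m' n'\<rparr> Mod commutator_subgroup (pc_group p q k l))"
proof -
  have "{g \<in> carrier (pc_group p q k l). artin_transfer (pc_group p q k l) (line m n) g
      = \<one>\<^bsub>pc_group p q k l\<lparr>carrier := line m n\<rparr> Mod derived (pc_group p q k l) (line m n)\<^esub>} = line m' n'"
    unfolding artin_transfer_trivial_iff[OF mn] ker by (simp add: line_def)
  then show ?thesis
    unfolding transfer_kernel_def by (auto simp: FactGroup_def RCOSETS_def r_coset_def)
qed

lemma lines_distinct: "distinct [line 1 1, line 1 (- 1), line 1 0, line 0 1]"
proof -
  have "m = m' \<and> n = n'" if "line m n = line m' n'" "(m, n) \<in> lines" "(m', n') \<in> lines" for m n m' n'
    by (rule line_subset_imp_eq) (use that in auto)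
  from this[of 1 1 1 "- 1"] this[of 1 1 1 0] this[of 1 1 0 1] this[of 1 "- 1" 1 0] this[of 1 "- 1" 0 1] this[of 1 0 0 1]
  show ?thesis by (auto simp: lines_def)
qed

text \<open>The maximal subgroups are numbered in this order so that the kernels of both groups
  yield the tabulated representatives without renumbering.\<close>

lemma has_TKT_pc_group:
  assumes "length \<kappa> = 4" "set \<kappa> \<subseteq> {1..4}"
    and "\<And>i. i < 4 \<Longrightarrow> transfer_kernel (pc_group p q k l) ([line 1 1, line 1 (- 1), line 1 0, line 0 1] ! i)
      = carrier (pc_group p q k l\<lparr>carrier := [line 1 1, line 1 (- 1), line 1 0, line 0 1] ! (\<kappa> ! i - 1)\<rparr>
          Mod commutator_subgroup (pc_group p q k l))"
  shows "has_TKT (pc_group p q k l) \<kappa>"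
  unfolding has_TKT_def
  by (intro conjI assms(1,2) exI[of _ "[line 1 1, line 1 (- 1), line 1 0, line 0 1]"] lines_distinct allI impI assms(3))
    (simp_all add: maximal_subgroups_pc_group)

lemma transfer_form_5:
  "transfer_form 1 0 1 0 1 1 (a, b) = 0 \<longleftrightarrow> 1 * a + 1 * b = 0"
  "transfer_form 1 0 1 0 1 (- 1) (a, b) = 0 \<longleftrightarrow> 1 * a + 1 * b = 0"
  "transfer_form 1 0 1 0 1 0 (a, b) = 0 \<longleftrightarrow> 1 * a + - 1 * b = 0"
  "transfer_form 1 0 1 0 0 1 (a, b) = 0 \<longleftrightarrow> 1 * a + 0 * b = 0"
  using cases_3[of a] cases_3[of b] by (auto simp: transfer_form_def)

lemma has_TKT_SG243_5: "has_TKT SG243_5 TKT_D10"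
proof -
  note K = transfer_kernel_line
  have "transfer_kernel SG243_5 (line 1 1) = carrier (SG243_5\<lparr>carrier := line 1 1\<rparr> Mod commutator_subgroup SG243_5)"
    "transfer_kernel SG243_5 (line 1 (- 1)) = carrier (SG243_5\<lparr>carrier := line 1 1\<rparr> Mod commutator_subgroup SG243_5)"
    "transfer_kernel SG243_5 (line 1 0) = carrier (SG243_5\<lparr>carrier := line 1 (- 1)\<rparr> Mod commutator_subgroup SG243_5)"
    "transfer_kernel SG243_5 (line 0 1) = carrier (SG243_5\<lparr>carrier := line 1 0\<rparr> Mod commutator_subgroup SG243_5)"
    unfolding SG243_5_def by (rule K[OF _ transfer_form_5(1)] K[OF _ transfer_form_5(2)] K[OF _ transfer_form_5(3)] K[OF _ transfer_form_5(4)]; simp add: lines_def)+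
  then show ?thesis
    unfolding SG243_5_def TKT_D10_def
    by (intro has_TKT_pc_group) (auto simp: less_Suc_eq numeral_eq_Suc)
qed

lemma transfer_form_7:
  "transfer_form 1 0 0 1 1 1 (a, b) = 0 \<longleftrightarrow> 1 * a + 1 * b = 0"
  "transfer_form 1 0 0 1 1 (- 1) (a, b) = 0 \<longleftrightarrow> 1 * a + - 1 * b = 0"
  "transfer_form 1 0 0 1 1 0 (a, b) = 0 \<longleftrightarrow> 1 * a + 1 * b = 0"
  "transfer_form 1 0 0 1 0 1 (a, b) = 0 \<longleftrightarrow> 1 * a + - 1 * b = 0"
  using cases_3[of a] cases_3[of b] by (auto simp: transfer_form_def)

lemma has_TKT_SG243_7: "has_TKT SG243_7 TKT_D5"
proof -
  note K = transfer_kernel_line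
  have "transfer_kernel SG243_7 (line 1 1) = carrier (SG243_7\<lparr>carrier := line 1 1\<rparr> Mod commutator_subgroup SG243_7)"
    "transfer_kernel SG243_7 (line 1 (- 1)) = carrier (SG243_7\<lparr>carrier := line 1 (- 1)\<rparr> Mod commutator_subgroup SG243_7)"
    "transfer_kernel SG243_7 (line 1 0) = carrier (SG243_7\<lparr>carrier := line 1 1\<rparr> Mod commutator_subgroup SG243_7)"
    "transfer_kernel SG243_7 (line 0 1) = carrier (SG243_7\<lparr>carrier := line 1 (- 1)\<rparr> Mod commutator_subgroup SG243_7)"
    unfolding SG243_7_def by (rule K[OF _ transfer_form_7(1)] K[OF _ transfer_form_7(2)] K[OF _ transfer_form_7(3)] K[OF _ transfer_form_7(4)]; simp add: lines_def)+
  then show ?thesis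
    unfolding SG243_7_def TKT_D5_def
    by (intro has_TKT_pc_group) (auto simp: less_Suc_eq numeral_eq_Suc)
qed

text \<open>The number of cubes separates the groups: all cubes of \<open>SG243_7\<close> lie in the
  five-element set \<open>A\<close>, whereas \<open>SG243_5\<close> has at least the six cubes in
  \<open>B\<close>.\<close>

lemma SG243_not_iso: "\<not> SG243_5 \<cong> SG243_7"
proof
  assume "SG243_5 \<cong> SG243_7"
  then obtain \<phi> where \<phi>: "\<phi> \<in> hom SG243_5 SG243_7" "inj \<phi>" "surj \<phi>"
    by (auto simp: is_iso_def iso_def bij_betw_def SG243_5_def SG243_7_def)
  define cube where "cube G v = v \<otimes>\<^bsub>G\<^esub> v \<otimes>\<^bsub>G\<^esub> v" for G :: "F3_5 monoid" and v
  have cube5: "cube SG243_5 (a, b, c, d, e) = (0, 0, 0, a + b + a * a * b, - (a * b * b))" for a b c d e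
    by (simp add: cube_def SG243_5_def cube_pc_group)
  have cube7: "cube SG243_7 (a, b, c, d, e) = (0, 0, 0, a + a * a * b, b - a * b * b)" for a b c d e
    by (simp add: cube_def SG243_7_def cube_pc_group)
  have hom: "\<phi> (cube SG243_5 v) = cube SG243_7 (\<phi> v)" for v
    unfolding cube_def using hom_mult[OF \<phi>(1)] by (simp add: SG243_5_def)
  define A :: "F3_5 set" where "A = {(0, 0, 0, 0, 0), (0, 0, 0, 1, 0), (0, 0, 0, - 1, 0), (0, 0, 0, 0, - 1), (0, 0, 0, 0, 1)}"
  define B :: "F3_5 set" where "B = insert (0, 0, 0, 1, 1) A"
  have "cube SG243_7 v \<in> A" for v
  proof -
    obtain a b c d e where v: "v = (a, b, c, d, e)" by (cases v)
    show ?thesis using cases_3[of a] cases_3[of b] unfolding v cube7 A_def by auto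
  qed
  note A = this
  have B: "B \<subseteq> range (cube SG243_5)"
  proof -
    have "cube SG243_5 (a, b, 0, 0, 0) \<in> range (cube SG243_5)" for a b by blast
    \<comment> \<open>Six pairs of exponents whose cubes are the six elements of
      \<open>B\<close>.\<close>
    from this[of 0 0] this[of 1 0] this[of "- 1" 0] this[of 1 1] this[of "- 1" "- 1"] this[of "- 1" 1]
    show ?thesis unfolding B_def A_def cube5 by (simp add: three_eq_0)
  qed
  have "\<phi> ` B \<subseteq> A"
  proof
    fix w assume "w \<in> \<phi> ` B"
    then obtain v where "w = \<phi> (cube SG243_5 v)" using B by blast
    then show "w \<in> A" using A by (simp only: hom)
  qed
  then have "card (\<phi> ` B) \<le> card A" by (rule card_mono[rotated]) (simp add: A_def)
  moreover have "card (\<phi> ` B) = card B" using \<phi>(2) by (meson card_image inj_on_subset top_greatest)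
  moreover have "card B = Suc (card A)" by (simp add: A_def B_def)
  ultimately show False by simp
qed

lemma terminal_params_iff:
  "(\<exists>p q k l. (p, q, k, l) \<in> terminal_params \<and> V \<cong> pc_group p q k l) \<longleftrightarrow> V \<cong> SG243_5 \<or> V \<cong> SG243_7"
  unfolding terminal_params_def SG243_5_def SG243_7_def by blast

text \<open>A type \<open>'a\<close> with too few elements carries no group isomorphic to one of the
  two. The properties of the concrete groups are therefore asserted in addition to the equivalences,
  which only speak about groups on \<open>'a\<close>.\<close>

theorem proposition5:
  shows
    "(\<forall>V :: 'a monoid. finite_3_group V \<and> abelianization_C3_C3 V \<longrightarrow>
        (metabelian V \<and> schur_sigma_group V \<longleftrightarrow> V \<cong> SG243_5 \<or> V \<cong> SG243_7))
   \<and> \<not> SG243_5 \<cong> SG243_7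
   \<and> finite_3_group SG243_5 \<and> abelianization_C3_C3 SG243_5
   \<and> metabelian SG243_5 \<and> schur_sigma_group SG243_5
   \<and> finite_3_group SG243_7 \<and> abelianization_C3_C3 SG243_7
   \<and> metabelian SG243_7 \<and> schur_sigma_group SG243_7
   \<and> order SG243_5 = 3 ^ 5 \<and> nilpotency_class SG243_5 = 3 \<and> has_coclass SG243_5 2
   \<and> order SG243_7 = 3 ^ 5 \<and> nilpotency_class SG243_7 = 3 \<and> has_coclass SG243_7 2
   \<and> has_TKT SG243_5 TKT_D10
   \<and> has_TKT SG243_7 TKT_D5
   \<and> (\<forall>V :: 'a monoid. group V \<longrightarrow>
        (immediate_descendant V SG27_3 \<and> step_size V SG27_3 = 2 \<and> terminal V
          \<longleftrightarrow> V \<cong> SG243_5 \<or> V \<cong> SG243_7))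
   \<and> isolated_vertex 2 (iso_class SG243_5) \<and> without_parent 2 (iso_class SG243_5)
   \<and> isolated_vertex 2 (iso_class SG243_7) \<and> without_parent 2 (iso_class SG243_7)"
proof -
  have P: "(1, 0, 1, 0) \<in> terminal_params" "(1, 0, 0, 1) \<in> terminal_params"
    by (simp_all add: terminal_params_def)
  note self = schur_sigma_of_terminal[OF _ group_pc_group iso_refl]
  note S5 = self[OF P(1), folded SG243_5_def] and S7 = self[OF P(2), folded SG243_7_def]
  have "metabelian V \<and> schur_sigma_group V \<longleftrightarrow> V \<cong> SG243_5 \<or> V \<cong> SG243_7"
    if V: "finite_3_group V" "abelianization_C3_C3 V" for V :: "'a monoid"
  proof -
    have "group V" using V(1) by (simp add: finite_3_group_def)
    note of_terminal = schur_sigma_of_terminal(3,4)[OF _ this]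
    show ?thesis
      unfolding terminal_params_iff[symmetric]
    proof (intro iffI; elim conjE exE)
      assume "metabelian V" "schur_sigma_group V"
      then obtain p q k l where "(p, q, k, l) \<in> terminal_params" "V \<cong> pc_group p q k l"
        by (rule metabelian_schur_sigma_imp_terminal[OF V])
      then show "\<exists>p q k l. (p, q, k, l) \<in> terminal_params \<and> V \<cong> pc_group p q k l"
        by (intro exI conjI)
    qed (intro conjI of_terminal)
  qed
  moreover have "immediate_descendant V SG27_3 \<and> step_size V SG27_3 = 2 \<and> terminal V
      \<longleftrightarrow> V \<cong> SG243_5 \<or> V \<cong> SG243_7" if V: "group V" for V :: "'a monoid"
    unfolding terminal_params_iff[symmetric]
  proof (intro iffI; elim conjE exE)
    assume "immediate_descendant V SG27_3" "step_size V SG27_3 = 2" "terminal V"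
    then obtain p q k l where "(p, q, k, l) \<in> terminal_params" "V \<cong> pc_group p q k l"
      by (rule terminal_descendant_imp[OF V])
    then show "\<exists>p q k l. (p, q, k, l) \<in> terminal_params \<and> V \<cong> pc_group p q k l"
      by (intro exI conjI)
  qed (intro conjI immediate_descendant_of_iso_pc_group[OF V] terminal_of_iso_terminal[OF _ V])
  moreover have "order SG243_5 = 3 ^ 5" "nilpotency_class SG243_5 = 3" "has_coclass SG243_5 2"
    "order SG243_7 = 3 ^ 5" "nilpotency_class SG243_7 = 3" "has_coclass SG243_7 2"
    unfolding SG243_5_def SG243_7_def
    by (rule order_pc_group nilpotency_class_pc_group has_coclass_pc_group)+
  moreover note terminal_isolated[OF P(1), folded SG243_5_def] terminal_isolated[OF P(2), folded SG243_7_def]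
    S5 S7 SG243_not_iso has_TKT_SG243_5 has_TKT_SG243_7
  ultimately show ?thesis by blast
qed

end
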